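(* Let $\alpha\in(1,2)$, $T>0$, $\Omega=(0,2T)$, $r\ge 1$ and $\sigma\in(0,\frac{\alpha}{2}]$. Let $u$ be a solution of $(-\Delta)^{\alpha/2}u=f$ in $\Omega$, $u=0$ in $\mathbb{R}\setminus\Omega$, with $u\in C^4(\Omega)$, $f\in C^2(\Omega)$, and suppose that for some constant $C_0$ and all $x\in\Omega$ $$|u^{(l)}(x)|\le C_0\,\delta(x)^{\sigma-l},\quad l=0,1,2,3,4,\qquad |f^{(l)}(x)|\le C_0\,\delta(x)^{\sigma-\alpha-l},\quad l=0,1,2.$$ For each positive integer $N$, let $u_1,\dots,u_{2N-1}$ be the approximate solution computed by the discretization scheme $-D_h^2I^{2-\alpha}u_h(x_i)=f(x_i)$, $1\le i\le 2N-1$, where $u_h=\sum_{j=1}^{2N-1}u_j\phi_j$. Then there is a positive constant $C=C(\Omega,\alpha,\sigma,r,f)$ (independent of $N$) such that, with $h=1/N$, $$\max_{1\le i\le 2N-1}|u_i-u(x_i)|\le C\,h^{\min\{r\sigma,2\}}.$$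
   Context: Operator: $(-\Delta)^{\alpha/2}u(x)=-\frac{d^2}{dx^2}I^{2-\alpha}u(x)$, where $I^{2-\alpha}w(x)=\int_\Omega K(x-y)w(y)\,dy$ and $K(x)=\frac{\kappa_\alpha}{\Gamma(2-\alpha)}|x|^{1-\alpha}$, $\kappa_\alpha=\frac{1}{2\cos((2-\alpha)\pi/2)}=-\frac{1}{2\cos(\alpha\pi/2)}>0$. Graded mesh: $x_j=T(j/N)^r$ for $0\le j\le N$, $x_j=2T-T((2N-j)/N)^r$ for $N+1\le j\le 2N$; $h_j=x_j-x_{j-1}$ for $1\le j\le 2N$; $h=1/N$. $\delta(x)=\min\{x,2T-x\}$. $\phi_j$ ($1\le j\le 2N-1$) are the standard hat functions of the mesh (continuous, piecewise linear, $\phi_j(x_k)=\delta_{jk}$). Difference quotient, for a function $g$ defined at mesh points: $D_h^2 g(x_i)=\frac{2}{h_i+h_{i+1}}\left(\frac{1}{h_i}g(x_{i-1})-\left(\frac1{h_i}+\frac1{h_{i+1}}\right)g(x_i)+\frac1{h_{i+1}}g(x_{i+1})\right)$. *)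

theory Defs
  imports "HOL-Analysis.Analysis"
begin

definition Omega :: "real \<Rightarrow> real set" where
  "Omega T = {0<..<2 * T}"

definition bdist :: "real \<Rightarrow> real \<Rightarrow> real" where
  "bdist T x = min x (2 * T - x)"

definition Ck_on :: "nat \<Rightarrow> (real \<Rightarrow> real) \<Rightarrow> real set \<Rightarrow> bool" where
  "Ck_on k g S \<longleftrightarrow>
     (\<forall>l<k. \<forall>x\<in>S. (deriv ^^ l) g field_differentiable at x) \<and>
     continuous_on S ((deriv ^^ k) g)"

definition kappa :: "real \<Rightarrow> real" where
  "kappa \<alpha> = 1 / (2 * cos ((2 - \<alpha>) * pi / 2))"

text \<open>Since \<open>0 powr a = 0\<close>, the kernel has the value 0 at its singularity; this does not
  affect any integral.\<close>

definition kern :: "real \<Rightarrow> real \<Rightarrow> real" where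
  "kern \<alpha> x = kappa \<alpha> / Gamma (2 - \<alpha>) * \<bar>x\<bar> powr (1 - \<alpha>)"

definition frac_int :: "real \<Rightarrow> real \<Rightarrow> (real \<Rightarrow> real) \<Rightarrow> real \<Rightarrow> real" where
  "frac_int \<alpha> T w x = (LINT y:Omega T|lborel. kern \<alpha> (x - y) * w y)"

definition frac_laplacian :: "real \<Rightarrow> real \<Rightarrow> (real \<Rightarrow> real) \<Rightarrow> real \<Rightarrow> real" where
  "frac_laplacian \<alpha> T u x = - (deriv ^^ 2) (frac_int \<alpha> T u) x"

text \<open>The operator is \<open>deriv\<close>-based and hence total, so being a solution includes that
  the two derivatives exist throughout the domain.\<close>

definition is_solution ::
    "real \<Rightarrow> real \<Rightarrow> (real \<Rightarrow> real) \<Rightarrow> (real \<Rightarrow> real) \<Rightarrow> bool" where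
  "is_solution \<alpha> T f u \<longleftrightarrow>
     (\<forall>x\<in>Omega T.
        frac_int \<alpha> T u field_differentiable at x \<and>
        deriv (frac_int \<alpha> T u) field_differentiable at x \<and>
        frac_laplacian \<alpha> T u x = f x) \<and>
     (\<forall>x. x \<notin> Omega T \<longrightarrow> u x = 0)"

text \<open>The mesh and everything built on it are meant for \<open>N \<ge> 1\<close> and indices
  \<open>0, \<dots>, 2N\<close>.\<close>

definition mesh :: "real \<Rightarrow> real \<Rightarrow> nat \<Rightarrow> nat \<Rightarrow> real" where
  "mesh T r N j =
     (if j \<le> N then T * (real j / real N) powr r
      else 2 * T - T * ((2 * real N - real j) / real N) powr r)"

definition mesh_step :: "real \<Rightarrow> real \<Rightarrow> nat \<Rightarrow> nat \<Rightarrow> real" where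
  "mesh_step T r N j = mesh T r N j - mesh T r N (j - 1)"

definition hat :: "real \<Rightarrow> real \<Rightarrow> nat \<Rightarrow> nat \<Rightarrow> real \<Rightarrow> real" where
  "hat T r N j y =
     (if mesh T r N (j - 1) \<le> y \<and> y \<le> mesh T r N j
      then (y - mesh T r N (j - 1)) / mesh_step T r N j
      else if mesh T r N j \<le> y \<and> y \<le> mesh T r N (j + 1)
      then (mesh T r N (j + 1) - y) / mesh_step T r N (j + 1)
      else 0)"

definition diff2 :: "real \<Rightarrow> real \<Rightarrow> nat \<Rightarrow> (real \<Rightarrow> real) \<Rightarrow> nat \<Rightarrow> real" where
  "diff2 T r N g i =
     2 / (mesh_step T r N i + mesh_step T r N (i + 1)) *
     (1 / mesh_step T r N i * g (mesh T r N (i - 1))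
      - (1 / mesh_step T r N i + 1 / mesh_step T r N (i + 1)) * g (mesh T r N i)
      + 1 / mesh_step T r N (i + 1) * g (mesh T r N (i + 1)))"

definition fe_fun :: "real \<Rightarrow> real \<Rightarrow> nat \<Rightarrow> (nat \<Rightarrow> real) \<Rightarrow> real \<Rightarrow> real" where
  "fe_fun T r N U y = (\<Sum>j=1..2 * N - 1. U j * hat T r N j y)"

definition is_approx_solution ::
    "real \<Rightarrow> real \<Rightarrow> real \<Rightarrow> (real \<Rightarrow> real) \<Rightarrow> nat \<Rightarrow> (nat \<Rightarrow> real) \<Rightarrow> bool" where
  "is_approx_solution \<alpha> T r f N U \<longleftrightarrow>
     (\<forall>i\<in>{1..2 * N - 1}.
        - diff2 T r N (frac_int \<alpha> T (fe_fun T r N U)) i = f (mesh T r N i))"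

end

theory Submission
  imports Defs
begin

text \<open>The nodal error satisfies a linear system whose matrix has positive row sums and nonpositive
  off-diagonal entries, so it is controlled by the truncation error through a barrier: a multiple of
  the distance to the boundary plus a constant. The barrier compensates a residual of size
  \<open>h powr min (r \<sigma>) 2 * (x powr (- \<alpha>) + (T - x) powr (1 - \<alpha>))\<close> on the left half, and reflection
  handles the right half.

  The truncation error consists of the consistency error of the difference quotient for the smooth
  function \<open>I\<^sup>2\<^sup>-\<^sup>\<alpha> u\<close> and of the difference quotient of the fractional integral of the interpolation
  error. For the latter, far cells are bounded through the second derivative of the kernel. Near cells
  are regrouped along the diagonals (node and cell shifted together), which turns derivatives of the
  singular kernel into differences of the mesh and of \<open>u''\<close>. Stability on refined meshes also shows that
  \<open>u\<close> is determined by \<open>f\<close> at the nodes, so the constant obtained from one solution serves all.\<close>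

section \<open>Slope differences and the kernel\<close>

text \<open>The rate has one source. With x = \<open>X N i\<close> the steps near node
  \<open>i\<close> are about x / i, and both parts of the truncation error carry a factor x powr
  \<sigma> / i^2, which the grading turns into h powr min (r \<sigma>) 2. The obstacle is the
  interpolation error close to the node. The second derivative of the kernel is not integrable
  there, and a bound by absolute values alone exceeds the required x powr (\<sigma> - \<alpha>) /
  i^2 by a factor i powr \<alpha>. The cancellation between neighbouring nodes has to be used, and
  it has to survive the kink of the mesh at T. What the kink costs is at most a term of the order of
  (T - x) powr (1 - \<alpha>), and the barrier contains a function whose fractional integral has a
  matching singularity at T. In the stability part the delicate entries of the matrix are those of
  neighbouring indices: their sign depends on three consecutive steps, and it is right because the
  steps grow from both ends towards T.\<close>

definition dd :: "real \<Rightarrow> real \<Rightarrow> real \<Rightarrow> (real \<Rightarrow> real) \<Rightarrow> real" where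
  "dd a b c g = (g c - g b) / (c - b) - (g b - g a) / (b - a)"

lemma dd_uminus: "dd a b c (\<lambda>x. - g x) = - dd a b c g"
  using dd_def by (simp add: dd_def diff_divide_distrib)

lemma dd_add: "dd a b c (\<lambda>x. f x + g x) = dd a b c f + dd a b c g"
  by (simp add: dd_def add_divide_distrib diff_divide_distrib)

lemma dd_diff: "dd a b c (\<lambda>x. f x - g x) = dd a b c f - dd a b c g"
  by (simp add: dd_def add_divide_distrib diff_divide_distrib)

lemma dd_cmult: "dd a b c (\<lambda>x. k * f x) = k * dd a b c f"
  by (simp add: dd_def algebra_simps diff_divide_distrib)

lemma dd_sum: "dd a b c (\<lambda>x. \<Sum>i\<in>I. f i x) = (\<Sum>i\<in>I. dd a b c (f i))"
  by (simp add: dd_def sum_subtractf sum_divide_distrib diff_divide_distrib)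

lemma dd_reflect: "dd a b c (\<lambda>x. g (s - x)) = dd (s - c) (s - b) (s - a) g"
proof -
  have "(g (s - c) - g (s - b)) / (c - b) = - ((g (s - b) - g (s - c)) / (c - b))"
       "(g (s - b) - g (s - a)) / (b - a) = - ((g (s - a) - g (s - b)) / (b - a))"
    by (simp_all add: minus_divide_left)
  thus ?thesis by (simp add: dd_def)
qed

lemma dd_cong:
  assumes "g a = g' a" "g b = g' b" "g c = g' c"
  shows "dd a b c g = dd a b c g'"
  using assms by (simp add: dd_def)

text \<open>No smoothness of \<open>g\<close> is involved; this serves the first nodes, where the
  singular kernel is integrated close to the boundary.\<close>

lemma dd_abs_le:
  assumes "0 < d" "d \<le> b - a" "d \<le> c - b" "\<bar>g a\<bar> \<le> M" "\<bar>g b\<bar> \<le> M" "\<bar>g c\<bar> \<le> M"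
  shows "\<bar>dd a b c g\<bar> \<le> 4 * M / d"
proof -
  have q: "\<bar>(p - q) / w\<bar> \<le> 2 * M / d" if "\<bar>p\<bar> \<le> M" "\<bar>q\<bar> \<le> M" "d \<le> w" for p q w
  proof -
    have "\<bar>(p - q) / w\<bar> = \<bar>p - q\<bar> / w" using that assms(1) by simp
    also have "\<dots> \<le> (2 * M) / d"
      by (rule frac_le) (use that assms(1) in auto)
    finally show ?thesis .
  qed
  have "\<bar>dd a b c g\<bar> \<le> \<bar>(g c - g b) / (c - b)\<bar> + \<bar>(g b - g a) / (b - a)\<bar>"
    unfolding dd_def by (rule abs_triangle_ineq4)
  also have "\<dots> \<le> 2 * M / d + 2 * M / d"
    by (intro add_mono q) (use assms in auto)
  finally show ?thesis by simp
qed

text \<open>Subtracting \<open>m * x\<^sup>2 / 2\<close> makes the derivative nondecreasing, and by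
  the mean value theorem the two slopes are values of that derivative at ordered points.\<close>

lemma dd_ge_deriv:
  assumes "a < b" "b < c" and cont: "continuous_on {a..c} g"
    and der: "\<And>x. a < x \<Longrightarrow> x < c \<Longrightarrow> (g has_real_derivative g' x) (at x)"
    and mono: "\<And>x y. a < x \<Longrightarrow> x < y \<Longrightarrow> y < c \<Longrightarrow> m * (y - x) \<le> g' y - g' x"
  shows "m * (c - a) / 2 \<le> dd a b c g"
proof -
  define q where "q = (\<lambda>x. g x - m * x\<^sup>2 / 2)"
  have dq: "(q has_real_derivative (g' x - m * x)) (at x)" if "a < x" "x < c" for x
    unfolding q_def using der[OF that] by (auto intro!: derivative_eq_intros)
  have dqd: "q differentiable at x" if "a < x" "x < c" for x
    using dq[OF that] real_differentiable_def by blast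
  have cq: "continuous_on {a..c} q"
    unfolding q_def by (auto intro!: continuous_intros cont)
  have "\<exists>l z. a < z \<and> z < b \<and> DERIV q z :> l \<and> q b - q a = (b - a) * l"
    by (rule MVT) (use assms(1,2) dqd in \<open>auto intro: continuous_on_subset[OF cq]\<close>)
  then obtain l1 z1 where 1: "a < z1" "z1 < b" "DERIV q z1 :> l1" "q b - q a = (b - a) * l1" by blast
  have "\<exists>l z. b < z \<and> z < c \<and> DERIV q z :> l \<and> q c - q b = (c - b) * l"
    by (rule MVT) (use assms(1,2) dqd in \<open>auto intro: continuous_on_subset[OF cq]\<close>)
  then obtain l2 z2 where 2: "b < z2" "z2 < c" "DERIV q z2 :> l2" "q c - q b = (c - b) * l2" by blast
  have "l1 = g' z1 - m * z1" using 1 dq[of z1] assms(1,2) DERIV_unique by fastforce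
  moreover have "l2 = g' z2 - m * z2" using 2 dq[of z2] assms(1,2) DERIV_unique by fastforce
  ultimately have "l1 \<le> l2" using mono[of z1 z2] 1 2 by (simp add: algebra_simps)
  moreover have "dd a b c q = l2 - l1" using 1 2 by (simp add: dd_def)
  moreover have "dd a b c q = dd a b c g - m * (c - a) / 2"
  proof -
    have "dd a b c (\<lambda>x. (m/2) * x\<^sup>2) = m / 2 * (c - a)"
    proof -
      have "c\<^sup>2 - b\<^sup>2 = (c - b) * (c + b)" "b\<^sup>2 - a\<^sup>2 = (b - a) * (b + a)"
        by (simp_all add: power2_eq_square algebra_simps)
      hence "dd a b c (\<lambda>x. x\<^sup>2) = c - a" using assms(1,2) by (simp add: dd_def)
      thus ?thesis using dd_cmult[of a b c "m/2" "\<lambda>x. x\<^sup>2"] by simp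
    qed
    moreover have "dd a b c q = dd a b c g - dd a b c (\<lambda>x. (m/2) * x\<^sup>2)"
      unfolding q_def dd_diff by (simp add: mult.commute)
    ultimately show ?thesis by simp
  qed
  ultimately show ?thesis by simp
qed

text \<open>The exceptional point \<open>s\<close> allows for a second derivative that is singular at one point.\<close>

lemma dd_ge_deriv2:
  assumes "a < b" "b < c" and cont: "continuous_on {a..c} g"
    and der: "\<And>x. a < x \<Longrightarrow> x < c \<Longrightarrow> (g has_real_derivative g' x) (at x)"
    and contg': "continuous_on {a<..<c} g'"
    and der2: "\<And>x. a < x \<Longrightarrow> x < c \<Longrightarrow> x \<noteq> s \<Longrightarrow> (g' has_real_derivative g'' x) (at x)"
    and ge: "\<And>x. a < x \<Longrightarrow> x < c \<Longrightarrow> x \<noteq> s \<Longrightarrow> m \<le> g'' x"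
  shows "m * (c - a) / 2 \<le> dd a b c g"
proof (rule dd_ge_deriv[OF assms(1-3)])
  show "(g has_real_derivative g' x) (at x)" if "a < x" "x < c" for x using der that by blast
next
  \<comment> \<open>The mean value theorem for \<open>g'\<close> on intervals without
    \<open>s\<close> in the interior; an interval around \<open>s\<close> is cut at
    \<open>s\<close>, where \<open>g'\<close> is still continuous.\<close>
  have *: "m * (y - x) \<le> g' y - g' x" if xy: "a < x" "x < y" "y < c" "\<And>z. x < z \<Longrightarrow> z < y \<Longrightarrow> z \<noteq> s" for x y
  proof -
    have "\<exists>l z. x < z \<and> z < y \<and> DERIV g' z :> l \<and> g' y - g' x = (y - x) * l"
    proof (rule MVT)
      show "g' differentiable at z" if z: "x < z" "z < y" for z
        using der2[of z] xy z by (auto simp: real_differentiable_def)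
    qed (use xy in \<open>auto intro!: continuous_on_subset[OF contg']\<close>)
    then obtain l z where z: "x < z" "z < y" "DERIV g' z :> l" "g' y - g' x = (y - x) * l" by blast
    have "l = g'' z" by (rule DERIV_unique[OF z(3) der2]) (use z xy in auto)
    hence "m \<le> l" using ge[of z] z xy by auto
    thus ?thesis using z by (simp add: mult.commute)
  qed
  show "m * (y - x) \<le> g' y - g' x" if xy: "a < x" "x < y" "y < c" for x y
  proof (cases "x < s \<and> s < y")
    case True
    have "m * (s - x) \<le> g' s - g' x" by (rule *) (use True xy in auto)
    moreover have "m * (y - s) \<le> g' y - g' s" by (rule *) (use True xy in auto)
    ultimately show ?thesis by (simp add: algebra_simps)
  next
    case False
    show ?thesis by (rule *) (use False xy in auto)
  qed
qed

lemma dd_abs_le_deriv2: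
  assumes "a < b" "b < c" and cont: "continuous_on {a..c} g"
    and der: "\<And>x. a < x \<Longrightarrow> x < c \<Longrightarrow> (g has_real_derivative g' x) (at x)"
    and der2: "\<And>x. a < x \<Longrightarrow> x < c \<Longrightarrow> (g' has_real_derivative g'' x) (at x)"
    and le: "\<And>x. a < x \<Longrightarrow> x < c \<Longrightarrow> \<bar>g'' x\<bar> \<le> m"
  shows "\<bar>dd a b c g\<bar> \<le> m * (c - a) / 2"
proof -
  have cg: "continuous_on {a<..<c} g'"
    by (rule DERIV_continuous_on) (use der2 in \<open>auto intro: DERIV_subset\<close>)
  \<comment> \<open>The choice \<open>s=a\<close> excepts nothing, since \<open>a\<close> is not in
    the open interval.\<close>
  have "(-m) * (c - a) / 2 \<le> dd a b c g"
    by (rule dd_ge_deriv2[OF assms(1-3) der cg, where g''=g'' and s=a])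
       (use der2 le in \<open>auto simp: abs_le_iff minus_le_iff\<close>)
  moreover have "(-m) * (c - a) / 2 \<le> dd a b c (\<lambda>x. - g x)"
    by (rule dd_ge_deriv2[where g'="\<lambda>x. - g' x" and g''="\<lambda>x. - g'' x" and s=a])
       (use assms der der2 le cg in \<open>auto simp: abs_le_iff intro!: continuous_intros DERIV_minus\<close>)
  ultimately show ?thesis by (simp add: dd_uminus abs_le_iff)
qed

text \<open>The factor 2 / (c - a) is kept out of \<open>dd\<close>: without it, a mixed difference
  of an even kernel over two triples is symmetric in the triples (\<open>dd_dd_swap\<close>), and
  signs can be studied for one order only.\<close>

lemma diff2_eq_dd:
  assumes "1 \<le> i"
  shows "diff2 T r N g i = 2 / (mesh T r N (i + 1) - mesh T r N (i - 1)) *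
           dd (mesh T r N (i - 1)) (mesh T r N i) (mesh T r N (i + 1)) g"
proof -
  have "mesh_step T r N i + mesh_step T r N (i + 1) = mesh T r N (i + 1) - mesh T r N (i - 1)"
    by (simp add: mesh_step_def)
  moreover have "1 / p * ga - (1 / p + 1 / q) * gb + 1 / q * gc = (gc - gb) / q - (gb - ga) / p"
    for p q ga gb gc :: real
    by (simp add: algebra_simps diff_divide_distrib)
  ultimately show ?thesis
    unfolding diff2_def dd_def mesh_step_def by simp
qed

section \<open>The kernel and its antiderivatives\<close>

locale frac_problem =
  fixes \<alpha> T r :: real
  assumes \<alpha>1: "1 < \<alpha>" and \<alpha>2: "\<alpha> < 2" and T0: "0 < T" and r1: "1 \<le> r"
begin

definition \<kappa> where "\<kappa> = kappa \<alpha> / Gamma (2 - \<alpha>)"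

text \<open>\<open>K1\<close> is the odd antiderivative of the kernel and \<open>K2\<close> the even
  antiderivative of \<open>K1\<close>; both vanish at 0. They are continuous across the singularity,
  so integrals of the kernel against piecewise linear functions become values of \<open>K1\<close>
  and \<open>K2\<close>.\<close>

definition K1 :: "real \<Rightarrow> real" where "K1 x = \<kappa> / (2 - \<alpha>) * (sgn x * \<bar>x\<bar> powr (2 - \<alpha>))"
definition K2 :: "real \<Rightarrow> real" where "K2 x = \<kappa> / ((2 - \<alpha>) * (3 - \<alpha>)) * \<bar>x\<bar> powr (3 - \<alpha>)"

abbreviation "K \<equiv> kern \<alpha>"

lemma \<kappa>0: "0 < \<kappa>"
proof -
  have "0 < cos ((2 - \<alpha>) * pi / 2)"
    by (rule cos_gt_zero_pi) (use \<alpha>1 \<alpha>2 in \<open>auto simp: field_simps intro: order.strict_trans2[of _ 0]\<close>)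
  moreover have "0 < Gamma (2 - \<alpha>)" using \<alpha>2 by (intro Gamma_real_pos) auto
  ultimately show ?thesis by (simp add: \<kappa>_def kappa_def)
qed

lemma K_eq: "K x = \<kappa> * \<bar>x\<bar> powr (1 - \<alpha>)"
  by (simp add: kern_def \<kappa>_def)

lemma K_nonneg: "0 \<le> K x" using \<kappa>0 by (simp add: K_eq)
lemma K_even: "K (- x) = K x" by (simp add: K_eq)
lemma K2_even: "K2 (- x) = K2 x" by (simp add: K2_def)
lemma K2_minus_commute: "K2 (x - y) = K2 (y - x)"
  by (simp add: K2_def abs_minus_commute)
lemma K1_odd: "K1 (- x) = - K1 x" by (simp add: K1_def sgn_minus)
lemma K1_0: "K1 0 = 0" by (simp add: K1_def)
lemma K2_0: "K2 0 = 0" by (simp add: K2_def)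

lemma K1_pos: "0 \<le> x \<Longrightarrow> K1 x = \<kappa> / (2 - \<alpha>) * x powr (2 - \<alpha>)" by (auto simp: K1_def sgn_if)

lemma DERIV_K1_pos: "0 < x \<Longrightarrow> (K1 has_real_derivative K x) (at x)"
proof -
  assume x: "0 < x"
  have "((\<lambda>x. \<kappa> / (2 - \<alpha>) * x powr (2 - \<alpha>)) has_real_derivative K x) (at x)"
    using x \<alpha>2 by (auto intro!: derivative_eq_intros simp: K_eq)
  thus ?thesis
    by (rule has_field_derivative_transform_within[OF _ x]) (auto simp: K1_pos dist_real_def)
qed

lemma DERIV_K1: assumes "x \<noteq> 0" shows "(K1 has_real_derivative K x) (at x)"
proof (cases "0 < x")
  case False
  have "((\<lambda>x. - K1 (- x)) has_real_derivative K x) (at x)"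
    using False assms DERIV_K1_pos[of "-x"] DERIV_minus[of "\<lambda>x. K1 (- x)" "- K x"] DERIV_mirror[of K1 "K (-x)" x]
    by (simp add: K_even)
  thus ?thesis by (simp add: K1_odd)
qed (rule DERIV_K1_pos)

lemma K1_cont: "continuous_on A K1"
proof -
  have "isCont K1 x" for x
  proof (cases "x = 0")
    case True
    have "((\<lambda>x. \<kappa> / (2 - \<alpha>) * \<bar>x\<bar> powr (2 - \<alpha>)) \<longlongrightarrow> \<kappa> / (2 - \<alpha>) * \<bar>0\<bar> powr (2 - \<alpha>)) (at 0)"
      using \<alpha>2 by (intro tendsto_intros tendsto_powr') (auto intro: always_eventually)
    hence "((\<lambda>x. \<kappa> / (2 - \<alpha>) * \<bar>x\<bar> powr (2 - \<alpha>)) \<longlongrightarrow> 0) (at 0)" by simp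
    hence "(K1 \<longlongrightarrow> 0) (at 0)"
      by (rule tendsto_rabs_zero_cancel[OF tendsto_cong[THEN iffD1], rotated])
         (use \<kappa>0 \<alpha>2 in \<open>auto simp: K1_def abs_mult sgn_if eventually_at_filter\<close>)
    thus ?thesis using True by (simp add: isCont_def K1_0)
  next
    case False
    thus ?thesis using DERIV_K1 DERIV_isCont by blast
  qed
  thus ?thesis by (simp add: continuous_at_imp_continuous_on)
qed

lemma DERIV_K2_pos: "0 < x \<Longrightarrow> (K2 has_real_derivative K1 x) (at x)"
proof -
  assume x: "0 < x"
  have "((\<lambda>x. \<kappa> / ((2 - \<alpha>) * (3 - \<alpha>)) * x powr (3 - \<alpha>)) has_real_derivative K1 x) (at x)"
  proof -
    have "\<kappa> / ((2 - \<alpha>) * (3 - \<alpha>)) * (3 - \<alpha>) = \<kappa> / (2 - \<alpha>)" using \<alpha>2 by simp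
    thus ?thesis using x \<alpha>2
      by (auto intro!: derivative_eq_intros simp: K1_pos simp flip: mult.assoc)
  qed
  thus ?thesis
    by (rule has_field_derivative_transform_within[OF _ x]) (auto simp: K2_def dist_real_def)
qed

text \<open>At 0 the difference quotient has the size of |h| powr (2 - \<alpha>), which tends to 0
  because \<alpha> < 2.\<close>

lemma DERIV_K2: "(K2 has_real_derivative K1 x) (at x)"
proof -
  consider "0 < x" | "x = 0" | "x < 0" by linarith
  thus ?thesis
  proof cases
    case 3
    have "((\<lambda>x. K2 (- x)) has_real_derivative K1 x) (at x)"
      using 3 DERIV_K2_pos[of "-x"] DERIV_mirror[of K2 "K1 (-x)" x]
      by (simp add: K1_odd)
    thus ?thesis by (simp add: K2_even)
  next
    case 2
    have "((\<lambda>h. \<kappa> / ((2 - \<alpha>) * (3 - \<alpha>)) * \<bar>h\<bar> powr (2 - \<alpha>)) \<longlongrightarrow> \<kappa> / ((2 - \<alpha>) * (3 - \<alpha>)) * \<bar>0\<bar> powr (2 - \<alpha>)) (at 0)"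
      using \<alpha>2 by (intro tendsto_intros tendsto_powr') (auto intro: always_eventually)
    hence *: "((\<lambda>h. \<kappa> / ((2 - \<alpha>) * (3 - \<alpha>)) * \<bar>h\<bar> powr (2 - \<alpha>)) \<longlongrightarrow> 0) (at 0)" by simp
    have "\<bar>h\<bar> powr (3 - \<alpha>) = \<bar>h\<bar> powr (2 - \<alpha>) * \<bar>h\<bar>" for h :: real
      using powr_add[of "\<bar>h\<bar>" "2 - \<alpha>" 1] by simp
    hence eq: "\<bar>K2 h / h\<bar> = \<kappa> / ((2 - \<alpha>) * (3 - \<alpha>)) * \<bar>h\<bar> powr (2 - \<alpha>)" if "h \<noteq> 0" for h
      using that \<kappa>0 \<alpha>2 by (simp add: K2_def abs_mult)
    have "((\<lambda>h. K2 h / h) \<longlongrightarrow> 0) (at 0)"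
      by (rule tendsto_rabs_zero_cancel[OF tendsto_cong[THEN iffD1, OF _ *]])
         (auto simp: eventually_at_filter eq simp del: abs_divide intro!: always_eventually)
    thus ?thesis using 2 by (simp add: DERIV_def K1_0 K2_0)
  qed (rule DERIV_K2_pos)
qed

lemma K2_cont: "continuous_on A K2"
  using DERIV_K2 by (meson DERIV_isCont continuous_at_imp_continuous_on)

lemma DERIV_K2_shift [derivative_intros]: "((\<lambda>x. K2 (x - y)) has_real_derivative K1 (x - y)) (at x)"
  using DERIV_shift[of K2 "K1 (x - y)" x "-y"] DERIV_K2[of "x - y"] by simp

lemma DERIV_K1_shift: "x \<noteq> y \<Longrightarrow> ((\<lambda>x. K1 (x - y)) has_real_derivative K (x - y)) (at x)"
  using DERIV_shift[of K1 "K (x - y)" x "-y"] DERIV_K1[of "x - y"] by simp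

lemma K1_cont_shift: "continuous_on A (\<lambda>x. K1 (x - y))"
  by (rule continuous_on_compose2[OF K1_cont[of UNIV]]) (auto intro!: continuous_intros)

lemma K2_cont_shift: "continuous_on A (\<lambda>x. K2 (x - y))"
  by (rule continuous_on_compose2[OF K2_cont[of UNIV]]) (auto intro!: continuous_intros)

lemma K_antimono: "0 < x \<Longrightarrow> x \<le> y \<Longrightarrow> K y \<le> K x"
  using \<kappa>0 \<alpha>1 by (auto simp: K_eq intro!: mult_left_mono powr_mono2')

lemma DERIV_K: "0 < t \<Longrightarrow> (K has_real_derivative (- (\<kappa> * (\<alpha> - 1)) * t powr (- \<alpha>))) (at t)"
proof -
  assume x: "0 < t"
  have "((\<lambda>x. \<kappa> * x powr (1 - \<alpha>)) has_real_derivative (- (\<kappa> * (\<alpha> - 1)) * t powr (- \<alpha>))) (at t)"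
    using x \<alpha>2 by (auto intro!: derivative_eq_intros simp: algebra_simps)
  thus ?thesis
    by (rule has_field_derivative_transform_within[OF _ x]) (auto simp: K_eq dist_real_def)
qed

lemma DERIV_K': "0 < t \<Longrightarrow> ((\<lambda>t. - (\<kappa> * (\<alpha> - 1)) * t powr (- \<alpha>)) has_real_derivative
    \<kappa> * (\<alpha> - 1) * \<alpha> * t powr (- 1 - \<alpha>)) (at t)"
proof -
  assume "0 < t"
  hence "((\<lambda>t. - (\<kappa> * (\<alpha> - 1)) * t powr (- \<alpha>)) has_real_derivative
    - (\<kappa> * (\<alpha> - 1)) * (- \<alpha> * t powr (- \<alpha> - 1))) (at t)"
    by (intro DERIV_cmult has_real_derivative_powr) auto
  moreover have "- \<alpha> - 1 = - 1 - \<alpha>" by simp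
  ultimately show ?thesis by (simp add: mult.assoc)
qed

text \<open>Integration by parts gives the antiderivative \<Psi>. It is continuous everywhere and
  differentiable off \<open>x\<close>, which is enough for the fundamental theorem even if the
  singularity \<open>x\<close> lies in the cell.\<close>

lemma cell_integral:
  assumes "a \<le> b"
  shows "((\<lambda>y. K (x - y) * (A + B * (y - a))) has_integral
     (A * K1 (x - a) - (A + B * (b - a)) * K1 (x - b) + B * (K2 (x - a) - K2 (x - b)))) {a..b}"
proof -
  define \<Psi> where "\<Psi> = (\<lambda>y. K1 (y - x) * (A + B * (y - a)) - B * K2 (y - x))"
  have "((\<lambda>y. K (x - y) * (A + B * (y - a))) has_integral (\<Psi> b - \<Psi> a)) {a..b}"
  proof (rule fundamental_theorem_of_calculus_interior_strong[where S="{x}"])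
    show "(\<Psi> has_vector_derivative K (x - y) * (A + B * (y - a))) (at y)" if "y \<in> {a<..<b} - {x}" for y
    proof -
      have "y \<noteq> x" using that by auto
      have "K (x - y) = K (y - x)" using K_even[of "y - x"] by simp
      hence "(\<Psi> has_real_derivative K (x - y) * (A + B * (y - a))) (at y)"
        unfolding \<Psi>_def
        by (auto intro!: derivative_eq_intros DERIV_K1_shift[OF \<open>y \<noteq> x\<close>])
      thus ?thesis by (simp add: has_real_derivative_iff_has_vector_derivative)
    qed
    show "continuous_on {a..b} \<Psi>"
      unfolding \<Psi>_def by (intro continuous_intros K1_cont_shift K2_cont_shift)
  qed (use assms in auto)
  moreover have "\<Psi> b - \<Psi> a = A * K1 (x - a) - (A + B * (b - a)) * K1 (x - b) + B * (K2 (x - a) - K2 (x - b))"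
    using K1_odd[of "x - a"] K1_odd[of "x - b"] K2_even[of "x - a"] K2_even[of "x - b"]
    by (simp add: \<Psi>_def algebra_simps)
  ultimately show ?thesis by simp
qed

lemma K_integral: "a \<le> b \<Longrightarrow> ((\<lambda>y. K (x - y)) has_integral (K1 (x - a) - K1 (x - b))) {a..b}"
  using cell_integral[of a b x 1 0] by simp

lemma K_absolutely_integrable: "(\<lambda>y. K (x - y)) absolutely_integrable_on {a..b}"
proof (cases "a \<le> b")
  case True
  show ?thesis
    by (rule nonnegative_absolutely_integrable_1) (use K_integral[OF True] K_nonneg in auto)
qed auto

lemma K_mult_absolutely_integrable:
  assumes "continuous_on {a..b} w"
  shows "(\<lambda>y. K (x - y) * w y) absolutely_integrable_on {a..b}"
proof -
  have "(\<lambda>y. w y * K (x - y)) absolutely_integrable_on {a..b}"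
    by (rule absolutely_integrable_bounded_measurable_product_real)
       (use assms in \<open>auto intro!: K_absolutely_integrable continuous_imp_measurable_on_sets_lebesgue
          compact_imp_bounded compact_continuous_image\<close>)
  thus ?thesis by (simp add: mult.commute)
qed

lemma K_mult_integrable:
  assumes "continuous_on {a..b} w"
  shows "(\<lambda>y. K (x - y) * w y) integrable_on {a..b}"
  using K_mult_absolutely_integrable[OF assms] absolutely_integrable_on_def by blast

lemma kern_borel_measurable [measurable]: "kern \<alpha> \<in> borel_measurable borel"
  unfolding kern_def[abs_def] by measurable

lemma frac_int_eq_integral:
  assumes "continuous_on {0..2*T} w"
  shows "frac_int \<alpha> T w x = integral {0..2*T} (\<lambda>y. K (x - y) * w y)"
proof -
  let ?f = "\<lambda>y. indicator {0..2*T} y *\<^sub>R (K (x - y) * w y)"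
  \<comment> \<open>Nothing is known about \<open>w\<close> outside the interval, so it is cut off
    before measurability is claimed.\<close>
  have wm: "(\<lambda>y. indicator {0..2*T} y *\<^sub>R w y) \<in> borel_measurable borel"
    using borel_measurable_continuous_on_indicator[OF _ assms] by (simp add: scaleR_conv_of_real)
  have eq: "?f = (\<lambda>y. K (x - y) * (indicator {0..2*T} y *\<^sub>R w y))" by (auto simp: fun_eq_iff)
  have m: "?f \<in> borel_measurable borel"
    unfolding eq using wm by measurable
  have "integrable lebesgue ?f"
    using K_mult_absolutely_integrable[OF assms, of x] by (simp add: set_integrable_def)
  hence "integrable lborel ?f"
    by (rule integrable_completion[THEN iffD1, rotated]) (simp only: m measurable_lborel2)
  hence si: "set_integrable lborel {0..2*T} (\<lambda>y. K (x - y) * w y)" by (simp add: set_integrable_def)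
  have si': "set_integrable lborel (Omega T) (\<lambda>y. K (x - y) * w y)"
    by (rule set_integrable_subset[OF si]) (auto simp: Omega_def)
  show ?thesis
    unfolding frac_int_def set_borel_integral_eq_integral(2)[OF si']
    by (simp add: Omega_def integral_open_interval_real)
qed

section \<open>The graded mesh\<close>

abbreviation "X \<equiv> mesh T r"
abbreviation "H \<equiv> mesh_step T r"

definition cN :: "nat \<Rightarrow> real" where "cN N = T / real N powr r"

lemma cN_pos: "1 \<le> N \<Longrightarrow> 0 < cN N" using T0 by (simp add: cN_def)

lemma mesh_left: "j \<le> N \<Longrightarrow> 1 \<le> N \<Longrightarrow> X N j = cN N * real j powr r"
  by (simp add: mesh_def cN_def powr_divide)

lemma mesh_0: "X N 0 = 0"
  by (simp add: mesh_def)

lemma mesh_mid: "1 \<le> N \<Longrightarrow> X N N = T" by (simp add: mesh_def)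

lemma mesh_reflect: assumes "1 \<le> N" "j \<le> 2 * N" shows "X N (2 * N - j) = 2 * T - X N j"
proof -
  consider "j < N" | "j = N" | "N < j" by linarith
  thus ?thesis
  proof cases
    case 1
    hence "(2 * N - j \<le> N) = False" "real (2 * N - j) = 2 * real N - real j" by auto
    thus ?thesis using 1 unfolding mesh_def by (simp only: if_False if_True) simp
  next
    case 2
    thus ?thesis using assms by (simp add: mesh_def)
  next
    case 3
    hence "(2 * N - j \<le> N) = True" "real (2 * N - j) = 2 * real N - real j" "(j \<le> N) = False" using assms by auto
    thus ?thesis unfolding mesh_def by (simp only: if_False if_True)
  qed
qed

lemma mesh_end: "1 \<le> N \<Longrightarrow> X N (2 * N) = 2 * T"
  using mesh_reflect[of N 0] by (simp add: mesh_0)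

lemma mesh_less_Suc: assumes "1 \<le> N" "j < 2 * N" shows "X N j < X N (Suc j)"
proof -
  have *: "X N j < X N (Suc j)" if "j < N" for j
  proof -
    have "real j powr r < real (Suc j) powr r" using r1 by (intro powr_less_mono2) auto
    thus ?thesis using that cN_pos[OF assms(1)] by (simp add: mesh_left)
  qed
  show ?thesis
  proof (cases "j < N")
    case False
    define k where "k = 2 * N - Suc j"
    have k: "k < N" "2 * N - k = Suc j" "2 * N - Suc k = j" using False assms by (auto simp: k_def)
    have "X N (Suc j) = 2 * T - X N k" "X N j = 2 * T - X N (Suc k)"
      using mesh_reflect[of N k] mesh_reflect[of N "Suc k"] k assms by auto
    thus ?thesis using *[OF k(1)] by simp
  qed (use * in auto)
qed

lemma mesh_less: assumes "1 \<le> N" "i < j" "j \<le> 2 * N" shows "X N i < X N j"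
  using assms(2,3)
proof (induction j)
  case (Suc j)
  show ?case
  proof (cases "i = j")
    case False
    hence "X N i < X N j" using Suc by auto
    thus ?thesis using mesh_less_Suc[OF assms(1), of j] Suc by auto
  qed (use mesh_less_Suc[OF assms(1), of j] Suc in auto)
qed auto

lemma mesh_le: "1 \<le> N \<Longrightarrow> i \<le> j \<Longrightarrow> j \<le> 2 * N \<Longrightarrow> X N i \<le> X N j"
  using mesh_less[of N i j] by (cases "i = j") auto

lemma mesh_nonneg: "1 \<le> N \<Longrightarrow> j \<le> 2 * N \<Longrightarrow> 0 \<le> X N j"
  using mesh_le[of N 0 j] by (simp add: mesh_0)

lemma mesh_pos: "1 \<le> N \<Longrightarrow> 1 \<le> j \<Longrightarrow> j \<le> 2 * N \<Longrightarrow> 0 < X N j"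
  using mesh_less[of N 0 j] by (simp add: mesh_0)

lemma mesh_upper: "1 \<le> N \<Longrightarrow> j \<le> 2 * N \<Longrightarrow> X N j \<le> 2 * T"
  using mesh_le[of N j "2 * N"] by (simp add: mesh_end)

lemma mesh_le_mid: "1 \<le> N \<Longrightarrow> j \<le> N \<Longrightarrow> X N j \<le> T"
  using mesh_le[of N j N] by (simp add: mesh_mid)

lemma step_eq: "H N (Suc j) = X N (Suc j) - X N j" by (simp add: mesh_step_def)
lemma step_eq': "1 \<le> j \<Longrightarrow> H N j = X N j - X N (j - 1)" by (simp add: mesh_step_def)

lemma step_pos: "1 \<le> N \<Longrightarrow> 1 \<le> j \<Longrightarrow> j \<le> 2 * N \<Longrightarrow> 0 < H N j"
  using mesh_less[of N "j - 1" j] by (simp add: step_eq')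

lemma step_reflect: assumes "1 \<le> N" "1 \<le> j" "j \<le> 2 * N" shows "H N (2 * N + 1 - j) = H N j"
proof -
  have "X N (2 * N + 1 - j) = 2 * T - X N (j - 1)"
    using mesh_reflect[of N "j - 1"] assms by (simp add: Suc_diff_le)
  moreover have "X N (2 * N + 1 - j - 1) = 2 * T - X N j"
    using mesh_reflect[of N j] assms by (simp add: Suc_diff_le)
  ultimately show ?thesis using assms by (simp add: step_eq')
qed

lemma step_left: "1 \<le> j \<Longrightarrow> j \<le> N \<Longrightarrow> H N j = cN N * (real j powr r - (real j - 1) powr r)"
  by (simp add: step_eq' mesh_left of_nat_diff algebra_simps)

text \<open>The local step size: on the left half \<open>X N i\<close> is proportional to i powr r,
  so the step next to it is about r times \<open>eta N i\<close>.\<close>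

definition eta :: "nat \<Rightarrow> nat \<Rightarrow> real" where "eta N i = X N i / real i"

lemma eta_eq: assumes "1 \<le> i" "i \<le> N" shows "eta N i = cN N * real i powr (r - 1)"
proof -
  have "real i powr r = real i powr (r - 1) * real i" using powr_add[of "real i" "r - 1" 1] assms by simp
  thus ?thesis using assms by (simp add: eta_def mesh_left)
qed

lemma eta_pos: "1 \<le> i \<Longrightarrow> i \<le> N \<Longrightarrow> 0 < eta N i"
  using mesh_pos[of N i] by (simp add: eta_def)

end

section \<open>Mesh steps in a window of comparable indices\<close>

lemma powr_window_upper:
  fixes s x \<beta> :: real
  assumes "0 < x" "x / 8 \<le> s" "s \<le> 8 * x"
  shows "s powr \<beta> \<le> 8 powr \<bar>\<beta>\<bar> * x powr \<beta>"
proof (cases "0 \<le> \<beta>")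
  case True
  have "s powr \<beta> \<le> (8 * x) powr \<beta>" using assms True by (intro powr_mono2) auto
  thus ?thesis using assms True by (simp add: powr_mult)
next
  case False
  have "s powr \<beta> \<le> (x / 8) powr \<beta>" using assms False by (intro powr_mono2') auto
  also have "\<dots> = x powr \<beta> / 8 powr \<beta>" using assms by (simp add: powr_divide)
  also have "\<dots> = 8 powr \<bar>\<beta>\<bar> * x powr \<beta>" using False by (simp add: powr_minus field_simps)
  finally show ?thesis .
qed

lemma powr_window_lower:
  fixes s x \<beta> :: real
  assumes "0 < x" "x / 8 \<le> s" "s \<le> 8 * x"
  shows "x powr \<beta> / 8 powr \<bar>\<beta>\<bar> \<le> s powr \<beta>"
proof -
  have "x powr \<beta> \<le> 8 powr \<bar>\<beta>\<bar> * s powr \<beta>"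
    by (rule powr_window_upper) (use assms in auto)
  thus ?thesis by (simp add: field_simps)
qed

lemma second_difference_le:
  fixes f :: "real \<Rightarrow> real"
  assumes "\<And>x. a \<le> x \<Longrightarrow> x \<le> a + 2 \<Longrightarrow> (f has_real_derivative f' x) (at x)"
    and "\<And>x. a \<le> x \<Longrightarrow> x \<le> a + 2 \<Longrightarrow> (f' has_real_derivative f'' x) (at x)"
    and "\<And>x. a \<le> x \<Longrightarrow> x \<le> a + 2 \<Longrightarrow> \<bar>f'' x\<bar> \<le> B"
  shows "\<bar>f (a + 2) - 2 * f (a + 1) + f a\<bar> \<le> B"
proof -
  have "continuous_on {a..a+2} f"
    by (rule DERIV_continuous_on) (use assms(1) in \<open>auto intro: DERIV_subset\<close>)
  hence "\<bar>dd a (a + 1) (a + 2) f\<bar> \<le> B * (a + 2 - a) / 2"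
    by (intro dd_abs_le_deriv2[where g'=f' and g''=f'']) (use assms in auto)
  thus ?thesis by (simp add: dd_def algebra_simps)
qed

context frac_problem
begin

text \<open>The window contains the indices whose mesh steps are comparable with those at \<open>i\<close>; the
  last condition says \<open>2 N - j \<ge> i / 8\<close>, and the slack in the first one keeps \<open>j - 1\<close> comparable.\<close>

definition win :: "nat \<Rightarrow> nat \<Rightarrow> nat \<Rightarrow> bool" where
  "win N i j \<longleftrightarrow> i + 8 \<le> 8 * j \<and> j \<le> 2 * i \<and> i + 8 * j \<le> 16 * N"

text \<open>One constant for all window estimates. The cube dominates the coefficients r, 1 / r, r
  (r - 1) and r (r - 1) (r - 2) from up to three derivatives of x powr r; the power of 8 dominates
  the change of x powr (r - k), k = 1, 2, 3, when x varies by a factor 8.\<close>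

definition Cw :: real where
  "Cw = 8 powr (r + 3) * (r + 1) ^ 3"

lemma Cw_ge: "1 \<le> Cw" "r * 8 powr \<bar>r - 1\<bar> \<le> Cw" "8 powr \<bar>r - 1\<bar> / r \<le> Cw"
   "r * (r - 1) * 8 powr \<bar>r - 2\<bar> \<le> Cw" "\<bar>r * (r - 1) * (r - 2)\<bar> * 8 powr \<bar>r - 3\<bar> \<le> Cw"
proof -
  have p: "8 powr \<bar>r - 1\<bar> \<le> 8 powr (r + 3)" "8 powr \<bar>r - 2\<bar> \<le> 8 powr (r + 3)" "8 powr \<bar>r - 3\<bar> \<le> 8 powr (r + 3)"
    using r1 by (auto intro!: powr_mono)
  have p1: "1 \<le> (8::real) powr (r + 3)" using r1 by (simp add: ge_one_powr_ge_zero)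
  have q: "1 \<le> (r + 1) ^ 3" "r \<le> (r + 1) ^ 3" "1 / r \<le> (r + 1) ^ 3" "r * (r - 1) \<le> (r + 1) ^ 3"
    "\<bar>r * (r - 1) * (r - 2)\<bar> \<le> (r + 1) ^ 3"
  proof -
    have s: "(r + 1) ^ 1 \<le> (r + 1) ^ 3" "(r + 1) ^ 2 \<le> (r + 1) ^ 3" using r1 by (intro power_increasing; simp)+
    thus "1 \<le> (r + 1) ^ 3" "r \<le> (r + 1) ^ 3" using r1 by auto
    show "1 / r \<le> (r + 1) ^ 3" using r1 \<open>1 \<le> (r + 1) ^ 3\<close> by (smt (verit) divide_le_eq_1)
    have "r * (r - 1) \<le> (r + 1) ^ 2" using r1 by (simp add: power2_eq_square algebra_simps)
    thus "r * (r - 1) \<le> (r + 1) ^ 3" using s by simp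
    have "\<bar>r * (r - 1) * (r - 2)\<bar> = r * (r - 1) * \<bar>r - 2\<bar>" using r1 by (simp add: abs_mult)
    also have "\<dots> \<le> (r + 1) * (r + 1) * (r + 1)" using r1 by (intro mult_mono) auto
    finally show "\<bar>r * (r - 1) * (r - 2)\<bar> \<le> (r + 1) ^ 3" by (simp add: power3_eq_cube)
  qed
  show "1 \<le> Cw" unfolding Cw_def using mult_mono[OF p1 q(1)] by simp
  show "r * 8 powr \<bar>r - 1\<bar> \<le> Cw" unfolding Cw_def using mult_mono[OF p(1) q(2)] r1 by (simp add: mult.commute)
  show "8 powr \<bar>r - 1\<bar> / r \<le> Cw" unfolding Cw_def using mult_mono[OF p(1) q(3)] r1 by simp
  show "r * (r - 1) * 8 powr \<bar>r - 2\<bar> \<le> Cw" unfolding Cw_def using mult_mono[OF p(2) q(4)] r1 by (simp add: mult.commute)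
  show "\<bar>r * (r - 1) * (r - 2)\<bar> * 8 powr \<bar>r - 3\<bar> \<le> Cw"
    unfolding Cw_def using mult_mono[OF p(3) q(5)] r1 by (simp add: mult.commute)
qed

lemma winD: assumes "1 \<le> i" "i \<le> N" "win N i j"
  shows "2 \<le> j" "j < 2 * N"
  using assms by (auto simp: win_def)

text \<open>By the mean value theorem the step is \<open>cN N\<close> times r z powr (r - 1) with z
  between j - 1 and j. The hypotheses put z between i / 8 and 8 i, so z can be replaced by i at the
  cost of a constant.\<close>

lemma window_left:
  assumes "1 \<le> i" "i \<le> N" "1 \<le> j" "j \<le> N" "i + 8 \<le> 8 * j" "j \<le> 2 * i"
  shows "eta N i / Cw \<le> H N j" "H N j \<le> Cw * eta N i"
proof -
  have "\<exists>z>real j - 1. z < real j \<and> real j powr r - (real j - 1) powr r = (real j - (real j - 1)) * (r * z powr (r - 1))"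
    by (rule MVT2) (use assms in \<open>auto intro!: has_real_derivative_powr\<close>)
  then obtain z where z: "real j - 1 < z" "z < real j" "real j powr r - (real j - 1) powr r = r * z powr (r - 1)"
    by auto
  have zb: "real i / 8 \<le> z" "z \<le> 8 * real i" using z assms by auto
  have h: "H N j = cN N * (r * z powr (r - 1))" using assms z by (simp add: step_left)
  have c: "0 < cN N" using assms by (intro cN_pos) auto
  have "z powr (r - 1) \<le> 8 powr \<bar>r - 1\<bar> * real i powr (r - 1)"
    by (rule powr_window_upper) (use assms zb in auto)
  hence "H N j \<le> cN N * (r * (8 powr \<bar>r - 1\<bar> * real i powr (r - 1)))"
    unfolding h using c r1 by (intro mult_left_mono) auto
  also have "\<dots> = (r * 8 powr \<bar>r - 1\<bar>) * eta N i" using assms by (simp add: eta_eq)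
  also have "\<dots> \<le> Cw * eta N i" using eta_pos[of i N] assms Cw_ge(2) by (intro mult_right_mono) auto
  finally show "H N j \<le> Cw * eta N i" .
  have "real i powr (r - 1) / 8 powr \<bar>r - 1\<bar> \<le> z powr (r - 1)"
    by (rule powr_window_lower) (use assms zb in auto)
  hence "cN N * (r * (real i powr (r - 1) / 8 powr \<bar>r - 1\<bar>)) \<le> H N j"
    unfolding h using c r1 by (intro mult_left_mono) auto
  moreover have "cN N * (r * (real i powr (r - 1) / 8 powr \<bar>r - 1\<bar>)) = eta N i / (8 powr \<bar>r - 1\<bar> / r)"
    using assms r1 by (simp only: eta_eq) simp
  moreover have "eta N i / Cw \<le> eta N i / (8 powr \<bar>r - 1\<bar> / r)"
    using eta_pos[of i N] assms Cw_ge(1,3) r1 by (intro divide_left_mono) auto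
  ultimately show "eta N i / Cw \<le> H N j" by (simp only:)
qed

lemma window_left_diff:
  assumes "1 \<le> i" "i \<le> N" "1 \<le> j" "j + 1 \<le> N" "i + 8 \<le> 8 * j" "j + 1 \<le> 2 * i"
  shows "\<bar>H N (j + 1) - H N j\<bar> \<le> Cw * eta N i / real i"
proof -
  let ?B = "r * (r - 1) * (8 powr \<bar>r - 2\<bar> * real i powr (r - 2))"
  have "\<bar>(real j - 1 + 2) powr r - 2 * (real j - 1 + 1) powr r + (real j - 1) powr r\<bar> \<le> ?B"
  proof (rule second_difference_le)
    fix x assume x: "real j - 1 \<le> x" "x \<le> real j - 1 + 2"
    have x0: "real i / 8 \<le> x" "x \<le> 8 * real i" "0 < x" using x assms by linarith+
    show "((\<lambda>x. x powr r) has_real_derivative r * x powr (r - 1)) (at x)"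
      by (rule has_real_derivative_powr) fact
    show "((\<lambda>x. r * x powr (r - 1)) has_real_derivative r * ((r - 1) * x powr (r - 1 - 1))) (at x)"
      by (intro DERIV_cmult has_real_derivative_powr) fact
    have "x powr (r - 2) \<le> 8 powr \<bar>r - 2\<bar> * real i powr (r - 2)"
      by (rule powr_window_upper) (use assms x0 in auto)
    thus "\<bar>r * ((r - 1) * x powr (r - 1 - 1))\<bar> \<le> ?B"
      using r1 by (simp add: abs_mult mult_left_mono)
  qed
  moreover have "H N (j + 1) - H N j = cN N * ((real j - 1 + 2) powr r - 2 * (real j - 1 + 1) powr r + (real j - 1) powr r)"
    using assms step_left[of "j + 1" N] step_left[of j N] by (simp add: algebra_simps)
  moreover have c: "0 < cN N" using assms by (intro cN_pos) auto
  ultimately have "\<bar>H N (j + 1) - H N j\<bar> \<le> cN N * ?B"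
    by (simp add: abs_mult)
  also have "\<dots> = (r * (r - 1) * 8 powr \<bar>r - 2\<bar>) * (eta N i / real i)"
  proof -
    have "real i powr (r - 1) = real i powr (r - 2) * real i" using powr_add[of "real i" "r - 2" 1] assms by simp
    thus ?thesis using assms by (simp add: eta_eq)
  qed
  also have "\<dots> \<le> Cw * (eta N i / real i)"
    using eta_pos[of i N] assms Cw_ge(4) by (intro mult_right_mono) auto
  finally show ?thesis by simp
qed

text \<open>This is a third difference of x powr r. It is treated as the second difference of (x +
  1) powr r - x powr r, whose second derivative is in turn a first difference of x powr (r - 2), so
  that one more mean value suffices. The summand 16 keeps j - 2 above i / 8.\<close>

lemma window_left_diff2:
  assumes "1 \<le> i" "i \<le> N" "2 \<le> j" "j + 1 \<le> N" "i + 16 \<le> 8 * j" "j + 1 \<le> 2 * i"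
  shows "\<bar>H N (j + 1) - 2 * H N j + H N (j - 1)\<bar> \<le> Cw * eta N i / (real i)\<^sup>2"
proof -
  let ?B = "\<bar>r * (r - 1) * (r - 2)\<bar> * (8 powr \<bar>r - 3\<bar> * real i powr (r - 3))"
  let ?f = "\<lambda>x. (x + 1) powr r - x powr r"
  have "\<bar>?f (real j - 2 + 2) - 2 * ?f (real j - 2 + 1) + ?f (real j - 2)\<bar> \<le> ?B"
  proof (rule second_difference_le)
    fix x assume x: "real j - 2 \<le> x" "x \<le> real j - 2 + 2"
    have x0: "real i / 8 \<le> x" "x + 1 \<le> 8 * real i" "0 < x" using x assms by linarith+
    show "(?f has_real_derivative r * (x + 1) powr (r - 1) - r * x powr (r - 1)) (at x)"
      using x0 by (auto intro!: derivative_eq_intros)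
    show "((\<lambda>x. r * (x + 1) powr (r - 1) - r * x powr (r - 1)) has_real_derivative
        r * (r - 1) * ((x + 1) powr (r - 2) - x powr (r - 2))) (at x)"
      using x0 by (auto intro!: derivative_eq_intros simp: algebra_simps)
    have "\<exists>z>x. z < x + 1 \<and> (x + 1) powr (r - 2) - x powr (r - 2) = (x + 1 - x) * ((r - 2) * z powr (r - 2 - 1))"
    proof (rule MVT2)
      show "((\<lambda>a. a powr (r - 2)) has_real_derivative (r - 2) * y powr (r - 2 - 1)) (at y)" if "x \<le> y" for y
        by (rule has_real_derivative_powr) (use x0 that in linarith)
    qed auto
    then obtain z where z: "x < z" "z < x + 1" "(x + 1) powr (r - 2) - x powr (r - 2) = (r - 2) * z powr (r - 3)"
      by auto
    have "z powr (r - 3) \<le> 8 powr \<bar>r - 3\<bar> * real i powr (r - 3)"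
      by (rule powr_window_upper) (use assms x0 z in auto)
    thus "\<bar>r * (r - 1) * ((x + 1) powr (r - 2) - x powr (r - 2))\<bar> \<le> ?B"
      using r1 unfolding z(3) by (simp add: abs_mult mult_left_mono)
  qed
  moreover have "H N (j + 1) - 2 * H N j + H N (j - 1) = cN N * (?f (real j - 2 + 2) - 2 * ?f (real j - 2 + 1) + ?f (real j - 2))"
    using assms step_left[of "j + 1" N] step_left[of j N] step_left[of "j - 1" N] by (simp add: algebra_simps of_nat_diff)
  moreover have c: "0 < cN N" using assms by (intro cN_pos) auto
  ultimately have "\<bar>H N (j + 1) - 2 * H N j + H N (j - 1)\<bar> \<le> cN N * ?B"
    by (simp add: abs_mult)
  also have "\<dots> = (\<bar>r * (r - 1) * (r - 2)\<bar> * 8 powr \<bar>r - 3\<bar>) * (eta N i / (real i)\<^sup>2)"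
  proof -
    have "real i powr (r - 1) = real i powr (r - 3) * (real i)\<^sup>2"
      using powr_add[of "real i" "r - 3" 2] assms by (simp add: powr_numeral)
    thus ?thesis using assms by (simp add: eta_eq)
  qed
  also have "\<dots> \<le> Cw * (eta N i / (real i)\<^sup>2)"
    using eta_pos[of i N] assms Cw_ge(5) by (intro mult_right_mono) auto
  finally show ?thesis by simp
qed

text \<open>A cell beyond T is reflected to the left half, and the last condition of
  \<open>win\<close> becomes the lower bound on the reflected index.\<close>

lemma window_step:
  assumes i: "1 \<le> i" "i \<le> N" and w: "win N i j"
  shows "eta N i / Cw \<le> H N j" "H N j \<le> Cw * eta N i"
proof -
  have "eta N i / Cw \<le> H N j \<and> H N j \<le> Cw * eta N i"
  proof (cases "j \<le> N")
    case True
    thus ?thesis using window_left[of i N j] i w by (auto simp: win_def)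
  next
    case False
    define k where "k = 2 * N + 1 - j"
    have k: "1 \<le> k" "k \<le> N" "i + 8 \<le> 8 * k" "k \<le> 2 * i" using False w i by (auto simp: k_def win_def)
    have "H N j = H N k" using step_reflect[of N j] winD[OF i w] i by (simp add: k_def)
    thus ?thesis using window_left[of i N k] i k by auto
  qed
  thus "eta N i / Cw \<le> H N j" "H N j \<le> Cw * eta N i" by auto
qed

text \<open>The kink at T does no harm here: the two steps that meet at T are equal by symmetry. It
  shows only in the second differences of the steps.\<close>

lemma window_step_diff:
  assumes i: "1 \<le> i" "i \<le> N" and w: "win N i j" "win N i (j + 1)"
  shows "\<bar>H N (j + 1) - H N j\<bar> \<le> Cw * eta N i / real i"
proof -
  consider "j + 1 \<le> N" | "j = N" | "N < j" by linarith
  thus ?thesis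
  proof cases
    case 1
    thus ?thesis using window_left_diff[of i N j] i w by (auto simp: win_def)
  next
    case 2
    have "H N (j + 1) = H N j" using step_reflect[of N N] 2 i by simp
    thus ?thesis using eta_pos[OF i] Cw_ge(1) by simp
  next
    case 3
    define k where "k = 2 * N - j"
    have k: "1 \<le> k" "k + 1 \<le> N" "i + 8 \<le> 8 * k" "k + 1 \<le> 2 * i" using 3 w i by (auto simp: k_def win_def)
    have "2 * N + 1 - j = k + 1" "2 * N + 1 - (j + 1) = k" using winD[OF i w(1)] by (auto simp: k_def)
    hence "H N j = H N (k + 1)" "H N (j + 1) = H N k"
      using step_reflect[of N j] step_reflect[of N "j + 1"] winD[OF i w(1)] winD[OF i w(2)] i by auto
    thus ?thesis using window_left_diff[of i N k] i k by (simp add: abs_minus_commute)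
  qed
qed

text \<open>Convexity of x powr r. For j = 1 the triple starts at 0, where only continuity of the
  power is available; this is all that \<open>dd_ge_deriv2\<close> asks for at an endpoint.\<close>

lemma step_mono: assumes "1 \<le> j" "j + 1 \<le> N" shows "H N j \<le> H N (j + 1)"
proof -
  have "0 * ((real j + 1) - (real j - 1)) / 2 \<le> dd (real j - 1) (real j) (real j + 1) (\<lambda>x. x powr r)"
  proof (rule dd_ge_deriv2[where g'="\<lambda>x. r * x powr (r - 1)" and g''="\<lambda>x. r * ((r - 1) * x powr (r - 1 - 1))" and s=0])
    show "continuous_on {real j - 1..real j + 1} (\<lambda>x. x powr r)"
      using r1 assms by (intro continuous_on_powr' continuous_intros) auto
    show "continuous_on {real j - 1<..<real j + 1} (\<lambda>x. r * x powr (r - 1))"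
      using assms by (intro continuous_intros) auto
    show "((\<lambda>x. x powr r) has_real_derivative r * x powr (r - 1)) (at x)"
      "((\<lambda>x. r * x powr (r - 1)) has_real_derivative r * ((r - 1) * x powr (r - 1 - 1))) (at x)"
      if "real j - 1 < x" for x
      by (intro has_real_derivative_powr DERIV_cmult; use that assms in linarith)+
  qed (use assms r1 in auto)
  hence "0 \<le> (real j + 1) powr r - 2 * real j powr r + (real j - 1) powr r" by (simp add: dd_def)
  moreover have "H N (j + 1) - H N j = cN N * ((real j + 1) powr r - 2 * real j powr r + (real j - 1) powr r)"
    using assms step_left[of "j + 1" N] step_left[of j N] by (simp add: algebra_simps)
  moreover have "0 < cN N" using assms by (intro cN_pos) auto
  ultimately have "0 \<le> H N (j + 1) - H N j" by (simp only: mult_nonneg_nonneg less_imp_le)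
  thus ?thesis by simp
qed

lemma step_mono_le: assumes "1 \<le> i" "i \<le> j" "j \<le> N" shows "H N i \<le> H N j"
  using assms(2,3)
proof (induction j)
  case (Suc j)
  show ?case
  proof (cases "i = Suc j")
    case False
    thus ?thesis using Suc step_mono[of j N] assms(1) by auto
  qed auto
qed (use assms in auto)

end

section \<open>The discrete operator\<close>

lemma DERIV_dd:
  assumes "\<And>y. y \<in> {a, b, c} \<Longrightarrow> ((\<lambda>x. g x y) has_real_derivative g' y) (at x)"
  shows "((\<lambda>x. dd a b c (g x)) has_real_derivative dd a b c g') (at x)"
  unfolding dd_def by (intro DERIV_cdivide DERIV_diff assms) auto

lemma continuous_on_dd:
  assumes "\<And>y. y \<in> {a, b, c} \<Longrightarrow> continuous_on A (\<lambda>x. g x y)"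
  shows "continuous_on A (\<lambda>x. dd a b c (g x))"
  unfolding dd_def divide_inverse by (auto intro!: continuous_intros assms)

lemma young_one:
  fixes s q :: real
  assumes "0 < s" "0 \<le> q" "q \<le> 1"
  shows "s powr q \<le> q * s + (1 - q)"
  using Youngs_inequality_0[of q "1 - q" s 1] assms by simp

text \<open>The scale-free form of the sign condition for neighbouring indices, with q = 2 -
  \<alpha> and s the ratio of two adjacent gaps. Bernoulli's inequality (1 + 1/s) powr q \<le> 1 +
  q/s, multiplied by s - q > 0, cancels the leading terms; what is left is bounded below by a
  square.\<close>

lemma adjacent_core:
  fixes s q :: real
  assumes s: "1 \<le> s" and q: "0 < q" "q < 1"
  shows "0 \<le> (1 + s) powr q * (q - s) + s powr q * s + (1 - q) * s - q"
proof -
  have "1 + s = s * (1 + 1 / s)" using s by (simp add: distrib_left)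
  hence "(1 + s) powr q = s powr q * (1 + 1 / s) powr q"
    using s powr_mult[of s "1 + 1 / s" q] by simp
  also have "\<dots> \<le> s powr q * (q * (1 + 1 / s) + (1 - q))"
    using young_one[of "1 + 1 / s" q] s q add_pos_nonneg[of 1 "1 / s"] by (intro mult_left_mono) auto
  also have "\<dots> = s powr q * (1 + q / s)" by (simp add: algebra_simps)
  finally have 1: "(1 + s) powr q * (s - q) \<le> s powr q * (1 + q / s) * (s - q)"
    using s q by (intro mult_right_mono) auto
  have 2: "s powr q * (1 + q / s) * (s - q) = s powr q * s - q\<^sup>2 * (s powr q / s)"
    using s by (simp add: field_simps power2_eq_square)
  \<comment> \<open>The weighted arithmetic mean that dominates s powr (1 - q). With 1 / w in place
    of s powr (q - 1) the remainder is exactly (w - q)^2 / w.\<close>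
  define w where "w = (1 - q) * s + q"
  have w: "0 < w" using s q by (simp add: w_def add_pos_pos)
  have "s powr q / s = 1 / s powr (1 - q)"
    using s by (simp add: powr_diff)
  also have "\<dots> \<ge> 1 / w"
    using young_one[of s "1 - q"] s q w by (intro divide_left_mono) (auto simp: w_def)
  finally have 3: "q\<^sup>2 * (1 / w) \<le> q\<^sup>2 * (s powr q / s)" by (intro mult_left_mono) auto
  have "0 \<le> (w - q)\<^sup>2 / w" using w by simp
  also have "(w - q)\<^sup>2 / w = q\<^sup>2 * (1 / w) + w - 2 * q" using w by (simp add: power2_diff field_simps power2_eq_square)
  finally have "0 \<le> q\<^sup>2 * (1 / w) + (1 - q) * s - q" by (simp add: w_def)
  thus ?thesis using 1 2 3 by (simp add: algebra_simps)
qed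

context frac_problem
begin

lemma dd_K_nonneg:
  assumes "0 < a" "a < b" "b < c"
  shows "0 \<le> dd a b c K"
proof -
  have "0 * (c - a) / 2 \<le> dd a b c K"
  proof (rule dd_ge_deriv2[where g'="\<lambda>t. - (\<kappa> * (\<alpha> - 1)) * t powr (- \<alpha>)"
        and g''="\<lambda>t. \<kappa> * (\<alpha> - 1) * \<alpha> * t powr (- 1 - \<alpha>)" and s=0])
    show "continuous_on {a..c} K"
      by (rule DERIV_continuous_on[OF DERIV_subset[OF DERIV_K]]) (use assms in auto)
    show "continuous_on {a<..<c} (\<lambda>t. - (\<kappa> * (\<alpha> - 1)) * t powr (- \<alpha>))"
      using assms by (intro continuous_intros) auto
  qed (use assms DERIV_K DERIV_K' \<kappa>0 \<alpha>1 in auto)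
  thus ?thesis by simp
qed

lemma dd_K_shift_nonneg:
  assumes "0 < a + t" "a < b" "b < c"
  shows "0 \<le> dd a b c (\<lambda>y. K (t + y))"
proof -
  have "dd a b c (\<lambda>y. K (t + y)) = dd (t + a) (t + b) (t + c) K" by (simp add: dd_def)
  thus ?thesis using dd_K_nonneg[of "t + a" "t + b" "t + c"] assms by simp
qed

text \<open>Two derivatives in x turn \<open>K2\<close> into \<open>K\<close>, and \<open>K\<close>
  is convex on either side of its singularity. Triples that share an endpoint are allowed, because
  the second derivative is needed only for x strictly between \<open>x0\<close> and
  \<open>x2\<close>.\<close>

lemma dd_dd_separated:
  assumes "x0 < x1" "x1 < x2" "x2 \<le> y0" "y0 < y1" "y1 < y2"
  shows "0 \<le> dd x0 x1 x2 (\<lambda>x. dd y0 y1 y2 (\<lambda>y. K2 (x - y)))"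
proof -
  have "0 * (x2 - x0) / 2 \<le> dd x0 x1 x2 (\<lambda>x. dd y0 y1 y2 (\<lambda>y. K2 (x - y)))"
  proof (rule dd_ge_deriv2[where g'="\<lambda>x. dd y0 y1 y2 (\<lambda>y. K1 (x - y))"
        and g''="\<lambda>x. dd y0 y1 y2 (\<lambda>y. K (x - y))" and s=x0])
    show "continuous_on {x0..x2} (\<lambda>x. dd y0 y1 y2 (\<lambda>y. K2 (x - y)))"
      by (intro continuous_on_dd K2_cont_shift)
    show "continuous_on {x0<..<x2} (\<lambda>x. dd y0 y1 y2 (\<lambda>y. K1 (x - y)))"
      by (intro continuous_on_dd K1_cont_shift)
    show "((\<lambda>x. dd y0 y1 y2 (\<lambda>y. K2 (x - y))) has_real_derivative dd y0 y1 y2 (\<lambda>y. K1 (x - y))) (at x)" for x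
      by (intro DERIV_dd DERIV_K2_shift)
    show "((\<lambda>x. dd y0 y1 y2 (\<lambda>y. K1 (x - y))) has_real_derivative dd y0 y1 y2 (\<lambda>y. K (x - y))) (at x)"
      if "x0 < x" "x < x2" for x
      by (intro DERIV_dd DERIV_K1_shift) (use that assms in auto)
    show "0 \<le> dd y0 y1 y2 (\<lambda>y. K (x - y))" if "x0 < x" "x < x2" for x
    proof -
      have "K (x - y) = K (- x + y)" for y using K_even[of "x - y"] by (simp add: algebra_simps)
      thus ?thesis using dd_K_shift_nonneg[of y0 "-x" y1 y2] assms that by simp
    qed
  qed (use assms in auto)
  thus ?thesis by simp
qed

text \<open>The mixed second difference over two overlapping triples can be negative when the middle gap
  is much larger than both outer gaps.\<close>

lemma dd_dd_adjacent:
  assumes "p0 < p1" "p1 < p2" "p2 < p3" "p2 - p1 \<le> p3 - p2"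
  shows "0 \<le> dd p0 p1 p2 (\<lambda>x. dd p1 p2 p3 (\<lambda>y. K2 (x - y)))"
proof -
  define a b c where "a = p1 - p0" and "b = p2 - p1" and "c = p3 - p2"
  have abc: "0 < a" "0 < b" "b \<le> c" "0 < c" using assms by (auto simp: a_def b_def c_def)
  \<comment> \<open>The inner difference as a function of the distance t of x from
    \<open>p1\<close>, for x to the left of \<open>p1\<close>; the nodes \<open>p1\<close> and
    \<open>p0\<close> are t = 0 and t = a.\<close>
  define G where "G = (\<lambda>t. dd 0 b (b + c) (\<lambda>y. K2 (t + y)))"
  define G' where "G' = (\<lambda>t. dd 0 b (b + c) (\<lambda>y. K1 (t + y)))"
  have dG: "(G has_real_derivative G' t) (at t)" for t
    unfolding G_def G'_def using DERIV_K2_shift[of "- y" for y] by (intro DERIV_dd) simp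
  have dG': "(G' has_real_derivative dd 0 b (b + c) (\<lambda>y. K (t + y))) (at t)" if "0 < t" for t
    unfolding G'_def
  proof (intro DERIV_dd)
    fix y assume "y \<in> {0, b, b + c}"
    thus "((\<lambda>x. K1 (x + y)) has_real_derivative K (t + y)) (at t)"
      using DERIV_K1_shift[of t "- y"] abc that by auto
  qed
  have cG': "continuous_on A G'" for A
    unfolding G'_def using K1_cont_shift[of A "- y" for y] by (intro continuous_on_dd) simp
  have mono: "G' 0 \<le> G' t" if "0 < t" for t
  proof (rule DERIV_nonneg_imp_increasing_open[OF less_imp_le[OF that]])
    show "\<exists>y. (G' has_real_derivative y) (at x) \<and> 0 \<le> y" if "0 < x" "x < t" for x
      using dG'[OF \<open>0 < x\<close>] dd_K_shift_nonneg[of 0 x b "b + c"] abc that by auto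
  qed (rule cG')
  have "\<exists>z>0. z < a \<and> G a - G 0 = (a - 0) * G' z"
    by (rule MVT2) (use abc dG in auto)
  \<comment> \<open>Since \<open>G'\<close> takes its least value at 0, the node \<open>p0\<close>
    enters only through the tangent at 0, and an inequality in the two gaps b and c remains.\<close>
  hence Ga: "G' 0 \<le> (G a - G 0) / a" using mono abc by (auto simp: field_simps)
  let ?S = "\<lambda>x. dd p1 p2 p3 (\<lambda>y. K2 (x - y))"
  have S: "?S p0 = G a" "?S p1 = G 0"
    using K2_minus_commute[of p0 p1] K2_minus_commute[of p0 p2] K2_minus_commute[of p0 p3]
      K2_minus_commute[of p1 p2] K2_minus_commute[of p1 p3]
    by (simp_all add: dd_def G_def a_def b_def c_def)
  have S2: "?S p2 = K2 c / c + K2 b / b"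
    using K2_minus_commute[of p2 p3] by (simp add: dd_def b_def c_def K2_0)
  have Q: "dd p0 p1 p2 ?S = (K2 c / c + K2 b / b - G 0) / b - (G 0 - G a) / a"
    by (simp add: dd_def[of p0 p1 p2] S S2) (simp add: a_def b_def)
  define q where "q = 2 - \<alpha>"
  have q: "0 < q" "q < 1" using \<alpha>1 \<alpha>2 by (auto simp: q_def)
  define k where "k = \<kappa> / (q * (1 + q))"
  have k: "0 < k" using \<kappa>0 q by (simp add: k_def)
  define s where "s = c / b"
  have s: "1 \<le> s" using abc by (simp add: s_def)
  have c: "c = b * s" "b + c = b * (1 + s)" using abc by (auto simp: s_def field_simps)
  have K2k: "K2 t = k * (t powr q * t)" if "0 < t" for t
  proof -
    have "\<bar>t\<bar> powr (3 - \<alpha>) = t powr q * t" using that powr_add[of t q 1] by (simp add: q_def)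
    thus ?thesis by (simp add: K2_def k_def q_def add.commute[of 1] )
  qed
  have K1k: "K1 t = k * (1 + q) * t powr q" if "0 < t" for t
    using that q by (simp add: K1_pos k_def q_def[symmetric])
  define B where "B = b powr q"
  define S0 where "S0 = s powr q"
  define W where "W = (1 + s) powr q"
  have pw: "c powr q = B * S0" "(b + c) powr q = B * W" "b powr q = B"
  proof -
    show "c powr q = B * S0" unfolding c(1) B_def S0_def using abc s by (simp add: powr_mult)
    show "(b + c) powr q = B * W" unfolding c(2) B_def W_def using abc s powr_mult[of b "1 + s" q] by simp
  qed (simp add: B_def)
  have v: "K2 b = k * (B * b)" "K2 c = k * (B * S0 * (b * s))" "K2 (b + c) = k * (B * W * (b * (1 + s)))"
      "K1 b = k * (1 + q) * B" "K1 (b + c) = k * (1 + q) * (B * W)"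
    using abc pw K2k[of b] K2k[of c] K2k[of "b + c"] K1k[of b] K1k[of "b + c"] c by auto
  \<comment> \<open>All terms are homogeneous of the same degree, so after extracting a power of b
    only the ratio s = c / b is left.\<close>
  have "b * G' 0 + K2 c / c + K2 b / b - G 0
      = k * B / s * (W * (q - s) + S0 * s + (1 - q) * s - q)"
    unfolding G_def G'_def dd_def using abc s
    by (simp add: K1_0 K2_0 v) (simp add: c(1) field_simps)
  also have "\<dots> \<ge> 0"
    using adjacent_core[OF s q] k s by (auto simp: W_def S0_def B_def intro!: mult_nonneg_nonneg)
  finally have "0 \<le> (K2 c / c + K2 b / b - G 0) / b + G' 0" using abc by (simp add: field_simps)
  thus ?thesis unfolding Q using Ga by (simp add: diff_divide_distrib)
qed

lemma dd_dd_swap: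
  "dd x0 x1 x2 (\<lambda>x. dd y0 y1 y2 (\<lambda>y. K2 (x - y))) = dd y0 y1 y2 (\<lambda>x. dd x0 x1 x2 (\<lambda>y. K2 (x - y)))"
proof -
  have "dd x0 x1 x2 (\<lambda>x. dd y0 y1 y2 (\<lambda>y. F x y)) = dd y0 y1 y2 (\<lambda>y. dd x0 x1 x2 (\<lambda>x. F x y))" for F
    by (simp add: dd_def divide_inverse algebra_simps)
  moreover have "dd x0 x1 x2 (\<lambda>x. K2 (x - y)) = dd x0 x1 x2 (\<lambda>x. K2 (y - x))" for y
    by (rule dd_cong) (rule K2_minus_commute)+
  ultimately show ?thesis by simp
qed

text \<open>Mirror image of the preceding case: reflection at 0 exchanges the two triples, and the
  symmetry of the mixed difference restores their order.\<close>

lemma dd_dd_adjacent':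
  assumes "p0 < p1" "p1 < p2" "p2 < p3" "p2 - p1 \<le> p1 - p0"
  shows "0 \<le> dd p0 p1 p2 (\<lambda>x. dd p1 p2 p3 (\<lambda>y. K2 (x - y)))"
proof -
  have "0 \<le> dd (- p3) (- p2) (- p1) (\<lambda>x. dd (- p2) (- p1) (- p0) (\<lambda>y. K2 (x - y)))"
    by (rule dd_dd_adjacent) (use assms in auto)
  also have "\<dots> = dd p1 p2 p3 (\<lambda>x. dd (- p2) (- p1) (- p0) (\<lambda>y. K2 (- x - y)))"
    using dd_reflect[of p1 p2 p3 "\<lambda>x. dd (- p2) (- p1) (- p0) (\<lambda>y. K2 (x - y))" 0] by simp
  also have "\<dots> = dd p1 p2 p3 (\<lambda>x. dd p0 p1 p2 (\<lambda>y. K2 (x - y)))"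
  proof -
    have "dd (- p2) (- p1) (- p0) (\<lambda>y. K2 (- x - y)) = dd p0 p1 p2 (\<lambda>y. K2 (x - y))" for x
    proof -
      have "K2 (- x + y) = K2 (x - y)" for y using K2_minus_commute[of x y] by simp
      thus ?thesis using dd_reflect[of p0 p1 p2 "\<lambda>y. K2 (- x - y)" 0] by simp
    qed
    thus ?thesis by simp
  qed
  finally show ?thesis by (simp add: dd_dd_swap)
qed

section \<open>The system matrix and the sign of its entries\<close>

definition nodal :: "nat \<Rightarrow> (nat \<Rightarrow> real) \<Rightarrow> nat \<Rightarrow> real" where
  "nodal N U k = (if 1 \<le> k \<and> k \<le> 2 * N - 1 then U k else 0)"

lemma nodal_simps: "nodal N U 0 = 0" "1 \<le> N \<Longrightarrow> nodal N U (2 * N) = 0"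
  by (auto simp: nodal_def)

lemma hat_cell:
  assumes N: "1 \<le> N" and j: "1 \<le> j" "j \<le> 2 * N" and y: "X N (j - 1) \<le> y" "y \<le> X N j"
    and k: "1 \<le> k" "k \<le> 2 * N - 1"
  shows "hat T r N k y = (if k = j then (y - X N (j - 1)) / H N j
           else if k = j - 1 then (X N j - y) / H N j else 0)"
proof -
  consider "k = j" | "k + 1 = j" | "k + 1 < j" | "j < k" by linarith
  thus ?thesis
  proof cases
    case 1
    thus ?thesis using y by (simp add: hat_def)
  next
    case 2
    have "X N (k - 1) < X N k" using N k by (intro mesh_less) auto
    moreover have "X N k < X N j" using N j 2 by (intro mesh_less) auto
    ultimately show ?thesis using 2 y k by (auto simp: hat_def step_eq')
  next
    case 3
    have "X N (k - 1) < X N k" "X N k < X N (k + 1)" using N k by (auto intro!: mesh_less)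
    moreover have "X N (k + 1) \<le> X N (j - 1)" using N j 3 by (intro mesh_le) auto
    ultimately show ?thesis using 3 y by (auto simp: hat_def)
  next
    case 4
    have "X N (k - 1) < X N k" "X N k < X N (k + 1)" using N k by (auto intro!: mesh_less)
    moreover have "X N j \<le> X N (k - 1)" using N j 4 k by (intro mesh_le) auto
    ultimately show ?thesis using 4 y by (auto simp: hat_def)
  qed
qed

lemma fe_fun_cell:
  assumes N: "1 \<le> N" and j: "1 \<le> j" "j \<le> 2 * N" and y: "X N (j - 1) \<le> y" "y \<le> X N j"
  shows "fe_fun T r N U y = nodal N U (j - 1) + (nodal N U j - nodal N U (j - 1)) / H N j * (y - X N (j - 1))"
proof -
  have h: "0 < H N j" using step_pos[OF N j] .
  let ?a = "(y - X N (j - 1)) / H N j" and ?b = "(X N j - y) / H N j"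
  have "fe_fun T r N U y = (\<Sum>k = 1..2 * N - 1. (if k = j then U k * ?a else 0) + (if k = j - 1 then U k * ?b else 0))"
    unfolding fe_fun_def using j by (intro sum.cong refl) (auto simp: hat_cell[OF N j y])
  also have "\<dots> = nodal N U j * ?a + nodal N U (j - 1) * ?b"
    by (simp add: sum.distrib nodal_def)
  also have "?b = 1 - ?a" using h j by (simp add: step_eq' field_simps)
  finally show ?thesis by (simp add: algebra_simps diff_divide_distrib)
qed

lemma cells_cover: assumes "1 \<le> N" "n \<le> 2 * N" "1 \<le> n" shows "(\<Union>j\<in>{1..n}. {X N (j - 1)..X N j}) = {0..X N n}"
  using assms(2,3)
proof (induction n)
  case (Suc n)
  show ?case
  proof (cases "n = 0")
    case True
    thus ?thesis by (simp add: mesh_0)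
  next
    case False
    have "{1..Suc n} = insert (Suc n) {1..n}" by auto
    moreover have "0 \<le> X N n" "X N n \<le> X N (Suc n)" using mesh_nonneg mesh_le assms Suc by auto
    ultimately show ?thesis using Suc False by (auto simp: ivl_disj_un_two_touch)
  qed
qed auto

lemma fe_fun_cont: assumes N: "1 \<le> N" shows "continuous_on {0..2 * T} (fe_fun T r N U)"
proof -
  have "continuous_on (\<Union>j\<in>{1..2 * N}. {X N (j - 1)..X N j}) (fe_fun T r N U)"
  proof (rule continuous_on_closed_Union)
    fix j assume j: "j \<in> {1..2 * N}"
    have "continuous_on {X N (j - 1)..X N j}
      (\<lambda>y. nodal N U (j - 1) + (nodal N U j - nodal N U (j - 1)) / H N j * (y - X N (j - 1)))"
      by (intro continuous_intros)
    thus "continuous_on {X N (j - 1)..X N j} (fe_fun T r N U)"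
      by (rule continuous_on_eq) (use j N in \<open>auto simp: fe_fun_cell[of N j]\<close>)
  qed auto
  thus ?thesis using cells_cover[of N "2 * N"] N by (simp add: mesh_end)
qed

lemma integral_cells:
  assumes N: "1 \<le> N" and "m \<le> n" "n \<le> 2 * N" and g: "(g :: real \<Rightarrow> real) integrable_on {0..2 * T}"
  shows "integral {X N m..X N n} g = (\<Sum>j = m + 1..n. integral {X N (j - 1)..X N j} g)"
  using assms(2,3)
proof (induction n)
  case (Suc n)
  show ?case
  proof (cases "m = Suc n")
    case False
    have le: "X N m \<le> X N n" "X N n \<le> X N (Suc n)" using False Suc N by (auto intro!: mesh_le)
    have "g integrable_on {X N m..X N (Suc n)}"
      by (rule integrable_subinterval_real[OF g])
         (use N Suc mesh_nonneg[of N m] mesh_upper[of N "Suc n"] in auto)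
    hence "integral {X N m..X N (Suc n)} g = integral {X N m..X N n} g + integral {X N n..X N (Suc n)} g"
      using Henstock_Kurzweil_Integration.integral_combine[OF le, of g] by simp
    thus ?thesis using Suc False by simp
  qed auto
qed auto

text \<open>The \<open>K1\<close> terms of \<open>cell_integral\<close> are end values of the
  continuous function \<open>fe_fun\<close> times \<open>K1\<close>. They telescope over the cells,
  and the outermost ones vanish with the nodal values there. Only the slopes, weighted by increments
  of \<open>K2\<close>, remain.\<close>

lemma frac_int_fe_fun:
  assumes N: "1 \<le> N"
  shows "frac_int \<alpha> T (fe_fun T r N U) x =
    (\<Sum>j = 1..2 * N. (nodal N U j - nodal N U (j - 1)) / H N j * (K2 (x - X N (j - 1)) - K2 (x - X N j)))"
proof -
  let ?g = "\<lambda>y. K (x - y) * fe_fun T r N U y" and ?V = "nodal N U"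
  have "frac_int \<alpha> T (fe_fun T r N U) x = integral {X N 0..X N (2 * N)} ?g"
    using N by (simp add: frac_int_eq_integral fe_fun_cont mesh_0 mesh_end)
  also have "\<dots> = (\<Sum>j = 0 + 1..2 * N. integral {X N (j - 1)..X N j} ?g)"
    by (rule integral_cells) (use N in \<open>auto intro!: K_mult_integrable fe_fun_cont\<close>)
  also have "\<dots> = (\<Sum>j = 1..2 * N. (?V (j - 1) * K1 (x - X N (j - 1)) - ?V j * K1 (x - X N j))
       + (?V j - ?V (j - 1)) / H N j * (K2 (x - X N (j - 1)) - K2 (x - X N j)))"
  proof (rule sum.cong)
    fix j assume j: "j \<in> {1..2 * N}"
    have h: "0 < H N j" using step_pos N j by auto
    let ?s = "(?V j - ?V (j - 1)) / H N j"
    have "integral {X N (j - 1)..X N j} ?g = integral {X N (j - 1)..X N j} (\<lambda>y. K (x - y) * (?V (j - 1) + ?s * (y - X N (j - 1))))"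
      by (rule integral_cong) (use j N fe_fun_cell[of N j] in auto)
    also have "\<dots> = ?V (j - 1) * K1 (x - X N (j - 1)) - (?V (j - 1) + ?s * (X N j - X N (j - 1))) * K1 (x - X N j)
        + ?s * (K2 (x - X N (j - 1)) - K2 (x - X N j))"
      by (rule integral_unique[OF cell_integral]) (use N j in \<open>auto intro!: mesh_le\<close>)
    also have "X N j - X N (j - 1) = H N j" using j by (simp add: step_eq')
    finally show "integral {X N (j - 1)..X N j} ?g = (?V (j - 1) * K1 (x - X N (j - 1)) - ?V j * K1 (x - X N j))
       + ?s * (K2 (x - X N (j - 1)) - K2 (x - X N j))" using h by simp
  qed simp
  also have "\<dots> = (\<Sum>j = 1..2 * N. ?V (j - 1) * K1 (x - X N (j - 1)) - ?V j * K1 (x - X N j))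
     + (\<Sum>j = 1..2 * N. (?V j - ?V (j - 1)) / H N j * (K2 (x - X N (j - 1)) - K2 (x - X N j)))"
    by (rule sum.distrib)
  also have "(\<Sum>j = 1..n. ?V (j - 1) * K1 (x - X N (j - 1)) - ?V j * K1 (x - X N j)) = ?V 0 * K1 (x - X N 0) - ?V n * K1 (x - X N n)" for n
    by (induction n) auto
  finally show ?thesis using N by (simp add: nodal_simps)
qed

definition L :: "nat \<Rightarrow> (nat \<Rightarrow> real) \<Rightarrow> nat \<Rightarrow> real" where
  "L N v i = - diff2 T r N (frac_int \<alpha> T (fe_fun T r N v)) i"

definition A :: "nat \<Rightarrow> nat \<Rightarrow> nat \<Rightarrow> real" where
  "A N i j = L N (\<lambda>k. if k = j then 1 else 0) i"

definition ddx :: "nat \<Rightarrow> nat \<Rightarrow> (real \<Rightarrow> real) \<Rightarrow> real" where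
  "ddx N i = dd (X N (i - 1)) (X N i) (X N (i + 1))"

definition span :: "nat \<Rightarrow> nat \<Rightarrow> real" where
  "span N i = X N (i + 1) - X N (i - 1)"

lemma span_pos: "1 \<le> N \<Longrightarrow> 1 \<le> i \<Longrightarrow> i \<le> 2 * N - 1 \<Longrightarrow> 0 < span N i"
  using mesh_less[of N "i - 1" "i + 1"] by (simp add: span_def)

lemma span_eq: "1 \<le> i \<Longrightarrow> span N i = H N i + H N (i + 1)"
  by (simp add: span_def step_eq')

lemma diff2_ddx: "1 \<le> i \<Longrightarrow> diff2 T r N g i = 2 / span N i * ddx N i g"
  by (simp add: diff2_eq_dd span_def ddx_def)

lemma L_eq: "1 \<le> i \<Longrightarrow> L N v i = - (2 / span N i * ddx N i (frac_int \<alpha> T (fe_fun T r N v)))"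
  by (simp add: L_def diff2_ddx)

text \<open>A hat function has the slopes 1 / h and - 1 / h' on its two cells, which are the
  coefficients of a difference of slopes. Hence the matrix entries are mixed second differences of
  K2 (x - y), up to a negative factor.\<close>

lemma frac_int_unit:
  assumes N: "1 \<le> N" and j: "1 \<le> j" "j \<le> 2 * N - 1"
  shows "frac_int \<alpha> T (fe_fun T r N (\<lambda>k. if k = j then 1 else 0)) x = ddx N j (\<lambda>y. K2 (x - y))"
proof -
  let ?V = "nodal N (\<lambda>k. if k = j then 1 else 0)"
  have V: "?V k = (if k = j then 1 else 0)" for k using j by (auto simp: nodal_def)
  let ?d = "\<lambda>k. K2 (x - X N (k - 1)) - K2 (x - X N k)"
  have "frac_int \<alpha> T (fe_fun T r N (\<lambda>k. if k = j then 1 else 0)) x =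
     (\<Sum>k = 1..2 * N. (if k = j then ?d k / H N k else 0) - (if k = j + 1 then ?d k / H N k else 0))"
    unfolding frac_int_fe_fun[OF N] using j by (intro sum.cong refl) (auto simp: V diff_divide_distrib)
  also have "\<dots> = ?d j / H N j - ?d (j + 1) / H N (j + 1)"
    using j by (simp add: sum_subtractf) linarith
  also have "\<dots> = ddx N j (\<lambda>y. K2 (x - y))"
  proof -
    have "?d (j + 1) / H N (j + 1) = - ((K2 (x - X N (j + 1)) - K2 (x - X N j)) / H N (j + 1))"
      unfolding minus_divide_left by simp
    moreover have "?d j / H N j = - ((K2 (x - X N j) - K2 (x - X N (j - 1))) / H N j)"
      unfolding minus_divide_left by simp
    ultimately show ?thesis using j by (simp add: ddx_def dd_def step_eq')
  qed
  finally show ?thesis .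
qed

lemma frac_int_sum:
  assumes N: "1 \<le> N"
  shows "frac_int \<alpha> T (fe_fun T r N v) x = (\<Sum>j = 1..2 * N - 1. v j * frac_int \<alpha> T (fe_fun T r N (\<lambda>k. if k = j then 1 else 0)) x)"
proof -
  have u: "fe_fun T r N (\<lambda>k. if k = j then 1 else 0) = hat T r N j" if "j \<in> {1..2 * N - 1}" for j
    using that by (simp add: fe_fun_def fun_eq_iff if_distrib[of "\<lambda>c. c * _"] cong: if_cong)
  have c: "continuous_on {0..2 * T} (hat T r N j)" if "j \<in> {1..2 * N - 1}" for j
    using fe_fun_cont[OF N, of "\<lambda>k. if k = j then 1 else 0"] u[OF that] by simp
  have "frac_int \<alpha> T (fe_fun T r N v) x = integral {0..2 * T} (\<lambda>y. \<Sum>j = 1..2 * N - 1. v j * (K (x - y) * hat T r N j y))"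
    unfolding frac_int_eq_integral[OF fe_fun_cont[OF N]]
    by (simp add: fe_fun_def sum_distrib_left mult.left_commute)
  also have "\<dots> = (\<Sum>j = 1..2 * N - 1. integral {0..2 * T} (\<lambda>y. v j * (K (x - y) * hat T r N j y)))"
    by (rule integral_sum) (auto intro!: integrable_on_mult_right K_mult_integrable c)
  also have "\<dots> = (\<Sum>j = 1..2 * N - 1. v j * frac_int \<alpha> T (fe_fun T r N (\<lambda>k. if k = j then 1 else 0)) x)"
    by (rule sum.cong) (auto simp: u frac_int_eq_integral c)
  finally show ?thesis .
qed

lemma L_sum:
  assumes N: "1 \<le> N" and i: "1 \<le> i"
  shows "L N v i = (\<Sum>j = 1..2 * N - 1. A N i j * v j)"
proof -
  have "ddx N i (frac_int \<alpha> T (fe_fun T r N v)) =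
      (\<Sum>j = 1..2 * N - 1. v j * ddx N i (frac_int \<alpha> T (fe_fun T r N (\<lambda>k. if k = j then 1 else 0))))"
    unfolding frac_int_sum[OF N, of v, abs_def] ddx_def dd_sum dd_cmult ..
  thus ?thesis using i unfolding A_def
    by (simp add: L_eq sum_distrib_left sum_negf[symmetric] mult.assoc mult.left_commute mult.commute[of _ "v _"])
qed

lemma A_eq:
  assumes N: "1 \<le> N" and i: "1 \<le> i" "i \<le> 2 * N - 1" and j: "1 \<le> j" "j \<le> 2 * N - 1"
  shows "A N i j = - (2 / span N i * ddx N i (\<lambda>x. ddx N j (\<lambda>y. K2 (x - y))))"
proof -
  have "frac_int \<alpha> T (fe_fun T r N (\<lambda>k. if k = j then 1 else 0)) = (\<lambda>x. ddx N j (\<lambda>y. K2 (x - y)))"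
    using frac_int_unit[OF N j] by blast
  thus ?thesis using i by (simp add: A_def L_eq)
qed

text \<open>If the indices are not neighbours, the triples at most touch. For neighbours the shared
  gap is \<open>H N (i + 1)\<close>, and it cannot exceed both adjacent gaps: the steps increase up
  to T and decrease after it, so one of the two adjacent cases applies.\<close>

lemma ddx_ddx_nonneg_less:
  assumes N: "1 \<le> N" and i: "1 \<le> i" "i < j" "j \<le> 2 * N - 1"
  shows "0 \<le> ddx N i (\<lambda>x. ddx N j (\<lambda>y. K2 (x - y)))"
proof (cases "i + 1 = j")
  case False
  show ?thesis unfolding ddx_def
    by (rule dd_dd_separated) (use i False N in \<open>auto intro!: mesh_less mesh_le\<close>)
next
  case True
  have m: "X N (i - 1) < X N i" "X N i < X N (i + 1)" "X N (i + 1) < X N (i + 2)"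
    using i True N by (auto intro!: mesh_less)
  have "H N (i + 1) \<le> H N (i + 2) \<or> H N (i + 1) \<le> H N i"
  proof (cases "i + 1 \<le> N")
    case True
    show ?thesis
    proof (cases "i + 2 \<le> N")
      case True
      thus ?thesis using step_mono[of "i + 1" N] by simp
    next
      case False
      hence "N = i + 1" using True by simp
      thus ?thesis using step_reflect[of N N] N by simp
    qed
  next
    case False
    have "H N (2 * N + 1 - (i + 1)) \<le> H N (2 * N + 1 - (i + 1) + 1)" if "N < i"
      by (rule step_mono) (use i True that in auto)
    moreover have "H N (2 * N + 1 - (i + 1)) = H N (i + 1)" by (rule step_reflect) (use i True N in auto)
    moreover have "H N (2 * N + 1 - i) = H N i" by (rule step_reflect) (use i True N in auto)
    moreover have "2 * N + 1 - (i + 1) + 1 = 2 * N + 1 - i" using i True by simp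
    moreover have "H N (N + 1) = H N N" using step_reflect[of N N] N by simp
    moreover have "N \<le> i" using False by simp
    ultimately show ?thesis by (cases "N = i") auto
  qed
  moreover have "X N (j - 1) = X N i" "X N j = X N (i + 1)" "X N (j + 1) = X N (i + 2)" using True by auto
  ultimately show ?thesis unfolding ddx_def
    using dd_dd_adjacent[OF m] dd_dd_adjacent'[OF m] i by (auto simp: step_eq')
qed

lemma A_offdiag:
  assumes N: "1 \<le> N" and i: "1 \<le> i" "i \<le> 2 * N - 1" and j: "1 \<le> j" "j \<le> 2 * N - 1" and "i \<noteq> j"
  shows "A N i j \<le> 0"
proof -
  have "0 \<le> ddx N i (\<lambda>x. ddx N j (\<lambda>y. K2 (x - y)))"
  proof (cases "i < j")
    case True
    thus ?thesis using ddx_ddx_nonneg_less N i j by auto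
  next
    case False
    have "ddx N i (\<lambda>x. ddx N j (\<lambda>y. K2 (x - y))) = ddx N j (\<lambda>x. ddx N i (\<lambda>y. K2 (x - y)))"
      unfolding ddx_def by (rule dd_dd_swap)
    thus ?thesis using ddx_ddx_nonneg_less[of N j i] N i j False assms by auto
  qed
  thus ?thesis using A_eq[OF N i j] span_pos[OF N i] by simp
qed

text \<open>Compare at the index where \<open>e j / B j\<close> is largest.\<close>

lemma comparison_upper:
  assumes N: "1 \<le> N"
    and B: "\<And>i. i \<in> {1..2 * N - 1} \<Longrightarrow> 0 < B i" and LB: "\<And>i. i \<in> {1..2 * N - 1} \<Longrightarrow> 0 < L N B i"
    and e: "\<And>i. i \<in> {1..2 * N - 1} \<Longrightarrow> L N e i \<le> \<epsilon> * L N B i"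
    and i: "i \<in> {1..2 * N - 1}"
  shows "e i \<le> \<epsilon> * B i"
proof -
  let ?I = "{1..2 * N - 1}"
  have "\<exists>m\<in>?I. \<forall>j\<in>?I. e j / B j \<le> e m / B m"
  proof -
    have fin: "finite ((\<lambda>j. e j / B j) ` ?I)" "(\<lambda>j. e j / B j) ` ?I \<noteq> {}" using i by auto
    from Max_in[OF this] Max_ge[OF fin(1)] show ?thesis by fastforce
  qed
  then obtain m where m: "m \<in> ?I" "\<And>j. j \<in> ?I \<Longrightarrow> e j / B j \<le> e m / B m" by blast
  define \<rho> where "\<rho> = e m / B m"
  \<comment> \<open>The vector \<rho> B - e is nonnegative and vanishes at \<open>m\<close>, so at
    row \<open>m\<close> only the nonpositive off-diagonal entries act on it.\<close>
  have "\<rho> * L N B m = (\<Sum>j\<in>?I. A N m j * (\<rho> * B j))"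
    using m N by (simp add: L_sum sum_distrib_left algebra_simps)
  also have "\<dots> \<le> (\<Sum>j\<in>?I. A N m j * e j)"
  proof (rule sum_mono)
    fix j assume j: "j \<in> ?I"
    show "A N m j * (\<rho> * B j) \<le> A N m j * e j"
    proof (cases "j = m")
      case True
      thus ?thesis using B[OF m(1)] by (simp add: \<rho>_def)
    next
      case False
      have "e j \<le> \<rho> * B j" using m(2)[OF j] B[OF j] by (simp add: \<rho>_def pos_divide_le_eq)
      thus ?thesis using A_offdiag[of N m j] m j N False by (intro mult_left_mono_neg) auto
    qed
  qed
  also have "\<dots> = L N e m" using m N by (simp add: L_sum)
  also have "\<dots> \<le> \<epsilon> * L N B m" using e m by auto
  finally have "\<rho> \<le> \<epsilon>" using LB[OF m(1)] by simp
  hence "e i / B i \<le> \<epsilon>" using m(2)[OF i] by (simp add: \<rho>_def)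
  thus ?thesis using B[OF i] by (simp add: pos_divide_le_eq)
qed

lemma L_diff: "1 \<le> N \<Longrightarrow> 1 \<le> i \<Longrightarrow> L N (\<lambda>k. u k - v k) i = L N u i - L N v i"
  by (simp add: L_sum algebra_simps sum_subtractf)

lemma L_add: "1 \<le> N \<Longrightarrow> 1 \<le> i \<Longrightarrow> L N (\<lambda>k. u k + v k) i = L N u i + L N v i"
  by (simp add: L_sum algebra_simps sum.distrib)

lemma L_cmult: "1 \<le> N \<Longrightarrow> 1 \<le> i \<Longrightarrow> L N (\<lambda>k. c * v k) i = c * L N v i"
  by (simp add: L_sum sum_distrib_left algebra_simps)

lemma L_minus: "1 \<le> N \<Longrightarrow> 1 \<le> i \<Longrightarrow> L N (\<lambda>k. - v k) i = - L N v i"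
  by (simp add: L_sum sum_negf)

lemma comparison:
  assumes N: "1 \<le> N"
    and B: "\<And>i. i \<in> {1..2 * N - 1} \<Longrightarrow> 0 < B i" and LB: "\<And>i. i \<in> {1..2 * N - 1} \<Longrightarrow> 0 < L N B i"
    and e: "\<And>i. i \<in> {1..2 * N - 1} \<Longrightarrow> \<bar>L N e i\<bar> \<le> \<epsilon> * L N B i"
    and i: "i \<in> {1..2 * N - 1}"
  shows "\<bar>e i\<bar> \<le> \<epsilon> * B i"
proof -
  have "e i \<le> \<epsilon> * B i"
    by (rule comparison_upper[where N=N]) (use assms in \<open>auto simp: abs_le_iff\<close>)
  moreover have "- e i \<le> \<epsilon> * B i"
    by (rule comparison_upper[where N=N and e="\<lambda>k. - e k"]) (use assms in \<open>auto simp: abs_le_iff L_minus\<close>)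
  ultimately show ?thesis by simp
qed

section \<open>Reflection about T\<close>

lemma frac_int_reflect:
  assumes "continuous_on {0..2 * T} w"
  shows "frac_int \<alpha> T (\<lambda>y. w (2 * T - y)) x = frac_int \<alpha> T w (2 * T - x)"
proof -
  have c: "continuous_on {0..2 * T} (\<lambda>y. w (2 * T - y))"
    by (rule continuous_on_compose2[OF assms]) (auto intro!: continuous_intros)
  have "(\<lambda>y. K (2 * T - x - y) * w y) integrable_on {0..2 * T}" by (rule K_mult_integrable[OF assms])
  then obtain I where I: "((\<lambda>y. K (2 * T - x - y) * w y) has_integral I) {0..2 * T}" by blast
  have "((\<lambda>y. K (2 * T - x - ((-1) *\<^sub>R y + 2 * T)) * w ((-1) *\<^sub>R y + 2 * T)) has_integral (1 / \<bar>-1\<bar> ^ DIM(real)) *\<^sub>R I)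
     ((\<lambda>x. (1 / (-1)) *\<^sub>R x + - ((1 / (-1)) *\<^sub>R (2 * T))) ` cbox 0 (2 * T))"
    by (rule has_integral_affinity) (use I in auto)
  moreover have "(\<lambda>x. (1 / (-1)) *\<^sub>R x + - ((1 / (-1)) *\<^sub>R (2 * T))) ` cbox 0 (2 * T) = {0..2 * T}"
    by (auto simp: image_iff intro!: bexI[of _ "2 * T - _"])
  moreover have "K (2 * T - x - ((-1) *\<^sub>R y + 2 * T)) = K (x - y)" for y
    using K_even[of "x - y"] by simp
  ultimately have "((\<lambda>y. K (x - y) * w (2 * T - y)) has_integral I) {0..2 * T}" by simp
  thus ?thesis using I by (simp add: frac_int_eq_integral c assms integral_unique)
qed

lemma fe_fun_reflect:
  assumes N: "1 \<le> N" and y: "0 \<le> y" "y \<le> 2 * T"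
  shows "fe_fun T r N (\<lambda>j. v (2 * N - j)) y = fe_fun T r N v (2 * T - y)"
proof -
  obtain j where j: "j \<in> {1..2 * N}" "X N (j - 1) \<le> y" "y \<le> X N j"
  proof -
    have "y \<in> (\<Union>j\<in>{1..2 * N}. {X N (j - 1)..X N j})"
      using cells_cover[of N "2 * N"] N y by (simp only: mesh_end) auto
    thus ?thesis using that by auto
  qed
  define k where "k = 2 * N + 1 - j"
  have k: "1 \<le> k" "k \<le> 2 * N" "k - 1 = 2 * N - j" "k = 2 * N - (j - 1)" using j by (auto simp: k_def)
  have Xk: "X N (k - 1) = 2 * T - X N j" "X N k = 2 * T - X N (j - 1)"
    using mesh_reflect[of N j] mesh_reflect[of N "j - 1"] k j N by auto
  have Hk: "H N k = H N j" using Xk k j by (simp add: step_eq')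
  have V: "nodal N v k = nodal N (\<lambda>j. v (2 * N - j)) (j - 1)" "nodal N v (k - 1) = nodal N (\<lambda>j. v (2 * N - j)) j"
    using k j by (auto simp: nodal_def)
  have h: "0 < H N j" using step_pos N j by auto
  have a: "fe_fun T r N v (2 * T - y) = nodal N v (k - 1) + (nodal N v k - nodal N v (k - 1)) / H N k * (2 * T - y - X N (k - 1))"
    by (rule fe_fun_cell) (use k N Xk j in auto)
  have b: "fe_fun T r N (\<lambda>j. v (2 * N - j)) y = nodal N v k + (nodal N v (k - 1) - nodal N v k) / H N j * (y - X N (j - 1))"
    using fe_fun_cell[of N j y "\<lambda>j. v (2 * N - j)"] N j V by simp
  have "2 * T - y - X N (k - 1) = H N j - (y - X N (j - 1))" using Xk j by (simp add: step_eq')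
  thus ?thesis unfolding a b Hk using h by (simp add: field_simps)
qed

lemma L_reflect:
  assumes N: "1 \<le> N" and i: "1 \<le> i" "i \<le> 2 * N - 1"
  shows "L N (\<lambda>j. v (2 * N - j)) i = L N v (2 * N - i)"
proof -
  have "frac_int \<alpha> T (fe_fun T r N (\<lambda>j. v (2 * N - j))) x = frac_int \<alpha> T (fe_fun T r N v) (2 * T - x)" for x
  proof -
    have "frac_int \<alpha> T (fe_fun T r N (\<lambda>j. v (2 * N - j))) x = frac_int \<alpha> T (\<lambda>y. fe_fun T r N v (2 * T - y)) x"
      unfolding frac_int_def set_lebesgue_integral_def
      by (rule arg_cong[where f="integral\<^sup>L lborel"])
         (auto simp: fun_eq_iff indicator_def Omega_def fe_fun_reflect[OF N])
    thus ?thesis using frac_int_reflect fe_fun_cont[OF N] by simp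
  qed
  hence "ddx N i (frac_int \<alpha> T (fe_fun T r N (\<lambda>j. v (2 * N - j)))) = ddx N i (\<lambda>x. frac_int \<alpha> T (fe_fun T r N v) (2 * T - x))"
    by (simp add: ddx_def dd_def)
  also have "\<dots> = ddx N (2 * N - i) (frac_int \<alpha> T (fe_fun T r N v))"
  proof -
    have "2 * N - i + 1 = 2 * N - (i - 1)" "2 * N - i - 1 = 2 * N - (i + 1)" using i by auto
    thus ?thesis using mesh_reflect[of N i] mesh_reflect[of N "i - 1"] mesh_reflect[of N "i + 1"] N i
      by (simp add: ddx_def dd_reflect)
  qed
  moreover have "span N (2 * N - i) = span N i"
  proof -
    have "2 * N - i + 1 = 2 * N - (i - 1)" "2 * N - i - 1 = 2 * N - (i + 1)" using i by auto
    thus ?thesis using mesh_reflect[of N "i - 1"] mesh_reflect[of N "i + 1"] N i by (simp add: span_def)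
  qed
  ultimately show ?thesis using i by (simp add: L_eq)
qed

section \<open>Barrier and stability\<close>

text \<open>On the left half i + 1 \<le> 2 i gives the factor 2 powr r; beyond T all nodes lie
  between T and 2 T, and 2 \<le> 2 powr r.\<close>

lemma mesh_ratio: assumes N: "1 \<le> N" and i: "1 \<le> i" "i + 1 \<le> 2 * N" shows "X N (i + 1) \<le> 2 powr r * X N i"
proof (cases "i + 1 \<le> N")
  case True
  have "real (i + 1) powr r \<le> (2 * real i) powr r" using i r1 by (intro powr_mono2) auto
  thus ?thesis using True cN_pos[OF N] i by (simp add: mesh_left powr_mult)
next
  case False
  have "X N (i + 1) \<le> 2 * T" using N i by (intro mesh_upper) auto
  also have "T \<le> X N i" using mesh_le[of N N i] False N i by (simp add: mesh_mid)
  hence "2 * T \<le> 2 * X N i" by simp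
  also have "\<dots> \<le> 2 powr r * X N i" using powr_mono[of 1 r "2::real"] r1 mesh_nonneg[of N i] N i by (intro mult_right_mono) auto
  finally show ?thesis .
qed

text \<open>The contribution of the first cell to the fractional integral of the function with
  interior nodal values 1. That function has nonzero slope only on the two boundary cells, both of
  length \<open>X N 1\<close>.\<close>

definition \<Phi> :: "real \<Rightarrow> real \<Rightarrow> real" where
  "\<Phi> h x = (K2 x - K2 (x - h)) / h"

lemma frac_int_one:
  assumes N: "1 \<le> N"
  shows "frac_int \<alpha> T (fe_fun T r N (\<lambda>_. 1)) x = \<Phi> (X N 1) x + \<Phi> (X N 1) (2 * T - x)"
proof -
  let ?V = "nodal N (\<lambda>_. 1)"
  let ?d = "\<lambda>k. K2 (x - X N (k - 1)) - K2 (x - X N k)"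
  have H1: "H N 1 = X N 1" by (simp add: step_eq' mesh_0)
  have H2: "H N (2 * N) = X N 1" using step_reflect[of N 1] N H1 by simp
  have X2: "X N (2 * N - 1) = 2 * T - X N 1" using mesh_reflect[of N 1] N by simp
  have "frac_int \<alpha> T (fe_fun T r N (\<lambda>_. 1)) x =
     (\<Sum>k = 1..2 * N. (if k = 1 then ?d k / H N k else 0) - (if k = 2 * N then ?d k / H N k else 0))"
    unfolding frac_int_fe_fun[OF N] using N
    by (intro sum.cong refl) (auto simp: nodal_def diff_divide_distrib)
  also have "\<dots> = ?d 1 / H N 1 - ?d (2 * N) / H N (2 * N)"
    using N by (simp add: sum_subtractf)
  also have "?d (2 * N) = K2 (x - (2 * T - X N 1)) - K2 (x - 2 * T)" using X2 N by (simp add: mesh_end)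
  also have "\<dots> = K2 (2 * T - x - X N 1) - K2 (2 * T - x)"
    using K2_minus_commute[of x "2 * T - X N 1"] K2_minus_commute[of x "2 * T"] by (simp add: algebra_simps)
  finally show ?thesis unfolding H1 H2 \<Phi>_def by (simp add: mesh_0 diff_divide_distrib)
qed

text \<open>Concavity of \<open>K1\<close> on the positive half-line: its derivative
  \<open>K\<close> decreases there, so increments of length h are largest at 0.\<close>

lemma K1_subadd: assumes "0 < h" "0 < t" shows "K1 (h + t) - K1 t \<le> K1 h"
proof -
  have "K1 (h + t) - K1 t \<le> K1 (h + 0) - K1 0"
  proof (rule DERIV_nonpos_imp_decreasing_open[of 0 t "\<lambda>t. K1 (h + t) - K1 t"])
    fix x assume x: "0 < x" "x < t"
    have "((\<lambda>t. K1 (h + t)) has_real_derivative K (h + x)) (at x)"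
      using DERIV_K1_shift[of x "- h"] x assms by (simp add: add.commute)
    hence "((\<lambda>t. K1 (h + t) - K1 t) has_real_derivative K (h + x) - K x) (at x)"
      using x DERIV_K1 by (intro DERIV_diff) auto
    moreover have "K (h + x) - K x \<le> 0" using K_antimono[of x "h + x"] x assms by simp
    ultimately show "\<exists>y. ((\<lambda>t. K1 (h + t) - K1 t) has_real_derivative y) (at x) \<and> y \<le> 0" by blast
  next
    have "continuous_on {0..t} (\<lambda>t. K1 (h + t))" using K1_cont_shift[of "{0..t}" "-h"] by (simp add: add.commute)
    thus "continuous_on {0..t} (\<lambda>t. K1 (h + t) - K1 t)" by (intro continuous_intros K1_cont)
  qed (use assms in auto)
  thus ?thesis by (simp add: K1_0)
qed

lemma K2_superadd: assumes "0 < h" "0 < t" shows "K2 (h + t) - K2 t - K2 h \<le> t * K1 h"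
proof -
  have "\<exists>z>0. z < t \<and> (K2 (h + t) - K2 t) - (K2 (h + 0) - K2 0) = (t - 0) * (K1 (h + z) - K1 z)"
  proof (rule MVT2)
    fix x
    have "((\<lambda>t. K2 (h + t)) has_real_derivative K1 (h + x)) (at x)"
      using DERIV_K2_shift[of "- h" x] by (simp add: add.commute)
    thus "((\<lambda>t. K2 (h + t) - K2 t) has_real_derivative K1 (h + x) - K1 x) (at x)"
      using DERIV_K2 by (intro DERIV_diff) auto
  qed (use assms in auto)
  then obtain z where z: "0 < z" "K2 (h + t) - K2 t - K2 h = t * (K1 (h + z) - K1 z)" by (auto simp: K2_0)
  show ?thesis unfolding z(2) using K1_subadd[of h z] assms z(1) by (intro mult_left_mono) auto
qed

text \<open>The first entry comes from the nodes i \<ge> 2, the second from i = 1, where the triple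
  of nodes contains both singular points of \<Phi>.\<close>

definition c1 :: real where
  "c1 = min (\<kappa> * (\<alpha> - 1) * 2 powr (- r * \<alpha>)) ((\<alpha> - 1) * (\<kappa> / ((2 - \<alpha>) * (3 - \<alpha>))) / 2 powr r * 2)"

lemma c1_pos: "0 < c1" using \<kappa>0 \<alpha>1 \<alpha>2 by (simp add: c1_def)

text \<open>For i \<ge> 2 the second derivative of - \<Phi> is a difference quotient of - K, hence a
  value of - K' at a point below \<open>X N (i + 1)\<close>. For i = 1 the difference is computed
  explicitly; \<open>K2_superadd\<close> leaves the factor 2 - (3 - \<alpha>) = \<alpha> - 1, which
  is positive.\<close>

lemma ddx_\<Phi>:
  assumes N: "1 \<le> N" and i: "1 \<le> i" "i \<le> 2 * N - 1"
  shows "c1 * X N i powr (- \<alpha>) * span N i / 2 \<le> - ddx N i (\<Phi> (X N 1))"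
proof -
  define h where "h = X N 1"
  have h0: "0 < h" unfolding h_def using N by (intro mesh_pos) auto
  have xi: "0 < X N i" "0 < X N (i + 1)" "X N i < X N (i + 1)" "X N (i - 1) < X N i"
    using N i by (auto intro!: mesh_pos mesh_less)
  have rat: "X N (i + 1) \<le> 2 powr r * X N i" by (rule mesh_ratio) (use N i in auto)
  show ?thesis
  proof (cases "i = 1")
    case False
    let ?m = "\<kappa> * (\<alpha> - 1) * X N (i + 1) powr (- \<alpha>)"
    have a: "h \<le> X N (i - 1)" unfolding h_def using N i False by (intro mesh_le) auto
    have dF: "((\<lambda>x. - \<Phi> h x) has_real_derivative - ((K1 x - K1 (x - h)) / h)) (at x)" for x
      unfolding \<Phi>_def using DERIV_K2_shift[of h x] DERIV_K2[of x] by (intro DERIV_minus DERIV_cdivide DERIV_diff)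
    have cK: "continuous_on U (\<lambda>x. - ((K1 x - K1 (x - h)) / h))" for U
      using h0 by (intro continuous_intros K1_cont K1_cont_shift) auto
    have "?m * (X N (i + 1) - X N (i - 1)) / 2 \<le> dd (X N (i - 1)) (X N i) (X N (i + 1)) (\<lambda>x. - \<Phi> h x)"
    proof (rule dd_ge_deriv2[where g'="\<lambda>x. - ((K1 x - K1 (x - h)) / h)" and g''="\<lambda>x. - ((K x - K (x - h)) / h)" and s="X N (i - 1)"])
      show "continuous_on {X N (i - 1)..X N (i + 1)} (\<lambda>x. - \<Phi> h x)"
        using dF by (meson DERIV_isCont continuous_at_imp_continuous_on)
      fix x assume x: "X N (i - 1) < x" "x < X N (i + 1)"
      show "((\<lambda>x. - ((K1 x - K1 (x - h)) / h)) has_real_derivative - ((K x - K (x - h)) / h)) (at x)"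
        using DERIV_K1_shift[of x h] DERIV_K1[of x] x a h0 by (intro DERIV_minus DERIV_cdivide DERIV_diff) auto
      have "\<exists>z>x - h. z < x \<and> K x - K (x - h) = (x - (x - h)) * (- (\<kappa> * (\<alpha> - 1)) * z powr (- \<alpha>))"
        by (rule MVT2) (use x a h0 DERIV_K in auto)
      then obtain z where z: "x - h < z" "z < x" "K x - K (x - h) = h * (- (\<kappa> * (\<alpha> - 1)) * z powr (- \<alpha>))" by auto
      have "X N (i + 1) powr (- \<alpha>) \<le> z powr (- \<alpha>)" using z x a \<alpha>1 by (intro powr_mono2') auto
      hence "?m \<le> \<kappa> * (\<alpha> - 1) * z powr (- \<alpha>)" using \<kappa>0 \<alpha>1 by (intro mult_left_mono) auto
      thus "?m \<le> - ((K x - K (x - h)) / h)" unfolding z(3) using h0 by simp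
    qed (use xi dF cK in auto)
    hence 1: "?m * span N i / 2 \<le> - ddx N i (\<Phi> h)" by (simp add: ddx_def span_def dd_uminus)
    have "c1 * X N i powr (- \<alpha>) \<le> \<kappa> * (\<alpha> - 1) * 2 powr (- r * \<alpha>) * X N i powr (- \<alpha>)"
      by (intro mult_right_mono) (auto simp: c1_def)
    also have "2 powr (- r * \<alpha>) * X N i powr (- \<alpha>) = (2 powr r * X N i) powr (- \<alpha>)"
      using xi by (simp add: powr_mult powr_powr)
    hence "\<kappa> * (\<alpha> - 1) * 2 powr (- r * \<alpha>) * X N i powr (- \<alpha>) = \<kappa> * (\<alpha> - 1) * (2 powr r * X N i) powr (- \<alpha>)"
      by (simp only: mult.assoc)
    also have "\<dots> \<le> ?m" using \<kappa>0 \<alpha>1 rat xi by (intro mult_left_mono powr_mono2') auto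
    finally have "c1 * X N i powr (- \<alpha>) * span N i / 2 \<le> ?m * span N i / 2"
      using span_pos[OF N i] by (intro divide_right_mono mult_right_mono) auto
    thus ?thesis using 1 by (simp add: h_def)
  next
    case True
    define t where "t = X N 2 - h"
    have t0: "0 < t" using xi True by (simp add: t_def h_def numeral_2_eq_2)
    have X2: "X N 2 = h + t" by (simp add: t_def)
    have "\<Phi> h 0 = - (K2 h / h)" "\<Phi> h h = K2 h / h" "\<Phi> h (h + t) = (K2 (h + t) - K2 t) / h"
      by (simp_all add: \<Phi>_def K2_0 K2_even)
    hence "- ddx N 1 (\<Phi> h) = 2 * K2 h / h\<^sup>2 - (K2 (h + t) - K2 t - K2 h) / h / t"
      unfolding ddx_def dd_def using h0 t0
      by (simp add: mesh_0 h_def[simplified, symmetric] X2 numeral_2_eq_2[symmetric] power2_eq_square diff_divide_distrib add_divide_distrib)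
    also have "\<dots> \<ge> 2 * K2 h / h\<^sup>2 - (t * K1 h) / h / t"
      using K2_superadd[OF h0 t0] h0 t0 by (intro diff_left_mono divide_right_mono) auto
    also have "(t * K1 h) / h / t = (3 - \<alpha>) * K2 h / h\<^sup>2"
    proof -
      have "h powr (3 - \<alpha>) = h powr (2 - \<alpha>) * h" using powr_add[of h "2 - \<alpha>" 1] h0 by simp
      hence "K1 h = (3 - \<alpha>) * K2 h / h" using h0 \<alpha>2 by (simp add: K1_pos K2_def)
      thus ?thesis using h0 t0 by (simp add: power2_eq_square)
    qed
    also have "2 * K2 h / h\<^sup>2 - (3 - \<alpha>) * K2 h / h\<^sup>2 = (\<alpha> - 1) * (K2 h / h\<^sup>2)"
      by (simp add: algebra_simps diff_divide_distrib)
    also have "K2 h / h\<^sup>2 = \<kappa> / ((2 - \<alpha>) * (3 - \<alpha>)) * h powr (1 - \<alpha>)"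
      using h0 powr_add[of h "1 - \<alpha>" 2] by (simp add: K2_def powr_numeral)
    finally have 1: "(\<alpha> - 1) * (\<kappa> / ((2 - \<alpha>) * (3 - \<alpha>)) * h powr (1 - \<alpha>)) \<le> - ddx N 1 (\<Phi> h)" .
    have "span N 1 = X N 2" by (simp add: span_def mesh_0 numeral_2_eq_2)
    also have "\<dots> \<le> 2 powr r * h" using rat True by (simp add: h_def numeral_2_eq_2)
    finally have sp: "span N 1 \<le> 2 powr r * h" .
    have sp0: "0 < span N 1" by (rule span_pos) (use N in auto)
    have d0: "0 \<le> (\<alpha> - 1) * (\<kappa> / ((2 - \<alpha>) * (3 - \<alpha>))) / 2 powr r * 2" using \<kappa>0 \<alpha>1 \<alpha>2 by simp
    have "c1 * h powr (- \<alpha>) * span N 1 / 2 \<le> ((\<alpha> - 1) * (\<kappa> / ((2 - \<alpha>) * (3 - \<alpha>))) / 2 powr r * 2) * h powr (- \<alpha>) * (2 powr r * h) / 2"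
    proof (intro divide_right_mono mult_mono mult_right_mono sp)
      show "c1 \<le> (\<alpha> - 1) * (\<kappa> / ((2 - \<alpha>) * (3 - \<alpha>))) / 2 powr r * 2" unfolding c1_def by (rule min.cobounded2)
      show "0 \<le> (\<alpha> - 1) * (\<kappa> / ((2 - \<alpha>) * (3 - \<alpha>))) / 2 powr r * 2 * h powr (- \<alpha>)"
        using d0 by (rule mult_nonneg_nonneg) simp
    qed (use sp0 d0 in \<open>simp_all\<close>)
    also have "\<dots> = (\<alpha> - 1) * (\<kappa> / ((2 - \<alpha>) * (3 - \<alpha>)) * (h powr (- \<alpha>) * h))"
      by simp
    also have "h powr (- \<alpha>) * h = h powr (1 - \<alpha>)" using h0 powr_add[of h "- \<alpha>" 1] by simp
    finally have F: "c1 * h powr (- \<alpha>) * span N 1 / 2 \<le> (\<alpha> - 1) * (\<kappa> / ((2 - \<alpha>) * (3 - \<alpha>)) * h powr (1 - \<alpha>))" .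
    show ?thesis using order_trans[OF F 1] True by (simp add: h_def)
  qed
qed

lemma ddx_reflect:
  assumes N: "1 \<le> N" and i: "1 \<le> i" "i \<le> 2 * N - 1"
  shows "ddx N i (\<lambda>x. g (2 * T - x)) = ddx N (2 * N - i) g"
proof -
  have "2 * N - i + 1 = 2 * N - (i - 1)" "2 * N - i - 1 = 2 * N - (i + 1)" using i by auto
  thus ?thesis using mesh_reflect[of N i] mesh_reflect[of N "i - 1"] mesh_reflect[of N "i + 1"] N i
    by (simp add: ddx_def dd_reflect)
qed

text \<open>These are the row sums of the matrix. The left boundary cell yields the bound, and the
  right one contributes a nonnegative amount by reflection.\<close>

lemma L_one:
  assumes N: "1 \<le> N" and i: "1 \<le> i" "i \<le> 2 * N - 1"
  shows "c1 * X N i powr (- \<alpha>) \<le> L N (\<lambda>_. 1) i"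
proof -
  have "0 \<le> c1 * X N (2 * N - i) powr (- \<alpha>) * span N (2 * N - i) / 2"
  proof -
    have "0 < span N (2 * N - i)" by (rule span_pos) (use N i in auto)
    thus ?thesis using c1_pos by simp
  qed
  also have "\<dots> \<le> - ddx N (2 * N - i) (\<Phi> (X N 1))" by (rule ddx_\<Phi>) (use N i in auto)
  finally have 2: "0 \<le> - ddx N i (\<lambda>x. \<Phi> (X N 1) (2 * T - x))" using ddx_reflect[OF N i] by simp
  have "frac_int \<alpha> T (fe_fun T r N (\<lambda>_. 1)) = (\<lambda>x. \<Phi> (X N 1) x + \<Phi> (X N 1) (2 * T - x))"
    using frac_int_one[OF N] by blast
  hence "L N (\<lambda>_. 1) i = 2 / span N i * (- ddx N i (\<Phi> (X N 1)) - ddx N i (\<lambda>x. \<Phi> (X N 1) (2 * T - x)))"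
    using i by (simp add: L_eq ddx_def dd_add algebra_simps)
  also have "\<dots> \<ge> 2 / span N i * (c1 * X N i powr (- \<alpha>) * span N i / 2)"
    using ddx_\<Phi>[OF N i] 2 span_pos[OF N i] by (intro mult_left_mono) auto
  finally show ?thesis using span_pos[OF N i] by simp
qed

definition tent :: "nat \<Rightarrow> nat \<Rightarrow> real" where
  "tent N j = (if j \<le> N then X N j else 2 * T - X N j)"

text \<open>Since T is a node, the slopes are 1 on the left half and -1 on the right, and the sum
  telescopes on each half. The change of slope at T produces the term - 2 K2 (x - T), whose second
  derivative is singular at T and dominates there.\<close>

lemma frac_int_tent:
  assumes N: "1 \<le> N"
  shows "frac_int \<alpha> T (fe_fun T r N (tent N)) x = K2 x + K2 (2 * T - x) - 2 * K2 (x - T)"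
proof -
  let ?V = "nodal N (tent N)"
  let ?d = "\<lambda>k. K2 (x - X N (k - 1)) - K2 (x - X N k)"
  have tel: "(\<Sum>k = m + 1..n. ?d k) = K2 (x - X N m) - K2 (x - X N n)" if "m \<le> n" for m n
    using that by (induction n) (auto simp: le_Suc_eq)
  have s: "(?V k - ?V (k - 1)) / H N k = (if k \<le> N then 1 else -1)" if "k \<in> {1..2 * N}" for k
  proof -
    have V: "?V k = tent N k" "?V (k - 1) = tent N (k - 1)"
      using that N by (cases "k = 2 * N"; auto simp: nodal_def tent_def mesh_0 mesh_end)+
    have h: "0 < H N k" using step_pos N that by auto
    show ?thesis
    proof (cases "k \<le> N")
      case True
      hence "k - 1 \<le> N" by simp
      thus ?thesis unfolding V using True h that by (simp add: tent_def step_eq')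
    next
      case False
      hence "tent N (k - 1) = 2 * T - X N (k - 1)" using N by (cases "k - 1 = N") (auto simp: tent_def mesh_mid)
      thus ?thesis unfolding V using h that False by (simp add: tent_def step_eq' field_simps)
    qed
  qed
  have "frac_int \<alpha> T (fe_fun T r N (tent N)) x = (\<Sum>k = 1..2 * N. (if k \<le> N then 1 else -1) * ?d k)"
    unfolding frac_int_fe_fun[OF N] by (intro sum.cong refl) (simp only: s)
  also have "\<dots> = (\<Sum>k = 0 + 1..N. (if k \<le> N then 1 else -1) * ?d k) + (\<Sum>k = N + 1..2 * N. (if k \<le> N then 1 else -1) * ?d k)"
    using N sum.ub_add_nat[of 1 N "\<lambda>k. (if k \<le> N then 1 else -1) * ?d k" N] by (simp add: mult_2)
  also have "(\<Sum>k = 0 + 1..N. (if k \<le> N then 1 else -1) * ?d k) = (\<Sum>k = 0 + 1..N. ?d k)"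
    by (intro sum.cong) auto
  also have "(\<Sum>k = N + 1..2 * N. (if k \<le> N then 1 else -1) * ?d k) = - (\<Sum>k = N + 1..2 * N. ?d k)"
    unfolding sum_negf[symmetric] by (intro sum.cong) auto
  also have "(\<Sum>k = 0 + 1..N. ?d k) = K2 (x - X N 0) - K2 (x - X N N)" by (rule tel) simp
  also have "(\<Sum>k = N + 1..2 * N. ?d k) = K2 (x - X N N) - K2 (x - X N (2 * N))" by (rule tel) simp
  finally show ?thesis using N K2_minus_commute[of x "2 * T"] by (simp add: mesh_0 mesh_mid mesh_end)
qed

text \<open>Because y \<le> T, a kernel value of order 1 - \<alpha> can be traded for T times y powr
  (- \<alpha>), the scale of the row sums.\<close>

lemma K_power_bound: assumes "0 < y" "y \<le> T" "y \<le> 2 powr r * x" "0 < x" "x \<le> y"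
  shows "K x \<le> \<kappa> * 2 powr r * T * y powr (- \<alpha>)"
proof -
  have "K x \<le> K (y / 2 powr r)" by (rule K_antimono) (use assms in \<open>auto simp: field_simps\<close>)
  also have "\<dots> = \<kappa> * (y powr (1 - \<alpha>) * (2 powr r) powr (\<alpha> - 1))"
    using assms by (simp add: K_eq powr_divide powr_diff)
  also have "\<dots> \<le> \<kappa> * ((T * y powr (- \<alpha>)) * 2 powr r)"
  proof (intro mult_left_mono mult_mono)
    have "y powr (1 - \<alpha>) = y * y powr (- \<alpha>)" using assms powr_add[of y 1 "- \<alpha>"] by simp
    thus "y powr (1 - \<alpha>) \<le> T * y powr (- \<alpha>)" using assms by (simp add: mult_right_mono)
    have "r * (\<alpha> - 1) \<le> r * 1" using \<alpha>2 r1 by (intro mult_left_mono) auto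
    thus "(2 powr r) powr (\<alpha> - 1) \<le> 2 powr r" unfolding powr_powr by (intro powr_mono) auto
  qed (use \<kappa>0 T0 in auto)
  finally show ?thesis by (simp add: mult_ac)
qed

text \<open>The first summand bounds the second derivative \<open>K\<close> away from the endpoint
  in question; the second serves i = 1, where the triple starts at the singular point of
  \<open>K\<close>.\<close>

definition C2 :: real where "C2 = \<kappa> * 2 powr r * T + 2 * \<kappa> / (2 - \<alpha>) * 4 powr r * T"

lemma C2_pos: "0 < C2" using \<kappa>0 T0 \<alpha>2 by (simp add: C2_def add_pos_pos)

lemma ddx_K2_upper:
  assumes N: "2 \<le> N" and i: "1 \<le> i" "i \<le> N"
  shows "ddx N i K2 \<le> C2 * X N i powr (- \<alpha>) * span N i / 2"
proof -
  have xi: "0 < X N i" "X N i < X N (i + 1)" "X N (i - 1) < X N i" "X N i \<le> T"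
    using N i by (auto intro!: mesh_pos mesh_less mesh_le_mid)
  show ?thesis
  proof (cases "i = 1")
    case False
    have a: "0 < X N (i - 1)" using N i False by (intro mesh_pos) auto
    have rat: "X N i \<le> 2 powr r * X N (i - 1)" using mesh_ratio[of N "i - 1"] N i False by simp
    have "\<bar>dd (X N (i - 1)) (X N i) (X N (i + 1)) K2\<bar> \<le> (C2 * X N i powr (- \<alpha>)) * (X N (i + 1) - X N (i - 1)) / 2"
    proof (rule dd_abs_le_deriv2[where g'=K1 and g''=K])
      fix x assume x: "X N (i - 1) < x" "x < X N (i + 1)"
      have "K x \<le> K (X N (i - 1))" using x a by (intro K_antimono) auto
      also have "\<dots> \<le> \<kappa> * 2 powr r * T * X N i powr (- \<alpha>)" using xi rat a by (intro K_power_bound) auto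
      also have "\<dots> \<le> C2 * X N i powr (- \<alpha>)" using \<kappa>0 T0 \<alpha>2 by (intro mult_right_mono) (auto simp: C2_def)
      finally show "\<bar>K x\<bar> \<le> C2 * X N i powr (- \<alpha>)" using K_nonneg[of x] by simp
    qed (use xi a DERIV_K1 DERIV_K2 K2_cont in auto)
    thus ?thesis by (simp add: ddx_def span_def)
  next
    case True
    have X2: "X N 1 < X N 2" "0 < X N 1" using N by (auto intro!: mesh_less mesh_pos)
    have rat: "X N 2 \<le> 2 powr r * X N 1" using mesh_ratio[of N 1] N by (simp add: numeral_2_eq_2)
    have "\<exists>z>X N 1. z < X N 2 \<and> K2 (X N 2) - K2 (X N 1) = (X N 2 - X N 1) * K1 z"
      by (rule MVT2) (use X2 DERIV_K2 in auto)
    then obtain z where z: "X N 1 < z" "z < X N 2" "K2 (X N 2) - K2 (X N 1) = (X N 2 - X N 1) * K1 z" by blast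
    have "ddx N 1 K2 = K1 z - K2 (X N 1) / X N 1"
      unfolding ddx_def dd_def using z by (simp add: mesh_0 K2_0 numeral_2_eq_2[symmetric])
    also have "\<dots> \<le> K1 z" using X2 \<kappa>0 \<alpha>2 by (simp add: K2_def)
    also have "\<dots> \<le> \<kappa> / (2 - \<alpha>) * (2 powr r * X N 1) powr (2 - \<alpha>)"
      using z X2 \<kappa>0 \<alpha>2 rat by (auto simp: K1_pos intro!: mult_left_mono divide_right_mono powr_mono2)
    also have "\<dots> = \<kappa> / (2 - \<alpha>) * ((2 powr r) powr (2 - \<alpha>) * X N 1 powr (2 - \<alpha>))"
      using X2 by (simp add: powr_mult)
    also have "\<dots> \<le> \<kappa> / (2 - \<alpha>) * (4 powr r * (T * X N 1 powr (- \<alpha>) * span N 1))"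
    proof (intro mult_left_mono mult_mono)
      have "(2 powr r) powr (2 - \<alpha>) \<le> (2 powr r) powr 2" using \<alpha>1 r1 by (intro powr_mono) (auto simp: ge_one_powr_ge_zero)
      also have "\<dots> = 4 powr r" using powr_powr[of 2 2 r] by (simp add: powr_powr mult.commute)
      finally show "(2 powr r) powr (2 - \<alpha>) \<le> 4 powr r" .
      have "X N 1 powr (2 - \<alpha>) = X N 1 * X N 1 powr (- \<alpha>) * X N 1"
        using powr_add[of "X N 1" 2 "- \<alpha>"] X2 by (simp add: powr_numeral power2_eq_square)
      also have "\<dots> \<le> T * X N 1 powr (- \<alpha>) * span N 1"
        using xi X2 True by (intro mult_mono) (auto simp: span_def mesh_0 numeral_2_eq_2)
      finally show "X N 1 powr (2 - \<alpha>) \<le> T * X N 1 powr (- \<alpha>) * span N 1" .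
    qed (use \<kappa>0 \<alpha>2 in auto)
    also have "\<dots> = (2 * \<kappa> / (2 - \<alpha>) * 4 powr r * T) * X N 1 powr (- \<alpha>) * span N 1 / 2" using \<alpha>2 by (simp add: field_simps)
    also have "\<dots> \<le> C2 * X N 1 powr (- \<alpha>) * span N 1 / 2"
    proof (intro divide_right_mono mult_right_mono)
      show "0 \<le> span N 1" by (rule less_imp_le, rule span_pos) (use N in auto)
    qed (use \<kappa>0 T0 \<alpha>2 in \<open>auto simp: C2_def\<close>)
    finally show ?thesis using True by simp
  qed
qed

text \<open>For i \<le> N all three nodes stay at least \<open>X N (N - 1)\<close> away from 2 T.
  This distance is positive since N \<ge> 2, and comparable with T.\<close>

lemma ddx_K2_reflect_upper:
  assumes N: "2 \<le> N" and i: "1 \<le> i" "i \<le> N"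
  shows "ddx N i (\<lambda>x. K2 (2 * T - x)) \<le> C2 * X N i powr (- \<alpha>) * span N i / 2"
proof -
  have xi: "0 < X N i" "X N i < X N (i + 1)" "X N (i - 1) < X N i" "X N i \<le> T"
    using N i by (auto intro!: mesh_pos mesh_less mesh_le_mid)
  have up: "X N (i + 1) \<le> 2 * T - X N (N - 1)"
  proof -
    have "X N (i + 1) \<le> X N (2 * N - (N - 1))" using N i by (intro mesh_le) auto
    thus ?thesis using mesh_reflect[of N "N - 1"] N by simp
  qed
  have a: "0 < X N (N - 1)" "X N (N - 1) \<le> T" using N by (auto intro!: mesh_pos mesh_le_mid)
  have rat: "T \<le> 2 powr r * X N (N - 1)" using mesh_ratio[of N "N - 1"] N by (simp add: mesh_mid)
  have eq: "K2 (2 * T - x) = K2 (x - 2 * T)" for x by (rule K2_minus_commute)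
  have "\<bar>dd (X N (i - 1)) (X N i) (X N (i + 1)) (\<lambda>x. K2 (x - 2 * T))\<bar> \<le> (C2 * X N i powr (- \<alpha>)) * (X N (i + 1) - X N (i - 1)) / 2"
  proof (rule dd_abs_le_deriv2[where g'="\<lambda>x. K1 (x - 2 * T)" and g''="\<lambda>x. K (x - 2 * T)"])
    fix x assume x: "X N (i - 1) < x" "x < X N (i + 1)"
    show "((\<lambda>x. K1 (x - 2 * T)) has_real_derivative K (x - 2 * T)) (at x)"
      by (rule DERIV_K1_shift) (use x up a in auto)
    have "K (x - 2 * T) = K (2 * T - x)" using K_even[of "x - 2 * T"] by simp
    also have "\<dots> \<le> K (X N (N - 1))" using x a up by (intro K_antimono) auto
    also have "\<dots> \<le> \<kappa> * 2 powr r * T * T powr (- \<alpha>)" using rat a T0 by (intro K_power_bound) auto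
    also have "\<dots> \<le> C2 * X N i powr (- \<alpha>)" using \<kappa>0 T0 \<alpha>2 \<alpha>1 xi
      by (intro mult_mono powr_mono2') (auto simp: C2_def)
    finally show "\<bar>K (x - 2 * T)\<bar> \<le> C2 * X N i powr (- \<alpha>)" using K_nonneg[of "x - 2 * T"] by simp
  qed (use xi DERIV_K2_shift K2_cont_shift in auto)
  thus ?thesis by (simp add: ddx_def span_def eq)
qed

text \<open>The second derivative K (x - T) is smallest at the point farthest from T, which for i
  \<le> N is the left node by symmetry of the mesh. For a lower bound the singularity at T is
  harmless, hence the exceptional point \<open>s=T\<close>.\<close>

lemma ddx_K2_mid_lower:
  assumes N: "2 \<le> N" and i: "1 \<le> i" "i \<le> N"
  shows "\<kappa> * (T - X N (i - 1)) powr (1 - \<alpha>) * span N i / 2 \<le> ddx N i (\<lambda>x. K2 (x - T))"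
proof -
  have xi: "X N i < X N (i + 1)" "X N (i - 1) < X N i" "X N i \<le> T"
    using N i by (auto intro!: mesh_less mesh_le_mid)
  have up: "X N (i + 1) - T \<le> T - X N (i - 1)"
  proof -
    have "X N (i + 1) \<le> X N (2 * N - (i - 1))" using N i by (intro mesh_le) auto
    thus ?thesis using mesh_reflect[of N "i - 1"] N i by simp
  qed
  have "(\<kappa> * (T - X N (i - 1)) powr (1 - \<alpha>)) * (X N (i + 1) - X N (i - 1)) / 2
     \<le> dd (X N (i - 1)) (X N i) (X N (i + 1)) (\<lambda>x. K2 (x - T))"
  proof (rule dd_ge_deriv2[where g'="\<lambda>x. K1 (x - T)" and g''="\<lambda>x. K (x - T)" and s=T])
    fix x assume x: "X N (i - 1) < x" "x < X N (i + 1)" "x \<noteq> T"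
    show "((\<lambda>x. K1 (x - T)) has_real_derivative K (x - T)) (at x)" by (rule DERIV_K1_shift) fact
    show "\<kappa> * (T - X N (i - 1)) powr (1 - \<alpha>) \<le> K (x - T)"
      unfolding K_eq using x up \<kappa>0 \<alpha>1 by (intro mult_left_mono powr_mono2') auto
  qed (use xi DERIV_K2_shift K2_cont_shift K1_cont_shift in auto)
  thus ?thesis by (simp add: ddx_def span_def)
qed

lemma L_tent:
  assumes N: "2 \<le> N" and i: "1 \<le> i" "i \<le> N"
  shows "2 * \<kappa> * (T - X N (i - 1)) powr (1 - \<alpha>) - 2 * C2 * X N i powr (- \<alpha>) \<le> L N (tent N) i"
proof -
  have N1: "1 \<le> N" using N by simp
  have sp: "0 < span N i" by (rule span_pos) (use N i in auto)
  have "frac_int \<alpha> T (fe_fun T r N (tent N)) = (\<lambda>x. (K2 x + K2 (2 * T - x)) - 2 * K2 (x - T))"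
    using frac_int_tent[OF N1] by blast
  hence "L N (tent N) i = 2 / span N i * (2 * ddx N i (\<lambda>x. K2 (x - T)) - ddx N i K2 - ddx N i (\<lambda>x. K2 (2 * T - x)))"
    using i by (simp add: L_eq ddx_def dd_add dd_diff dd_cmult algebra_simps)
  also have "\<dots> \<ge> 2 / span N i * (2 * (\<kappa> * (T - X N (i - 1)) powr (1 - \<alpha>) * span N i / 2)
       - C2 * X N i powr (- \<alpha>) * span N i / 2 - C2 * X N i powr (- \<alpha>) * span N i / 2)"
    using ddx_K2_upper[OF assms] ddx_K2_reflect_upper[OF assms] ddx_K2_mid_lower[OF assms] sp
    by (intro mult_left_mono) (auto simp: algebra_simps)
  also have "2 / span N i * (2 * (\<kappa> * P * span N i / 2) - C2 * Q * span N i / 2 - C2 * Q * span N i / 2) = 2 * \<kappa> * P - 2 * C2 * Q" for P Q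
    using sp by (simp add: field_simps)
  finally show ?thesis by simp
qed

text \<open>The shape of the truncation error at \<open>i \<le> N\<close>. The second term is caused by the kink of the
  mesh at \<open>T\<close>, where \<open>r > 1\<close> makes the second difference of the nodes only first order small.\<close>

definition rho :: "nat \<Rightarrow> nat \<Rightarrow> real" where
  "rho N i = X N i powr (- \<alpha>) + (T - X N (i - 1)) powr (1 - \<alpha>)"

text \<open>The nodal values of the distance to the boundary produce the second term of \<open>rho\<close>; the
  constant produces the first one and absorbs the negative part of the other.\<close>

definition barrier :: "nat \<Rightarrow> nat \<Rightarrow> real" where
  "barrier N j = tent N j + (2 * C2 / c1 + 1)"

lemma tent_bounds: "1 \<le> N \<Longrightarrow> j \<le> 2 * N \<Longrightarrow> 0 \<le> tent N j \<and> tent N j \<le> T"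
  using mesh_nonneg[of N j] mesh_upper[of N j] mesh_le_mid[of N j] mesh_le[of N N j]
  by (auto simp: tent_def mesh_mid)

lemma tent_reflect: assumes "1 \<le> N" "j \<le> 2 * N" shows "tent N (2 * N - j) = tent N j"
  using assms mesh_reflect[of N j] by (cases "j = N") (auto simp: tent_def)

lemma barrier_bounds:
  assumes "1 \<le> N" "j \<le> 2 * N"
  shows "0 < barrier N j" "barrier N j \<le> T + 2 * C2 / c1 + 1"
  using tent_bounds[OF assms] C2_pos c1_pos by (auto simp: barrier_def intro!: add_nonneg_pos)

definition c3 :: real where "c3 = min (2 * \<kappa>) c1"

lemma c3_pos: "0 < c3" using \<kappa>0 c1_pos by (simp add: c3_def)

lemma L_barrier:
  assumes N: "2 \<le> N" and i: "1 \<le> i" "i \<le> N"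
  shows "c3 * rho N i \<le> L N (barrier N) i"
proof -
  have N1: "1 \<le> N" using N by simp
  let ?k = "2 * C2 / c1 + 1"
  have "L N (barrier N) i = L N (tent N) i + ?k * L N (\<lambda>_. 1) i"
    using L_add[OF N1 i(1), of "tent N" "\<lambda>_. ?k"] L_cmult[OF N1 i(1), of ?k "\<lambda>_. 1"]
    by (simp add: barrier_def[abs_def])
  also have "\<dots> \<ge> (2 * \<kappa> * (T - X N (i - 1)) powr (1 - \<alpha>) - 2 * C2 * X N i powr (- \<alpha>)) + ?k * (c1 * X N i powr (- \<alpha>))"
    using L_tent[OF assms] L_one[OF N1, of i] i N c1_pos C2_pos by (intro add_mono mult_left_mono) auto
  \<comment> \<open>The part 2 C2 / c1 of the constant cancels the negative term exactly, and the
    added 1 leaves the term with \<open>c1\<close>.\<close>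
  also have "(2 * \<kappa> * (T - X N (i - 1)) powr (1 - \<alpha>) - 2 * C2 * X N i powr (- \<alpha>)) + ?k * (c1 * X N i powr (- \<alpha>))
     = 2 * \<kappa> * (T - X N (i - 1)) powr (1 - \<alpha>) + c1 * X N i powr (- \<alpha>)"
    using c1_pos by (simp add: field_simps)
  finally have 1: "2 * \<kappa> * (T - X N (i - 1)) powr (1 - \<alpha>) + c1 * X N i powr (- \<alpha>) \<le> L N (barrier N) i" .
  have "c3 * rho N i \<le> 2 * \<kappa> * (T - X N (i - 1)) powr (1 - \<alpha>) + c1 * X N i powr (- \<alpha>)"
    unfolding rho_def distrib_left add.commute[of "c3 * X N i powr _"]
    by (intro add_mono mult_right_mono) (auto simp: c3_def)
  thus ?thesis using 1 by simp
qed

lemma rho_pos: assumes N: "1 \<le> N" and i: "1 \<le> i" "i \<le> N" shows "0 < rho N i"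
  using mesh_pos[of N i] N i by (simp add: rho_def add_pos_nonneg)

text \<open>The barrier is symmetric about T, so a residual at 2 N - i may be measured by the weight
  at i.\<close>

lemma stability:
  assumes N: "2 \<le> N" and \<epsilon>: "0 \<le> \<epsilon>"
    and l: "\<And>i. 1 \<le> i \<Longrightarrow> i \<le> N \<Longrightarrow> \<bar>L N e i\<bar> \<le> \<epsilon> * rho N i"
    and r: "\<And>i. 1 \<le> i \<Longrightarrow> i \<le> N \<Longrightarrow> \<bar>L N e (2 * N - i)\<bar> \<le> \<epsilon> * rho N i"
    and i: "i \<in> {1..2 * N - 1}"
  shows "\<bar>e i\<bar> \<le> \<epsilon> * ((T + 2 * C2 / c1 + 1) / c3)"
proof -
  have N1: "1 \<le> N" using N by simp
  have refl: "L N (barrier N) (2 * N - i) = L N (barrier N) i" if "1 \<le> i" "i \<le> N" for i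
  proof -
    have "L N (barrier N) (2 * N - i) = L N (\<lambda>j. barrier N (2 * N - j)) i"
      using L_reflect[OF N1, of i "barrier N"] that N by simp
    also have "\<dots> = L N (barrier N) i"
      using that N1 tent_reflect[OF N1] by (auto simp: L_sum barrier_def intro!: sum.cong)
    finally show ?thesis .
  qed
  have LB: "0 < L N (barrier N) j \<and> \<bar>L N e j\<bar> \<le> \<epsilon> / c3 * L N (barrier N) j" if j: "j \<in> {1..2 * N - 1}" for j
  proof -
    define m where "m = (if j \<le> N then j else 2 * N - j)"
    have m: "1 \<le> m" "m \<le> N" "j = m \<or> j = 2 * N - m" using j by (auto simp: m_def)
    have eq: "L N (barrier N) j = L N (barrier N) m" using refl[OF m(1,2)] m(3) by auto
    have b: "c3 * rho N m \<le> L N (barrier N) m" by (rule L_barrier) (use N m in auto)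
    have "\<bar>L N e j\<bar> \<le> \<epsilon> * rho N m" using l[OF m(1,2)] r[OF m(1,2)] m(3) by auto
    also have "\<dots> = \<epsilon> / c3 * (c3 * rho N m)" using c3_pos by simp
    also have "\<dots> \<le> \<epsilon> / c3 * L N (barrier N) m" using b \<epsilon> c3_pos by (intro mult_left_mono) auto
    finally have "\<bar>L N e j\<bar> \<le> \<epsilon> / c3 * L N (barrier N) m" .
    moreover have "0 < c3 * rho N m" using c3_pos rho_pos[OF N1 m(1,2)] by simp
    ultimately show ?thesis using b eq by simp
  qed
  have "\<bar>e i\<bar> \<le> \<epsilon> / c3 * barrier N i"
    by (rule comparison[OF N1, where B="barrier N"]) (use LB barrier_bounds[OF N1] i in auto)
  also have "\<dots> \<le> \<epsilon> / c3 * (T + 2 * C2 / c1 + 1)"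
    using barrier_bounds[OF N1, of i] i \<epsilon> c3_pos by (intro mult_left_mono) auto
  finally show ?thesis by simp
qed

end

section \<open>The interpolation error\<close>

lemma dd_integral:
  fixes k :: "real \<Rightarrow> real \<Rightarrow> real"
  assumes "\<And>x. x \<in> {a, b, c} \<Longrightarrow> k x integrable_on S"
  shows "(\<lambda>y. dd a b c (\<lambda>x. k x y)) integrable_on S"
    and "dd a b c (\<lambda>x. integral S (k x)) = integral S (\<lambda>y. dd a b c (\<lambda>x. k x y))"
proof -
  have i: "k a integrable_on S" "k b integrable_on S" "k c integrable_on S" using assms by auto
  have 1: "(\<lambda>y. (k c y - k b y) / (c - b)) integrable_on S" "(\<lambda>y. (k b y - k a y) / (b - a)) integrable_on S"
    unfolding divide_inverse using i by (intro integrable_on_mult_left integrable_diff; simp)+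
  show "(\<lambda>y. dd a b c (\<lambda>x. k x y)) integrable_on S"
    unfolding dd_def using 1 by (intro integrable_diff)
  have "integral S (\<lambda>y. dd a b c (\<lambda>x. k x y)) = integral S (\<lambda>y. (k c y - k b y) / (c - b)) - integral S (\<lambda>y. (k b y - k a y) / (b - a))"
    unfolding dd_def by (rule integral_diff) (use 1 in auto)
  also have "\<dots> = dd a b c (\<lambda>x. integral S (k x))"
    using i by (simp add: dd_def integral_diff)
  finally show "dd a b c (\<lambda>x. integral S (k x)) = integral S (\<lambda>y. dd a b c (\<lambda>x. k x y))" ..
qed

text \<open>Taylor's formula about y, evaluated at c, with integral remainder. The segment is
  rescaled to the unit interval so that remainders of different cells are integrals over the same
  set and can be compared pointwise.\<close>

lemma taylor_integral:
  fixes u :: "real \<Rightarrow> real"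
  assumes "\<And>t. 0 \<le> t \<Longrightarrow> t \<le> 1 \<Longrightarrow> (u has_real_derivative u1 (c + t * (y - c))) (at (c + t * (y - c)))"
    and "\<And>t. 0 \<le> t \<Longrightarrow> t \<le> 1 \<Longrightarrow> (u1 has_real_derivative u2 (c + t * (y - c))) (at (c + t * (y - c)))"
  shows "((\<lambda>t. (y - c)\<^sup>2 * (t * u2 (c + t * (y - c)))) has_integral (u c - u y - (c - y) * u1 y)) {0..1}"
proof -
  let ?G = "\<lambda>t. t * (y - c) * u1 (c + t * (y - c)) - u (c + t * (y - c))"
  have "((\<lambda>t. (y - c)\<^sup>2 * (t * u2 (c + t * (y - c)))) has_integral (?G 1 - ?G 0)) {0..1}"
  proof (rule fundamental_theorem_of_calculus)
    fix t :: real assume t: "t \<in> {0..1}"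
    have a: "((\<lambda>t. c + t * (y - c)) has_real_derivative (y - c)) (at t)"
      by (auto intro!: derivative_eq_intros)
    have 1: "((\<lambda>t. u (c + t * (y - c))) has_real_derivative u1 (c + t * (y - c)) * (y - c)) (at t)"
      by (rule DERIV_chain2[OF assms(1) a]) (use t in auto)
    have 2: "((\<lambda>t. u1 (c + t * (y - c))) has_real_derivative u2 (c + t * (y - c)) * (y - c)) (at t)"
      by (rule DERIV_chain2[OF assms(2) a]) (use t in auto)
    have 3: "((\<lambda>t. t * (y - c)) has_real_derivative (y - c)) (at t)"
      by (auto intro!: derivative_eq_intros)
    note DERIV_diff[OF DERIV_mult[OF 3 2] 1]
    hence "(?G has_real_derivative (y - c)\<^sup>2 * (t * u2 (c + t * (y - c)))) (at t)"
      by (simp add: power2_eq_square algebra_simps)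
    thus "(?G has_vector_derivative (y - c)\<^sup>2 * (t * u2 (c + t * (y - c)))) (at t within {0..1})"
      unfolding has_real_derivative_iff_has_vector_derivative[symmetric] by (rule DERIV_subset) auto
  qed simp
  thus ?thesis by (simp add: algebra_simps)
qed

locale frac_sigma = frac_problem +
  fixes \<sigma> :: real
  assumes \<sigma>0: "0 < \<sigma>" and \<sigma>\<alpha>: "\<sigma> < \<alpha>"
begin

definition eps :: "nat \<Rightarrow> real" where "eps N = (1 / real N) powr min (r * \<sigma>) 2"

lemma eps_nonneg: "0 \<le> eps N" by (simp add: eps_def)

text \<open>The origin of the rate: X powr \<sigma> is T powr \<sigma> times (m / N) powr (r
  \<sigma>). As m / N \<le> 1, the exponent may be lowered to e = min (r \<sigma>) 2, and then m
  powr e \<le> m^2.\<close>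

lemma mesh_powr_eps:
  assumes m: "1 \<le> m" "m \<le> N"
  shows "X N m powr \<sigma> / (real m)\<^sup>2 \<le> T powr \<sigma> * eps N"
proof -
  let ?e = "min (r * \<sigma>) 2"
  have e: "0 \<le> ?e" "?e \<le> r * \<sigma>" "?e \<le> 2" using r1 \<sigma>0 by auto
  have "X N m powr \<sigma> = T powr \<sigma> * (real m / real N) powr (r * \<sigma>)"
    using m T0 by (simp add: mesh_def powr_mult powr_powr)
  also have "(real m / real N) powr (r * \<sigma>) \<le> (real m / real N) powr ?e"
    using m e by (intro powr_mono') auto
  also have "(real m / real N) powr ?e = real m powr ?e * eps N"
    using m by (simp add: eps_def powr_divide)
  also have "real m powr ?e \<le> real m powr 2" using m e by (intro powr_mono) auto
  also have "real m powr 2 = (real m)\<^sup>2" using m by (simp add: powr_numeral)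
  finally have "X N m powr \<sigma> \<le> T powr \<sigma> * ((real m)\<^sup>2 * eps N)"
    using eps_nonneg T0 by (simp add: mult_left_mono mult_right_mono)
  thus ?thesis using m by (simp add: field_simps)
qed

lemma mesh_one_eps: "1 \<le> N \<Longrightarrow> X N 1 powr \<sigma> \<le> T powr \<sigma> * eps N"
  using mesh_powr_eps[of 1 N] by simp

end

text \<open>The derivatives are functions of their own instead of iterates of \<open>deriv\<close>,
  so the reflected data form another instance with explicit derivatives. The equation enters as a
  chain: \<open>F1\<close> is the derivative of the fractional integral and - f that of
  \<open>F1\<close>.\<close>

locale frac_data = frac_sigma +
  fixes C0 :: real and u u1 u2 u3 u4 f f1 f2 F1 :: "real \<Rightarrow> real"
  assumes du: "\<And>x. x \<in> Omega T \<Longrightarrow> (u has_real_derivative u1 x) (at x)"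
    and du1: "\<And>x. x \<in> Omega T \<Longrightarrow> (u1 has_real_derivative u2 x) (at x)"
    and du2: "\<And>x. x \<in> Omega T \<Longrightarrow> (u2 has_real_derivative u3 x) (at x)"
    and du3: "\<And>x. x \<in> Omega T \<Longrightarrow> (u3 has_real_derivative u4 x) (at x)"
    and df: "\<And>x. x \<in> Omega T \<Longrightarrow> (f has_real_derivative f1 x) (at x)"
    and df1: "\<And>x. x \<in> Omega T \<Longrightarrow> (f1 has_real_derivative f2 x) (at x)"
    and dF: "\<And>x. x \<in> Omega T \<Longrightarrow> (frac_int \<alpha> T u has_real_derivative F1 x) (at x)"
    and dF1: "\<And>x. x \<in> Omega T \<Longrightarrow> (F1 has_real_derivative - f x) (at x)"
    and bu: "\<And>x. x \<in> Omega T \<Longrightarrow> \<bar>u x\<bar> \<le> C0 * bdist T x powr \<sigma>"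
    and bu2: "\<And>x. x \<in> Omega T \<Longrightarrow> \<bar>u2 x\<bar> \<le> C0 * bdist T x powr (\<sigma> - 2)"
    and bu3: "\<And>x. x \<in> Omega T \<Longrightarrow> \<bar>u3 x\<bar> \<le> C0 * bdist T x powr (\<sigma> - 3)"
    and bu4: "\<And>x. x \<in> Omega T \<Longrightarrow> \<bar>u4 x\<bar> \<le> C0 * bdist T x powr (\<sigma> - 4)"
    and bf: "\<And>x. x \<in> Omega T \<Longrightarrow> \<bar>f x\<bar> \<le> C0 * bdist T x powr (\<sigma> - \<alpha>)"
    and bf1: "\<And>x. x \<in> Omega T \<Longrightarrow> \<bar>f1 x\<bar> \<le> C0 * bdist T x powr (\<sigma> - \<alpha> - 1)"
    and bf2: "\<And>x. x \<in> Omega T \<Longrightarrow> \<bar>f2 x\<bar> \<le> C0 * bdist T x powr (\<sigma> - \<alpha> - 2)"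
    and u_out: "\<And>x. x \<notin> Omega T \<Longrightarrow> u x = 0"
begin

lemma C0_nonneg: "0 \<le> C0"
proof -
  have "0 \<le> C0 * T powr \<sigma>" using bu[of T] T0 by (simp add: Omega_def bdist_def)
  thus ?thesis using T0 by (simp add: zero_le_mult_iff)
qed

lemma bdist_nonneg: "x \<in> {0..2 * T} \<Longrightarrow> 0 \<le> bdist T x" by (simp add: bdist_def)

lemma u_bound: "x \<in> {0..2 * T} \<Longrightarrow> \<bar>u x\<bar> \<le> C0 * bdist T x powr \<sigma>"
  using bu[of x] u_out[of x] C0_nonneg by (cases "x \<in> Omega T") auto

text \<open>At the two endpoints continuity follows from the bound by bdist powr \<sigma>, which
  tends to 0 because \<sigma> > 0.\<close>

lemma u_cont: "continuous_on {0..2 * T} u"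
proof -
  have "isCont u x \<or> (u \<longlongrightarrow> u x) (at x within {0..2 * T})" if x: "x \<in> {0..2 * T}" for x
  proof (cases "x \<in> Omega T")
    case True
    thus ?thesis using du DERIV_isCont by blast
  next
    case False
    hence b0: "bdist T x = 0" and u0: "u x = 0" using x T0 u_out by (auto simp: Omega_def bdist_def)
    have "((\<lambda>y. C0 * bdist T y powr \<sigma>) \<longlongrightarrow> C0 * bdist T x powr \<sigma>) (at x within {0..2 * T})"
      unfolding bdist_def using \<sigma>0 x
      by (intro tendsto_intros tendsto_powr') (auto simp: eventually_at_filter)
    hence "((\<lambda>y. C0 * bdist T y powr \<sigma>) \<longlongrightarrow> 0) (at x within {0..2 * T})" using b0 by simp
    hence "(u \<longlongrightarrow> 0) (at x within {0..2 * T})"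
      by (rule Lim_null_comparison[rotated]) (use u_bound in \<open>auto simp: eventually_at_filter\<close>)
    thus ?thesis using u0 by simp
  qed
  thus ?thesis unfolding continuous_on_def by (meson continuous_at_imp_continuous_at_within continuous_within)
qed

abbreviation "uh N \<equiv> fe_fun T r N (\<lambda>j. u (X N j))"

definition E :: "nat \<Rightarrow> real \<Rightarrow> real" where "E N y = uh N y - u y"

lemma E_cont: "1 \<le> N \<Longrightarrow> continuous_on {0..2 * T} (E N)"
  unfolding E_def[abs_def] by (intro continuous_intros fe_fun_cont u_cont)

lemma nodal_u: "1 \<le> N \<Longrightarrow> j \<le> 2 * N \<Longrightarrow> nodal N (\<lambda>j. u (X N j)) j = u (X N j)"
proof -
  assume N: "1 \<le> N" and j: "j \<le> 2 * N"
  consider "j = 0" | "j = 2 * N" | "1 \<le> j \<and> j \<le> 2 * N - 1" using j by linarith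
  thus ?thesis
    by cases (use N u_out[of 0] u_out[of "2 * T"] in \<open>auto simp: nodal_def mesh_0 mesh_end Omega_def\<close>)
qed

text \<open>The second divided difference of \<open>u\<close> at \<open>a\<close>, \<open>b\<close> and \<open>a + \<theta> (b - a)\<close>.\<close>

definition V :: "real \<Rightarrow> real \<Rightarrow> real \<Rightarrow> real" where
  "V a b \<theta> = integral {0..1} (\<lambda>t. t * (\<theta> * u2 ((1 - t * \<theta>) * a + t * \<theta> * b) + (1 - \<theta>) * u2 (t * (1 - \<theta>) * a + (1 - t * (1 - \<theta>)) * b)))"

text \<open>Taylor expansions about the intermediate point, evaluated at a and b, are combined with
  the weights 1 - \<theta> and \<theta>; the first derivatives cancel. In the resulting formula a
  cell enters only through the arguments of \<open>u2\<close>, so that a shift of the cell can be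
  followed.\<close>

lemma V_repr:
  assumes ab: "0 < a" "a \<le> b" "b < 2 * T" and \<theta>: "0 < \<theta>" "\<theta> < 1"
  shows "(\<lambda>t. t * (\<theta> * u2 ((1 - t * \<theta>) * a + t * \<theta> * b) + (1 - \<theta>) * u2 (t * (1 - \<theta>) * a + (1 - t * (1 - \<theta>)) * b))) integrable_on {0..1}"
      (is "?v integrable_on _")
    and "(1 - \<theta>) * u a + \<theta> * u b - u (a + \<theta> * (b - a)) = (b - a)\<^sup>2 * (\<theta> * (1 - \<theta>)) * V a b \<theta>"
proof -
  define y where "y = a + \<theta> * (b - a)"
  have y: "a \<le> y" "y \<le> b" using ab \<theta> using mult_right_mono[of \<theta> 1 "b - a"] by (auto simp: y_def)
  have in\<Omega>: "c + t * (y - c) \<in> Omega T" if "0 \<le> t" "t \<le> 1" "c = a \<or> c = b" for t c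
  proof -
    have "a \<le> c + t * (y - c) \<and> c + t * (y - c) \<le> b"
      using convex_bound_le[of c b y "1 - t" t] convex_bound_le[of "-c" "-a" "-y" "1 - t" t] that y ab
      by (auto simp: algebra_simps)
    thus ?thesis using ab by (auto simp: Omega_def)
  qed
  have Ia: "((\<lambda>t. (y - a)\<^sup>2 * (t * u2 (a + t * (y - a)))) has_integral (u a - u y - (a - y) * u1 y)) {0..1}"
    by (rule taylor_integral) (use du du1 in\<Omega> in auto)
  have Ib: "((\<lambda>t. (y - b)\<^sup>2 * (t * u2 (b + t * (y - b)))) has_integral (u b - u y - (b - y) * u1 y)) {0..1}"
    by (rule taylor_integral) (use du du1 in\<Omega> in auto)
  have yb: "y - b = - ((1 - \<theta>) * (b - a))" "y - a = \<theta> * (b - a)" by (auto simp: y_def algebra_simps)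
  have eq: "(1 - \<theta>) * ((y - a)\<^sup>2 * (t * u2 (a + t * (y - a)))) + \<theta> * ((y - b)\<^sup>2 * (t * u2 (b + t * (y - b))))
     = (b - a)\<^sup>2 * (\<theta> * (1 - \<theta>)) * ?v t" for t
  proof -
    have "a + t * (y - a) = (1 - t * \<theta>) * a + t * \<theta> * b" "b + t * (y - b) = t * (1 - \<theta>) * a + (1 - t * (1 - \<theta>)) * b"
      unfolding yb by (auto simp: algebra_simps)
    thus ?thesis unfolding yb by (simp only:) (simp add: power2_eq_square algebra_simps)
  qed
  have "((\<lambda>t. (1 - \<theta>) * ((y - a)\<^sup>2 * (t * u2 (a + t * (y - a)))) + \<theta> * ((y - b)\<^sup>2 * (t * u2 (b + t * (y - b)))))
     has_integral ((1 - \<theta>) * (u a - u y - (a - y) * u1 y) + \<theta> * (u b - u y - (b - y) * u1 y))) {0..1}"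
    by (intro has_integral_add has_integral_mult_right Ia Ib)
  moreover have "(1 - \<theta>) * (u a - u y - (a - y) * u1 y) + \<theta> * (u b - u y - (b - y) * u1 y) = (1 - \<theta>) * u a + \<theta> * u b - u y"
  proof -
    have "(1 - \<theta>) * (a - y) + \<theta> * (b - y) = 0" by (simp add: y_def algebra_simps)
    hence "((1 - \<theta>) * (a - y) + \<theta> * (b - y)) * u1 y = 0" by simp
    thus ?thesis by (simp add: algebra_simps)
  qed
  ultimately have I: "((\<lambda>t. (b - a)\<^sup>2 * (\<theta> * (1 - \<theta>)) * ?v t) has_integral ((1 - \<theta>) * u a + \<theta> * u b - u y)) {0..1}"
    by (simp only: eq)
  show int: "?v integrable_on {0..1}"
  proof (cases "a = b")
    case False
    have "(b - a)\<^sup>2 * (\<theta> * (1 - \<theta>)) \<noteq> 0" using False \<theta> by simp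
    moreover have "(\<lambda>t. (b - a)\<^sup>2 * (\<theta> * (1 - \<theta>)) * ?v t) integrable_on {0..1}" using I by blast
    ultimately show ?thesis using integrable_on_cmult_iff[of "(b - a)\<^sup>2 * (\<theta> * (1 - \<theta>))" ?v "{0..1}"] by simp
  next
    case True
    have "?v = (\<lambda>t. t * u2 a)" using True by (auto simp: fun_eq_iff algebra_simps)
    thus ?thesis by (simp add: integrable_continuous_real continuous_intros)
  qed
  have "(b - a)\<^sup>2 * (\<theta> * (1 - \<theta>)) * V a b \<theta> = integral {0..1} (\<lambda>t. (b - a)\<^sup>2 * (\<theta> * (1 - \<theta>)) * ?v t)"
    unfolding V_def by (simp only: integral_mult_right)
  also have "\<dots> = (1 - \<theta>) * u a + \<theta> * u b - u y" using I by (rule integral_unique)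
  finally show "(1 - \<theta>) * u a + \<theta> * u b - u (a + \<theta> * (b - a)) = (b - a)\<^sup>2 * (\<theta> * (1 - \<theta>)) * V a b \<theta>"
    by (simp add: y_def)
qed

lemma V_bound:
  assumes ab: "0 < a" "a \<le> b" "b < 2 * T" and \<theta>: "0 < \<theta>" "\<theta> < 1"
    and M: "\<And>z. a \<le> z \<Longrightarrow> z \<le> b \<Longrightarrow> \<bar>u2 z\<bar> \<le> M"
  shows "\<bar>V a b \<theta>\<bar> \<le> M"
proof -
  have M0: "0 \<le> M" using M[of a] ab by auto
  have "norm (V a b \<theta>) \<le> integral {0..1} (\<lambda>t::real. M)"
    unfolding V_def
  proof (rule Henstock_Kurzweil_Integration.integral_norm_bound_integral[OF V_repr(1)[OF ab \<theta>]])
    fix t :: real assume t: "t \<in> {0..1}"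
    have s: "\<bar>u2 ((1 - s) * a + s * b)\<bar> \<le> M" if "0 \<le> s" "s \<le> 1" for s
      using convex_bound_le[of a b b "1 - s" s] convex_bound_le[of "-a" "-a" "-b" "1 - s" s] that ab
      by (intro M) (auto simp: algebra_simps)
    have 1: "\<bar>u2 ((1 - t * \<theta>) * a + t * \<theta> * b)\<bar> \<le> M" using t \<theta> by (intro s) (auto simp: mult_le_one)
    have 2: "\<bar>u2 (t * (1 - \<theta>) * a + (1 - t * (1 - \<theta>)) * b)\<bar> \<le> M"
      using s[of "1 - t * (1 - \<theta>)"] t \<theta> by (auto simp: mult_le_one)
    have "\<bar>\<theta> * u2 ((1 - t * \<theta>) * a + t * \<theta> * b) + (1 - \<theta>) * u2 (t * (1 - \<theta>) * a + (1 - t * (1 - \<theta>)) * b)\<bar> \<le> \<theta> * M + (1 - \<theta>) * M"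
      using \<theta> by (intro order_trans[OF abs_triangle_ineq] add_mono) (auto simp: abs_mult intro!: mult_left_mono 1 2)
    also have "\<dots> = M" by (simp add: algebra_simps)
    finally have "t * \<bar>\<theta> * u2 ((1 - t * \<theta>) * a + t * \<theta> * b) + (1 - \<theta>) * u2 (t * (1 - \<theta>) * a + (1 - t * (1 - \<theta>)) * b)\<bar> \<le> 1 * M"
      using t M0 by (intro mult_mono) auto
    thus "norm (t * (\<theta> * u2 ((1 - t * \<theta>) * a + t * \<theta> * b) + (1 - \<theta>) * u2 (t * (1 - \<theta>) * a + (1 - t * (1 - \<theta>)) * b))) \<le> M"
      using t by (simp add: abs_mult)
  qed auto
  thus ?thesis by simp
qed

lemma E_cell:
  assumes N: "1 \<le> N" and j: "1 \<le> j" "j \<le> 2 * N" and \<theta>: "0 \<le> \<theta>" "\<theta> \<le> 1"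
  shows "E N (X N (j - 1) + \<theta> * H N j) = (1 - \<theta>) * u (X N (j - 1)) + \<theta> * u (X N j) - u (X N (j - 1) + \<theta> * H N j)"
proof -
  have h: "0 < H N j" using step_pos N j by auto
  have "uh N (X N (j - 1) + \<theta> * H N j) = u (X N (j - 1)) + (u (X N j) - u (X N (j - 1))) / H N j * (\<theta> * H N j)"
  proof -
    have "X N (j - 1) + \<theta> * H N j \<le> X N (j - 1) + 1 * H N j" using \<theta> h by (intro add_left_mono mult_right_mono) auto
    hence "X N (j - 1) + \<theta> * H N j \<le> X N j" using j by (simp add: step_eq')
    thus ?thesis using fe_fun_cell[OF N j, of "X N (j - 1) + \<theta> * H N j"] \<theta> h j N by (simp add: nodal_u)
  qed
  also have "(u (X N j) - u (X N (j - 1))) / H N j * (\<theta> * H N j) = \<theta> * (u (X N j) - u (X N (j - 1)))"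
    using h by simp
  finally show ?thesis by (simp add: E_def algebra_simps)
qed

lemma E_cell_V:
  assumes N: "1 \<le> N" and j: "2 \<le> j" "j \<le> 2 * N - 1" and \<theta>: "0 < \<theta>" "\<theta> < 1"
  shows "E N (X N (j - 1) + \<theta> * H N j) = (H N j)\<^sup>2 * (\<theta> * (1 - \<theta>)) * V (X N (j - 1)) (X N j) \<theta>"
proof -
  have a: "0 < X N (j - 1)" using N j by (intro mesh_pos) auto
  have b: "X N j < 2 * T" using mesh_less[of N j "2 * N"] N j by (simp add: mesh_end)
  have "X N (j - 1) \<le> X N j" using N j by (intro mesh_le) auto
  from V_repr(2)[OF a this b \<theta>] show ?thesis using E_cell[of N j \<theta>] N j \<theta> by (simp add: step_eq')
qed

definition CE :: real where "CE = (2 + Cw\<^sup>2) * T powr \<sigma>"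

text \<open>In the two boundary cells u itself has size X_1 powr \<sigma>, and \<open>E\<close> is
  at most twice that. In the other cells \<open>E\<close> is bounded by h^2 times u'', that is by a
  multiple of x powr \<sigma> / i^2. The two cases give the two summands of
  \<open>CE\<close>.\<close>

lemma E_bound:
  assumes N: "1 \<le> N" and y: "y \<in> {0..2 * T}"
  shows "\<bar>E N y\<bar> \<le> CE * C0 * eps N"
proof -
  have "y \<in> (\<Union>j\<in>{1..2 * N}. {X N (j - 1)..X N j})"
    using cells_cover[of N "2 * N"] N y by (simp only: mesh_end)
  then obtain j where j: "1 \<le> j" "j \<le> 2 * N" "X N (j - 1) \<le> y" "y \<le> X N j" by auto
  have h: "0 < H N j" using step_pos N j by auto
  define \<theta> where "\<theta> = (y - X N (j - 1)) / H N j"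
  have y_eq: "y = X N (j - 1) + \<theta> * H N j" using h by (simp add: \<theta>_def)
  have \<theta>: "0 \<le> \<theta>" "\<theta> \<le> 1" using h j by (auto simp: \<theta>_def step_eq')
  have CE1: "2 * T powr \<sigma> \<le> CE" "Cw\<^sup>2 * T powr \<sigma> \<le> CE" by (auto simp: CE_def algebra_simps)
  have k: "0 \<le> C0 * eps N" using C0_nonneg eps_nonneg by simp
  show ?thesis
  proof (cases "j = 1 \<or> j = 2 * N")
    case True
    have ub: "\<bar>u z\<bar> \<le> C0 * (T powr \<sigma> * eps N)" if z: "X N (j - 1) \<le> z" "z \<le> X N j" for z
    proof -
      have "0 \<le> X N (j - 1)" "X N j \<le> 2 * T" using N j by (intro mesh_nonneg mesh_upper; simp)+
      hence z2: "z \<in> {0..2 * T}" using z by auto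
      have "bdist T z \<le> X N 1"
      proof (cases "j = 1")
        case False
        hence "j = 2 * N" using True by simp
        hence "2 * T - X N 1 \<le> z" using z mesh_reflect[of N 1] N by simp
        thus ?thesis by (simp add: bdist_def)
      qed (use z in \<open>auto simp: bdist_def\<close>)
      hence "bdist T z powr \<sigma> \<le> X N 1 powr \<sigma>" using bdist_nonneg[OF z2] \<sigma>0 by (intro powr_mono2) auto
      also have "\<dots> \<le> T powr \<sigma> * eps N" by (rule mesh_one_eps[OF N])
      finally have "C0 * bdist T z powr \<sigma> \<le> C0 * (T powr \<sigma> * eps N)" using C0_nonneg by (rule mult_left_mono)
      thus ?thesis using u_bound[OF z2] by simp
    qed
    let ?m = "C0 * (T powr \<sigma> * eps N)"
    have l: "\<bar>u (X N (j - 1))\<bar> \<le> ?m" "\<bar>u (X N j)\<bar> \<le> ?m" "\<bar>u y\<bar> \<le> ?m" using h j by (auto intro!: ub simp: step_eq')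
    have "\<bar>E N y\<bar> \<le> \<bar>(1 - \<theta>) * u (X N (j - 1))\<bar> + \<bar>\<theta> * u (X N j)\<bar> + \<bar>u y\<bar>"
      using E_cell[OF N j(1,2) \<theta>] unfolding y_eq[symmetric] by linarith
    also have "\<dots> \<le> (1 - \<theta>) * ?m + \<theta> * ?m + ?m"
      using l \<theta> by (intro add_mono) (auto simp: abs_mult intro!: mult_left_mono)
    also have "\<dots> = 2 * T powr \<sigma> * (C0 * eps N)" by (simp add: algebra_simps)
    also have "\<dots> \<le> CE * (C0 * eps N)" using CE1 k by (intro mult_right_mono) auto
    finally show ?thesis by (simp add: mult.assoc)
  next
    case False
    hence j2: "2 \<le> j" "j \<le> 2 * N - 1" using j by auto
    \<comment> \<open>The cell is moved to the left half; i = k - 1 is then the index of its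
      endpoint nearer to the boundary, where the bound on u'' is worst.\<close>
    define k where "k = (if j \<le> N then j else 2 * N + 1 - j)"
    have k2: "2 \<le> k" "k \<le> N" using j2 by (auto simp: k_def)
    have Hk: "H N j = H N k" using step_reflect[OF N j(1,2)] by (simp add: k_def)
    define i where "i = k - 1"
    have i: "1 \<le> i" "i \<le> N" "k = i + 1" using k2 by (auto simp: i_def)
    have Xi: "0 < X N i" using N i by (intro mesh_pos) auto
    have bd: "X N i \<le> bdist T z \<and> z \<in> Omega T" if z: "X N (j - 1) \<le> z" "z \<le> X N j" for z
    proof (cases "j \<le> N")
      case True
      hence "X N j \<le> T" "X N i = X N (j - 1)" using N by (auto intro!: mesh_le_mid simp: i_def k_def)
      thus ?thesis using z Xi by (auto simp: bdist_def Omega_def)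
    next
      case False
      have 1: "X N i = 2 * T - X N j" using mesh_reflect[of N j] False N j2 by (simp add: i_def k_def)
      have "T \<le> X N (j - 1)" using mesh_le[of N N "j - 1"] False N j2 by (simp add: mesh_mid)
      moreover have "X N i \<le> T" using i N by (intro mesh_le_mid) auto
      ultimately show ?thesis using z Xi 1 T0 by (auto simp: bdist_def Omega_def)
    qed
    have u2b: "\<bar>u2 z\<bar> \<le> C0 * X N i powr (\<sigma> - 2)" if z: "X N (j - 1) \<le> z" "z \<le> X N j" for z
    proof -
      have "bdist T z powr (\<sigma> - 2) \<le> X N i powr (\<sigma> - 2)"
        using bd[OF z] Xi \<sigma>\<alpha> \<alpha>2 by (intro powr_mono2') auto
      thus ?thesis using bu2[of z] bd[OF z] C0_nonneg by (meson mult_left_mono order_trans)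
    qed
    have Hb: "0 < H N j" "H N j \<le> Cw * (X N i / real i)"
      using window_left(2)[of i N k] i k2 h Hk by (auto simp: eta_def)
    have main: "\<bar>E N y\<bar> \<le> (H N j)\<^sup>2 * (C0 * X N i powr (\<sigma> - 2))"
    proof (cases "\<theta> = 0 \<or> \<theta> = 1")
      case True
      have "X N (j - 1) + H N j = X N j" using j by (simp add: step_eq')
      hence "E N y = 0" using E_cell[OF N j(1,2) \<theta>] True unfolding y_eq by auto
      thus ?thesis using C0_nonneg by simp
    next
      case False
      hence \<theta>': "0 < \<theta>" "\<theta> < 1" using \<theta> by auto
      have "\<bar>E N y\<bar> = (H N j)\<^sup>2 * (\<theta> * (1 - \<theta>)) * \<bar>V (X N (j - 1)) (X N j) \<theta>\<bar>"
        unfolding y_eq using E_cell_V[OF N j2 \<theta>'] \<theta>' by (simp add: abs_mult)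
      also have "\<dots> \<le> (H N j)\<^sup>2 * 1 * (C0 * X N i powr (\<sigma> - 2))"
      proof (intro mult_mono)
        show "\<theta> * (1 - \<theta>) \<le> 1" using \<theta>' by (intro mult_le_one) auto
        show "\<bar>V (X N (j - 1)) (X N j) \<theta>\<bar> \<le> C0 * X N i powr (\<sigma> - 2)"
          by (rule V_bound[OF _ _ _ \<theta>'])
             (use u2b bd[of "X N (j - 1)"] bd[of "X N j"] h j in \<open>auto simp: step_eq' Omega_def\<close>)
      qed (use C0_nonneg \<theta>' in auto)
      finally show ?thesis by simp
    qed
    also have "\<dots> \<le> (Cw * (X N i / real i))\<^sup>2 * (C0 * X N i powr (\<sigma> - 2))"
      using Hb C0_nonneg by (intro mult_right_mono power_mono) auto
    also have "\<dots> = Cw\<^sup>2 * C0 * (X N i powr \<sigma> / (real i)\<^sup>2)"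
    proof -
      have "X N i powr \<sigma> = (X N i)\<^sup>2 * X N i powr (\<sigma> - 2)"
        using powr_add[of "X N i" 2 "\<sigma> - 2"] Xi by (simp add: powr_numeral)
      thus ?thesis by (simp add: power_mult_distrib power_divide)
    qed
    also have "\<dots> \<le> Cw\<^sup>2 * C0 * (T powr \<sigma> * eps N)"
      using mesh_powr_eps[OF i(1,2)] C0_nonneg by (intro mult_left_mono) auto
    also have "\<dots> = Cw\<^sup>2 * T powr \<sigma> * (C0 * eps N)" by simp
    also have "\<dots> \<le> CE * (C0 * eps N)" using CE1 k by (intro mult_right_mono) auto
    finally show ?thesis by (simp add: mult.assoc)
  qed
qed

end

context frac_problem
begin

section \<open>The truncation error at the first nodes\<close>

lemma ddx_kernel_bound:
  assumes ab: "a < b" "b < c" and y: "y < a \<or> c < y" and d: "d \<le> \<bar>a - y\<bar>" "d \<le> \<bar>c - y\<bar>" "0 < d"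
  shows "\<bar>dd a b c (\<lambda>x. K (x - y))\<bar> \<le> \<kappa> * (\<alpha> - 1) * \<alpha> * d powr (- 1 - \<alpha>) * (c - a) / 2"
proof -
  have right: "\<bar>dd a b c (\<lambda>x. K (x - y))\<bar> \<le> \<kappa> * (\<alpha> - 1) * \<alpha> * d powr (- 1 - \<alpha>) * (c - a) / 2"
    if ab: "a < b" "b < c" and y: "y < a" and d: "d \<le> a - y" "0 < d" for a b c y
  proof (rule dd_abs_le_deriv2[where g'="\<lambda>x. - (\<kappa> * (\<alpha> - 1)) * (x - y) powr (- \<alpha>)"
        and g''="\<lambda>x. \<kappa> * (\<alpha> - 1) * \<alpha> * (x - y) powr (- 1 - \<alpha>)"])
    have D: "((\<lambda>x. K (x - y)) has_real_derivative - (\<kappa> * (\<alpha> - 1)) * (x - y) powr (- \<alpha>)) (at x)" if "a \<le> x" for x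
      using DERIV_shift[of K "- (\<kappa> * (\<alpha> - 1)) * (x - y) powr (- \<alpha>)" x "- y"] DERIV_K[of "x - y"] y that by simp
    show "continuous_on {a..c} (\<lambda>x. K (x - y))"
      using D by (meson DERIV_isCont atLeastAtMost_iff continuous_at_imp_continuous_on)
    fix x assume x: "a < x" "x < c"
    show "((\<lambda>x. K (x - y)) has_real_derivative - (\<kappa> * (\<alpha> - 1)) * (x - y) powr (- \<alpha>)) (at x)"
      using D x by simp
    show "((\<lambda>x. - (\<kappa> * (\<alpha> - 1)) * (x - y) powr (- \<alpha>)) has_real_derivative \<kappa> * (\<alpha> - 1) * \<alpha> * (x - y) powr (- 1 - \<alpha>)) (at x)"
      using DERIV_shift[of "\<lambda>t. - (\<kappa> * (\<alpha> - 1)) * t powr (- \<alpha>)" "\<kappa> * (\<alpha> - 1) * \<alpha> * (x - y) powr (- 1 - \<alpha>)" x "- y"]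
        DERIV_K'[of "x - y"] y x by simp
    have "(x - y) powr (- 1 - \<alpha>) \<le> d powr (- 1 - \<alpha>)" using x d \<alpha>1 by (intro powr_mono2') auto
    thus "\<bar>\<kappa> * (\<alpha> - 1) * \<alpha> * (x - y) powr (- 1 - \<alpha>)\<bar> \<le> \<kappa> * (\<alpha> - 1) * \<alpha> * d powr (- 1 - \<alpha>)"
      using \<kappa>0 \<alpha>1 by (simp add: abs_mult mult_left_mono)
  qed (use ab in auto)
  show ?thesis
  proof (cases "y < a")
    case True
    thus ?thesis using right[of a b c y] ab d by auto
  next
    case False
    have "dd a b c (\<lambda>x. K (x - y)) = dd (- c) (- b) (- a) (\<lambda>x. K (x - (- y)))"
    proof -
      have "K (x - y) = K (- x + y)" for x using K_even[of "x - y"] by simp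
      thus ?thesis using dd_reflect[of a b c "\<lambda>x. K (x - (- y))" 0] by simp
    qed
    thus ?thesis using right[of "-c" "-b" "-a" "-y"] ab d False y by auto
  qed
qed

text \<open>The second derivative of the kernel behaves like t powr (- 1 - \<alpha>), whose integral
  over all t \<ge> \<rho> is a multiple of \<rho> powr (- \<alpha>). The length of the interval
  therefore does not enter.\<close>

lemma far_integral_bound:
  fixes E :: "real \<Rightarrow> real"
  assumes ab: "a < b" "b < c" and pq: "p \<le> q" and far: "c + \<rho> \<le> p \<or> q \<le> a - \<rho>" and \<rho>: "0 < \<rho>"
    and E: "continuous_on {p..q} E" "\<And>y. y \<in> {p..q} \<Longrightarrow> \<bar>E y\<bar> \<le> M" and M: "0 \<le> M"
  shows "\<bar>dd a b c (\<lambda>x. integral {p..q} (\<lambda>y. K (x - y) * E y))\<bar> \<le> M * (\<kappa> * (\<alpha> - 1) * \<rho> powr (- \<alpha>)) * (c - a) / 2"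
proof -
  let ?D = "\<lambda>y. if c + \<rho> \<le> p then y - c else a - y"
  let ?B = "\<lambda>y. M * (\<kappa> * (\<alpha> - 1) * \<alpha> * (c - a) / 2) * ?D y powr (- 1 - \<alpha>)"
  have Dpos: "\<rho> \<le> ?D y" if "y \<in> {p..q}" for y using that far by auto
  define I where "I = (if c + \<rho> \<le> p then ((p - c) powr (- \<alpha>) - (q - c) powr (- \<alpha>)) / \<alpha>
      else ((a - q) powr (- \<alpha>) - (a - p) powr (- \<alpha>)) / \<alpha>)"
  have int: "((\<lambda>y. ?D y powr (- 1 - \<alpha>)) has_integral I) {p..q}"
  proof (cases "c + \<rho> \<le> p")
    case True
    let ?G = "\<lambda>y. - ((y - c) powr (- \<alpha>)) / \<alpha>"
    have "((\<lambda>y. (y - c) powr (- 1 - \<alpha>)) has_integral (?G q - ?G p)) {p..q}"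
    proof (rule fundamental_theorem_of_calculus[OF pq])
      fix y assume y: "y \<in> {p..q}"
      have "- \<alpha> - 1 = - 1 - \<alpha>" by simp
      hence e: "z powr (- \<alpha> - 1) = z powr (- 1 - \<alpha>)" for z :: real by (simp only:)
      have "(?G has_real_derivative (y - c) powr (- 1 - \<alpha>)) (at y)"
        using y True \<rho> \<alpha>1 by (auto intro!: derivative_eq_intros simp: e)
      thus "(?G has_vector_derivative (y - c) powr (- 1 - \<alpha>)) (at y within {p..q})"
        unfolding has_real_derivative_iff_has_vector_derivative[symmetric] by (rule DERIV_subset) auto
    qed
    thus ?thesis using True by (simp add: I_def diff_divide_distrib)
  next
    case False
    let ?G = "\<lambda>y. (a - y) powr (- \<alpha>) / \<alpha>"
    have "((\<lambda>y. (a - y) powr (- 1 - \<alpha>)) has_integral (?G q - ?G p)) {p..q}"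
    proof (rule fundamental_theorem_of_calculus[OF pq])
      fix y assume y: "y \<in> {p..q}"
      have "- \<alpha> - 1 = - 1 - \<alpha>" by simp
      hence e: "z powr (- \<alpha> - 1) = z powr (- 1 - \<alpha>)" for z :: real by (simp only:)
      have "(?G has_real_derivative (a - y) powr (- 1 - \<alpha>)) (at y)"
        using y False far \<rho> \<alpha>1 by (auto intro!: derivative_eq_intros simp: e)
      thus "(?G has_vector_derivative (a - y) powr (- 1 - \<alpha>)) (at y within {p..q})"
        unfolding has_real_derivative_iff_has_vector_derivative[symmetric] by (rule DERIV_subset) auto
    qed
    thus ?thesis using False by (simp add: I_def diff_divide_distrib)
  qed
  have I: "I \<le> \<rho> powr (- \<alpha>) / \<alpha>"
  proof -
    have "z powr (- \<alpha>) - w powr (- \<alpha>) \<le> \<rho> powr (- \<alpha>)" if "\<rho> \<le> z" for z w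
      using powr_mono2'[of "- \<alpha>" \<rho> z] that \<rho> \<alpha>1 by (smt (verit) powr_ge_zero)
    thus ?thesis using far \<alpha>1 unfolding I_def by (auto intro!: divide_right_mono)
  qed
  have k: "(\<lambda>y. K (x - y) * E y) integrable_on {p..q}" for x by (rule K_mult_integrable[OF E(1)])
  have "norm (integral {p..q} (\<lambda>y. dd a b c (\<lambda>x. K (x - y) * E y))) \<le> integral {p..q} ?B"
  proof (rule Henstock_Kurzweil_Integration.integral_norm_bound_integral)
    show "(\<lambda>y. dd a b c (\<lambda>x. K (x - y) * E y)) integrable_on {p..q}" by (rule dd_integral) (rule k)
    show "?B integrable_on {p..q}" using int by (intro integrable_on_mult_right) blast
    fix y assume y: "y \<in> {p..q}"
    have "dd a b c (\<lambda>x. K (x - y) * E y) = E y * dd a b c (\<lambda>x. K (x - y))"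
      using dd_cmult[of a b c "E y" "\<lambda>x. K (x - y)"] by (simp add: mult.commute)
    hence "\<bar>dd a b c (\<lambda>x. K (x - y) * E y)\<bar> = \<bar>E y\<bar> * \<bar>dd a b c (\<lambda>x. K (x - y))\<bar>" by (simp add: abs_mult)
    also have "\<dots> \<le> M * (\<kappa> * (\<alpha> - 1) * \<alpha> * ?D y powr (- 1 - \<alpha>) * (c - a) / 2)"
      by (intro mult_mono E(2)[OF y] ddx_kernel_bound M) (use ab y far \<rho> in auto)
    also have "\<dots> = ?B y" by (simp add: mult_ac)
    finally show "norm (dd a b c (\<lambda>x. K (x - y) * E y)) \<le> ?B y" by simp
  qed
  also have "integral {p..q} ?B = M * (\<kappa> * (\<alpha> - 1) * \<alpha> * (c - a) / 2) * I"
    using int by (intro integral_unique has_integral_mult_right)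
  also have "\<dots> \<le> M * (\<kappa> * (\<alpha> - 1) * \<alpha> * (c - a) / 2) * (\<rho> powr (- \<alpha>) / \<alpha>)"
    using I M \<kappa>0 \<alpha>1 ab by (intro mult_left_mono) auto
  also have "\<dots> = M * (\<kappa> * (\<alpha> - 1) * \<rho> powr (- \<alpha>)) * (c - a) / 2" using \<alpha>1 by simp
  finally have "\<bar>integral {p..q} (\<lambda>y. dd a b c (\<lambda>x. K (x - y) * E y))\<bar> \<le> M * (\<kappa> * (\<alpha> - 1) * \<rho> powr (- \<alpha>)) * (c - a) / 2" by simp
  moreover have "dd a b c (\<lambda>x. integral {p..q} (\<lambda>y. K (x - y) * E y)) = integral {p..q} (\<lambda>y. dd a b c (\<lambda>x. K (x - y) * E y))"
    by (rule dd_integral) (rule k)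
  ultimately show ?thesis by simp
qed

text \<open>Only the integrability of the kernel is used, so its singularity may lie in the
  interval.\<close>

lemma near_integral_bound:
  assumes pq: "p \<le> x" "x \<le> q" and E: "continuous_on {p..q} E" "\<And>y. y \<in> {p..q} \<Longrightarrow> \<bar>E y\<bar> \<le> M" and M: "0 \<le> M"
  shows "\<bar>integral {p..q} (\<lambda>y. K (x - y) * E y)\<bar> \<le> 2 * M * K1 (q - p)"
proof -
  have "p \<le> q" using pq by simp
  have int: "((\<lambda>y. M * K (x - y)) has_integral (M * (K1 (x - p) - K1 (x - q)))) {p..q}"
    by (intro has_integral_mult_right K_integral) fact
  have "norm (integral {p..q} (\<lambda>y. K (x - y) * E y)) \<le> integral {p..q} (\<lambda>y. M * K (x - y))"
  proof (rule Henstock_Kurzweil_Integration.integral_norm_bound_integral)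
    show "norm (K (x - y) * E y) \<le> M * K (x - y)" if "y \<in> {p..q}" for y
      using mult_left_mono[OF E(2)[OF that] K_nonneg[of "x - y"]] K_nonneg[of "x - y"] by (simp add: abs_mult mult.commute)
  qed (use int K_mult_integrable[OF E(1)] in auto)
  also have "\<dots> = M * (K1 (x - p) + K1 (q - x))" using integral_unique[OF int] K1_odd[of "q - x"] by simp
  also have "\<dots> \<le> M * (K1 (q - p) + K1 (q - p))"
    using pq M \<kappa>0 \<alpha>2 by (intro mult_left_mono add_mono) (auto simp: K1_pos intro!: mult_left_mono divide_right_mono powr_mono2)
  finally show ?thesis by simp
qed

lemma mesh_le_power: assumes "1 \<le> i" "i \<le> N" shows "X N i \<le> real i powr r * X N 1"
  using assms by (simp add: mesh_left)

lemma step_ge_first: assumes "1 \<le> N" "1 \<le> i" "i \<le> 2 * N" shows "X N 1 \<le> H N i"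
proof -
  have 1: "H N 1 = X N 1" by (simp add: step_eq' mesh_0)
  show ?thesis
  proof (cases "i \<le> N")
    case True
    thus ?thesis using step_mono_le[of 1 i N] assms 1 by simp
  next
    case False
    thus ?thesis using step_mono_le[of 1 "2 * N + 1 - i" N] step_reflect[of N i] assms 1 by simp
  qed
qed

end

context frac_data
begin

definition P :: "nat \<Rightarrow> real \<Rightarrow> real" where
  "P N x = integral {0..2 * T} (\<lambda>y. K (x - y) * E N y)"

lemma P_eq: assumes N: "1 \<le> N" shows "frac_int \<alpha> T (uh N) x - frac_int \<alpha> T u x = P N x"
  unfolding P_def E_def using N
  by (simp add: frac_int_eq_integral fe_fun_cont u_cont right_diff_distrib integral_diff K_mult_integrable)

definition CS :: real where
  "CS = CE * (16 * (8 powr r)\<^sup>2 * (\<kappa> / (2 - \<alpha>)) * (2 * 2 powr r) powr (2 - \<alpha>) + \<kappa> * (\<alpha> - 1))"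

lemma P_split:
  assumes N: "1 \<le> N" and m: "0 \<le> m" "m \<le> 2 * T"
  shows "P N x = integral {0..m} (\<lambda>y. K (x - y) * E N y) + integral {m..2 * T} (\<lambda>y. K (x - y) * E N y)"
  unfolding P_def
  by (rule Henstock_Kurzweil_Integration.integral_combine[symmetric]) (use m K_mult_integrable[OF E_cont[OF N]] in auto)

lemma CE_nonneg: "0 \<le> CE" using T0 by (simp add: CE_def)

lemma small_index:
  assumes N: "2 \<le> N" and i: "1 \<le> i" "i \<le> 8" "i \<le> N"
  shows "\<bar>2 / span N i * ddx N i (P N)\<bar> \<le> CS * C0 * eps N * X N i powr (- \<alpha>)"
proof -
  have N1: "1 \<le> N" using N by simp
  let ?M = "CE * C0 * eps N"
  have M: "0 \<le> ?M" using CE_nonneg C0_nonneg eps_nonneg by simp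
  have sp: "0 < span N i" by (rule span_pos) (use N i in auto)
  have xs: "0 \<le> X N (i - 1)" "X N (i - 1) < X N i" "X N i < X N (i + 1)" "0 < X N i" "0 < X N 1"
    using N i by (auto intro!: mesh_nonneg mesh_less mesh_pos)
  have rat: "X N (i + 1) \<le> 2 powr r * X N i" by (rule mesh_ratio) (use N i in auto)
  have up: "X N (i + 1) \<le> 2 * T" by (rule mesh_upper) (use N i in auto)
  \<comment> \<open>Beyond 2 \<open>X N (i + 1)\<close> every point is at least
    \<open>X N (i + 1)\<close> away from the three nodes; the minimum covers meshes so coarse that
    no such point is left.\<close>
  define m where "m = min (2 * T) (2 * X N (i + 1))"
  have m: "0 \<le> m" "m \<le> 2 * T" "X N (i + 1) \<le> m" "m \<le> 2 * X N (i + 1)" using up xs T0 by (auto simp: m_def)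
  let ?A = "\<lambda>x. integral {0..m} (\<lambda>y. K (x - y) * E N y)" and ?B = "\<lambda>x. integral {m..2 * T} (\<lambda>y. K (x - y) * E N y)"
  have cE: "continuous_on {0..m} (E N)" "continuous_on {m..2 * T} (E N)"
    using m by (auto intro!: continuous_on_subset[OF E_cont[OF N1]])
  have bE: "\<bar>E N y\<bar> \<le> ?M" if "y \<in> {0..2 * T}" for y using E_bound[OF N1 that] .
  have split: "ddx N i (P N) = ddx N i ?A + ddx N i ?B"
    unfolding P_split[OF N1 m(1,2), abs_def] by (simp add: ddx_def dd_add)
  have B: "\<bar>2 / span N i * ddx N i ?B\<bar> \<le> ?M * (\<kappa> * (\<alpha> - 1)) * X N i powr (- \<alpha>)"
  proof (cases "m = 2 * T")
    case True
    hence "?B = (\<lambda>_. 0)" using integral_refl[of "2 * T"] by simp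
    hence "ddx N i ?B = 0" by (simp add: ddx_def dd_def)
    thus ?thesis using M \<kappa>0 \<alpha>1 by simp
  next
    case False
    hence m2: "m = 2 * X N (i + 1)" by (auto simp: m_def min_def split: if_splits)
    have "\<bar>ddx N i ?B\<bar> \<le> ?M * (\<kappa> * (\<alpha> - 1) * X N (i + 1) powr (- \<alpha>)) * (X N (i + 1) - X N (i - 1)) / 2"
      unfolding ddx_def by (rule far_integral_bound) (use xs m m2 cE bE M in auto)
    also have "\<dots> \<le> ?M * (\<kappa> * (\<alpha> - 1) * X N i powr (- \<alpha>)) * span N i / 2"
      unfolding span_def using M xs \<kappa>0 \<alpha>1
      by (intro divide_right_mono mult_right_mono mult_left_mono powr_mono2') auto
    finally show ?thesis using sp by (simp add: abs_mult field_simps)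
  qed
  have Ab: "\<bar>?A x\<bar> \<le> 2 * ?M * K1 (2 * X N (i + 1))" if "0 \<le> x" "x \<le> X N (i + 1)" for x
  proof -
    have "\<bar>?A x\<bar> \<le> 2 * ?M * K1 (m - 0)" by (rule near_integral_bound) (use that m cE bE M in auto)
    also have "\<dots> \<le> 2 * ?M * K1 (2 * X N (i + 1))" using m M \<kappa>0 \<alpha>2
      by (intro mult_left_mono) (auto simp: K1_pos intro!: mult_left_mono divide_right_mono powr_mono2)
    finally show ?thesis .
  qed
  have "\<bar>ddx N i ?A\<bar> \<le> 4 * (2 * ?M * K1 (2 * X N (i + 1))) / X N 1"
    unfolding ddx_def
  proof (rule dd_abs_le)
    show "X N 1 \<le> X N i - X N (i - 1)" using step_ge_first[of N i] N i by (simp add: step_eq')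
    show "X N 1 \<le> X N (i + 1) - X N i" using step_ge_first[of N "i + 1"] N i by (simp add: step_eq')
  qed (rule xs(5) Ab; use xs in linarith)+
  moreover have "K1 (2 * X N (i + 1)) \<le> \<kappa> / (2 - \<alpha>) * ((2 * 2 powr r) powr (2 - \<alpha>) * X N i powr (2 - \<alpha>))"
  proof -
    have "K1 (2 * X N (i + 1)) \<le> K1 (2 * 2 powr r * X N i)"
      using rat xs \<kappa>0 \<alpha>2 by (auto simp: K1_pos intro!: mult_left_mono divide_right_mono powr_mono2)
    thus ?thesis using xs by (simp add: K1_pos powr_mult)
  qed
  ultimately have A1: "\<bar>ddx N i ?A\<bar> \<le> 4 * (2 * ?M * (\<kappa> / (2 - \<alpha>) * ((2 * 2 powr r) powr (2 - \<alpha>) * X N i powr (2 - \<alpha>)))) / X N 1"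
    using M xs by (smt (verit, best) divide_right_mono mult_left_mono)
  let ?k = "\<kappa> / (2 - \<alpha>) * (2 * 2 powr r) powr (2 - \<alpha>)"
  have k0: "0 \<le> ?k" using \<kappa>0 \<alpha>2 by simp
  have sp1: "X N 1 \<le> span N i" using step_ge_first[of N i] N i xs by (simp add: span_def step_eq')
  have x1: "X N i / 8 powr r \<le> X N 1"
  proof -
    have "X N i \<le> real i powr r * X N 1" by (rule mesh_le_power) (use i in auto)
    also have "\<dots> \<le> 8 powr r * X N 1" using i xs r1 by (intro mult_right_mono powr_mono2) auto
    finally show ?thesis by (simp add: field_simps)
  qed
  have "\<bar>2 / span N i * ddx N i ?A\<bar> = 2 / span N i * \<bar>ddx N i ?A\<bar>" using sp by (simp add: abs_mult)
  also have "\<dots> \<le> 2 / X N 1 * (8 * ?M * ?k * X N i powr (2 - \<alpha>) / X N 1)"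
    using A1 sp1 sp xs by (intro mult_mono divide_left_mono) (auto simp: mult_ac)
  also have "\<dots> = 16 * ?M * ?k * X N i powr (2 - \<alpha>) / (X N 1)\<^sup>2" by (simp add: power2_eq_square mult_ac)
  also have "\<dots> \<le> 16 * ?M * ?k * X N i powr (2 - \<alpha>) / (X N i / 8 powr r)\<^sup>2"
  proof (intro divide_left_mono power_mono mult_pos_pos x1)
    show "0 \<le> 16 * ?M * ?k * X N i powr (2 - \<alpha>)"
      by (rule mult_nonneg_nonneg[OF mult_nonneg_nonneg[OF _ k0]]) (use M in simp_all)
  qed (use xs in auto)
  also have "\<dots> = 16 * (8 powr r)\<^sup>2 * ?M * ?k * (X N i powr (2 - \<alpha>) / (X N i)\<^sup>2)"
    by (simp add: power_divide)
  also have "X N i powr (2 - \<alpha>) / (X N i)\<^sup>2 = X N i powr (- \<alpha>)"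
    using powr_add[of "X N i" 2 "- \<alpha>"] xs by (simp add: powr_numeral)
  finally have A: "\<bar>2 / span N i * ddx N i ?A\<bar> \<le> 16 * (8 powr r)\<^sup>2 * ?M * ?k * X N i powr (- \<alpha>)" .
  have "\<bar>2 / span N i * ddx N i (P N)\<bar> \<le> \<bar>2 / span N i * ddx N i ?A\<bar> + \<bar>2 / span N i * ddx N i ?B\<bar>"
    unfolding split distrib_left by (rule abs_triangle_ineq)
  also have "\<dots> \<le> 16 * (8 powr r)\<^sup>2 * ?M * ?k * X N i powr (- \<alpha>) + ?M * (\<kappa> * (\<alpha> - 1)) * X N i powr (- \<alpha>)"
    by (rule add_mono[OF A B])
  also have "\<dots> = CS * C0 * eps N * X N i powr (- \<alpha>)" by (simp add: CS_def algebra_simps)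
  finally show ?thesis .
qed

text \<open>The interval \<open>[0, b]\<close> reaches the boundary, where \<open>f\<close> need not be integrable;
  \<open>F\<close> is compared with a multiple of \<open>t powr (2 - \<alpha>)\<close>.\<close>

lemma boundary_taylor:
  fixes F F' g :: "real \<Rightarrow> real"
  assumes b: "0 < b" and cont: "continuous_on {0..b} F"
    and dF: "\<And>x. 0 < x \<Longrightarrow> x \<le> b \<Longrightarrow> (F has_real_derivative F' x) (at x)"
    and dF': "\<And>x. 0 < x \<Longrightarrow> x \<le> b \<Longrightarrow> (F' has_real_derivative g x) (at x)"
    and bd: "\<And>x. 0 < x \<Longrightarrow> x \<le> b \<Longrightarrow> \<bar>g x\<bar> \<le> M * x powr (- \<alpha>)"
  shows "\<bar>F 0 - F b + F' b * b\<bar> \<le> M * b powr (2 - \<alpha>) / (2 - \<alpha>)"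
proof -
  \<comment> \<open>Chosen so that its second derivative is t powr (- \<alpha>); it is continuous at
    0 because \<alpha> < 2, although its first derivative is unbounded there.\<close>
  define G where "G = (\<lambda>t. - (1 / ((2 - \<alpha>) * (\<alpha> - 1))) * t powr (2 - \<alpha>))"
  define G' where "G' = (\<lambda>t. - (1 / (\<alpha> - 1)) * t powr (1 - \<alpha>))"
  have dG: "(G has_real_derivative G' x) (at x)" if "0 < x" for x
  proof -
    have "(G has_real_derivative - (1 / ((2 - \<alpha>) * (\<alpha> - 1))) * ((2 - \<alpha>) * x powr (2 - \<alpha> - 1))) (at x)"
      unfolding G_def by (intro DERIV_cmult has_real_derivative_powr that)
    thus ?thesis using \<alpha>2 by (simp add: G'_def)
  qed
  have dG': "(G' has_real_derivative x powr (- \<alpha>)) (at x)" if "0 < x" for x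
  proof -
    have "(G' has_real_derivative - (1 / (\<alpha> - 1)) * ((1 - \<alpha>) * x powr (1 - \<alpha> - 1))) (at x)"
      unfolding G'_def by (intro DERIV_cmult has_real_derivative_powr that)
    moreover have "- (1 / (\<alpha> - 1)) * ((1 - \<alpha>) * w) = w" for w using \<alpha>1 by (simp add: field_simps)
    moreover have "1 - \<alpha> - 1 = - \<alpha>" by simp
    ultimately show ?thesis by (simp only:)
  qed
  have cG: "continuous_on {0..b} G"
    unfolding G_def using \<alpha>2 by (intro continuous_on_mult_left continuous_on_powr' continuous_intros) auto
  \<comment> \<open>For either sign s the function s F + M G is convex on the half-open interval and
    continuous at 0, so at 0 it lies above its tangent at b.\<close>
  have main: "0 \<le> s * (F 0 - F b + F' b * b) + M * (G 0 - G b + G' b * b)" if s: "s = 1 \<or> s = -1" for s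
  proof -
    define \<phi> where "\<phi> = (\<lambda>t. s * (F t - F b - F' b * (t - b)) + M * (G t - G b - G' b * (t - b)))"
    define \<phi>' where "\<phi>' = (\<lambda>t. s * (F' t - F' b) + M * (G' t - G' b))"
    have d: "(\<phi> has_real_derivative \<phi>' x) (at x)" if "0 < x" "x \<le> b" for x
      unfolding \<phi>_def \<phi>'_def using dF[OF that] dG[OF that(1)]
      by (auto intro!: derivative_eq_intros)
    have d': "(\<phi>' has_real_derivative s * g x + M * x powr (- \<alpha>)) (at x)" if "0 < x" "x \<le> b" for x
      unfolding \<phi>'_def using dF'[OF that] dG'[OF that(1)]
      by (auto intro!: derivative_eq_intros)
    have neg: "\<phi>' x \<le> 0" if "0 < x" "x < b" for x
    proof -
      have "\<phi>' x \<le> \<phi>' b"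
      proof (rule DERIV_nonneg_imp_nondecreasing[of x b \<phi>'])
        fix z assume z: "x \<le> z" "z \<le> b"
        have "0 \<le> s * g z + M * z powr (- \<alpha>)" using bd[of z] z that s by (auto simp: abs_le_iff)
        thus "\<exists>y. (\<phi>' has_real_derivative y) (at z) \<and> 0 \<le> y" using d'[of z] z that by auto
      qed (use that in auto)
      thus ?thesis by (simp add: \<phi>'_def)
    qed
    have "\<phi> b \<le> \<phi> 0"
    proof (rule DERIV_nonpos_imp_decreasing_open[of 0 b \<phi>])
      show "continuous_on {0..b} \<phi>" unfolding \<phi>_def by (intro continuous_intros cont cG)
      show "\<exists>y. (\<phi> has_real_derivative y) (at x) \<and> y \<le> 0" if "0 < x" "x < b" for x
        using d[of x] neg[OF that] that by auto
    qed (use b in auto)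
    thus ?thesis by (simp add: \<phi>_def algebra_simps)
  qed
  have "G 0 - G b + G' b * b = b powr (2 - \<alpha>) / (2 - \<alpha>)"
  proof -
    have "b powr (2 - \<alpha>) = b powr (1 - \<alpha>) * b" using powr_add[of b "1 - \<alpha>" 1] b by simp
    moreover have "1 / ((2 - \<alpha>) * (\<alpha> - 1)) - 1 / (\<alpha> - 1) = 1 / (2 - \<alpha>)"
    proof -
      have "1 / (p * q) - 1 / q = 1 / p" if "p + q = 1" "p \<noteq> 0" "q \<noteq> 0" for p q :: real
      proof -
        have "1 / (p * q) - 1 / q = (1 - p) / (p * q)" using that by (simp add: diff_divide_distrib)
        moreover have "1 - p = q" using that by simp
        ultimately show ?thesis using that by simp
      qed
      thus ?thesis using \<alpha>1 \<alpha>2 by simp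
    qed
    hence "(1 / ((2 - \<alpha>) * (\<alpha> - 1)) - 1 / (\<alpha> - 1)) * w = w / (2 - \<alpha>)" for w by simp
    ultimately show ?thesis by (simp add: G_def G'_def algebra_simps)
  qed
  thus ?thesis using main[of 1] main[of "-1"] by (simp add: abs_le_iff)
qed

section \<open>The difference quotient of the exact fractional integral\<close>

abbreviation "F \<equiv> frac_int \<alpha> T u"

text \<open>The equation gives regularity of F only inside the domain. At the boundary, u is
  bounded, and the difference of the kernels centred at 0 and at x is integrated in closed form by
  \<open>K1\<close>; the result is continuous in x and vanishes at 0.\<close>

lemma F_cont_0: "(F \<longlongrightarrow> F 0) (at_right 0)"
proof -
  define M where "M = C0 * T powr \<sigma>"
  have uM: "\<bar>u y\<bar> \<le> M" if "y \<in> {0..2 * T}" for y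
  proof -
    have "bdist T y powr \<sigma> \<le> T powr \<sigma>" using bdist_nonneg[OF that] that \<sigma>0 by (intro powr_mono2) (auto simp: bdist_def)
    thus ?thesis using u_bound[OF that] C0_nonneg by (auto simp: M_def intro: order_trans[OF _ mult_left_mono])
  qed
  define I where "I = (\<lambda>x. (K1 (0 - 0) - K1 (0 - x / 2)) - (K1 (x - 0) - K1 (x - x / 2))
     + ((K1 (x - x / 2) - K1 (x - 2 * T)) - (K1 (0 - x / 2) - K1 (0 - 2 * T))))"
  have bound: "\<bar>F x - F 0\<bar> \<le> M * I x" if x: "0 < x" "x < T" for x
  proof -
    \<comment> \<open>At x / 2 the two kernels agree, and the sign of their difference changes
      there.\<close>
    let ?g = "\<lambda>y. if y \<le> x / 2 then K (0 - y) - K (x - y) else K (x - y) - K (0 - y)"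
    have i1: "((\<lambda>y. K (0 - y) - K (x - y)) has_integral ((K1 (0 - 0) - K1 (0 - x / 2)) - (K1 (x - 0) - K1 (x - x / 2)))) {0..x / 2}"
      by (intro has_integral_diff K_integral) (use x in auto)
    have i2: "((\<lambda>y. K (x - y) - K (0 - y)) has_integral ((K1 (x - x / 2) - K1 (x - 2 * T)) - (K1 (0 - x / 2) - K1 (0 - 2 * T)))) {x / 2..2 * T}"
      by (intro has_integral_diff K_integral) (use x in auto)
    have i1': "(?g has_integral ((K1 (0 - 0) - K1 (0 - x / 2)) - (K1 (x - 0) - K1 (x - x / 2)))) {0..x / 2}"
      by (rule has_integral_eq[OF _ i1]) auto
    have i2': "(?g has_integral ((K1 (x - x / 2) - K1 (x - 2 * T)) - (K1 (0 - x / 2) - K1 (0 - 2 * T)))) {x / 2..2 * T}"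
      by (rule has_integral_spike_finite[OF _ _ i2, of "{x / 2}"]) auto
    have g: "(?g has_integral I x) {0..2 * T}"
      unfolding I_def by (rule has_integral_combine[OF _ _ i1' i2']) (use x in auto)
    \<comment> \<open>The points 0 and x are left out because the kernel has the value 0 at its
      singularity, which would make \<open>?g\<close> negative there.\<close>
    have le: "\<bar>K (x - y) - K (0 - y)\<bar> \<le> ?g y" if y: "y \<in> {0..2 * T} - {0, x}" for y
    proof (cases "y \<le> x / 2")
      case True
      have "K (x - y) \<le> K y" using y True x by (intro K_antimono) auto
      thus ?thesis using True K_even[of y] by simp
    next
      case False
      have "K y \<le> K \<bar>x - y\<bar>" using y False x by (intro K_antimono) auto
      thus ?thesis using False K_even[of y] by (simp add: K_eq)
    qed
    have "F x - F 0 = integral {0..2 * T} (\<lambda>y. (K (x - y) - K (0 - y)) * u y)"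
      by (simp add: frac_int_eq_integral u_cont left_diff_distrib integral_diff[OF K_mult_integrable[OF u_cont] K_mult_integrable[OF u_cont, of 0, simplified]])
    also have "\<dots> = integral {0..2 * T} (\<lambda>y. if y \<in> {0, x} then 0 else (K (x - y) - K (0 - y)) * u y)"
      by (rule integral_spike[of "{0, x}"]) auto
    finally have 1: "F x - F 0 = integral {0..2 * T} (\<lambda>y. if y \<in> {0, x} then 0 else (K (x - y) - K (0 - y)) * u y)" .
    have 2: "norm (integral {0..2 * T} (\<lambda>y. if y \<in> {0, x} then 0 else (K (x - y) - K (0 - y)) * u y)) \<le> integral {0..2 * T} (\<lambda>y. M * (if y \<in> {0, x} then 0 else ?g y))"
    proof (rule Henstock_Kurzweil_Integration.integral_norm_bound_integral)
      have "(\<lambda>y. K (x - y) * u y - K (0 - y) * u y) integrable_on {0..2 * T}"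
        by (intro integrable_diff K_mult_integrable u_cont)
      hence "(\<lambda>y. (K (x - y) - K (0 - y)) * u y) integrable_on {0..2 * T}" by (simp add: left_diff_distrib)
      thus "(\<lambda>y. if y \<in> {0, x} then 0 else (K (x - y) - K (0 - y)) * u y) integrable_on {0..2 * T}"
        by (rule integrable_spike[where S="{0, x}"]) auto
      have "?g integrable_on {0..2 * T}" using g by blast
      hence "(\<lambda>y. if y \<in> {0, x} then 0 else ?g y) integrable_on {0..2 * T}"
        by (rule integrable_spike[where S="{0, x}"]) auto
      thus "(\<lambda>y. M * (if y \<in> {0, x} then 0 else ?g y)) integrable_on {0..2 * T}"
        by (rule integrable_on_mult_right)
      fix y assume y: "y \<in> {0..2 * T}"
      show "norm (if y \<in> {0, x} then 0 else (K (x - y) - K (0 - y)) * u y) \<le> M * (if y \<in> {0, x} then 0 else ?g y)"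
      proof (cases "y \<in> {0, x}")
        case False
        have "\<bar>K (x - y) - K (0 - y)\<bar> * \<bar>u y\<bar> \<le> ?g y * M"
          using le[of y] uM[OF y] False y by (intro mult_mono) (auto intro: order_trans[OF abs_ge_zero])
        thus ?thesis using False by (simp only: if_False real_norm_def abs_mult mult.commute[of M])
      next
        case True
        thus ?thesis by (simp only: if_True) simp
      qed
    qed
    have "integral {0..2 * T} (\<lambda>y. M * (if y \<in> {0, x} then 0 else ?g y)) = M * integral {0..2 * T} (\<lambda>y. if y \<in> {0, x} then 0 else ?g y)"
      by (rule Henstock_Kurzweil_Integration.integral_mult_right)
    also have "integral {0..2 * T} (\<lambda>y. if y \<in> {0, x} then 0 else ?g y) = integral {0..2 * T} ?g"
      by (rule integral_spike[of "{0, x}"]) auto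
    also have "\<dots> = I x" using g by (rule integral_unique)
    finally have 3: "integral {0..2 * T} (\<lambda>y. M * (if y \<in> {0, x} then 0 else ?g y)) = M * I x" .
    show ?thesis using 2 unfolding 1[symmetric] 3 by (simp only: real_norm_def)
  qed
  have cI: "continuous_on UNIV I"
    unfolding I_def
    by (intro continuous_intros continuous_on_compose2[OF K1_cont[of UNIV]]) auto
  have "I 0 = 0" using K1_odd[of "2 * T"] by (simp add: I_def K1_0)
  moreover have "(I \<longlongrightarrow> I 0) (at_right 0)"
    using cI unfolding continuous_on_def by (auto intro: tendsto_within_subset)
  ultimately have "((\<lambda>x. M * I x) \<longlongrightarrow> M * 0) (at_right 0)" by (intro tendsto_intros) simp
  hence lim: "((\<lambda>x. M * I x) \<longlongrightarrow> 0) (at_right 0)" by simp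
  have "((\<lambda>x. F x - F 0) \<longlongrightarrow> 0) (at_right 0)"
  proof (rule Lim_null_comparison[OF _ lim])
    show "\<forall>\<^sub>F x in at_right 0. norm (F x - F 0) \<le> M * I x"
      unfolding eventually_at_right_field using bound T0 by auto
  qed
  thus ?thesis by (simp add: LIM_zero_iff)
qed

lemma F_cont: assumes "b < 2 * T" shows "continuous_on {0..b} F"
proof -
  have "(F \<longlongrightarrow> F x) (at x within {0..b})" if x: "x \<in> {0..b}" for x
  proof (cases "x = 0")
    case True
    have "at (0::real) within {0..b} \<le> at_right 0"
      unfolding at_within_def by (intro inf_mono) auto
    thus ?thesis using F_cont_0 True by (auto intro: tendsto_mono)
  next
    case False
    hence "x \<in> Omega T" using x assms by (auto simp: Omega_def)
    hence "isCont F x" using dF DERIV_isCont by blast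
    thus ?thesis unfolding isCont_def by (rule tendsto_within_subset) simp
  qed
  thus ?thesis by (simp add: continuous_on_def)
qed

definition CQ :: real where
  "CQ = (Cw + Cw\<^sup>2 * 2 powr (4 * r)) * T powr \<sigma> + (2 + 2 / (2 - \<alpha>)) * T powr \<sigma>"

lemma CQ_ge: "(Cw + Cw\<^sup>2 * 2 powr (4 * r)) * T powr \<sigma> \<le> CQ" "(2 + 2 / (2 - \<alpha>)) * T powr \<sigma> \<le> CQ"
  using \<alpha>2 Cw_ge(1) by (auto simp: CQ_def)

text \<open>At the first node X_1 powr \<sigma> is already of the order of \<open>eps N\<close>, so
  no cancellation with f is required: the three terms are bounded separately by multiples of b powr
  (\<sigma> - \<alpha>). Towards the boundary \<open>boundary_taylor\<close> replaces Taylor's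
  formula.\<close>

lemma quad_first:
  assumes N: "2 \<le> N"
  shows "\<bar>2 / span N 1 * ddx N 1 F + f (X N 1)\<bar> \<le> CQ * C0 * eps N * X N 1 powr (- \<alpha>)"
proof -
  define b c where "b = X N 1" and "c = X N 2"
  have bc: "0 < b" "b < c" "c \<le> T" "b < T" unfolding b_def c_def using N mesh_le_mid[of N 2] mesh_less[of N 1 2]
    by (auto intro!: mesh_pos)
  have F0: "ddx N 1 F = (F c - F b) / (c - b) - (F b - F 0) / b"
    by (simp add: ddx_def dd_def b_def c_def mesh_0 numeral_2_eq_2)
  have sp: "span N 1 = c" by (simp add: span_def mesh_0 c_def numeral_2_eq_2)
  have fb: "\<bar>f t\<bar> \<le> C0 * t powr (\<sigma> - \<alpha>)" if "0 < t" "t \<le> T" for t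
  proof -
    have "bdist T t = t" "t \<in> Omega T" using that T0 by (auto simp: bdist_def Omega_def)
    thus ?thesis using bf[of t] by simp
  qed
  have "\<bar>F 0 - F b + F1 b * b\<bar> \<le> (C0 * b powr \<sigma>) * b powr (2 - \<alpha>) / (2 - \<alpha>)"
  proof (rule boundary_taylor[where g="\<lambda>x. - f x"])
    show "continuous_on {0..b} F" by (rule F_cont) (use bc T0 in auto)
    fix x assume x: "0 < x" "x \<le> b"
    hence "x \<in> Omega T" using bc by (auto simp: Omega_def)
    thus "(F has_real_derivative F1 x) (at x)" "(F1 has_real_derivative - f x) (at x)" using dF dF1 by auto
    have "x powr (\<sigma> - \<alpha>) = x powr \<sigma> * x powr (- \<alpha>)" using powr_add[of x \<sigma> "- \<alpha>"] by simp
    also have "\<dots> \<le> b powr \<sigma> * x powr (- \<alpha>)" using x \<sigma>0 by (intro mult_right_mono powr_mono2) auto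
    finally have "C0 * x powr (\<sigma> - \<alpha>) \<le> C0 * (b powr \<sigma> * x powr (- \<alpha>))" using C0_nonneg by (rule mult_left_mono)
    thus "\<bar>- f x\<bar> \<le> C0 * b powr \<sigma> * x powr (- \<alpha>)" using fb[of x] x bc by (simp add: mult.assoc)
  qed (use bc in auto)
  define A where "A = F 0 - F b + F1 b * b"
  have A: "\<bar>A\<bar> \<le> C0 * (b powr (\<sigma> - \<alpha>) * b\<^sup>2) / (2 - \<alpha>)"
  proof -
    have "b powr \<sigma> * b powr (2 - \<alpha>) = b powr (\<sigma> - \<alpha>) * b\<^sup>2"
      using powr_add[of b \<sigma> "2 - \<alpha>"] powr_add[of b "\<sigma> - \<alpha>" 2] bc by (simp add: powr_numeral algebra_simps)
    thus ?thesis using \<open>\<bar>F 0 - F b + F1 b * b\<bar> \<le> _\<close> by (simp add: A_def mult.assoc)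
  qed
  let ?d = "\<lambda>m::nat. if m = 0 then F else if m = 1 then F1 else (\<lambda>x. - f x)"
  have "\<exists>t. b < t \<and> t < c \<and> F c = (\<Sum>m<2. (?d m b / fact m) * (c - b) ^ m) + (?d 2 t / fact 2) * (c - b) ^ 2"
  proof (rule Taylor_up[where a=b])
    show "\<forall>m t. m < 2 \<and> b \<le> t \<and> t \<le> c \<longrightarrow> (?d m has_real_derivative ?d (Suc m) t) (at t)"
      using dF dF1 bc T0 by (auto simp: less_2_cases_iff Omega_def)
  qed (use bc in auto)
  then obtain t where t: "b < t" "t < c" "F c = F b + F1 b * (c - b) - f t / 2 * (c - b)\<^sup>2"
    by (auto simp: numeral_2_eq_2)
  have e1: "(F c - F b) / (c - b) = F1 b - f t / 2 * (c - b)"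
    unfolding t(3) using bc by (simp add: field_simps power2_eq_square)
  have e2: "(F b - F 0) / b = F1 b - A / b" using bc by (simp add: A_def field_simps)
  have D: "2 / span N 1 * ddx N 1 F + f b = 2 / c * (A / b) - f t * ((c - b) / c) + f b"
    unfolding F0 e1 e2 sp using bc by (simp add: field_simps)
  let ?w = "C0 * b powr (\<sigma> - \<alpha>)"
  have ft: "\<bar>f t\<bar> \<le> ?w" "\<bar>f b\<bar> \<le> ?w"
  proof -
    have "t powr (\<sigma> - \<alpha>) \<le> b powr (\<sigma> - \<alpha>)" using t bc \<sigma>\<alpha> by (intro powr_mono2') auto
    thus "\<bar>f t\<bar> \<le> ?w" using fb[of t] t bc C0_nonneg by (meson less_le_trans less_imp_le mult_left_mono order_trans less_trans)
    show "\<bar>f b\<bar> \<le> ?w" using fb[of b] bc by simp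
  qed
  have a1: "\<bar>2 / c * (A / b)\<bar> \<le> 2 / (2 - \<alpha>) * ?w"
  proof -
    have "\<bar>2 / c * (A / b)\<bar> = 2 / c / b * \<bar>A\<bar>" using bc by (simp add: abs_mult)
    also have "\<dots> \<le> 2 / b / b * (C0 * (b powr (\<sigma> - \<alpha>) * b\<^sup>2) / (2 - \<alpha>))"
      using bc A by (intro mult_mono divide_right_mono divide_left_mono) auto
    also have "\<dots> = 2 / (2 - \<alpha>) * ?w" using bc by (simp add: power2_eq_square)
    finally show ?thesis .
  qed
  have a2: "\<bar>f t * ((c - b) / c)\<bar> \<le> ?w"
  proof -
    have "\<bar>f t\<bar> * ((c - b) / c) \<le> ?w * 1" using ft bc C0_nonneg by (intro mult_mono) auto
    thus ?thesis using bc by (simp add: abs_mult)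
  qed
  have "\<bar>2 / span N 1 * ddx N 1 F + f b\<bar> \<le> 2 / (2 - \<alpha>) * ?w + ?w + ?w"
  proof -
    have "\<bar>x - y + z\<bar> \<le> \<bar>x\<bar> + \<bar>y\<bar> + \<bar>z\<bar>" for x y z :: real by linarith
    thus ?thesis unfolding D using a1 a2 ft(2) by (blast intro: order_trans add_mono)
  qed
  also have "\<dots> = (2 + 2 / (2 - \<alpha>)) * C0 * (b powr \<sigma> * b powr (- \<alpha>))"
    using powr_add[of b \<sigma> "- \<alpha>"] by (simp add: algebra_simps)
  also have "\<dots> \<le> (2 + 2 / (2 - \<alpha>)) * C0 * ((T powr \<sigma> * eps N) * b powr (- \<alpha>))"
    using mesh_one_eps[of N] N C0_nonneg \<alpha>2 by (intro mult_left_mono mult_right_mono) (auto simp: b_def)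
  also have "\<dots> = ((2 + 2 / (2 - \<alpha>)) * T powr \<sigma>) * (C0 * eps N * b powr (- \<alpha>))" by simp
  also have "\<dots> \<le> CQ * (C0 * eps N * b powr (- \<alpha>))"
    using CQ_ge C0_nonneg eps_nonneg by (intro mult_right_mono) auto
  finally show ?thesis by (simp add: b_def mult.assoc)
qed

lemma win_self: "2 \<le> N \<Longrightarrow> 2 \<le> i \<Longrightarrow> i \<le> N \<Longrightarrow> win N i i \<and> win N i (i + 1)"
  by (auto simp: win_def)

text \<open>Taylor expansion to fourth order about the middle node. On unequal steps the leading
  error is f' (p - q) / 3, where p - q is smaller than the steps by a factor of order i; the
  remainder is f'' times squares of the steps. Both have the size of x powr (\<sigma> - \<alpha>) /
  i^2.\<close>

lemma quad_rest:
  assumes N: "2 \<le> N" and i: "2 \<le> i" "i \<le> N"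
  shows "\<bar>2 / span N i * ddx N i F + f (X N i)\<bar> \<le> CQ * C0 * eps N * X N i powr (- \<alpha>)"
proof -
  define a b c where "a = X N (i - 1)" and "b = X N i" and "c = X N (i + 1)"
  have abc: "0 < a" "a < b" "b < c" "b \<le> T" "c \<le> 2 * T - a"
  proof -
    have "X N (i + 1) \<le> X N (2 * N - (i - 1))" using N i by (intro mesh_le) auto
    thus "c \<le> 2 * T - a" using mesh_reflect[of N "i - 1"] N i by (simp add: a_def c_def)
  qed (use N i in \<open>auto simp: a_def b_def c_def intro!: mesh_pos mesh_less mesh_le_mid\<close>)
  have in\<Omega>: "t \<in> Omega T \<and> a \<le> bdist T t" if "a \<le> t" "t \<le> c" for t
    using that abc by (auto simp: Omega_def bdist_def)
  define p q where "p = c - b" and "q = b - a"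
  have pq: "0 < p" "0 < q" using abc by (auto simp: p_def q_def)
  let ?d = "\<lambda>m::nat. if m = 0 then F else if m = 1 then F1 else if m = 2 then (\<lambda>x. - f x) else if m = 3 then (\<lambda>x. - f1 x) else (\<lambda>x. - f2 x)"
  have D: "\<forall>m t. m < 4 \<and> a \<le> t \<and> t \<le> c \<longrightarrow> (?d m has_real_derivative ?d (Suc m) t) (at t)"
  proof (intro allI impI, elim conjE)
    fix m :: nat and t assume m: "m < 4" and t: "a \<le> t" "t \<le> c"
    have "t \<in> Omega T" using in\<Omega> t by blast
    note * = dF[OF this] dF1[OF this] DERIV_minus[OF df[OF this]] DERIV_minus[OF df1[OF this]]
    consider "m = 0" | "m = 1" | "m = 2" | "m = 3" using m by linarith
    thus "(?d m has_real_derivative ?d (Suc m) t) (at t)" by cases (use * in simp_all)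
  qed
  have "\<exists>t. b < t \<and> t < c \<and> F c = (\<Sum>m<4. (?d m b / fact m) * (c - b) ^ m) + (?d 4 t / fact 4) * (c - b) ^ 4"
    by (rule Taylor_up[where a=a]) (use D abc in auto)
  then obtain t where t: "b < t" "t < c" "F c = F b + F1 b * p - f b / 2 * p\<^sup>2 - f1 b / 6 * p ^ 3 - f2 t / 24 * p ^ 4"
    by (auto simp: p_def lessThan_nat_numeral fact_numeral lessThan_Suc numeral_eq_Suc[of "num.Bit0 num.One"] eval_nat_numeral)
  have "\<exists>t. a < t \<and> t < b \<and> F a = (\<Sum>m<4. (?d m b / fact m) * (a - b) ^ m) + (?d 4 t / fact 4) * (a - b) ^ 4"
    by (rule Taylor_down[where b=c]) (use D abc in auto)
  then obtain s where s: "a < s" "s < b" "F a = F b - F1 b * q - f b / 2 * q\<^sup>2 + f1 b / 6 * q ^ 3 - f2 s / 24 * q ^ 4"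
  proof -
    assume *: "\<And>s. \<lbrakk>a < s; s < b; F a = F b - F1 b * q - f b / 2 * q\<^sup>2 + f1 b / 6 * q ^ 3 - f2 s / 24 * q ^ 4\<rbrakk> \<Longrightarrow> thesis"
      and "\<exists>t. a < t \<and> t < b \<and> F a = (\<Sum>m<4. (?d m b / fact m) * (a - b) ^ m) + (?d 4 t / fact 4) * (a - b) ^ 4"
    then obtain s where s: "a < s" "s < b" "F a = (\<Sum>m<4. (?d m b / fact m) * (a - b) ^ m) + (?d 4 s / fact 4) * (a - b) ^ 4" by blast
    have "a - b = - q" by (simp add: q_def)
    hence "F a = F b - F1 b * q - f b / 2 * q\<^sup>2 + f1 b / 6 * q ^ 3 - f2 s / 24 * q ^ 4"
      using s(3) by (simp add: lessThan_nat_numeral fact_numeral lessThan_Suc eval_nat_numeral)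
    thus thesis using * s by blast
  qed
  have e1: "(F c - F b) / p = F1 b - f b / 2 * p - f1 b / 6 * p\<^sup>2 - f2 t / 24 * p ^ 3"
    unfolding t(3) using pq by (simp add: field_simps eval_nat_numeral)
  have e2: "(F b - F a) / q = F1 b + f b / 2 * q - f1 b / 6 * q\<^sup>2 + f2 s / 24 * q ^ 3"
    unfolding s(3) using pq by (simp add: field_simps eval_nat_numeral)
  have sp: "span N i = p + q" by (simp add: span_def p_def q_def a_def c_def)
  have "ddx N i F = (F c - F b) / p - (F b - F a) / q"
    by (simp add: ddx_def dd_def p_def q_def a_def b_def c_def)
  hence "2 / span N i * ddx N i F + f b
     = - (f1 b / 3 * (p - q)) - (f2 t * (p ^ 3 / (p + q)) + f2 s * (q ^ 3 / (p + q))) / 12"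
  proof -
    let ?A = "f b / 2 + f1 b / 6 * (p - q)" and ?B = "f2 t * p ^ 3 + f2 s * q ^ 3" and ?w = "p + q"
    assume "ddx N i F = (F c - F b) / p - (F b - F a) / q"
    also have "\<dots> = - ?A * ?w - ?B / 24"
      unfolding e1 e2 by (simp add: algebra_simps power2_eq_square add_divide_distrib diff_divide_distrib)
    finally have "2 / span N i * ddx N i F + f b = 2 / ?w * (- ?A * ?w - ?B / 24) + f b" unfolding sp by (simp only:)
    also have "2 / w * (- A * w - B / 24) = - 2 * A - (B / w) / 12" if "0 < w" for w A B :: real
      using that by (simp add: field_simps)
    hence "2 / ?w * (- ?A * ?w - ?B / 24) = - 2 * ?A - (?B / ?w) / 12" using pq by (meson add_pos_pos)
    also have "?B / ?w = f2 t * (p ^ 3 / ?w) + f2 s * (q ^ 3 / ?w)" by (simp add: add_divide_distrib)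
    finally show ?thesis by simp
  qed
  also have "\<bar>\<dots>\<bar> \<le> \<bar>f1 b\<bar> * \<bar>p - q\<bar> + (\<bar>f2 t\<bar> * p\<^sup>2 + \<bar>f2 s\<bar> * q\<^sup>2) / 2"
  proof -
    have "p ^ 3 / (p + q) \<le> p\<^sup>2" "q ^ 3 / (p + q) \<le> q\<^sup>2" using pq by (auto simp: field_simps eval_nat_numeral)
    from mult_left_mono[OF this(1), of "\<bar>f2 t\<bar>"] mult_left_mono[OF this(2), of "\<bar>f2 s\<bar>"]
    have "\<bar>f2 t * (p ^ 3 / (p + q))\<bar> \<le> \<bar>f2 t\<bar> * p\<^sup>2" "\<bar>f2 s * (q ^ 3 / (p + q))\<bar> \<le> \<bar>f2 s\<bar> * q\<^sup>2"
      using pq by (auto simp: abs_mult)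
    moreover have "\<bar>f1 b / 3 * (p - q)\<bar> \<le> \<bar>f1 b\<bar> * \<bar>p - q\<bar>" by (simp add: abs_mult)
    moreover have "\<bar>- x - (y + z) / 12\<bar> \<le> X + (Y + Z) / 2" if "\<bar>y\<bar> \<le> Y" "\<bar>z\<bar> \<le> Z" "\<bar>x\<bar> \<le> X" for x y z X Y Z :: real
    proof -
      have "y \<le> Y" "- y \<le> Y" "z \<le> Z" "- z \<le> Z" "x \<le> X" "- x \<le> X" using that by auto
      thus ?thesis unfolding abs_le_iff by (intro conjI; simp; argo)
    qed
    ultimately show ?thesis by blast
  qed
  finally have main: "\<bar>2 / span N i * ddx N i F + f b\<bar> \<le> \<bar>f1 b\<bar> * \<bar>p - q\<bar> + (\<bar>f2 t\<bar> * p\<^sup>2 + \<bar>f2 s\<bar> * q\<^sup>2) / 2" .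
  have w: "win N i i" "win N i (i + 1)" using win_self[OF N i] by auto
  have i1: "1 \<le> i" using i by simp
  have pH: "p = H N (i + 1)" "q = H N i" using i by (auto simp: p_def q_def a_def b_def c_def step_eq')
  have pb: "p \<le> Cw * (b / real i)" "q \<le> Cw * (b / real i)"
    using window_step(2)[OF i1 i(2) w(1)] window_step(2)[OF i1 i(2) w(2)] by (auto simp: pH eta_def b_def)
  have pd: "\<bar>p - q\<bar> \<le> Cw * (b / real i) / real i"
    using window_step_diff[OF i1 i(2) w] by (simp add: pH eta_def b_def)
  have b0: "0 < b" using abc by simp
  have rat: "b / 2 powr r \<le> a" using mesh_ratio[of N "i - 1"] N i by (simp add: a_def b_def field_simps)
  have f2b: "\<bar>f2 z\<bar> \<le> C0 * (2 powr (4 * r) * b powr (\<sigma> - \<alpha> - 2))" if z: "a \<le> z" "z \<le> c" for z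
  proof -
    have "bdist T z powr (\<sigma> - \<alpha> - 2) \<le> (b / 2 powr r) powr (\<sigma> - \<alpha> - 2)"
      using in\<Omega>[OF z] rat b0 \<sigma>\<alpha> by (intro powr_mono2') auto
    also have "\<dots> = b powr (\<sigma> - \<alpha> - 2) * 2 powr (r * (2 + \<alpha> - \<sigma>))"
    proof -
      have "(b / 2 powr r) powr e = b powr e * 2 powr (r * (- e))" for e
        using b0 powr_divide[of b "2 powr r" e] by (simp add: powr_powr powr_minus_divide)
      from this[of "\<sigma> - \<alpha> - 2"] show ?thesis by (simp add: algebra_simps)
    qed
    also have "\<dots> \<le> b powr (\<sigma> - \<alpha> - 2) * 2 powr (4 * r)"
      using r1 \<alpha>2 \<sigma>0 by (intro mult_left_mono powr_mono) (auto simp: mult.commute[of 4])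
    finally have "C0 * bdist T z powr (\<sigma> - \<alpha> - 2) \<le> C0 * (b powr (\<sigma> - \<alpha> - 2) * 2 powr (4 * r))"
      using C0_nonneg by (rule mult_left_mono)
    thus ?thesis using bf2[of z] in\<Omega>[OF z] by (simp add: mult.commute)
  qed
  have f1b: "\<bar>f1 b\<bar> \<le> C0 * b powr (\<sigma> - \<alpha> - 1)"
  proof -
    have "bdist T b = b" using abc by (auto simp: bdist_def)
    thus ?thesis using bf1[of b] in\<Omega>[of b] abc by simp
  qed
  let ?k = "C0 * (2 powr (4 * r) * b powr (\<sigma> - \<alpha> - 2))"
  have t1: "\<bar>f1 b\<bar> * \<bar>p - q\<bar> \<le> C0 * b powr (\<sigma> - \<alpha> - 1) * (Cw * (b / real i) / real i)"
    using f1b pd C0_nonneg by (intro mult_mono) auto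
  have t2: "\<bar>f2 t\<bar> * p\<^sup>2 \<le> ?k * (Cw * (b / real i))\<^sup>2"
    using f2b[of t] t abc pb pq C0_nonneg by (intro mult_mono power_mono) auto
  have t3: "\<bar>f2 s\<bar> * q\<^sup>2 \<le> ?k * (Cw * (b / real i))\<^sup>2"
    using f2b[of s] s abc pb pq C0_nonneg by (intro mult_mono power_mono) auto
  have pw: "b powr (\<sigma> - \<alpha> - 1) * b = b powr (\<sigma> - \<alpha>)" "b powr (\<sigma> - \<alpha> - 2) * b\<^sup>2 = b powr (\<sigma> - \<alpha>)"
    using powr_add[of b "\<sigma> - \<alpha> - 1" 1] powr_add[of b "\<sigma> - \<alpha> - 2" 2] b0 by (auto simp: powr_numeral)
  have "\<bar>2 / span N i * ddx N i F + f b\<bar> \<le> C0 * b powr (\<sigma> - \<alpha> - 1) * (Cw * (b / real i) / real i) + ?k * (Cw * (b / real i))\<^sup>2"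
  proof -
    have "a \<le> M + k" if "a \<le> m + (y + z) / 2" "m \<le> M" "y \<le> k" "z \<le> k" for a m y z M k :: real
      using that by argo
    from this[OF main t1 t2 t3] show ?thesis .
  qed
  also have "\<dots> = C0 * Cw * (b powr (\<sigma> - \<alpha> - 1) * b) / (real i)\<^sup>2 + C0 * 2 powr (4 * r) * Cw\<^sup>2 * (b powr (\<sigma> - \<alpha> - 2) * b\<^sup>2) / (real i)\<^sup>2"
    by (simp add: power2_eq_square mult_ac)
  also have "\<dots> = (Cw + Cw\<^sup>2 * 2 powr (4 * r)) * C0 * (b powr (\<sigma> - \<alpha>) / (real i)\<^sup>2)"
    unfolding pw by (simp add: algebra_simps add_divide_distrib)
  also have "b powr (\<sigma> - \<alpha>) / (real i)\<^sup>2 = b powr \<sigma> / (real i)\<^sup>2 * b powr (- \<alpha>)"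
    using powr_add[of b \<sigma> "- \<alpha>"] by simp
  also have "(Cw + Cw\<^sup>2 * 2 powr (4 * r)) * C0 * (b powr \<sigma> / (real i)\<^sup>2 * b powr (- \<alpha>)) \<le> (Cw + Cw\<^sup>2 * 2 powr (4 * r)) * C0 * ((T powr \<sigma> * eps N) * b powr (- \<alpha>))"
    using mesh_powr_eps[OF i1 i(2)] C0_nonneg Cw_ge(1) by (intro mult_left_mono mult_right_mono) (auto simp: b_def)
  also have "\<dots> = ((Cw + Cw\<^sup>2 * 2 powr (4 * r)) * T powr \<sigma>) * (C0 * eps N * b powr (- \<alpha>))" by simp
  also have "\<dots> \<le> CQ * (C0 * eps N * b powr (- \<alpha>))"
    using CQ_ge C0_nonneg eps_nonneg by (intro mult_right_mono) auto
  finally show ?thesis by (simp add: b_def mult.assoc)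
qed

end

section \<open>Second differences along the diagonals\<close>

text \<open>Each index shift gains a factor \<open>\<epsilon>\<close>; the weight \<open>w\<close> absorbs the loss in the second
  difference where the mesh has its kink. The class is closed under products, compositions and
  integration in a parameter.\<close>

definition S3 :: "real \<Rightarrow> real \<Rightarrow> real \<Rightarrow> real \<Rightarrow> real \<Rightarrow> real \<Rightarrow> bool" where
  "S3 M \<epsilon> w a b c \<longleftrightarrow> \<bar>a\<bar> \<le> M \<and> \<bar>b\<bar> \<le> M \<and> \<bar>c\<bar> \<le> M \<and> \<bar>b - a\<bar> \<le> M * \<epsilon> \<and> \<bar>c - b\<bar> \<le> M * \<epsilon> \<and>
     \<bar>c - 2 * b + a\<bar> \<le> M * (\<epsilon>\<^sup>2 * w)"

lemma S3_mono:
  assumes "S3 M \<epsilon> w a b c" "M \<le> M'" "0 \<le> \<epsilon>" "0 \<le> w"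
  shows "S3 M' \<epsilon> w a b c"
proof -
  have "M * \<epsilon> \<le> M' * \<epsilon>" "M * (\<epsilon>\<^sup>2 * w) \<le> M' * (\<epsilon>\<^sup>2 * w)"
    using assms by (auto intro!: mult_right_mono)
  thus ?thesis using assms(1,2) unfolding S3_def by linarith
qed

lemma S3_nonneg: "S3 M \<epsilon> w a b c \<Longrightarrow> 0 \<le> M"
  unfolding S3_def by (meson abs_ge_zero order_trans)

lemma S3_zero: "0 \<le> M \<Longrightarrow> 0 \<le> \<epsilon> \<Longrightarrow> 0 \<le> w \<Longrightarrow> S3 M \<epsilon> w 0 0 0"
  unfolding S3_def by simp

lemma S3_cmult:
  assumes "S3 M \<epsilon> w a b c"
  shows "S3 (\<bar>k\<bar> * M) \<epsilon> w (k * a) (k * b) (k * c)"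
proof -
  have "k * b - k * a = k * (b - a)" "k * c - k * b = k * (c - b)" "k * c - 2 * (k * b) + k * a = k * (c - 2 * b + a)"
    by (simp_all add: algebra_simps)
  thus ?thesis using assms unfolding S3_def by (simp add: abs_mult mult.assoc mult_left_mono)
qed

lemma S3_add:
  assumes "S3 M \<epsilon> w a b c" "S3 M' \<epsilon> w a' b' c'"
  shows "S3 (M + M') \<epsilon> w (a + a') (b + b') (c + c')"
proof -
  have t: "\<bar>x + y\<bar> \<le> A + B" if "\<bar>x\<bar> \<le> A" "\<bar>y\<bar> \<le> B" for x y A B :: real
    using that by linarith
  have eq: "(b + b') - (a + a') = (b - a) + (b' - a')" "(c + c') - (b + b') = (c - b) + (c' - b')"
    "(c + c') - 2 * (b + b') + (a + a') = (c - 2 * b + a) + (c' - 2 * b' + a')" by simp_all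
  show ?thesis using assms unfolding S3_def eq distrib_right by (simp add: t)
qed

text \<open>The discrete Leibniz rule writes the second difference as four products, hence the
  factor 4. The two products of first differences carry no weight, which w \<ge> 1
  compensates.\<close>

lemma S3_mult:
  assumes f: "S3 M \<epsilon> w a b c" and g: "S3 M' \<epsilon> w a' b' c'" and e: "0 \<le> \<epsilon>" "1 \<le> w"
  shows "S3 (4 * (M * M')) \<epsilon> w (a * a') (b * b') (c * c')"
proof -
  have M: "0 \<le> M" "0 \<le> M'" using f g S3_nonneg by auto
  note f' = f[unfolded S3_def] and g' = g[unfolded S3_def]
  have m: "\<bar>x * y\<bar> \<le> A * B" if "\<bar>x\<bar> \<le> A" "\<bar>y\<bar> \<le> B" for x y A B :: real
    unfolding abs_mult using that by (intro mult_mono) auto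
  have MM: "0 \<le> M * M'" using M by simp
  have d: "\<bar>b * b' - a * a'\<bar> \<le> 2 * (M * M') * \<epsilon>" "\<bar>c * c' - b * b'\<bar> \<le> 2 * (M * M') * \<epsilon>"
  proof -
    have "b * b' - a * a' = b * (b' - a') + (b - a) * a'" by (simp add: algebra_simps)
    moreover have "\<bar>b * (b' - a')\<bar> \<le> M * (M' * \<epsilon>)" "\<bar>(b - a) * a'\<bar> \<le> (M * \<epsilon>) * M'"
      using f' g' by (auto intro!: m)
    ultimately show "\<bar>b * b' - a * a'\<bar> \<le> 2 * (M * M') * \<epsilon>" by (simp add: mult_ac)
    have "c * c' - b * b' = c * (c' - b') + (c - b) * b'" by (simp add: algebra_simps)
    moreover have "\<bar>c * (c' - b')\<bar> \<le> M * (M' * \<epsilon>)" "\<bar>(c - b) * b'\<bar> \<le> (M * \<epsilon>) * M'"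
      using f' g' by (auto intro!: m)
    ultimately show "\<bar>c * c' - b * b'\<bar> \<le> 2 * (M * M') * \<epsilon>" by (simp add: mult_ac)
  qed
  have "c * c' - 2 * (b * b') + a * a' =
    b * (c' - 2 * b' + a') + (c - 2 * b + a) * b' + (c - b) * (c' - b') + (b - a) * (b' - a')"
    by (simp add: algebra_simps)
  moreover have "\<bar>b * (c' - 2 * b' + a')\<bar> \<le> M * (M' * (\<epsilon>\<^sup>2 * w))" "\<bar>(c - 2 * b + a) * b'\<bar> \<le> (M * (\<epsilon>\<^sup>2 * w)) * M'"
    "\<bar>(c - b) * (c' - b')\<bar> \<le> (M * \<epsilon>) * (M' * \<epsilon>)" "\<bar>(b - a) * (b' - a')\<bar> \<le> (M * \<epsilon>) * (M' * \<epsilon>)"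
    using f' g' by (auto intro!: m)
  moreover have "(M * \<epsilon>) * (M' * \<epsilon>) = M * M' * (\<epsilon>\<^sup>2 * 1)" by (simp add: power2_eq_square mult_ac)
  moreover have "M * M' * (\<epsilon>\<^sup>2 * 1) \<le> M * M' * (\<epsilon>\<^sup>2 * w)" using MM e by (intro mult_left_mono) auto
  moreover have "M * (M' * (\<epsilon>\<^sup>2 * w)) = M * M' * (\<epsilon>\<^sup>2 * w)" "(M * (\<epsilon>\<^sup>2 * w)) * M' = M * M' * (\<epsilon>\<^sup>2 * w)" by (simp_all add: mult_ac)
  ultimately have "\<bar>c * c' - 2 * (b * b') + a * a'\<bar> \<le> 4 * (M * M' * (\<epsilon>\<^sup>2 * w))" by linarith
  moreover have "\<bar>a * a'\<bar> \<le> M * M'" "\<bar>b * b'\<bar> \<le> M * M'" "\<bar>c * c'\<bar> \<le> M * M'" using f' g' by (auto intro!: m)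
  moreover have "0 \<le> (M * M') * \<epsilon>" using MM e by simp
  ultimately show ?thesis using d MM unfolding S3_def by (auto simp: mult.assoc)
qed

text \<open>Taylor expansion about the middle value: the quadratic remainders amount to A
  \<epsilon>^2, and the linear term passes on the second difference of the argument. The factors M
  and M^2 in the hypotheses express derivatives in units of the argument.\<close>

lemma S3_comp:
  fixes \<phi> :: "real \<Rightarrow> real"
  assumes f: "S3 M \<epsilon> w a b c" and M: "0 < M" and e: "0 \<le> \<epsilon>" "1 \<le> w"
    and J: "a \<in> {lo..hi}" "b \<in> {lo..hi}" "c \<in> {lo..hi}"
    and d1: "\<And>x. x \<in> {lo..hi} \<Longrightarrow> (\<phi> has_real_derivative \<phi>' x) (at x)"
    and d2: "\<And>x. x \<in> {lo..hi} \<Longrightarrow> (\<phi>' has_real_derivative \<phi>'' x) (at x)"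
    and bd: "\<And>x. x \<in> {lo..hi} \<Longrightarrow> \<bar>\<phi> x\<bar> \<le> A"
    and bd1: "\<And>x. x \<in> {lo..hi} \<Longrightarrow> \<bar>\<phi>' x\<bar> * M \<le> A"
    and bd2: "\<And>x. x \<in> {lo..hi} \<Longrightarrow> \<bar>\<phi>'' x\<bar> * M\<^sup>2 \<le> A"
  shows "S3 (2 * A) \<epsilon> w (\<phi> a) (\<phi> b) (\<phi> c)"
proof -
  note f' = f[unfolded S3_def]
  have A: "0 \<le> A" using bd[OF J(1)] by linarith
  have first: "\<bar>\<phi> y - \<phi> x\<bar> \<le> A * \<epsilon>" if xy: "x \<in> {lo..hi}" "y \<in> {lo..hi}" "\<bar>y - x\<bar> \<le> M * \<epsilon>" for x y
  proof -
    have "norm (\<phi> y - \<phi> x) \<le> (A / M) * norm (y - x)"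
    proof (rule field_differentiable_bound[of "{lo..hi}" \<phi> \<phi>'])
      show "norm (\<phi>' z) \<le> A / M" if "z \<in> {lo..hi}" for z using bd1[OF that] M by (simp add: pos_le_divide_eq)
      show "(\<phi> has_real_derivative \<phi>' z) (at z within {lo..hi})" if "z \<in> {lo..hi}" for z
        using d1[OF that] by (rule DERIV_subset) simp
    qed (use xy in auto)
    also have "\<dots> \<le> (A / M) * (M * \<epsilon>)" using xy A M by (intro mult_left_mono) auto
    finally show ?thesis using M by simp
  qed
  have second: "\<bar>\<phi> y - \<phi> b - \<phi>' b * (y - b)\<bar> \<le> A * \<epsilon>\<^sup>2 / 2" if y: "y \<in> {lo..hi}" "\<bar>y - b\<bar> \<le> M * \<epsilon>" for y
  proof (cases "y = b")
    case False
    let ?d = "\<lambda>m::nat. if m = 0 then \<phi> else if m = 1 then \<phi>' else \<phi>''"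
    have "\<exists>t. (if y < b then y < t \<and> t < b else b < t \<and> t < y) \<and>
       \<phi> y = (\<Sum>m<2. (?d m b / fact m) * (y - b) ^ m) + (?d 2 t / fact 2) * (y - b) ^ 2"
      by (rule Taylor[where a=lo and b=hi]) (use d1 d2 J y False in \<open>auto simp: less_2_cases_iff\<close>)
    then obtain t where t: "if y < b then y < t \<and> t < b else b < t \<and> t < y"
      "\<phi> y = \<phi> b + \<phi>' b * (y - b) + \<phi>'' t / 2 * (y - b)\<^sup>2" by (auto simp: numeral_2_eq_2)
    have tJ: "t \<in> {lo..hi}" using t(1) J(2) y(1) by (auto split: if_splits)
    have "\<bar>\<phi>'' t\<bar> \<le> A / M\<^sup>2" using bd2[OF tJ] M by (simp add: pos_le_divide_eq)
    moreover have "(y - b)\<^sup>2 \<le> (M * \<epsilon>)\<^sup>2" using y(2) by (simp add: abs_le_square_iff[symmetric] M e less_imp_le mult_nonneg_nonneg)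
    ultimately have "\<bar>\<phi>'' t\<bar> * (y - b)\<^sup>2 \<le> A / M\<^sup>2 * (M * \<epsilon>)\<^sup>2" using A M by (intro mult_mono) auto
    also have "\<dots> = A * \<epsilon>\<^sup>2" using M by (simp add: power_mult_distrib)
    finally show ?thesis unfolding t(2) by (simp add: abs_mult)
  qed (use A e in simp)
  have "\<phi> c - 2 * \<phi> b + \<phi> a = (\<phi> c - \<phi> b - \<phi>' b * (c - b)) + (\<phi> a - \<phi> b - \<phi>' b * (a - b)) + \<phi>' b * (c - 2 * b + a)"
    by (simp add: algebra_simps)
  moreover have "\<bar>\<phi>' b * (c - 2 * b + a)\<bar> \<le> A * (\<epsilon>\<^sup>2 * w)"
  proof -
    have "\<bar>\<phi>' b\<bar> * \<bar>c - 2 * b + a\<bar> \<le> \<bar>\<phi>' b\<bar> * (M * (\<epsilon>\<^sup>2 * w))" using f' by (intro mult_left_mono) auto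
    also have "\<dots> = (\<bar>\<phi>' b\<bar> * M) * (\<epsilon>\<^sup>2 * w)" by simp
    also have "\<dots> \<le> A * (\<epsilon>\<^sup>2 * w)" using bd1[OF J(2)] e by (intro mult_right_mono) auto
    finally show ?thesis by (simp add: abs_mult)
  qed
  moreover have "A * \<epsilon>\<^sup>2 \<le> A * (\<epsilon>\<^sup>2 * w)" using A e by (intro mult_left_mono) (auto simp: mult_le_cancel_left1)
  moreover have "\<bar>\<phi> c - \<phi> b - \<phi>' b * (c - b)\<bar> \<le> A * \<epsilon>\<^sup>2 / 2" by (rule second) (use f' J in auto)
  moreover have "\<bar>\<phi> a - \<phi> b - \<phi>' b * (a - b)\<bar> \<le> A * \<epsilon>\<^sup>2 / 2" by (rule second) (use f' J in \<open>auto simp: abs_minus_commute\<close>)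
  ultimately have "\<bar>\<phi> c - 2 * \<phi> b + \<phi> a\<bar> \<le> 2 * (A * (\<epsilon>\<^sup>2 * w))" by linarith
  moreover have "\<bar>\<phi> b - \<phi> a\<bar> \<le> A * \<epsilon>" "\<bar>\<phi> c - \<phi> b\<bar> \<le> A * \<epsilon>" using first f' J by auto
  moreover have "0 \<le> A * \<epsilon>" using A e by simp
  moreover have "\<bar>\<phi> a\<bar> \<le> A" "\<bar>\<phi> b\<bar> \<le> A" "\<bar>\<phi> c\<bar> \<le> A" using bd J by auto
  ultimately show ?thesis unfolding S3_def mult.assoc using A by linarith
qed

lemma integral_unit_bound:
  fixes g :: "real \<Rightarrow> real"
  assumes "g integrable_on {0..1}" "\<And>t. t \<in> {0..1} \<Longrightarrow> \<bar>g t\<bar> \<le> B"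
  shows "\<bar>integral {0..1} g\<bar> \<le> B"
proof -
  have "norm (integral {0..1} g) \<le> integral {0..1} (\<lambda>t::real. B)"
    by (rule Henstock_Kurzweil_Integration.integral_norm_bound_integral) (use assms in auto)
  thus ?thesis by simp
qed

lemma S3_integral:
  fixes f g h :: "real \<Rightarrow> real"
  assumes i: "f integrable_on {0..1}" "g integrable_on {0..1}" "h integrable_on {0..1}"
    and S: "\<And>t. t \<in> {0..1} \<Longrightarrow> S3 M \<epsilon> w (f t) (g t) (h t)"
  shows "S3 M \<epsilon> w (integral {0..1} f) (integral {0..1} g) (integral {0..1} h)"
proof -
  note S' = S[unfolded S3_def]
  have "integral {0..1} g - integral {0..1} f = integral {0..1} (\<lambda>t. g t - f t)"
    using i by (simp add: integral_diff)
  moreover have "integral {0..1} h - integral {0..1} g = integral {0..1} (\<lambda>t. h t - g t)"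
    using i by (simp add: integral_diff)
  moreover have "integral {0..1} h - 2 * integral {0..1} g + integral {0..1} f = integral {0..1} (\<lambda>t. h t - 2 * g t + f t)"
    using i by (simp add: integral_diff integral_add integrable_diff integrable_on_mult_right)
  moreover have "(\<lambda>t. g t - f t) integrable_on {0..1}" "(\<lambda>t. h t - g t) integrable_on {0..1}" "(\<lambda>t. h t - 2 * g t + f t) integrable_on {0..1}"
    using i by (auto intro!: integrable_diff integrable_add integrable_on_mult_right)
  ultimately show ?thesis unfolding S3_def using i S' by (auto intro!: integral_unit_bound)
qed

section \<open>Mesh quantities under diagonal shifts\<close>

context frac_problem
begin

lemma win_pred: "1 \<le> i \<Longrightarrow> win N i (j - 1) \<Longrightarrow> 3 \<le> j"
  unfolding win_def by linarith

lemma win_Suc: "1 \<le> i \<Longrightarrow> win N i (j + 1) \<Longrightarrow> j + 1 < 2 * N \<and> j + 1 \<le> 2 * i"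
  unfolding win_def by auto

text \<open>The side condition excludes j = N and j = N + 1, the indices for which the three steps
  lie on both sides of T.\<close>

lemma window_diff2:
  assumes i: "1 \<le> i" "i \<le> N" and w: "win N i (j - 1)" "win N i j" "win N i (j + 1)"
    and side: "j + 1 \<le> N \<or> N + 2 \<le> j"
  shows "\<bar>H N (j + 1) - 2 * H N j + H N (j - 1)\<bar> \<le> Cw * eta N i / (real i)\<^sup>2"
proof (cases "j + 1 \<le> N")
  case True
  thus ?thesis using window_left_diff2[of i N j] i w by (auto simp: win_def)
next
  case False
  hence j: "N + 2 \<le> j" using side by simp
  define k where "k = 2 * N + 1 - j"
  have k: "2 \<le> k" "k + 1 \<le> N" "i + 16 \<le> 8 * k" "k + 1 \<le> 2 * i" using j w i by (auto simp: k_def win_def)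
  have b: "j + 1 < 2 * N" "1 \<le> j - 1" using w(3) i w(1) by (auto simp: win_def)
  have "2 * N + 1 - j = k" "2 * N + 1 - (j + 1) = k - 1" "2 * N + 1 - (j - 1) = k + 1" using b j by (auto simp: k_def)
  hence "H N j = H N k" "H N (j + 1) = H N (k - 1)" "H N (j - 1) = H N (k + 1)"
    using step_reflect[of N j] step_reflect[of N "j + 1"] step_reflect[of N "j - 1"] b i by auto
  thus ?thesis using window_left_diff2[of i N k] i k by (simp add: algebra_simps)
qed

lemma gap_bounds:
  assumes i: "1 \<le> i" "i \<le> N" and w: "\<And>j. l < j \<Longrightarrow> j \<le> l + q \<Longrightarrow> win N i j"
  shows "real q * (eta N i / Cw) \<le> X N (l + q) - X N l" "X N (l + q) - X N l \<le> real q * (Cw * eta N i)"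
proof -
  have "real q * (eta N i / Cw) \<le> X N (l + q) - X N l \<and> X N (l + q) - X N l \<le> real q * (Cw * eta N i)"
    using w
  proof (induction q)
    case (Suc q)
    have "win N i (l + Suc q)" using Suc.prems by simp
    from window_step[OF i this] have "eta N i / Cw \<le> H N (l + Suc q)" "H N (l + Suc q) \<le> Cw * eta N i" by auto
    moreover have "H N (l + Suc q) = X N (l + Suc q) - X N (l + q)" by (simp add: step_eq)
    moreover have "real q * (eta N i / Cw) \<le> X N (l + q) - X N l \<and> X N (l + q) - X N l \<le> real q * (Cw * eta N i)"
      using Suc by auto
    moreover have "real (Suc q) * y = real q * y + y" for y by (simp add: algebra_simps)
    ultimately show ?case by (simp only:) linarith
  qed simp
  thus "real q * (eta N i / Cw) \<le> X N (l + q) - X N l" "X N (l + q) - X N l \<le> real q * (Cw * eta N i)" by auto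
qed

lemma step_diff_sum:
  assumes i: "1 \<le> i" "i \<le> N" and w: "\<And>j. l \<le> j \<Longrightarrow> j \<le> l + q \<Longrightarrow> win N i j"
  shows "\<bar>H N (l + q) - H N l\<bar> \<le> real q * (Cw * eta N i) / real i"
  using w
proof (induction q)
  case (Suc q)
  have "\<bar>H N (l + q) - H N l\<bar> \<le> real q * (Cw * eta N i) / real i" using Suc by auto
  moreover have "\<bar>H N (l + q + 1) - H N (l + q)\<bar> \<le> Cw * eta N i / real i"
    by (rule window_step_diff[OF i]) (use Suc.prems in auto)
  moreover have "real (Suc q) * (Cw * eta N i) / real i = real q * (Cw * eta N i) / real i + Cw * eta N i / real i"
    by (simp add: algebra_simps add_divide_distrib)
  ultimately show ?case by simp
qed simp

lemma step_diff2_sum: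
  assumes i: "1 \<le> i" "i \<le> N" and w: "\<And>j. l \<le> j \<Longrightarrow> j \<le> l + q + 1 \<Longrightarrow> win N i j" and N: "l + q + 1 \<le> N"
  shows "\<bar>(H N (l + q + 1) - H N (l + q)) - (H N (l + 1) - H N l)\<bar> \<le> real q * (Cw * eta N i) / (real i)\<^sup>2"
  using w N
proof (induction q)
  case (Suc q)
  have "\<bar>(H N (l + q + 1) - H N (l + q)) - (H N (l + 1) - H N l)\<bar> \<le> real q * (Cw * eta N i) / (real i)\<^sup>2"
    using Suc by auto
  moreover have "\<bar>H N (l + q + 1 + 1) - 2 * H N (l + q + 1) + H N (l + q + 1 - 1)\<bar> \<le> Cw * eta N i / (real i)\<^sup>2"
    by (rule window_diff2[OF i]) (use Suc.prems in auto)
  moreover have "real (Suc q) * (Cw * eta N i) / (real i)\<^sup>2 = real q * (Cw * eta N i) / (real i)\<^sup>2 + Cw * eta N i / (real i)\<^sup>2"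
    by (simp add: algebra_simps add_divide_distrib)
  ultimately show ?case by simp
qed simp

text \<open>The second difference of a gap of q cells is the difference of the step increments at
  its two ends. On one side of T it is a sum of q second differences of steps. Across T each
  increment is bounded alone, by eta / i; this exceeds the wanted q eta / i^2 by 2 i / q, which the
  weight must cover.\<close>

lemma gap_S3:
  assumes i: "1 \<le> i" "i \<le> N" and l: "1 \<le> l" and w: "\<And>j. l \<le> j \<Longrightarrow> j \<le> l + q + 1 \<Longrightarrow> win N i j"
    and weight: "1 \<le> \<omega>" "l + q + 1 \<le> N \<or> q = 0 \<or> 2 * real i \<le> real q * \<omega>"
  shows "S3 (real q * (Cw * eta N i)) (1 / real i) \<omega> (X N (l - 1 + q) - X N (l - 1)) (X N (l + q) - X N l) (X N (l + 1 + q) - X N (l + 1))"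
proof -
  let ?M = "real q * (Cw * eta N i)"
  have eta0: "0 \<le> Cw * eta N i" using eta_pos[OF i] Cw_ge(1) by simp
  have le: "X N (l' + q) - X N l' \<le> ?M" "0 \<le> X N (l' + q) - X N l'" if "l' \<in> {l - 1, l, l + 1}" for l'
  proof -
    have w': "\<And>j. l' < j \<Longrightarrow> j \<le> l' + q \<Longrightarrow> win N i j" using that w by auto
    have "0 \<le> real q * (eta N i / Cw)" using eta_pos[OF i] Cw_ge(1) by simp
    thus "X N (l' + q) - X N l' \<le> ?M" "0 \<le> X N (l' + q) - X N l'" using gap_bounds[OF i, of l' q, OF w'] by auto
  qed
  have l1: "l - 1 + q = l + q - 1" using l by simp
  have d1: "(X N (l + q) - X N l) - (X N (l - 1 + q) - X N (l - 1)) = H N (l + q) - H N l"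
    using l by (simp add: step_eq' l1)
  have d2: "(X N (l + 1 + q) - X N (l + 1)) - (X N (l + q) - X N l) = H N (l + 1 + q) - H N (l + 1)"
    by (simp add: step_eq')
  have dd: "(X N (l + 1 + q) - X N (l + 1)) - 2 * (X N (l + q) - X N l) + (X N (l - 1 + q) - X N (l - 1)) =
     (H N (l + q + 1) - H N (l + q)) - (H N (l + 1) - H N l)"
    using d1 d2 by (simp add: algebra_simps)
  have "\<bar>H N (l + q) - H N l\<bar> \<le> ?M / real i" by (rule step_diff_sum[OF i]) (use w in auto)
  moreover have "\<bar>H N (l + 1 + q) - H N (l + 1)\<bar> \<le> ?M / real i" by (rule step_diff_sum[OF i]) (use w in auto)
  moreover have "\<bar>(H N (l + q + 1) - H N (l + q)) - (H N (l + 1) - H N l)\<bar> \<le> ?M * ((1 / real i)\<^sup>2 * \<omega>)"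
  proof -
    consider "q = 0" | "l + q + 1 \<le> N" | "0 < q" "2 * real i \<le> real q * \<omega>" using weight by auto
    thus ?thesis
    proof cases
      case 2
      have "\<bar>(H N (l + q + 1) - H N (l + q)) - (H N (l + 1) - H N l)\<bar> \<le> ?M / (real i)\<^sup>2"
        by (rule step_diff2_sum[OF i]) (use w 2 in auto)
      also have "\<dots> = ?M * ((1 / real i)\<^sup>2 * 1)" by (simp add: power_divide)
      also have "\<dots> \<le> ?M * ((1 / real i)\<^sup>2 * \<omega>)" using eta0 weight(1) by (intro mult_left_mono) auto
      finally show ?thesis .
    next
      case 3
      have "\<bar>H N (l + q + 1) - H N (l + q)\<bar> \<le> Cw * eta N i / real i" "\<bar>H N (l + 1) - H N l\<bar> \<le> Cw * eta N i / real i"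
        by (rule window_step_diff[OF i]; use w in auto)+
      hence "\<bar>(H N (l + q + 1) - H N (l + q)) - (H N (l + 1) - H N l)\<bar> \<le> 2 * (Cw * eta N i / real i)" by linarith
      also have "\<dots> = (Cw * eta N i) * (1 / real i)\<^sup>2 * (2 * real i)" using i by (simp add: power2_eq_square)
      also have "\<dots> \<le> (Cw * eta N i) * (1 / real i)\<^sup>2 * (real q * \<omega>)" using 3 eta0 by (intro mult_left_mono) auto
      finally show ?thesis by (simp add: mult_ac)
    qed simp
  qed
  ultimately show ?thesis unfolding S3_def d1 d2 dd using le[of "l - 1"] le[of l] le[of "l + 1"] by auto
qed

definition Cy :: real where "Cy = 2 * 2 powr r * Cw"

lemma Cy_ge: "1 \<le> Cy" "Cw \<le> Cy" "2 * 2 powr r \<le> Cy"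
proof -
  have p: "1 \<le> (2::real) powr r" using r1 by (simp add: ge_one_powr_ge_zero)
  have "2 * 2 powr r * 1 \<le> Cy" unfolding Cy_def using Cw_ge(1) p by (intro mult_left_mono) auto
  thus "2 * 2 powr r \<le> Cy" by simp
  thus "1 \<le> Cy" using p by simp
  have "1 * Cw \<le> Cy" unfolding Cy_def using Cw_ge(1) p by (intro mult_right_mono) auto
  thus "Cw \<le> Cy" by simp
qed

lemma mesh_lower:
  assumes i: "1 \<le> i" "i \<le> N" and n: "i \<le> 8 * n" "n \<le> 2 * N"
  shows "X N i / 8 powr r \<le> X N n"
proof (cases "n \<le> N")
  case True
  have "real i powr r / 8 powr r = (real i / 8) powr r" by (simp add: powr_divide)
  also have "\<dots> \<le> real n powr r" using n i r1 by (intro powr_mono2) auto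
  finally have "cN N * (real i powr r / 8 powr r) \<le> cN N * real n powr r"
    using cN_pos[of N] i by (intro mult_left_mono) auto
  thus ?thesis using True i by (simp add: mesh_left)
next
  case False
  have "X N i / 8 powr r \<le> X N i / 1" using mesh_pos[of N i] i r1 by (intro divide_left_mono) (auto simp: ge_one_powr_ge_zero)
  also have "\<dots> \<le> X N n" using mesh_le[of N i n] False i n by simp
  finally show ?thesis .
qed

text \<open>If n > N, then N < 2 i, so T is at most 2 powr r times \<open>X N i\<close>; the extra
  factor 2 is for nodes between T and 2 T.\<close>

lemma mesh_upper_window:
  assumes i: "1 \<le> i" "i \<le> N" and n: "n \<le> 2 * i" "n \<le> 2 * N"
  shows "X N n \<le> 2 * 2 powr r * X N i"
proof (cases "n \<le> N")
  case True
  have "real n powr r \<le> (2 * real i) powr r" using n i r1 by (intro powr_mono2) auto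
  hence "cN N * real n powr r \<le> cN N * (2 powr r * real i powr r)"
    using cN_pos[of N] i by (intro mult_left_mono) (auto simp: powr_mult)
  hence "X N n \<le> 2 powr r * X N i" using True i by (simp add: mesh_left mult_ac)
  moreover have "0 \<le> 2 powr r * X N i" using mesh_nonneg[of N i] i by simp
  ultimately show ?thesis by simp
next
  case False
  have "real N powr r \<le> (2 * real i) powr r" using n i False r1 by (intro powr_mono2) auto
  hence "cN N * real N powr r \<le> cN N * (2 powr r * real i powr r)"
    using cN_pos[of N] i by (intro mult_left_mono) (auto simp: powr_mult)
  hence "X N N \<le> 2 powr r * X N i" using i by (simp add: mesh_left mult_ac)
  moreover have "X N n \<le> 2 * T" by (rule mesh_upper) (use i n in auto)
  ultimately show ?thesis using i by (simp add: mesh_mid)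
qed

text \<open>No condition at the kink is necessary: second differences of nodes are first differences
  of steps, which stay small across T.\<close>

lemma node_S3:
  assumes i: "1 \<le> i" "i \<le> N" and w: "win N i (j - 1)" "win N i j" "win N i (j + 1)" and weight: "1 \<le> \<omega>" and \<tau>: "0 \<le> \<tau>" "\<tau> \<le> 1"
  shows "S3 (Cy * X N i) (1 / real i) \<omega> ((1 - \<tau>) * X N (j - 2) + \<tau> * X N (j - 1))
     ((1 - \<tau>) * X N (j - 1) + \<tau> * X N j) ((1 - \<tau>) * X N j + \<tau> * X N (j + 1))"
proof -
  have j: "3 \<le> j" "j + 1 < 2 * N" "j + 1 \<le> 2 * i"
    using win_pred[OF i(1) w(1)] win_Suc[OF i(1) w(3)] by auto
  have N1: "1 \<le> N" using i by simp
  have Xi: "0 < X N i" using mesh_pos[of N i] i by simp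
  have eta: "Cw * eta N i \<le> Cy * X N i * (1 / real i)"
    using mult_right_mono[OF Cy_ge(2), of "eta N i"] eta_pos[OF i] by (simp add: eta_def)
  have cc: "\<bar>(1 - \<tau>) * a + \<tau> * b\<bar> \<le> B" if "\<bar>a\<bar> \<le> B" "\<bar>b\<bar> \<le> B" for a b B :: real
  proof -
    have "\<bar>(1 - \<tau>) * a + \<tau> * b\<bar> \<le> (1 - \<tau>) * \<bar>a\<bar> + \<tau> * \<bar>b\<bar>"
      using abs_triangle_ineq[of "(1 - \<tau>) * a" "\<tau> * b"] \<tau> by (simp add: abs_mult)
    also have "\<dots> \<le> (1 - \<tau>) * B + \<tau> * B" using that \<tau> by (intro add_mono mult_left_mono) auto
    finally show ?thesis by (simp add: algebra_simps)
  qed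
  have Xb: "\<bar>X N n\<bar> \<le> Cy * X N i" if "n \<le> j + 1" for n
  proof -
    have "X N n \<le> 2 * 2 powr r * X N i" by (rule mesh_upper_window[OF i]) (use that j in auto)
    also have "\<dots> \<le> Cy * X N i" using Cy_ge(3) Xi by (intro mult_right_mono) auto
    finally show ?thesis using mesh_nonneg[of N n] that j N1 by simp
  qed
  have Hb: "\<bar>H N n\<bar> \<le> Cy * X N i * (1 / real i)" if "win N i n" for n
  proof -
    have "0 \<le> eta N i / Cw" using eta_pos[OF i] Cw_ge(1) by simp
    thus ?thesis using window_step[OF i that] eta by auto
  qed
  have D: "\<bar>H N (n + 1) - H N n\<bar> \<le> Cy * X N i * ((1 / real i)\<^sup>2 * \<omega>)" if "win N i n" "win N i (n + 1)" for n
  proof -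
    have "\<bar>H N (n + 1) - H N n\<bar> \<le> Cw * eta N i / real i" by (rule window_step_diff[OF i that])
    also have "\<dots> \<le> Cy * X N i * (1 / real i) / real i" using eta by (intro divide_right_mono) auto
    also have "\<dots> = Cy * X N i * ((1 / real i)\<^sup>2 * 1)" by (simp add: power2_eq_square)
    also have "\<dots> \<le> Cy * X N i * ((1 / real i)\<^sup>2 * \<omega>)" using weight Xi Cy_ge(1) by (intro mult_left_mono) auto
    finally show ?thesis .
  qed
  have H: "H N (j - 1) = X N (j - 1) - X N (j - 2)" "H N j = X N j - X N (j - 1)" "H N (j + 1) = X N (j + 1) - X N j"
    using j by (auto simp: step_eq' numeral_2_eq_2)
  have d1: "((1 - \<tau>) * X N (j - 1) + \<tau> * X N j) - ((1 - \<tau>) * X N (j - 2) + \<tau> * X N (j - 1)) = (1 - \<tau>) * H N (j - 1) + \<tau> * H N j"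
    "((1 - \<tau>) * X N j + \<tau> * X N (j + 1)) - ((1 - \<tau>) * X N (j - 1) + \<tau> * X N j) = (1 - \<tau>) * H N j + \<tau> * H N (j + 1)"
    unfolding H by (simp_all add: algebra_simps)
  have d2: "((1 - \<tau>) * X N j + \<tau> * X N (j + 1)) - 2 * ((1 - \<tau>) * X N (j - 1) + \<tau> * X N j) + ((1 - \<tau>) * X N (j - 2) + \<tau> * X N (j - 1))
     = (1 - \<tau>) * (H N j - H N (j - 1)) + \<tau> * (H N (j + 1) - H N j)"
    unfolding H by (simp add: algebra_simps)
  have D': "\<bar>H N j - H N (j - 1)\<bar> \<le> Cy * X N i * ((1 / real i)\<^sup>2 * \<omega>)" using D[of "j - 1"] w j by simp
  show ?thesis unfolding S3_def d1 d2 by (intro conjI cc Xb Hb w D D') auto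
qed

lemma node_inner:
  assumes i: "1 \<le> i" "i \<le> N" and w: "win N i (j - 1)" "win N i j" "win N i (j + 1)" and y: "X N (j - 2) \<le> y" "y \<le> X N (j + 1)"
  shows "X N i / 8 powr r \<le> bdist T y" "y \<in> Omega T"
proof -
  have j: "3 \<le> j" "j + 1 < 2 * N"
    using win_pred[OF i(1) w(1)] win_Suc[OF i(1) w(3)] by auto
  have N1: "1 \<le> N" using i by simp
  have "X N i / 8 powr r \<le> X N (j - 2)" by (rule mesh_lower[OF i]) (use w j in \<open>auto simp: win_def\<close>)
  moreover have "X N i / 8 powr r \<le> X N (2 * N - (j + 1))" by (rule mesh_lower[OF i]) (use w j in \<open>auto simp: win_def\<close>)
  moreover have "X N (2 * N - (j + 1)) = 2 * T - X N (j + 1)" by (rule mesh_reflect) (use j N1 in auto)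
  ultimately show 1: "X N i / 8 powr r \<le> bdist T y" using y by (simp add: bdist_def)
  have "0 < X N i / 8 powr r" using mesh_pos[of N i] i by simp
  hence "0 < bdist T y" using 1 by linarith
  thus "y \<in> Omega T" by (simp add: bdist_def Omega_def)
qed

text \<open>For the two triples of steps around the kink only first differences are small, and the
  weight must supply the lost factor 2 i.\<close>

lemma step_S3:
  assumes i: "1 \<le> i" "i \<le> N" and w: "win N i (j - 1)" "win N i j" "win N i (j + 1)"
    and weight: "1 \<le> \<omega>" "j + 1 \<le> N \<or> N + 2 \<le> j \<or> 2 * real i \<le> \<omega>"
  shows "S3 (Cw * eta N i) (1 / real i) \<omega> (H N (j - 1)) (H N j) (H N (j + 1))"
proof -
  have eta0: "0 \<le> Cw * eta N i" using eta_pos[OF i] Cw_ge(1) by simp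
  have j: "3 \<le> j" using win_pred[OF i(1) w(1)] .
  have b: "\<bar>H N n\<bar> \<le> Cw * eta N i" if "win N i n" for n
  proof -
    have "0 \<le> eta N i / Cw" using eta_pos[OF i] Cw_ge(1) by simp
    thus ?thesis using window_step[OF i that] by auto
  qed
  have d1: "\<bar>H N j - H N (j - 1)\<bar> \<le> Cw * eta N i / real i"
    using window_step_diff[OF i w(1)] w j by simp
  have d2: "\<bar>H N (j + 1) - H N j\<bar> \<le> Cw * eta N i / real i"
    by (rule window_step_diff[OF i w(2,3)])
  have dd: "\<bar>H N (j + 1) - 2 * H N j + H N (j - 1)\<bar> \<le> Cw * eta N i * ((1 / real i)\<^sup>2 * \<omega>)"
  proof (cases "j + 1 \<le> N \<or> N + 2 \<le> j")
    case True
    have "\<bar>H N (j + 1) - 2 * H N j + H N (j - 1)\<bar> \<le> Cw * eta N i / (real i)\<^sup>2"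
      by (rule window_diff2[OF i w True])
    also have "\<dots> = Cw * eta N i * ((1 / real i)\<^sup>2 * 1)" by (simp add: power_divide)
    also have "\<dots> \<le> Cw * eta N i * ((1 / real i)\<^sup>2 * \<omega>)" using eta0 weight(1) by (intro mult_left_mono) auto
    finally show ?thesis .
  next
    case False
    have "\<bar>H N (j + 1) - 2 * H N j + H N (j - 1)\<bar> \<le> 2 * (Cw * eta N i / real i)" using d1 d2 by linarith
    also have "\<dots> = (Cw * eta N i) * (1 / real i)\<^sup>2 * (2 * real i)" using i by (simp add: power2_eq_square)
    also have "\<dots> \<le> (Cw * eta N i) * (1 / real i)\<^sup>2 * \<omega>" using False weight eta0 by (intro mult_left_mono) auto
    finally show ?thesis by (simp add: mult_ac)
  qed
  show ?thesis unfolding S3_def using b[OF w(1)] b[OF w(2)] b[OF w(3)] d1 d2 dd by simp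
qed

text \<open>Composition with the kernel on a range of values comparable with \<mu>, where the
  derivative of order p times (Cw \<mu>)^p is of the order \<mu> powr (1 - \<alpha>). The power of
  \<open>Cw\<close> is 2 p + \<alpha> - 1, at most 5 for p \<le> 2.\<close>

lemma K_S3:
  assumes S: "S3 (Cw * \<mu>) \<epsilon> \<omega> a b c" and \<mu>: "0 < \<mu>" and e: "0 \<le> \<epsilon>" "1 \<le> \<omega>"
    and lo: "\<mu> / Cw \<le> a" "\<mu> / Cw \<le> b" "\<mu> / Cw \<le> c"
  shows "S3 (4 * \<kappa> * Cw ^ 5 * \<mu> powr (1 - \<alpha>)) \<epsilon> \<omega> (K a) (K b) (K c)"
proof -
  have C: "1 \<le> Cw" by (rule Cw_ge(1))
  let ?A = "2 * \<kappa> * Cw ^ 5 * \<mu> powr (1 - \<alpha>)"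
  have lo0: "0 < \<mu> / Cw" using \<mu> C by simp
  have pw: "t powr (1 - \<alpha> - p) * (Cw * \<mu>) powr p \<le> Cw ^ 5 * \<mu> powr (1 - \<alpha>)"
    if t: "\<mu> / Cw \<le> t" and p: "0 \<le> p" "p \<le> 2" for t p
  proof -
    have "t powr (1 - \<alpha> - p) \<le> (\<mu> / Cw) powr (1 - \<alpha> - p)" using t lo0 \<alpha>1 p by (intro powr_mono2') auto
    hence "t powr (1 - \<alpha> - p) * (Cw * \<mu>) powr p \<le> (\<mu> / Cw) powr (1 - \<alpha> - p) * (Cw * \<mu>) powr p"
      by (rule mult_right_mono) simp
    also have "\<dots> = (\<mu> powr (1 - \<alpha> - p) * \<mu> powr p) * (Cw powr (- (1 - \<alpha> - p)) * Cw powr p)"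
    proof -
      have "(\<mu> / Cw) powr d = \<mu> powr d * Cw powr (- d)" for d
        using powr_divide[of \<mu> Cw d] \<mu> C by (simp add: powr_minus_divide)
      thus ?thesis using \<mu> C by (simp only: powr_mult mult_ac)
    qed
    also have "\<dots> = \<mu> powr (1 - \<alpha>) * Cw powr (2 * p + \<alpha> - 1)"
    proof -
      have "1 - \<alpha> - p + p = 1 - \<alpha>" "- (1 - \<alpha> - p) + p = 2 * p + \<alpha> - 1" by simp_all
      thus ?thesis by (simp only: powr_add[symmetric])
    qed
    also have "Cw powr (2 * p + \<alpha> - 1) \<le> Cw powr 5" using C p \<alpha>2 by (intro powr_mono) auto
    also have "Cw powr 5 = Cw ^ 5" using C by (simp add: powr_numeral)
    finally show ?thesis using \<mu> by (simp add: mult.commute mult_left_mono)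
  qed
  have CM: "0 < Cw * \<mu>" using C \<mu> by simp
  have "S3 (2 * ?A) \<epsilon> \<omega> (K a) (K b) (K c)"
  proof (rule S3_comp[OF S CM e, where lo="\<mu> / Cw" and hi="Cw * \<mu>"
        and \<phi>'="\<lambda>t. - (\<kappa> * (\<alpha> - 1)) * t powr (- \<alpha>)" and \<phi>''="\<lambda>t. \<kappa> * (\<alpha> - 1) * \<alpha> * t powr (- 1 - \<alpha>)"])
    show "a \<in> {\<mu> / Cw..Cw * \<mu>}" "b \<in> {\<mu> / Cw..Cw * \<mu>}" "c \<in> {\<mu> / Cw..Cw * \<mu>}"
      using S lo unfolding S3_def by auto
    fix t assume t: "t \<in> {\<mu> / Cw..Cw * \<mu>}"
    hence t0: "\<mu> / Cw \<le> t" "0 < t" using lo0 by auto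
    show "(K has_real_derivative - (\<kappa> * (\<alpha> - 1)) * t powr (- \<alpha>)) (at t)" by (rule DERIV_K[OF t0(2)])
    show "((\<lambda>t. - (\<kappa> * (\<alpha> - 1)) * t powr (- \<alpha>)) has_real_derivative \<kappa> * (\<alpha> - 1) * \<alpha> * t powr (- 1 - \<alpha>)) (at t)"
      by (rule DERIV_K'[OF t0(2)])
    let ?B = "Cw ^ 5 * \<mu> powr (1 - \<alpha>)"
    have B0: "0 \<le> ?B" using C by simp
    have c: "\<kappa> * 1 \<le> 2 * \<kappa>" "\<kappa> * (\<alpha> - 1) \<le> 2 * \<kappa>" "\<kappa> * (\<alpha> - 1) * \<alpha> \<le> 2 * \<kappa>"
    proof -
      have "(\<alpha> - 1) * \<alpha> \<le> 1 * 2" using \<alpha>1 \<alpha>2 by (intro mult_mono) auto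
      thus "\<kappa> * (\<alpha> - 1) * \<alpha> \<le> 2 * \<kappa>" using \<kappa>0 mult_left_mono[of "(\<alpha> - 1) * \<alpha>" 2 \<kappa>] by (simp add: mult_ac)
      show "\<kappa> * (\<alpha> - 1) \<le> 2 * \<kappa>" using \<kappa>0 \<alpha>2 mult_left_mono[of "\<alpha> - 1" 2 \<kappa>] by (simp add: mult_ac)
    qed (use \<kappa>0 in simp)
    have "t powr (1 - \<alpha>) \<le> ?B" using pw[OF t0(1), of 0] CM by (auto split: if_splits)
    hence "\<kappa> * 1 * t powr (1 - \<alpha>) \<le> 2 * \<kappa> * ?B"
      by (rule mult_mono[OF c(1)]) (use \<kappa>0 in auto)
    thus "\<bar>K t\<bar> \<le> ?A" using \<kappa>0 t0 by (simp add: K_eq mult.assoc)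
    have "\<kappa> * (\<alpha> - 1) * (t powr (1 - \<alpha> - 1) * (Cw * \<mu>) powr 1) \<le> 2 * \<kappa> * ?B"
      by (rule mult_mono[OF c(2) pw[OF t0(1), of 1]]) (use \<kappa>0 in auto)
    moreover have "1 - \<alpha> - 1 = - \<alpha>" by simp
    moreover have "(Cw * \<mu>) powr 1 = Cw * \<mu>" using CM by simp
    ultimately have "\<kappa> * (\<alpha> - 1) * (t powr (- \<alpha>) * (Cw * \<mu>)) \<le> 2 * \<kappa> * ?B" by (simp only:)
    thus "\<bar>- (\<kappa> * (\<alpha> - 1)) * t powr (- \<alpha>)\<bar> * (Cw * \<mu>) \<le> ?A"
      using \<kappa>0 \<alpha>1 CM by (simp add: abs_mult mult.assoc)
    have "\<kappa> * (\<alpha> - 1) * \<alpha> * (t powr (1 - \<alpha> - 2) * (Cw * \<mu>) powr 2) \<le> 2 * \<kappa> * ?B"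
      by (rule mult_mono[OF c(3) pw[OF t0(1), of 2]]) (use \<kappa>0 in auto)
    moreover have "1 - \<alpha> - 2 = - 1 - \<alpha>" by simp
    moreover have "(Cw * \<mu>) powr 2 = (Cw * \<mu>)\<^sup>2" using CM by (simp only: powr_numeral)
    ultimately have "\<kappa> * (\<alpha> - 1) * \<alpha> * (t powr (- 1 - \<alpha>) * (Cw * \<mu>)\<^sup>2) \<le> 2 * \<kappa> * ?B" by (simp only:)
    thus "\<bar>\<kappa> * (\<alpha> - 1) * \<alpha> * t powr (- 1 - \<alpha>)\<bar> * (Cw * \<mu>)\<^sup>2 \<le> ?A"
      using \<kappa>0 \<alpha>1 by (simp add: abs_mult mult.assoc)
  qed
  thus ?thesis by (simp add: mult.assoc)
qed

end

section \<open>Cell integrals under diagonal shifts\<close>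

context frac_data
begin

text \<open>The second difference of \<open>P N\<close> is taken along the diagonals \<open>(p, j) = (X N (i + d), j + d)\<close>,
  which keeps the singularity of the kernel in place.\<close>

definition Tc :: "nat \<Rightarrow> real \<Rightarrow> nat \<Rightarrow> real" where
  "Tc N p j = integral {X N (j - 1)..X N j} (\<lambda>y. K (p - y) * E N y)"

text \<open>The integrand of \<open>Tc\<close> after the substitution y = X_{j-1} + \<theta> H_j.
  One step comes from the substitution and two from the interpolation error. It is written as a
  product so that \<open>S3_mult\<close> applies factor by factor.\<close>

definition Tg :: "nat \<Rightarrow> real \<Rightarrow> nat \<Rightarrow> real \<Rightarrow> real" where
  "Tg N p j \<theta> = \<theta> * (1 - \<theta>) * (H N j * H N j * H N j * V (X N (j - 1)) (X N j) \<theta> * K (p - (X N (j - 1) + \<theta> * H N j)))"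

lemma T_repr:
  assumes N: "1 \<le> N" and j: "2 \<le> j" "j \<le> 2 * N - 1"
  shows "(Tg N p j has_integral Tc N p j) {0..1}"
proof -
  have h: "0 < H N j" using step_pos N j by auto
  let ?a = "X N (j - 1)" and ?b = "X N j"
  have ab: "?b - ?a = H N j" using j by (simp add: step_eq')
  have "continuous_on {?a..?b} (E N)"
    by (rule continuous_on_subset[OF E_cont[OF N]]) (use mesh_nonneg[of N "j - 1"] mesh_upper[of N j] N j in auto)
  hence "(\<lambda>y. K (p - y) * E N y) integrable_on {?a..?b}" by (rule K_mult_integrable)
  hence "((\<lambda>y. K (p - y) * E N y) has_integral Tc N p j) (cbox ?a ?b)" unfolding Tc_def by (simp add: integrable_integral)
  from has_integral_affinity'[OF this h, of ?a]
  have "((\<lambda>\<theta>. K (p - (H N j * \<theta> + ?a)) * E N (H N j * \<theta> + ?a)) has_integral Tc N p j / H N j) {0..1}"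
    using h ab by (simp add: divide_inverse_commute)
  hence "((\<lambda>\<theta>. H N j * (K (p - (H N j * \<theta> + ?a)) * E N (H N j * \<theta> + ?a))) has_integral H N j * (Tc N p j / H N j)) {0..1}"
    by (rule has_integral_mult_right)
  hence I: "((\<lambda>\<theta>. H N j * (K (p - (H N j * \<theta> + ?a)) * E N (H N j * \<theta> + ?a))) has_integral Tc N p j) {0..1}" using h by simp
  show ?thesis
  proof (rule has_integral_eq[OF _ I])
    fix \<theta> :: real assume \<theta>: "\<theta> \<in> {0..1}"
    have y: "H N j * \<theta> + ?a = ?a + \<theta> * H N j" by simp
    show "H N j * (K (p - (H N j * \<theta> + ?a)) * E N (H N j * \<theta> + ?a)) = Tg N p j \<theta>"
    proof (cases "\<theta> = 0 \<or> \<theta> = 1")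
      case True
      have "?a + 1 * H N j = ?b" using ab by simp
      hence "E N (?a + \<theta> * H N j) = 0" using E_cell[OF N, of j \<theta>] j True \<theta> by auto
      thus ?thesis unfolding y Tg_def using True by auto
    next
      case False
      hence "E N (?a + \<theta> * H N j) = (H N j)\<^sup>2 * (\<theta> * (1 - \<theta>)) * V ?a ?b \<theta>"
        using E_cell_V[OF N j, of \<theta>] \<theta> by auto
      thus ?thesis unfolding y Tg_def by (simp add: power2_eq_square mult_ac)
    qed
  qed
qed

definition CA :: real where "CA = 8 powr (4 * r) * Cy\<^sup>2"

lemma CA_pos: "0 < CA" using Cy_ge(1) by (simp add: CA_def)

text \<open>Brings the bounds on the derivatives of u of order e = 2, 3, 4, multiplied by the power
  of the argument size that \<open>S3_comp\<close> demands, to the common size of u''.\<close>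

lemma inner_powr:
  assumes z: "0 < (z::real)" and b: "z / 8 powr r \<le> b" and e: "2 \<le> e" "e \<le> 4"
  shows "b powr (\<sigma> - e) * (Cy * z) powr (e - 2) \<le> CA * z powr (\<sigma> - 2)"
proof -
  have "b powr (\<sigma> - e) \<le> (z / 8 powr r) powr (\<sigma> - e)"
    using b z e \<sigma>\<alpha> \<alpha>2 by (intro powr_mono2') auto
  also have "\<dots> = z powr (\<sigma> - e) * 8 powr (r * (e - \<sigma>))"
  proof -
    have "(z / 8 powr r) powr d = z powr d * 8 powr (r * (- d))" for d
      using z powr_divide[of z "8 powr r" d] by (simp add: powr_powr powr_minus_divide)
    from this[of "\<sigma> - e"] show ?thesis by simp
  qed
  also have "8 powr (r * (e - \<sigma>)) \<le> 8 powr (4 * r)"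
    using r1 e \<sigma>0 mult_left_mono[of "e - \<sigma>" 4 r] by (intro powr_mono) (auto simp: mult.commute)
  finally have 1: "b powr (\<sigma> - e) \<le> z powr (\<sigma> - e) * 8 powr (4 * r)" by (simp add: mult_left_mono)
  have "Cy powr (e - 2) \<le> Cy powr 2" using Cy_ge(1) e by (intro powr_mono) auto
  hence 2: "(Cy * z) powr (e - 2) \<le> Cy\<^sup>2 * z powr (e - 2)" using z Cy_ge(1) by (simp add: powr_mult powr_numeral)
  have "b powr (\<sigma> - e) * (Cy * z) powr (e - 2) \<le> (z powr (\<sigma> - e) * 8 powr (4 * r)) * (Cy\<^sup>2 * z powr (e - 2))"
    by (rule mult_mono[OF 1 2]) auto
  also have "\<dots> = CA * (z powr (\<sigma> - e) * z powr (e - 2))" by (simp add: CA_def)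
  also have "z powr (\<sigma> - e) * z powr (e - 2) = z powr (\<sigma> - 2)" by (simp add: powr_add[symmetric])
  finally show ?thesis .
qed

text \<open>The composition of u'' with a point moving along with its cell; this is where the bounds
  on the third and fourth derivatives of u enter.\<close>

lemma u2_S3:
  assumes i: "1 \<le> i" "i \<le> N" and w: "win N i (j - 1)" "win N i j" "win N i (j + 1)" and weight: "1 \<le> \<omega>" and s: "0 \<le> s" "s \<le> 1"
  shows "S3 (2 * (CA * C0 * X N i powr (\<sigma> - 2))) (1 / real i) \<omega> (u2 ((1 - s) * X N (j - 2) + s * X N (j - 1)))
     (u2 ((1 - s) * X N (j - 1) + s * X N j)) (u2 ((1 - s) * X N j + s * X N (j + 1)))"
proof (rule S3_comp[OF node_S3[OF i w weight s], where lo="X N (j - 2)" and hi="X N (j + 1)" and \<phi>'=u3 and \<phi>''=u4])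
  have Xi: "0 < X N i" using mesh_pos[of N i] i by simp
  show M: "0 < Cy * X N i" using Xi Cy_ge(1) by simp
  have j: "3 \<le> j" "j + 1 < 2 * N" using win_pred[OF i(1) w(1)] win_Suc[OF i(1) w(3)] by auto
  have mono: "X N (j - 2) \<le> X N (j - 1)" "X N (j - 1) \<le> X N j" "X N j \<le> X N (j + 1)"
    using j i by (auto intro!: mesh_le)
  have cv: "a \<le> (1 - s) * a + s * b \<and> (1 - s) * a + s * b \<le> b" if "a \<le> b" for a b :: real
    using convex_bound_le[of a b b "1 - s" s] convex_bound_le[of "-a" "-a" "-b" "1 - s" s] that s by auto
  show "(1 - s) * X N (j - 2) + s * X N (j - 1) \<in> {X N (j - 2)..X N (j + 1)}"
    "(1 - s) * X N (j - 1) + s * X N j \<in> {X N (j - 2)..X N (j + 1)}"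
    "(1 - s) * X N j + s * X N (j + 1) \<in> {X N (j - 2)..X N (j + 1)}"
    using cv[OF mono(1)] cv[OF mono(2)] cv[OF mono(3)] mono by auto
  fix z assume z: "z \<in> {X N (j - 2)..X N (j + 1)}"
  hence bz: "X N i / 8 powr r \<le> bdist T z" and zO: "z \<in> Omega T" using node_inner[OF i w] by auto
  show "(u2 has_real_derivative u3 z) (at z)" "(u3 has_real_derivative u4 z) (at z)" using du2 du3 zO by auto
  have b: "C0 * bdist T z powr (\<sigma> - e) * (Cy * X N i) powr (e - 2) \<le> CA * C0 * X N i powr (\<sigma> - 2)" if "2 \<le> e" "e \<le> 4" for e
    using mult_left_mono[OF inner_powr[OF Xi bz that] C0_nonneg] by (simp add: mult_ac)
  show "\<bar>u2 z\<bar> \<le> CA * C0 * X N i powr (\<sigma> - 2)" using bu2[OF zO] b[of 2] M Xi Cy_ge(1) by (auto split: if_splits)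
  show "\<bar>u3 z\<bar> * (Cy * X N i) \<le> CA * C0 * X N i powr (\<sigma> - 2)"
    using mult_right_mono[OF bu3[OF zO], of "Cy * X N i"] b[of 3] M by simp
  show "\<bar>u4 z\<bar> * (Cy * X N i)\<^sup>2 \<le> CA * C0 * X N i powr (\<sigma> - 2)"
  proof -
    have "(Cy * X N i) powr (4 - 2) = (Cy * X N i)\<^sup>2" using M powr_numeral[of "Cy * X N i" "num.Bit0 num.One"] by simp
    thus ?thesis using mult_right_mono[OF bu4[OF zO], of "(Cy * X N i)\<^sup>2"] b[of 4] by simp
  qed
qed (use weight in auto)

lemma V_S3:
  assumes i: "1 \<le> i" "i \<le> N" and w: "win N i (j - 1)" "win N i j" "win N i (j + 1)" and weight: "1 \<le> \<omega>" and \<theta>: "0 < \<theta>" "\<theta> < 1"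
  shows "S3 (2 * (CA * C0 * X N i powr (\<sigma> - 2))) (1 / real i) \<omega> (V (X N (j - 2)) (X N (j - 1)) \<theta>)
     (V (X N (j - 1)) (X N j) \<theta>) (V (X N j) (X N (j + 1)) \<theta>)"
  unfolding V_def
proof (rule S3_integral)
  have j: "3 \<le> j" "j + 1 < 2 * N" using win_pred[OF i(1) w(1)] win_Suc[OF i(1) w(3)] by auto
  have N1: "1 \<le> N" using i by simp
  have p: "0 < X N (j - 2)" "X N (j + 1) < 2 * T" "X N (j - 2) \<le> X N (j - 1)" "X N (j - 1) \<le> X N j" "X N j \<le> X N (j + 1)"
    using j N1 mesh_less[of N "j + 1" "2 * N"] by (auto simp: mesh_end intro!: mesh_pos mesh_le)
  let ?v = "\<lambda>a b t. t * (\<theta> * u2 ((1 - t * \<theta>) * a + t * \<theta> * b) + (1 - \<theta>) * u2 (t * (1 - \<theta>) * a + (1 - t * (1 - \<theta>)) * b))"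
  show "?v (X N (j - 2)) (X N (j - 1)) integrable_on {0..1}" "?v (X N (j - 1)) (X N j) integrable_on {0..1}"
    "?v (X N j) (X N (j + 1)) integrable_on {0..1}"
    by (rule V_repr(1); use p \<theta> in linarith)+
  fix t :: real assume t: "t \<in> {0..1}"
  let ?A = "2 * (CA * C0 * X N i powr (\<sigma> - 2))"
  have A0: "0 \<le> ?A" using CA_pos C0_nonneg by simp
  have 1: "S3 ?A (1 / real i) \<omega> (u2 ((1 - t * \<theta>) * X N (j - 2) + t * \<theta> * X N (j - 1)))
     (u2 ((1 - t * \<theta>) * X N (j - 1) + t * \<theta> * X N j)) (u2 ((1 - t * \<theta>) * X N j + t * \<theta> * X N (j + 1)))"
    by (rule u2_S3[OF i w weight]) (use t \<theta> in \<open>auto simp: mult_le_one\<close>)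
  have s: "0 \<le> 1 - t * (1 - \<theta>)" "1 - t * (1 - \<theta>) \<le> 1" using t \<theta> by (auto simp: mult_le_one)
  have 2: "S3 ?A (1 / real i) \<omega> (u2 (t * (1 - \<theta>) * X N (j - 2) + (1 - t * (1 - \<theta>)) * X N (j - 1)))
     (u2 (t * (1 - \<theta>) * X N (j - 1) + (1 - t * (1 - \<theta>)) * X N j)) (u2 (t * (1 - \<theta>) * X N j + (1 - t * (1 - \<theta>)) * X N (j + 1)))"
    using u2_S3[OF i w weight s] by simp
  have "S3 (\<bar>t\<bar> * (\<bar>\<theta>\<bar> * ?A + \<bar>1 - \<theta>\<bar> * ?A)) (1 / real i) \<omega> (?v (X N (j - 2)) (X N (j - 1)) t) (?v (X N (j - 1)) (X N j) t) (?v (X N j) (X N (j + 1)) t)"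
    by (intro S3_cmult S3_add 1 2)
  moreover have "\<bar>t\<bar> * (\<bar>\<theta>\<bar> * ?A + \<bar>1 - \<theta>\<bar> * ?A) \<le> ?A"
  proof -
    have "\<bar>\<theta>\<bar> * ?A + \<bar>1 - \<theta>\<bar> * ?A = ?A" using \<theta> by (simp add: algebra_simps)
    thus ?thesis using t A0 mult_right_mono[of t 1 ?A] by simp
  qed
  ultimately show "S3 ?A (1 / real i) \<omega> (?v (X N (j - 2)) (X N (j - 1)) t) (?v (X N (j - 1)) (X N j) t) (?v (X N j) (X N (j + 1)) t)"
    by (rule S3_mono) (use weight in auto)
qed

text \<open>Four applications of \<open>S3_mult\<close> give 4^4, \<open>V_S3\<close> gives 2
  \<open>CA\<close> and \<open>K_S3\<close> gives 4 \<kappa> Cw^5; three steps contribute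
  Cw^3.\<close>

definition CT :: real where "CT = 2048 * \<kappa> * Cw ^ 8 * CA"

text \<open>The scale \<mu> of the distance may depend on \<theta>, because the distance vanishes at
  an end of a cell that touches the node. The factor \<theta> (1 - \<theta>) of the interpolation
  error compensates for this, so the bound \<open>B\<close> is uniform in \<theta>.\<close>

lemma T_S3_core:
  assumes i: "1 \<le> i" "i \<le> N" and w: "win N i (j - 1)" "win N i j" "win N i (j + 1)"
    and weight: "1 \<le> \<omega>" "j + 1 \<le> N \<or> N + 2 \<le> j \<or> 2 * real i \<le> \<omega>"
    and B: "0 \<le> B"
    and D: "\<And>\<theta>. 0 < \<theta> \<Longrightarrow> \<theta> < 1 \<Longrightarrow> \<exists>\<mu>>0. \<theta> * (1 - \<theta>) * \<mu> powr (1 - \<alpha>) \<le> B \<and>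
      S3 (Cw * \<mu>) (1 / real i) \<omega> \<bar>pa - (X N (j - 2) + \<theta> * H N (j - 1))\<bar> \<bar>pb - (X N (j - 1) + \<theta> * H N j)\<bar> \<bar>pc - (X N j + \<theta> * H N (j + 1))\<bar> \<and>
      \<mu> / Cw \<le> \<bar>pa - (X N (j - 2) + \<theta> * H N (j - 1))\<bar> \<and> \<mu> / Cw \<le> \<bar>pb - (X N (j - 1) + \<theta> * H N j)\<bar> \<and> \<mu> / Cw \<le> \<bar>pc - (X N j + \<theta> * H N (j + 1))\<bar>"
  shows "S3 (CT * C0 * X N i powr (\<sigma> - 2) * eta N i ^ 3 * B) (1 / real i) \<omega> (Tc N pa (j - 1)) (Tc N pb j) (Tc N pc (j + 1))"
proof -
  have j: "3 \<le> j" "j + 1 < 2 * N" using win_pred[OF i(1) w(1)] win_Suc[OF i(1) w(3)] by auto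
  have N1: "1 \<le> N" using i by simp
  have eta: "0 < eta N i" by (rule eta_pos[OF i])
  have I: "(Tg N pa (j - 1) has_integral Tc N pa (j - 1)) {0..1}" "(Tg N pb j has_integral Tc N pb j) {0..1}"
     "(Tg N pc (j + 1) has_integral Tc N pc (j + 1)) {0..1}"
    by (rule T_repr[OF N1]; use j in linarith)+
  let ?M = "CT * C0 * X N i powr (\<sigma> - 2) * eta N i ^ 3 * B"
  have CT0: "0 \<le> CT" using \<kappa>0 CA_pos by (simp add: CT_def)
  have M0: "0 \<le> ?M" using CT0 C0_nonneg eta B by simp
  have S: "S3 ?M (1 / real i) \<omega> (Tg N pa (j - 1) \<theta>) (Tg N pb j \<theta>) (Tg N pc (j + 1) \<theta>)" if \<theta>: "\<theta> \<in> {0..1}" for \<theta>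
  proof (cases "\<theta> = 0 \<or> \<theta> = 1")
    case True
    hence "Tg N pa (j - 1) \<theta> = 0" "Tg N pb j \<theta> = 0" "Tg N pc (j + 1) \<theta> = 0" by (auto simp: Tg_def)
    thus ?thesis using M0 weight by (simp add: S3_zero)
  next
    case False
    hence \<theta>': "0 < \<theta>" "\<theta> < 1" using \<theta> by auto
    obtain \<mu> where \<mu>: "0 < \<mu>" "\<theta> * (1 - \<theta>) * \<mu> powr (1 - \<alpha>) \<le> B"
      "S3 (Cw * \<mu>) (1 / real i) \<omega> \<bar>pa - (X N (j - 2) + \<theta> * H N (j - 1))\<bar> \<bar>pb - (X N (j - 1) + \<theta> * H N j)\<bar> \<bar>pc - (X N j + \<theta> * H N (j + 1))\<bar>"
      "\<mu> / Cw \<le> \<bar>pa - (X N (j - 2) + \<theta> * H N (j - 1))\<bar>" "\<mu> / Cw \<le> \<bar>pb - (X N (j - 1) + \<theta> * H N j)\<bar>" "\<mu> / Cw \<le> \<bar>pc - (X N j + \<theta> * H N (j + 1))\<bar>"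
      using D[OF \<theta>'] by blast
    have e: "0 \<le> 1 / real i" by simp
    have Kabs: "K \<bar>x\<bar> = K x" for x by (simp add: K_eq)
    have SK: "S3 (4 * \<kappa> * Cw ^ 5 * \<mu> powr (1 - \<alpha>)) (1 / real i) \<omega> (K (pa - (X N (j - 2) + \<theta> * H N (j - 1))))
      (K (pb - (X N (j - 1) + \<theta> * H N j))) (K (pc - (X N j + \<theta> * H N (j + 1))))"
      using K_S3[OF \<mu>(3,1) e weight(1) \<mu>(4-6)] by (simp add: Kabs)
    have SH: "S3 (Cw * eta N i) (1 / real i) \<omega> (H N (j - 1)) (H N j) (H N (j + 1))"
      by (rule step_S3[OF i w weight])
    have SV: "S3 (2 * (CA * C0 * X N i powr (\<sigma> - 2))) (1 / real i) \<omega> (V (X N (j - 2)) (X N (j - 1)) \<theta>)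
      (V (X N (j - 1)) (X N j) \<theta>) (V (X N j) (X N (j + 1)) \<theta>)"
      by (rule V_S3[OF i w weight(1) \<theta>'])
    note SHH = S3_mult[OF SH SH e weight(1)]
    note SHHH = S3_mult[OF SHH SH e weight(1)]
    note SHV = S3_mult[OF SHHH SV e weight(1)]
    note S = S3_cmult[OF S3_mult[OF SHV SK e weight(1)], of "\<theta> * (1 - \<theta>)"]
    have jj: "j - 1 - 1 = j - 2" "j + 1 - 1 = j" using j by auto
    let ?M' = "\<bar>\<theta> * (1 - \<theta>)\<bar> * (4 * (4 * (4 * (4 * (Cw * eta N i * (Cw * eta N i)) * (Cw * eta N i)) * (2 * (CA * C0 * X N i powr (\<sigma> - 2)))) * (4 * \<kappa> * Cw ^ 5 * \<mu> powr (1 - \<alpha>))))"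
    have S': "S3 ?M' (1 / real i) \<omega> (Tg N pa (j - 1) \<theta>) (Tg N pb j \<theta>) (Tg N pc (j + 1) \<theta>)"
      using S unfolding Tg_def jj .
    have "?M' = CT * C0 * X N i powr (\<sigma> - 2) * eta N i ^ 3 * (\<theta> * (1 - \<theta>) * \<mu> powr (1 - \<alpha>))"
      using \<theta>' by (simp add: CT_def abs_mult eval_nat_numeral mult_ac)
    also have "\<dots> \<le> ?M" using \<mu>(2) CT0 C0_nonneg eta by (intro mult_left_mono) auto
    finally show ?thesis by (rule S3_mono[OF S']) (use weight in auto)
  qed
  have "S3 ?M (1 / real i) \<omega> (integral {0..1} (Tg N pa (j - 1))) (integral {0..1} (Tg N pb j)) (integral {0..1} (Tg N pc (j + 1)))"
    by (rule S3_integral) (use I S in auto)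
  thus ?thesis using I by (simp add: integral_unique)
qed

end

section \<open>Weights of the near cells and their sum\<close>

lemma sum_atLeastAtMost_Suc_shift:
  fixes g :: "nat \<Rightarrow> real"
  assumes "a \<le> b + 1"
  shows "(\<Sum>j = a..b. g (j + 1)) = (\<Sum>j = a..b. g j) - g a + g (b + 1)"
proof -
  have "(\<Sum>j = a..b. g (j + 1)) = (\<Sum>j = a + 1..b + 1. g j)"
    using sum.shift_bounds_cl_nat_ivl[of g a 1 b] by simp
  moreover have "(\<Sum>j = a..b + 1. g j) = (\<Sum>j = a..b. g j) + g (b + 1)" using assms by (cases "a = b + 1") auto
  moreover have "(\<Sum>j = a..b + 1. g j) = g a + (\<Sum>j = a + 1..b + 1. g j)"
    using assms by (intro sum.atLeast_Suc_atMost[of a "b + 1" g, simplified Suc_eq_plus1])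
  ultimately show ?thesis by linarith
qed

lemma sum_powr_le:
  fixes \<beta> :: real
  assumes \<beta>: "0 < \<beta>" "\<beta> < 1"
  shows "(\<Sum>k = 1..n. real k powr (\<beta> - 1)) \<le> real n powr \<beta> / \<beta>"
proof (induction n)
  case (Suc n)
  have "real (Suc n) powr (\<beta> - 1) \<le> (real (Suc n) powr \<beta> - real n powr \<beta>) / \<beta>"
  proof (cases "n = 0")
    case False
    have "\<exists>z>real n. z < real (Suc n) \<and> real (Suc n) powr \<beta> - real n powr \<beta> = (real (Suc n) - real n) * (\<beta> * z powr (\<beta> - 1))"
      by (rule MVT2) (use False in \<open>auto intro!: has_real_derivative_powr\<close>)
    then obtain z where z: "real n < z" "z < real (Suc n)" "real (Suc n) powr \<beta> - real n powr \<beta> = \<beta> * z powr (\<beta> - 1)" by auto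
    have "real (Suc n) powr (\<beta> - 1) \<le> z powr (\<beta> - 1)" using z \<beta> by (intro powr_mono2') auto
    thus ?thesis unfolding z(3) using \<beta> by simp
  qed (use \<beta> in simp)
  thus ?case using Suc \<beta> by (simp add: diff_divide_distrib)
qed (use \<beta> in simp)

lemma sum_powr_tail_le:
  fixes \<alpha> :: real
  assumes \<alpha>: "1 < \<alpha>" and \<nu>: "1 \<le> \<nu>"
  shows "(\<Sum>k = \<nu>..n. real k powr (- \<alpha>)) \<le> \<alpha> / (\<alpha> - 1) * real \<nu> powr (1 - \<alpha>)"
proof (cases "\<nu> \<le> n")
  case True
  have "(\<Sum>k = \<nu>..n. real k powr (- \<alpha>)) \<le> real \<nu> powr (- \<alpha>) + (real \<nu> powr (1 - \<alpha>) - real n powr (1 - \<alpha>)) / (\<alpha> - 1)"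
    using True
  proof (induction n rule: nat_induct_at_least)
    case (Suc n)
    have n0: "0 < n" using Suc \<nu> by simp
    have "\<exists>z>real n. z < real (Suc n) \<and> real (Suc n) powr (1 - \<alpha>) - real n powr (1 - \<alpha>) = (real (Suc n) - real n) * ((1 - \<alpha>) * z powr (1 - \<alpha> - 1))"
    proof (rule MVT2)
      show "((\<lambda>a. a powr (1 - \<alpha>)) has_real_derivative (1 - \<alpha>) * x powr (1 - \<alpha> - 1)) (at x)" if "real n \<le> x" for x
        by (rule has_real_derivative_powr) (use n0 that in linarith)
    qed simp
    then obtain z where z: "real n < z" "z < real (Suc n)" "real (Suc n) powr (1 - \<alpha>) - real n powr (1 - \<alpha>) = (1 - \<alpha>) * z powr (- \<alpha>)" by auto
    have "real (Suc n) powr (- \<alpha>) \<le> z powr (- \<alpha>)" using z \<alpha> by (intro powr_mono2') auto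
    also have "z powr (- \<alpha>) = (real n powr (1 - \<alpha>) - real (Suc n) powr (1 - \<alpha>)) / (\<alpha> - 1)"
    proof -
      have "real n powr (1 - \<alpha>) - real (Suc n) powr (1 - \<alpha>) = (\<alpha> - 1) * z powr (- \<alpha>)" using z(3) by (simp add: algebra_simps)
      thus ?thesis using \<alpha> by simp
    qed
    finally show ?case using Suc by (simp add: diff_divide_distrib)
  qed simp
  also have "\<dots> \<le> real \<nu> powr (1 - \<alpha>) + real \<nu> powr (1 - \<alpha>) / (\<alpha> - 1)"
    using \<nu> \<alpha> by (intro add_mono powr_mono divide_right_mono) auto
  also have "\<dots> = (1 + 1 / (\<alpha> - 1)) * real \<nu> powr (1 - \<alpha>)" by (simp add: algebra_simps)
  also have "1 + 1 / (\<alpha> - 1) = \<alpha> / (\<alpha> - 1)" using \<alpha> by (simp add: field_simps)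
  finally show ?thesis .
qed (use \<alpha> in auto)

context frac_data
begin

text \<open>On the cell \<open>j\<close> the kernel at \<open>X N i\<close> has the size of \<open>(cell_dist i j * eta N i) powr (1 - \<alpha>)\<close>.
  A second difference along the diagonal loses a factor \<open>i\<close> when a mesh step next to the kink is
  involved, and \<open>i / cell_dist i j\<close> when only the distance of the cell from \<open>X N i\<close> involves the kink.\<close>

definition cell_dist :: "nat \<Rightarrow> nat \<Rightarrow> nat" where "cell_dist i j = (if j \<le> i then i + 1 - j else j - i)"

text \<open>The shifted triple uses indices up to max i j + 1, and it reaches beyond T when this
  number exceeds N.\<close>

definition cross :: "nat \<Rightarrow> nat \<Rightarrow> nat \<Rightarrow> bool" where "cross N i j \<longleftrightarrow> N \<le> max i j"

definition weight :: "nat \<Rightarrow> nat \<Rightarrow> nat \<Rightarrow> real" where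
  "weight N i j = (if \<not> cross N i j then 1 else if j = N \<or> j = N + 1 then 4 * real i else 4 * real i / real (cell_dist i j))"

text \<open>The threshold 8 for large indices comes from here: the smallest admissible j is about i
  / 2 - 2, and 8 (i / 2 - 2) \<ge> i + 8 amounts to i \<ge> 8.\<close>

lemma window_near:
  assumes i: "8 \<le> i" "i \<le> N" and j: "i - i div 2 - 2 \<le> j" "j \<le> i + i div 2 + 2"
  shows "win N i j"
proof -
  have m: "2 * (i div 2) \<le> i" "i \<le> 2 * (i div 2) + 1" by auto
  show ?thesis unfolding win_def using i j m by linarith
qed

text \<open>In a cell that touches the node the distance is proportional to \<theta>. One factor
  \<theta> of the interpolation error turns the singular power into \<theta> powr (2 - \<alpha>),
  which is at most 1.\<close>

lemma weight_powr:
  assumes "0 < \<theta>" "\<theta> < (1::real)" "1 \<le> k" "0 < \<eta>" "real k * \<theta> * \<eta> \<le> \<mu>"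
  shows "\<theta> * (1 - \<theta>) * \<mu> powr (1 - \<alpha>) \<le> (real k * \<eta>) powr (1 - \<alpha>)"
proof -
  have pos: "0 < real k * \<theta> * \<eta>" using assms by simp
  have "\<mu> powr (1 - \<alpha>) \<le> (real k * \<theta> * \<eta>) powr (1 - \<alpha>)" using assms pos \<alpha>1 by (intro powr_mono2') auto
  also have "\<dots> = (real k * \<eta>) powr (1 - \<alpha>) * \<theta> powr (1 - \<alpha>)"
    using assms by (simp add: powr_mult mult_ac)
  finally have "\<theta> * (1 - \<theta>) * \<mu> powr (1 - \<alpha>) \<le> \<theta> * (1 - \<theta>) * ((real k * \<eta>) powr (1 - \<alpha>) * \<theta> powr (1 - \<alpha>))"
    using assms by (intro mult_left_mono) auto
  also have "\<dots> = (1 - \<theta>) * \<theta> powr (2 - \<alpha>) * (real k * \<eta>) powr (1 - \<alpha>)"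
    using powr_add[of \<theta> 1 "1 - \<alpha>"] assms by simp
  also have "\<dots> \<le> 1 * 1 * (real k * \<eta>) powr (1 - \<alpha>)"
    using assms \<alpha>2 by (intro mult_right_mono mult_mono powr_le1) auto
  finally show ?thesis by simp
qed

text \<open>The weight contains 4 i although \<open>gap_S3\<close> asks for 2 i: the distance is a
  mixture of gaps of k and k - 1 cells with k = \<open>cell_dist i j\<close>, and k \<le> 2 (k - 1)
  as soon as the smaller gap is not empty.\<close>

lemma weight_props:
  assumes i: "8 \<le> i" "i \<le> N" and j: "i - i div 2 - 1 \<le> j" "j \<le> i + i div 2 + 1"
  shows "1 \<le> weight N i j" "1 \<le> cell_dist i j" "j + 1 \<le> N \<or> N + 2 \<le> j \<or> 2 * real i \<le> weight N i j"
    "max i j + 1 \<le> N \<or> 4 * real i \<le> real (cell_dist i j) * weight N i j"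
proof -
  have m: "2 * (i div 2) \<le> i" "i \<le> 2 * (i div 2) + 1" by auto
  show k: "1 \<le> cell_dist i j" by (auto simp: cell_dist_def)
  have "cell_dist i j \<le> 4 * i" using i j m by (auto simp: cell_dist_def)
  hence kr: "real (cell_dist i j) \<le> 4 * real i" by linarith
  have kpos: "0 < real (cell_dist i j)" using k by simp
  show "1 \<le> weight N i j" using kr kpos i by (auto simp: weight_def)
  show "j + 1 \<le> N \<or> N + 2 \<le> j \<or> 2 * real i \<le> weight N i j"
    by (auto simp: weight_def cross_def)
  show "max i j + 1 \<le> N \<or> 4 * real i \<le> real (cell_dist i j) * weight N i j"
  proof (cases "cross N i j")
    case True
    have "4 * real i \<le> real (cell_dist i j) * weight N i j"
    proof (cases "j = N \<or> j = N + 1")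
      case sp: True
      have "1 * (4 * real i) \<le> real (cell_dist i j) * (4 * real i)" using k by (intro mult_right_mono) auto
      thus ?thesis using True sp by (simp add: weight_def)
    qed (use True kpos in \<open>simp add: weight_def\<close>)
    thus ?thesis ..
  qed (auto simp: cross_def)
qed

text \<open>The distance from the node to a point of the cell is a convex combination of a gap of k
  - 1 and one of k cells, so it inherits its behaviour under diagonal shifts from
  \<open>gap_S3\<close>.\<close>

lemma T_S3_right:
  assumes i: "8 \<le> i" "i \<le> N" and j: "i < j" "j \<le> i + i div 2 + 1"
  shows "S3 (CT * C0 * X N i powr (\<sigma> - 2) * eta N i ^ 3 * (real (cell_dist i j) * eta N i) powr (1 - \<alpha>)) (1 / real i) (weight N i j)
    (Tc N (X N (i - 1)) (j - 1)) (Tc N (X N i) j) (Tc N (X N (i + 1)) (j + 1))"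
proof -
  have i1: "1 \<le> i" using i by simp
  have m: "2 * (i div 2) \<le> i" "i \<le> 2 * (i div 2) + 1" by auto
  have W: "win N i n" if "i \<le> n + 1" "n \<le> j + 1" for n
    by (rule window_near[OF i]) (use that i j m in linarith)+
  define k where "k = j - i"
  have k: "1 \<le> k" "j = i + k" "cell_dist i j = k" using j by (auto simp: k_def cell_dist_def)
  have op: "1 \<le> weight N i j" "j + 1 \<le> N \<or> N + 2 \<le> j \<or> 2 * real i \<le> weight N i j" "max i j + 1 \<le> N \<or> 4 * real i \<le> real k * weight N i j"
    using weight_props[OF i, of j] j k m by auto
  have eta: "0 < eta N i" by (rule eta_pos[OF i1 i(2)])
  have g1: "S3 (real (k - 1) * (Cw * eta N i)) (1 / real i) (weight N i j) (X N (i - 1 + (k - 1)) - X N (i - 1)) (X N (i + (k - 1)) - X N i) (X N (i + 1 + (k - 1)) - X N (i + 1))"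
  proof (rule gap_S3[OF i1 i(2) i1 _ op(1)])
    have "2 * real i \<le> real (k - 1) * weight N i j" if "2 \<le> k" "4 * real i \<le> real k * weight N i j"
    proof -
      have "real k * weight N i j \<le> (2 * real (k - 1)) * weight N i j" using that op(1) by (intro mult_right_mono) auto
      also have "\<dots> = 2 * (real (k - 1) * weight N i j)" by simp
      finally show ?thesis using that by linarith
    qed
    moreover have "k = 1 \<or> 2 \<le> k" using k by linarith
    ultimately show "i + (k - 1) + 1 \<le> N \<or> k - 1 = 0 \<or> 2 * real i \<le> real (k - 1) * weight N i j" using op(3) k by auto
  qed (use W k in auto)
  have g2: "S3 (real k * (Cw * eta N i)) (1 / real i) (weight N i j) (X N (i - 1 + k) - X N (i - 1)) (X N (i + k) - X N i) (X N (i + 1 + k) - X N (i + 1))"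
    by (rule gap_S3[OF i1 i(2) i1 _ op(1)]) (use W k op(3) i1 in auto)
  have lo: "real q * (eta N i / Cw) \<le> X N (l + q) - X N l" if "l \<in> {i - 1, i, i + 1}" "q \<le> k" for l q
    by (rule gap_bounds(1)[OF i1 i(2)]) (use W k that i1 in auto)
  show ?thesis unfolding k(3)
  proof (rule T_S3_core[OF i1 i(2)])
    show "win N i (j - 1)" "win N i j" "win N i (j + 1)" by (rule W; use j in linarith)+
    fix \<theta> :: real assume \<theta>: "0 < \<theta>" "\<theta> < 1"
    \<comment> \<open>The same convex combination with every cell replaced by
      \<open>eta N i\<close>; upper and lower bounds of the two gaps then combine without further
      loss.\<close>
    define \<mu> where "\<mu> = (real (k - 1) * (1 - \<theta>) + real k * \<theta>) * eta N i"
    have mu1: "real k * \<theta> * eta N i \<le> \<mu>" unfolding \<mu>_def using \<theta> eta by (intro mult_right_mono) auto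
    have mu0: "0 < \<mu>" using mu1 \<theta> eta k by (smt (verit) mult_pos_pos of_nat_0_less_iff zero_less_one less_le_trans Suc_le_eq One_nat_def)
    have D: "X N (l + (k - 1)) + \<theta> * H N (l + k) - X N l = (1 - \<theta>) * (X N (l + (k - 1)) - X N l) + \<theta> * (X N (l + k) - X N l)" for l
      using k by (simp add: step_eq' algebra_simps)
    have g: "S3 (\<bar>1 - \<theta>\<bar> * (real (k - 1) * (Cw * eta N i)) + \<bar>\<theta>\<bar> * (real k * (Cw * eta N i))) (1 / real i) (weight N i j)
      ((1 - \<theta>) * (X N (i - 1 + (k - 1)) - X N (i - 1)) + \<theta> * (X N (i - 1 + k) - X N (i - 1)))
      ((1 - \<theta>) * (X N (i + (k - 1)) - X N i) + \<theta> * (X N (i + k) - X N i))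
      ((1 - \<theta>) * (X N (i + 1 + (k - 1)) - X N (i + 1)) + \<theta> * (X N (i + 1 + k) - X N (i + 1)))"
      by (intro S3_add S3_cmult g1 g2)
    have M: "\<bar>1 - \<theta>\<bar> * (real (k - 1) * (Cw * eta N i)) + \<bar>\<theta>\<bar> * (real k * (Cw * eta N i)) = Cw * \<mu>"
      using \<theta> by (simp add: \<mu>_def algebra_simps)
    have low: "\<mu> / Cw \<le> X N (l + (k - 1)) + \<theta> * H N (l + k) - X N l" if "l \<in> {i - 1, i, i + 1}" for l
    proof -
      have "\<mu> / Cw = (1 - \<theta>) * (real (k - 1) * (eta N i / Cw)) + \<theta> * (real k * (eta N i / Cw))"
        by (simp add: \<mu>_def algebra_simps add_divide_distrib diff_divide_distrib)
      also have "\<dots> \<le> (1 - \<theta>) * (X N (l + (k - 1)) - X N l) + \<theta> * (X N (l + k) - X N l)"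
        using lo[OF that] \<theta> by (intro add_mono mult_left_mono) auto
      finally show ?thesis unfolding D .
    qed
    have abs: "\<bar>X N l - (X N (l + (k - 1)) + \<theta> * H N (l + k))\<bar> = X N (l + (k - 1)) + \<theta> * H N (l + k) - X N l"
      if "l \<in> {i - 1, i, i + 1}" for l
      using low[OF that] mu0 Cw_ge(1) by (smt (verit) divide_pos_pos)
    have idx: "j - 2 = i - 1 + (k - 1)" "j - 1 = i - 1 + k" "j - 1 = i + (k - 1)" "j = i + k" "j = i + 1 + (k - 1)" "j + 1 = i + 1 + k"
      using k i1 by auto
    have XH: "X N (j - 2) = X N (i - 1 + (k - 1))" "H N (j - 1) = H N (i - 1 + k)" "X N (j - 1) = X N (i + (k - 1))"
      "H N j = H N (i + k)" "X N j = X N (i + 1 + (k - 1))" "H N (j + 1) = H N (i + 1 + k)"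
      using idx by metis+
    have a1: "\<bar>X N (i - 1) - (X N (j - 2) + \<theta> * H N (j - 1))\<bar> = X N (i - 1 + (k - 1)) + \<theta> * H N (i - 1 + k) - X N (i - 1)"
      unfolding XH(1,2) by (rule abs) simp
    have a2: "\<bar>X N i - (X N (j - 1) + \<theta> * H N j)\<bar> = X N (i + (k - 1)) + \<theta> * H N (i + k) - X N i"
      unfolding XH(3,4) by (rule abs) simp
    have a3: "\<bar>X N (i + 1) - (X N j + \<theta> * H N (j + 1))\<bar> = X N (i + 1 + (k - 1)) + \<theta> * H N (i + 1 + k) - X N (i + 1)"
      unfolding XH(5,6) by (rule abs) simp
    show "\<exists>\<mu>>0. \<theta> * (1 - \<theta>) * \<mu> powr (1 - \<alpha>) \<le> (real k * eta N i) powr (1 - \<alpha>) \<and>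
      S3 (Cw * \<mu>) (1 / real i) (weight N i j) \<bar>X N (i - 1) - (X N (j - 2) + \<theta> * H N (j - 1))\<bar> \<bar>X N i - (X N (j - 1) + \<theta> * H N j)\<bar> \<bar>X N (i + 1) - (X N j + \<theta> * H N (j + 1))\<bar> \<and>
      \<mu> / Cw \<le> \<bar>X N (i - 1) - (X N (j - 2) + \<theta> * H N (j - 1))\<bar> \<and> \<mu> / Cw \<le> \<bar>X N i - (X N (j - 1) + \<theta> * H N j)\<bar> \<and> \<mu> / Cw \<le> \<bar>X N (i + 1) - (X N j + \<theta> * H N (j + 1))\<bar>"
      unfolding a1 a2 a3
    proof (intro exI[of _ \<mu>] conjI mu0 low)
      show "\<theta> * (1 - \<theta>) * \<mu> powr (1 - \<alpha>) \<le> (real k * eta N i) powr (1 - \<alpha>)"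
        by (rule weight_powr[OF \<theta> k(1) eta mu1])
      show "S3 (Cw * \<mu>) (1 / real i) (weight N i j) (X N (i - 1 + (k - 1)) + \<theta> * H N (i - 1 + k) - X N (i - 1))
        (X N (i + (k - 1)) + \<theta> * H N (i + k) - X N i) (X N (i + 1 + (k - 1)) + \<theta> * H N (i + 1 + k) - X N (i + 1))"
        using g unfolding M D .
    qed auto
  qed (use op in auto)
qed

text \<open>As on the right, with gaps of k + 1 and k cells. The cell j = i touches the node at
  \<theta> = 1, so the roles of \<theta> and 1 - \<theta> are exchanged.\<close>

lemma T_S3_left:
  assumes i: "8 \<le> i" "i \<le> N" and j: "i - i div 2 - 1 \<le> j" "j \<le> i"
  shows "S3 (CT * C0 * X N i powr (\<sigma> - 2) * eta N i ^ 3 * (real (cell_dist i j) * eta N i) powr (1 - \<alpha>)) (1 / real i) (weight N i j)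
    (Tc N (X N (i - 1)) (j - 1)) (Tc N (X N i) j) (Tc N (X N (i + 1)) (j + 1))"
proof -
  have i1: "1 \<le> i" using i by simp
  have m: "2 * (i div 2) \<le> i" "i \<le> 2 * (i div 2) + 1" by auto
  have W: "win N i n" if "j \<le> n + 1" "n \<le> i + 1" for n
    by (rule window_near[OF i]) (use that i j m in linarith)+
  have j2: "2 \<le> j" using i j m by linarith
  define k where "k = i - j"
  have ik: "i = j + k" and kki: "cell_dist i j = k + 1" using j by (auto simp: k_def cell_dist_def)
  have jr: "j \<le> i + i div 2 + 1" using j by simp
  have op: "1 \<le> weight N i j" "j + 1 \<le> N \<or> N + 2 \<le> j \<or> 2 * real i \<le> weight N i j" "i + 1 \<le> N \<or> 4 * real i \<le> real (k + 1) * weight N i j"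
    using weight_props(1,3,4)[OF i j(1) jr] max.absorb1[OF j(2)] unfolding kki by simp_all
  have eta: "0 < eta N i" by (rule eta_pos[OF i1 i(2)])
  have g1: "S3 (real (k + 1) * (Cw * eta N i)) (1 / real i) (weight N i j) (X N (j - 1 - 1 + (k + 1)) - X N (j - 1 - 1)) (X N (j - 1 + (k + 1)) - X N (j - 1)) (X N (j - 1 + 1 + (k + 1)) - X N (j - 1 + 1))"
  proof (rule gap_S3[OF i1 i(2) _ _ op(1)])
    have "2 * real i \<le> real (k + 1) * weight N i j" if "4 * real i \<le> real (k + 1) * weight N i j" using that by linarith
    moreover have "j - 1 + (k + 1) + 1 \<le> N" if "i + 1 \<le> N" using that ik j2 by linarith
    ultimately show "j - 1 + (k + 1) + 1 \<le> N \<or> k + 1 = 0 \<or> 2 * real i \<le> real (k + 1) * weight N i j" using op(3) by blast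
    show "win N i n" if "j - 1 \<le> n" "n \<le> j - 1 + (k + 1) + 1" for n by (rule W) (use that ik j2 in linarith)+
  qed (use j2 in simp)
  have g2: "S3 (real k * (Cw * eta N i)) (1 / real i) (weight N i j) (X N (j - 1 + k) - X N (j - 1)) (X N (j + k) - X N j) (X N (j + 1 + k) - X N (j + 1))"
  proof (rule gap_S3[OF i1 i(2) _ _ op(1)])
    have "2 * real i \<le> real k * weight N i j" if "1 \<le> k" "4 * real i \<le> real (k + 1) * weight N i j"
    proof -
      have "real (k + 1) * weight N i j \<le> (2 * real k) * weight N i j" using that op(1) by (intro mult_right_mono) auto
      also have "\<dots> = 2 * (real k * weight N i j)" by simp
      finally show ?thesis using that by linarith
    qed
    moreover have "k = 0 \<or> 1 \<le> k" by linarith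
    moreover have "j + k + 1 \<le> N" if "i + 1 \<le> N" using that ik by linarith
    ultimately show "j + k + 1 \<le> N \<or> k = 0 \<or> 2 * real i \<le> real k * weight N i j" using op(3) by blast
    show "win N i n" if "j \<le> n" "n \<le> j + k + 1" for n by (rule W) (use that ik in linarith)+
  qed (use j2 in simp)
  have lo1: "real (k + 1) * (eta N i / Cw) \<le> X N (l + (k + 1)) - X N l" if l: "l \<in> {j - 2, j - 1, j}" for l
  proof (rule gap_bounds(1)[OF i1 i(2)])
    have l': "j \<le> l + 2" "l \<le> j" using l by auto
    show "win N i n" if "l < n" "n \<le> l + (k + 1)" for n by (rule W) (use that ik l' in linarith)+
  qed
  have lo2: "real k * (eta N i / Cw) \<le> X N (l + k) - X N l" if l: "l \<in> {j - 1, j, j + 1}" for l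
  proof (rule gap_bounds(1)[OF i1 i(2)])
    have l': "j \<le> l + 1" "l \<le> j + 1" using l by auto
    show "win N i n" if "l < n" "n \<le> l + k" for n by (rule W) (use that ik l' in linarith)+
  qed
  show ?thesis unfolding kki
  proof (rule T_S3_core[OF i1 i(2)])
    show "win N i (j - 1)" "win N i j" "win N i (j + 1)" by (rule W; use j in linarith)+
    fix \<theta> :: real assume \<theta>: "0 < \<theta>" "\<theta> < 1"
    define \<mu> where "\<mu> = (real (k + 1) * (1 - \<theta>) + real k * \<theta>) * eta N i"
    have mu1: "real (k + 1) * (1 - \<theta>) * eta N i \<le> \<mu>" unfolding \<mu>_def using \<theta> eta by (intro mult_right_mono) auto
    have mu0: "0 < \<mu>"
    proof -
      have "0 < real (k + 1) * (1 - \<theta>) * eta N i" using \<theta> eta by (intro mult_pos_pos) auto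
      thus ?thesis using mu1 by linarith
    qed
    have D: "X N (l + k + 1) - (X N l + \<theta> * H N (l + 1)) = (1 - \<theta>) * (X N (l + (k + 1)) - X N l) + \<theta> * (X N (l + 1 + k) - X N (l + 1))" for l
      by (simp add: step_eq' algebra_simps)
    have j1: "j - 1 - 1 = j - 2" "j - 1 + 1 = j" "j - 2 + 1 = j - 1" using j2 by auto
    have g: "S3 (\<bar>1 - \<theta>\<bar> * (real (k + 1) * (Cw * eta N i)) + \<bar>\<theta>\<bar> * (real k * (Cw * eta N i))) (1 / real i) (weight N i j)
      ((1 - \<theta>) * (X N (j - 2 + (k + 1)) - X N (j - 2)) + \<theta> * (X N (j - 2 + 1 + k) - X N (j - 2 + 1)))
      ((1 - \<theta>) * (X N (j - 1 + (k + 1)) - X N (j - 1)) + \<theta> * (X N (j - 1 + 1 + k) - X N (j - 1 + 1)))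
      ((1 - \<theta>) * (X N (j + (k + 1)) - X N j) + \<theta> * (X N (j + 1 + k) - X N (j + 1)))"
      using S3_add[OF S3_cmult[OF g1, of "1 - \<theta>"] S3_cmult[OF g2, of \<theta>]] unfolding j1 .
    have M: "\<bar>1 - \<theta>\<bar> * (real (k + 1) * (Cw * eta N i)) + \<bar>\<theta>\<bar> * (real k * (Cw * eta N i)) = Cw * \<mu>"
      using \<theta> by (simp add: \<mu>_def algebra_simps)
    have low: "\<mu> / Cw \<le> X N (l + k + 1) - (X N l + \<theta> * H N (l + 1))" if "l \<in> {j - 2, j - 1, j}" for l
    proof -
      have "\<mu> / Cw = (1 - \<theta>) * (real (k + 1) * (eta N i / Cw)) + \<theta> * (real k * (eta N i / Cw))"
        by (simp add: \<mu>_def algebra_simps add_divide_distrib diff_divide_distrib)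
      also have "\<dots> \<le> (1 - \<theta>) * (X N (l + (k + 1)) - X N l) + \<theta> * (X N (l + 1 + k) - X N (l + 1))"
      proof (intro add_mono mult_left_mono lo1 lo2)
        show "l + 1 \<in> {j - 1, j, j + 1}" using that j2 by auto
      qed (use that \<theta> in auto)
      finally show ?thesis unfolding D .
    qed
    have abs: "\<bar>X N (l + k + 1) - (X N l + \<theta> * H N (l + 1))\<bar> = X N (l + k + 1) - (X N l + \<theta> * H N (l + 1))"
      if "l \<in> {j - 2, j - 1, j}" for l
    proof -
      have "0 < \<mu> / Cw" using mu0 Cw_ge(1) by simp
      thus ?thesis using low[OF that] by linarith
    qed
    have idx: "i - 1 = j - 2 + k + 1" "i = j - 1 + k + 1" "i + 1 = j + k + 1"
      using ik j2 by linarith+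
    have a1: "\<bar>X N (i - 1) - (X N (j - 2) + \<theta> * H N (j - 1))\<bar> = X N (j - 2 + k + 1) - (X N (j - 2) + \<theta> * H N (j - 2 + 1))"
      using abs[of "j - 2"] unfolding idx(1) j1 by simp
    have a2: "\<bar>X N i - (X N (j - 1) + \<theta> * H N j)\<bar> = X N (j - 1 + k + 1) - (X N (j - 1) + \<theta> * H N (j - 1 + 1))"
      using abs[of "j - 1"] idx(2)[symmetric] unfolding j1 by simp
    have a3: "\<bar>X N (i + 1) - (X N j + \<theta> * H N (j + 1))\<bar> = X N (j + k + 1) - (X N j + \<theta> * H N (j + 1))"
      using abs[of j] unfolding idx(3) by simp
    show "\<exists>\<mu>>0. \<theta> * (1 - \<theta>) * \<mu> powr (1 - \<alpha>) \<le> (real (k + 1) * eta N i) powr (1 - \<alpha>) \<and>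
      S3 (Cw * \<mu>) (1 / real i) (weight N i j) \<bar>X N (i - 1) - (X N (j - 2) + \<theta> * H N (j - 1))\<bar> \<bar>X N i - (X N (j - 1) + \<theta> * H N j)\<bar> \<bar>X N (i + 1) - (X N j + \<theta> * H N (j + 1))\<bar> \<and>
      \<mu> / Cw \<le> \<bar>X N (i - 1) - (X N (j - 2) + \<theta> * H N (j - 1))\<bar> \<and> \<mu> / Cw \<le> \<bar>X N i - (X N (j - 1) + \<theta> * H N j)\<bar> \<and> \<mu> / Cw \<le> \<bar>X N (i + 1) - (X N j + \<theta> * H N (j + 1))\<bar>"
      unfolding a1 a2 a3
    proof (intro exI[of _ \<mu>] conjI mu0 low)
      have "(1 - \<theta>) * (1 - (1 - \<theta>)) * \<mu> powr (1 - \<alpha>) \<le> (real (k + 1) * eta N i) powr (1 - \<alpha>)"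
        by (rule weight_powr) (use \<theta> eta mu1 in auto)
      thus "\<theta> * (1 - \<theta>) * \<mu> powr (1 - \<alpha>) \<le> (real (k + 1) * eta N i) powr (1 - \<alpha>)" by (simp add: mult.commute)
      show "S3 (Cw * \<mu>) (1 / real i) (weight N i j) (X N (j - 2 + k + 1) - (X N (j - 2) + \<theta> * H N (j - 2 + 1)))
        (X N (j - 1 + k + 1) - (X N (j - 1) + \<theta> * H N (j - 1 + 1))) (X N (j + k + 1) - (X N j + \<theta> * H N (j + 1)))"
        using g unfolding M D .
    qed auto
  qed (use op in auto)
qed

lemma T_S3:
  assumes i: "8 \<le> i" "i \<le> N" and j: "i - i div 2 - 1 \<le> j" "j \<le> i + i div 2 + 1"
  shows "S3 (CT * C0 * X N i powr (\<sigma> - 2) * eta N i ^ 3 * (real (cell_dist i j) * eta N i) powr (1 - \<alpha>)) (1 / real i) (weight N i j)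
    (Tc N (X N (i - 1)) (j - 1)) (Tc N (X N i) j) (Tc N (X N (i + 1)) (j + 1))"
  using T_S3_left[OF i j(1)] T_S3_right[OF i _ j(2)] by (cases "j \<le> i") auto

text \<open>The distance from node i to T counted in cells, made positive so that negative powers of
  it make sense for i = N.\<close>

definition mid_dist :: "nat \<Rightarrow> nat \<Rightarrow> nat" where "mid_dist N i = max 1 (N - i)"

definition CC :: real where "CC = 4 * (2 * \<alpha> / (\<alpha> - 1) + 2)"

text \<open>Without the kink the sum of k powr (1 - \<alpha>) is of the order of i powr (2 -
  \<alpha>). Cells whose triples pass T add i times a tail of the sum of k powr (- \<alpha>)
  starting at \<open>mid_dist\<close>, and the two cells at T add i times \<open>mid_dist\<close>
  powr (1 - \<alpha>) each. Two tails and two cells make up \<open>CC\<close>.\<close>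

lemma weighted_sum:
  assumes i: "8 \<le> i" "i \<le> N"
  shows "(\<Sum>j = i - i div 2..i + i div 2. real (cell_dist i j) powr (1 - \<alpha>) * weight N i j)
     \<le> 2 / (2 - \<alpha>) * real i powr (2 - \<alpha>) + (if N \<le> i + i div 2 then CC * real i * real (mid_dist N i) powr (1 - \<alpha>) else 0)"
proof -
  let ?m = "i div 2"
  let ?J = "{i - ?m..i + ?m}"
  have m: "2 * ?m \<le> i" "i \<le> 2 * ?m + 1" "1 \<le> ?m" using i by auto
  have nu1: "1 \<le> mid_dist N i" by (simp add: mid_dist_def)
  have split: "(\<Sum>j\<in>?J. g (cell_dist i j) j) = (\<Sum>k = 1..?m + 1. g k (i + 1 - k)) + (\<Sum>k = 1..?m. g k (i + k))" for g :: "nat \<Rightarrow> nat \<Rightarrow> real"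
  proof -
    have "?J = {i - ?m..i} \<union> {i + 1..i + ?m}" using m by auto
    hence "(\<Sum>j\<in>?J. g (cell_dist i j) j) = (\<Sum>j = i - ?m..i. g (cell_dist i j) j) + (\<Sum>j = i + 1..i + ?m. g (cell_dist i j) j)"
      by (simp add: sum.union_disjoint)
    moreover have "(\<Sum>j = i - ?m..i. g (cell_dist i j) j) = (\<Sum>k = 1..?m + 1. g k (i + 1 - k))"
      by (rule sum.reindex_bij_witness[of _ "\<lambda>k. i + 1 - k" "\<lambda>j. i + 1 - j"]) (use m in \<open>auto simp: cell_dist_def\<close>)
    moreover have "(\<Sum>j = i + 1..i + ?m. g (cell_dist i j) j) = (\<Sum>k = 1..?m. g k (i + k))"
      by (rule sum.reindex_bij_witness[of _ "\<lambda>k. i + k" "\<lambda>j. j - i"]) (use m in \<open>auto simp: cell_dist_def\<close>)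
    ultimately show ?thesis by simp
  qed
  let ?c = "\<lambda>k j. if cross N i j then 4 * real i * real k powr (- \<alpha>) else 0"
  let ?s = "\<lambda>j. if j = N \<or> j = N + 1 then 4 * real i * real (mid_dist N i) powr (1 - \<alpha>) else 0"
  have tm: "real (cell_dist i j) powr (1 - \<alpha>) * weight N i j \<le> real (cell_dist i j) powr (1 - \<alpha>) + (?c (cell_dist i j) j + ?s j)"
    if j: "j \<in> ?J" for j
  proof -
    have k: "1 \<le> cell_dist i j" by (auto simp: cell_dist_def)
    consider "\<not> cross N i j" | "cross N i j" "j = N \<or> j = N + 1" | "cross N i j" "\<not> (j = N \<or> j = N + 1)" by blast
    thus ?thesis
    proof cases
      case 1
      thus ?thesis by (simp add: weight_def)
    next
      case 2
      have "mid_dist N i \<le> cell_dist i j" using 2(2) i by (auto simp: mid_dist_def cell_dist_def)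
      hence "real (cell_dist i j) powr (1 - \<alpha>) \<le> real (mid_dist N i) powr (1 - \<alpha>)" using nu1 \<alpha>1 by (intro powr_mono2') auto
      hence "real (cell_dist i j) powr (1 - \<alpha>) * (4 * real i) \<le> real (mid_dist N i) powr (1 - \<alpha>) * (4 * real i)" by (rule mult_right_mono) simp
      note h = this
      have o: "weight N i j = 4 * real i" and s: "?s j = real (mid_dist N i) powr (1 - \<alpha>) * (4 * real i)"
        using 2 by (auto simp: weight_def)
      have c0: "0 \<le> ?c (cell_dist i j) j" by simp
      have a0: "0 \<le> real (cell_dist i j) powr (1 - \<alpha>)" by simp
      from add_increasing[OF a0 add_increasing[OF c0 h]] show ?thesis unfolding o s .
    next
      case 3
      have "real (cell_dist i j) powr (1 - \<alpha>) = real (cell_dist i j) powr (- \<alpha>) * real (cell_dist i j)" using powr_add[of "real (cell_dist i j)" "- \<alpha>" 1] k by simp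
      thus ?thesis using 3 k by (simp add: weight_def)
    qed
  qed
  have A: "(\<Sum>j\<in>?J. real (cell_dist i j) powr (1 - \<alpha>)) \<le> 2 / (2 - \<alpha>) * real i powr (2 - \<alpha>)"
  proof -
    have p: "(\<Sum>k = 1..n. real k powr (1 - \<alpha>)) \<le> real i powr (2 - \<alpha>) / (2 - \<alpha>)" if "n \<le> i" for n
    proof -
      have "(\<Sum>k = 1..n. real k powr (1 - \<alpha>)) \<le> real n powr (2 - \<alpha>) / (2 - \<alpha>)"
        using sum_powr_le[of "2 - \<alpha>" n] \<alpha>1 \<alpha>2 by simp
      also have "\<dots> \<le> real i powr (2 - \<alpha>) / (2 - \<alpha>)" using that \<alpha>2 by (intro divide_right_mono powr_mono2) auto
      finally show ?thesis .
    qed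
    show ?thesis unfolding split[of "\<lambda>k j. real k powr (1 - \<alpha>)"] using p[of "?m + 1"] p[of ?m] m i by simp
  qed
  have B: "(\<Sum>j\<in>?J. ?c (cell_dist i j) j + ?s j) \<le> (if N \<le> i + ?m then CC * real i * real (mid_dist N i) powr (1 - \<alpha>) else 0)"
  proof (cases "N \<le> i + ?m")
    case False
    have "(\<Sum>j\<in>?J. ?c (cell_dist i j) j + ?s j) = (\<Sum>j\<in>?J. 0)"
      by (rule sum.cong) (use False m in \<open>auto simp: cross_def\<close>)
    thus ?thesis using False by simp
  next
    case True
    let ?P = "real (mid_dist N i) powr (1 - \<alpha>)"
    have P0: "0 \<le> \<alpha> / (\<alpha> - 1) * ?P" using \<alpha>1 by simp
    have i0: "0 \<le> 4 * real i" by simp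
    have s: "(\<Sum>j\<in>?J. ?s j) \<le> 2 * (4 * real i * ?P)"
    proof -
      have "(\<Sum>j\<in>?J. ?s j) \<le> (\<Sum>j\<in>{N, N + 1} \<union> ?J. ?s j)" by (rule sum_mono2) auto
      also have "\<dots> = (\<Sum>j\<in>{N, N + 1}. ?s j)" by (rule sum.mono_neutral_right) auto
      also have "\<dots> = 2 * (4 * real i * ?P)" by simp
      finally show ?thesis .
    qed
    \<comment> \<open>For cells to the left of the node \<open>cross\<close> means i = N. Then
      \<open>mid_dist\<close> is 1 and the tail may be the whole sum.\<close>
    have cl: "(\<Sum>k = 1..?m + 1. ?c k (i + 1 - k)) \<le> 4 * real i * (\<alpha> / (\<alpha> - 1) * ?P)"
    proof (cases "i = N")
      case True
      hence mid_dist: "mid_dist N i = 1" by (simp add: mid_dist_def)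
      have "(\<Sum>k = 1..?m + 1. ?c k (i + 1 - k)) = 4 * real i * (\<Sum>k = 1..?m + 1. real k powr (- \<alpha>))"
        unfolding sum_distrib_left by (rule sum.cong) (use True in \<open>auto simp: cross_def\<close>)
      also have "\<dots> \<le> 4 * real i * (\<alpha> / (\<alpha> - 1) * real 1 powr (1 - \<alpha>))"
        by (intro mult_left_mono sum_powr_tail_le \<alpha>1) auto
      finally show ?thesis unfolding mid_dist .
    next
      case False
      have "(\<Sum>k = 1..?m + 1. ?c k (i + 1 - k)) = (\<Sum>k = 1..?m + 1. 0)"
        by (rule sum.cong) (use False i in \<open>auto simp: cross_def\<close>)
      thus ?thesis using mult_nonneg_nonneg[OF i0 P0] by simp
    qed
    have cr: "(\<Sum>k = 1..?m. ?c k (i + k)) \<le> 4 * real i * (\<alpha> / (\<alpha> - 1) * ?P)"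
    proof -
      have "(\<Sum>k = 1..?m. ?c k (i + k)) = (\<Sum>k \<in> {mid_dist N i..?m}. ?c k (i + k))"
        by (rule sum.mono_neutral_right) (use i in \<open>auto simp: cross_def mid_dist_def\<close>)
      also have "\<dots> \<le> (\<Sum>k = mid_dist N i..?m. 4 * real i * real k powr (- \<alpha>))" by (rule sum_mono) auto
      also have "\<dots> = 4 * real i * (\<Sum>k = mid_dist N i..?m. real k powr (- \<alpha>))" by (simp add: sum_distrib_left)
      also have "\<dots> \<le> 4 * real i * (\<alpha> / (\<alpha> - 1) * ?P)"
        by (intro mult_left_mono sum_powr_tail_le \<alpha>1 nu1) auto
      finally show ?thesis .
    qed
    have "(\<Sum>j\<in>?J. ?c (cell_dist i j) j + ?s j) \<le> 4 * real i * (\<alpha> / (\<alpha> - 1) * ?P) + 4 * real i * (\<alpha> / (\<alpha> - 1) * ?P) + 2 * (4 * real i * ?P)"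
      unfolding sum.distrib split[of ?c] using cl cr s by linarith
    also have "\<dots> = CC * real i * ?P" by (simp add: CC_def algebra_simps)
    finally show ?thesis using True by simp
  qed
  have "(\<Sum>j\<in>?J. real (cell_dist i j) powr (1 - \<alpha>) * weight N i j) \<le> (\<Sum>j\<in>?J. real (cell_dist i j) powr (1 - \<alpha>) + (?c (cell_dist i j) j + ?s j))"
    by (rule sum_mono[OF tm])
  also have "\<dots> = (\<Sum>j\<in>?J. real (cell_dist i j) powr (1 - \<alpha>)) + (\<Sum>j\<in>?J. ?c (cell_dist i j) j + ?s j)" by (rule sum.distrib)
  finally show ?thesis using A B by linarith
qed

end

context frac_problem
begin

section \<open>The truncation error away from the boundary\<close>

lemma inverse_step_bounds:
  assumes \<eta>: "0 < \<eta>" and h: "\<eta> / Cw \<le> h" "\<eta> / Cw \<le> h'" and d: "\<bar>h' - h\<bar> \<le> Cw * \<eta> / n" and n: "0 < n"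
  shows "0 < h" "1 / h \<le> Cw / \<eta>" "\<bar>1 / h' - 1 / h\<bar> \<le> Cw ^ 3 / (\<eta> * n)"
proof -
  have C: "1 \<le> Cw" by (rule Cw_ge(1))
  have lo: "0 < \<eta> / Cw" using \<eta> C by simp
  show h0: "0 < h" using lo h by linarith
  have h0': "0 < h'" using lo h by linarith
  have inv: "1 / x \<le> Cw / \<eta>" if "\<eta> / Cw \<le> x" for x
  proof -
    have "1 / x \<le> 1 / (\<eta> / Cw)" by (rule divide_left_mono[OF that]) (use lo less_le_trans[OF lo that] in \<open>simp_all only: mult_pos_pos zero_le_one\<close>)
    thus ?thesis by simp
  qed
  show "1 / h \<le> Cw / \<eta>" by (rule inv) fact
  have "\<bar>1 / h' - 1 / h\<bar> = \<bar>h' - h\<bar> * (1 / h) * (1 / h')"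
  proof -
    have "1 / h' - 1 / h = (h - h') * (1 / h) * (1 / h')" using h0 h0' by (simp add: field_simps)
    thus ?thesis using h0 h0' by (simp add: abs_mult abs_minus_commute)
  qed
  also have "\<dots> \<le> (Cw * \<eta> / n) * (Cw / \<eta>) * (Cw / \<eta>)"
    using d inv[OF h(1)] inv[OF h(2)] h0 h0' n C \<eta> by (intro mult_mono) auto
  also have "\<dots> = Cw ^ 3 / (\<eta> * n)" using \<eta> by (simp add: power3_eq_cube)
  finally show "\<bar>1 / h' - 1 / h\<bar> \<le> Cw ^ 3 / (\<eta> * n)" .
qed

text \<open>The two slopes have different denominators. Besides the second difference over h' this
  leaves the first difference times 1 / h' - 1 / h; both terms are of order 1 / n^2, because the
  steps change by a relative amount of order 1 / n.\<close>

lemma S3_slope: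
  assumes S: "S3 M (1 / n) w a b c" and w: "1 \<le> w" and \<eta>: "0 < \<eta>" and h: "\<eta> / Cw \<le> h" "\<eta> / Cw \<le> h'"
    and d: "\<bar>h' - h\<bar> \<le> Cw * \<eta> / n" and n: "0 < n"
  shows "\<bar>(c - b) / h' - (b - a) / h\<bar> \<le> 2 * Cw ^ 3 / (n\<^sup>2 * \<eta>) * (M * w)"
proof -
  have C: "1 \<le> Cw" by (rule Cw_ge(1))
  have M: "0 \<le> M" using S3_nonneg[OF S] .
  note ib = inverse_step_bounds[OF \<eta> h d n]
  have d': "\<bar>h - h'\<bar> \<le> Cw * \<eta> / n" using d by (simp add: abs_minus_commute)
  note ib' = inverse_step_bounds[OF \<eta> h(2,1) d' n]
  have C3: "Cw \<le> Cw ^ 3" using C power_increasing[of 1 3 Cw] by simp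
  have "(c - b) / h' - (b - a) / h = (c - 2 * b + a) * (1 / h') + (b - a) * (1 / h' - 1 / h)"
    by (simp add: algebra_simps diff_divide_distrib add_divide_distrib)
  hence "\<bar>(c - b) / h' - (b - a) / h\<bar> \<le> \<bar>c - 2 * b + a\<bar> * (1 / h') + \<bar>b - a\<bar> * \<bar>1 / h' - 1 / h\<bar>"
    using abs_triangle_ineq[of "(c - 2 * b + a) * (1 / h')" "(b - a) * (1 / h' - 1 / h)"] ib'(1) by (simp add: abs_mult)
  also have "\<dots> \<le> (M * ((1 / n)\<^sup>2 * w)) * (Cw / \<eta>) + (M * (1 / n)) * (Cw ^ 3 / (\<eta> * n))"
    using S ib' ib(3) M w n unfolding S3_def by (intro add_mono mult_mono) auto
  also have "\<dots> = Cw / (n\<^sup>2 * \<eta>) * (M * w) + Cw ^ 3 / (n\<^sup>2 * \<eta>) * (M * 1)"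
    by (simp add: power2_eq_square mult_ac)
  also have "\<dots> \<le> Cw ^ 3 / (n\<^sup>2 * \<eta>) * (M * w) + Cw ^ 3 / (n\<^sup>2 * \<eta>) * (M * w)"
    using C3 C M w n \<eta> by (intro add_mono mult_mono divide_right_mono) auto
  finally show ?thesis by (simp add: mult_ac)
qed

lemma edge_bound:
  assumes p: "\<bar>p\<bar> \<le> M" "\<bar>p - q\<bar> \<le> \<delta>" and \<eta>: "0 < \<eta>" and h: "\<eta> / Cw \<le> h" "\<eta> / Cw \<le> h'"
    and d: "\<bar>h' - h\<bar> \<le> Cw * \<eta> / n" and n: "0 < n"
  shows "\<bar>p / h - q / h'\<bar> \<le> \<delta> * (Cw / \<eta>) + M * (Cw ^ 3 / (\<eta> * n))"
proof -
  have M: "0 \<le> M" "0 \<le> \<delta>" using p by linarith+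
  note ib = inverse_step_bounds[OF \<eta> h d n]
  have d': "\<bar>h - h'\<bar> \<le> Cw * \<eta> / n" using d by (simp add: abs_minus_commute)
  note ib' = inverse_step_bounds[OF \<eta> h(2,1) d' n]
  have "p / h - q / h' = (p - q) * (1 / h') + p * (1 / h - 1 / h')"
    by (simp add: algebra_simps diff_divide_distrib)
  hence "\<bar>p / h - q / h'\<bar> \<le> \<bar>p - q\<bar> * (1 / h') + \<bar>p\<bar> * \<bar>1 / h - 1 / h'\<bar>"
    using abs_triangle_ineq[of "(p - q) * (1 / h')" "p * (1 / h - 1 / h')"] ib'(1) by (simp add: abs_mult)
  also have "\<dots> \<le> \<delta> * (Cw / \<eta>) + M * (Cw ^ 3 / (\<eta> * n))"
    using p ib' M by (intro add_mono mult_mono) auto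
  finally show ?thesis .
qed

lemma K_lipschitz:
  assumes "0 < \<rho>" "\<rho> \<le> s" "\<rho> \<le> t"
  shows "\<bar>K s - K t\<bar> \<le> \<kappa> * (\<alpha> - 1) * \<rho> powr (- \<alpha>) * \<bar>s - t\<bar>"
proof -
  have "norm (K s - K t) \<le> (\<kappa> * (\<alpha> - 1) * \<rho> powr (- \<alpha>)) * norm (s - t)"
  proof (rule field_differentiable_bound[of "{\<rho>..}" K "\<lambda>t. - (\<kappa> * (\<alpha> - 1)) * t powr (- \<alpha>)"])
    show "(K has_real_derivative - (\<kappa> * (\<alpha> - 1)) * z powr (- \<alpha>)) (at z within {\<rho>..})" if "z \<in> {\<rho>..}" for z
      using DERIV_K[of z] that assms by (auto intro: DERIV_subset)
    show "norm (- (\<kappa> * (\<alpha> - 1)) * z powr (- \<alpha>)) \<le> \<kappa> * (\<alpha> - 1) * \<rho> powr (- \<alpha>)" if "z \<in> {\<rho>..}" for z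
    proof -
      have "z powr (- \<alpha>) \<le> \<rho> powr (- \<alpha>)" using that assms \<alpha>1 by (intro powr_mono2') auto
      thus ?thesis using \<kappa>0 \<alpha>1 by (simp add: abs_mult mult_left_mono)
    qed
  qed (use assms in auto)
  thus ?thesis by simp
qed

end

context frac_data
begin

lemma Tc_lipschitz:
  assumes N: "1 \<le> N" and j: "1 \<le> j" "j \<le> 2 * N" and \<rho>: "0 < \<rho>" and pp: "p \<le> p'" and far: "p' + \<rho> \<le> X N (j - 1) \<or> X N j \<le> p - \<rho>"
  shows "\<bar>Tc N p j - Tc N p' j\<bar> \<le> CE * C0 * eps N * (\<kappa> * \<rho> powr (- \<alpha>) * (p' - p)) * H N j"
proof -
  let ?a = "X N (j - 1)" and ?b = "X N j"
  have ab: "?a \<le> ?b" "0 \<le> ?a" "?b \<le> 2 * T" using N j by (auto intro!: mesh_le mesh_nonneg mesh_upper)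
  have cE: "continuous_on {?a..?b} (E N)" by (rule continuous_on_subset[OF E_cont[OF N]]) (use ab in auto)
  have i: "(\<lambda>y. K (q - y) * E N y) integrable_on {?a..?b}" for q by (rule K_mult_integrable[OF cE])
  let ?M = "CE * C0 * eps N"
  have M: "0 \<le> ?M" using CE_nonneg C0_nonneg eps_nonneg by simp
  have e: "Tc N p j - Tc N p' j = integral {?a..?b} (\<lambda>y. K (p - y) * E N y - K (p' - y) * E N y)"
    unfolding Tc_def using i by (simp add: integral_diff)
  have "norm (integral {?a..?b} (\<lambda>y. K (p - y) * E N y - K (p' - y) * E N y)) \<le> integral {?a..?b} (\<lambda>y. ?M * (\<kappa> * \<rho> powr (- \<alpha>) * (p' - p)))"
  proof (rule Henstock_Kurzweil_Integration.integral_norm_bound_integral)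
    fix y assume y: "y \<in> {?a..?b}"
    have "\<bar>K \<bar>p - y\<bar> - K \<bar>p' - y\<bar>\<bar> \<le> \<kappa> * (\<alpha> - 1) * \<rho> powr (- \<alpha>) * \<bar>\<bar>p - y\<bar> - \<bar>p' - y\<bar>\<bar>"
      by (rule K_lipschitz[OF \<rho>]) (use far y pp in auto)
    also have "\<bar>\<bar>p - y\<bar> - \<bar>p' - y\<bar>\<bar> \<le> p' - p" using pp by linarith
    hence "\<kappa> * (\<alpha> - 1) * \<rho> powr (- \<alpha>) * \<bar>\<bar>p - y\<bar> - \<bar>p' - y\<bar>\<bar> \<le> \<kappa> * 1 * \<rho> powr (- \<alpha>) * (p' - p)"
      using \<kappa>0 \<alpha>1 \<alpha>2 pp by (intro mult_mono) auto
    finally have k: "\<bar>K (p - y) - K (p' - y)\<bar> \<le> \<kappa> * \<rho> powr (- \<alpha>) * (p' - p)" by (simp add: K_eq)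
    have "\<bar>E N y\<bar> \<le> ?M" by (rule E_bound[OF N]) (use y ab in auto)
    hence "\<bar>E N y\<bar> * \<bar>K (p - y) - K (p' - y)\<bar> \<le> ?M * (\<kappa> * \<rho> powr (- \<alpha>) * (p' - p))"
      using k M by (intro mult_mono) auto
    thus "norm (K (p - y) * E N y - K (p' - y) * E N y) \<le> ?M * (\<kappa> * \<rho> powr (- \<alpha>) * (p' - p))"
      by (simp add: abs_mult mult.commute left_diff_distrib[symmetric])
  qed (use i in \<open>auto intro!: integrable_diff\<close>)
  also have "\<dots> = (?b - ?a) * (?M * (\<kappa> * \<rho> powr (- \<alpha>) * (p' - p)))"
    by (simp only: integral_const_real real_scaleR_def content_real[OF ab(1)])
  finally show ?thesis unfolding e step_eq'[OF j(1)] real_norm_def by (simp only: mult_ac)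
qed

text \<open>\<open>CN1\<close> and \<open>CN2\<close> belong to the near cells, without and with the
  effect of the kink, \<open>CN3\<close> to the two end terms of the diagonal regrouping, and
  \<open>CN4\<close> to the two far parts.\<close>

definition CN1 :: real where "CN1 = 4 * Cw ^ 4 * CT * (T powr \<sigma>) / (2 - \<alpha>)"
definition CN2 :: real where "CN2 = 2 * Cw ^ 4 * CT * CC * (T powr \<sigma>) * (2 powr r / T) * (2 * Cw)"
definition CN3 :: real where "CN3 = 2 * (4 * Cw ^ 4 * CT * T powr \<sigma> + 16 * \<kappa> * Cw ^ 6 * CE)"
definition CN4 :: real where "CN4 = 32 * \<kappa> * Cw ^ 2 * CE"

lemma CT_nonneg: "0 \<le> CT" using \<kappa>0 CA_pos by (simp add: CT_def)

lemma CN12_nonneg: "0 \<le> CN1" "0 \<le> CN2"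
proof -
  have "0 \<le> CC" using \<alpha>1 by (simp add: CC_def)
  thus "0 \<le> CN1" "0 \<le> CN2" unfolding CN1_def CN2_def using Cw_ge(1) CT_nonneg T0 \<alpha>2 by auto
qed

text \<open>The kink is felt only for N \<le> 3 i / 2. Then \<open>X N i\<close> is comparable with
  T, and the steps between node i - 1 and T, at most 2 \<open>mid_dist N i\<close> in number, have
  at most the size Cw \<open>eta N i\<close>.\<close>

lemma middle_distance:
  assumes i: "8 \<le> i" "i \<le> N" "N \<le> i + i div 2"
  shows "(eta N i * real (mid_dist N i)) powr (1 - \<alpha>) \<le> 2 * Cw * (T - X N (i - 1)) powr (1 - \<alpha>)" "1 / X N i \<le> 2 powr r / T"
proof -
  have i1: "1 \<le> i" using i by simp
  have N1: "1 \<le> N" using i by simp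
  have eta: "0 < eta N i" using eta_pos i by auto
  have d0: "0 < T - X N (i - 1)" using mesh_less[of N "i - 1" N] i by (simp add: mesh_mid)
  have "T - X N (i - 1) = (\<Sum>j = i..N. H N j)"
  proof -
    have "(\<Sum>j = i..n. H N j) = X N n - X N (i - 1)" if "i \<le> n" for n
      using that
    proof (induction n rule: nat_induct_at_least)
      case base thus ?case using i1 by (simp add: step_eq')
    next
      case (Suc n) thus ?case by (simp add: step_eq)
    qed
    thus ?thesis using i N1 by (simp add: mesh_mid)
  qed
  also have "\<dots> \<le> (\<Sum>j = i..N. Cw * eta N i)"
    by (rule sum_mono, rule window_left(2)) (use i in auto)
  also have "\<dots> = real (N + 1 - i) * (Cw * eta N i)" by simp
  also have "\<dots> \<le> (2 * real (mid_dist N i)) * (Cw * eta N i)"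
    using eta Cw_ge(1) by (intro mult_right_mono) (auto simp: mid_dist_def)
  finally have "(T - X N (i - 1)) / (2 * Cw) \<le> eta N i * real (mid_dist N i)"
    using Cw_ge(1) by (simp add: field_simps)
  hence "(eta N i * real (mid_dist N i)) powr (1 - \<alpha>) \<le> ((T - X N (i - 1)) / (2 * Cw)) powr (1 - \<alpha>)"
    using d0 Cw_ge(1) \<alpha>1 by (intro powr_mono2') auto
  also have "\<dots> = (T - X N (i - 1)) powr (1 - \<alpha>) * (2 * Cw) powr (\<alpha> - 1)"
    using d0 Cw_ge(1) powr_divide[of "T - X N (i - 1)" "2 * Cw" "1 - \<alpha>"] powr_minus_divide[of "2 * Cw" "\<alpha> - 1"] by simp
  also have "(2 * Cw) powr (\<alpha> - 1) \<le> (2 * Cw) powr 1" using Cw_ge(1) \<alpha>2 by (intro powr_mono) auto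
  hence "(T - X N (i - 1)) powr (1 - \<alpha>) * (2 * Cw) powr (\<alpha> - 1) \<le> (T - X N (i - 1)) powr (1 - \<alpha>) * (2 * Cw)"
    using Cw_ge(1) by (intro mult_left_mono) auto
  finally show "(eta N i * real (mid_dist N i)) powr (1 - \<alpha>) \<le> 2 * Cw * (T - X N (i - 1)) powr (1 - \<alpha>)" by (simp add: mult_ac)
  have "real N powr r \<le> (2 * real i) powr r" using i r1 by (intro powr_mono2) auto
  hence "cN N * real N powr r \<le> cN N * (2 powr r * real i powr r)"
    using cN_pos[OF N1] by (intro mult_left_mono) (auto simp: powr_mult)
  hence "T \<le> 2 powr r * X N i" using i N1 mesh_left[of N N] mesh_mid[OF N1] by (simp add: mesh_left mult_ac)
  thus "1 / X N i \<le> 2 powr r / T" using T0 mesh_pos[of N i] i1 i by (simp add: field_simps)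
qed

text \<open>With x = i eta the powers of the part without the kink collapse to x powr (\<sigma> -
  \<alpha>) / i^2. In the other part a factor 1 / x is left over, which is bounded because x is
  comparable with T whenever that part occurs.\<close>

lemma near_sum_bound:
  assumes i: "8 \<le> i" "i \<le> N"
  shows "(\<Sum>j = i - i div 2..i + i div 2. 2 * Cw ^ 3 / ((real i)\<^sup>2 * eta N i) * (CT * C0 * X N i powr (\<sigma> - 2) * eta N i ^ 3 * (real (cell_dist i j) * eta N i) powr (1 - \<alpha>) * weight N i j)) * (Cw / eta N i)
    \<le> (CN1 + CN2) * C0 * eps N * rho N i"
proof -
  have i1: "1 \<le> i" using i by simp
  define x where "x = X N i"
  define \<eta> where "\<eta> = eta N i"
  have \<eta>0: "0 < \<eta>" using eta_pos i by (auto simp: \<eta>_def)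
  have x0: "0 < x" using mesh_pos[of N i] i by (simp add: x_def)
  have xe: "x = \<eta> * real i" using i by (simp add: x_def \<eta>_def eta_def)
  have ri: "0 < real i" using i by simp
  let ?S = "\<Sum>j = i - i div 2..i + i div 2. real (cell_dist i j) powr (1 - \<alpha>) * weight N i j"
  let ?k = "2 * Cw ^ 4 * CT * C0"
  let ?X = "x powr (\<sigma> - 2) * \<eta> powr (2 - \<alpha>) / (real i)\<^sup>2"
  have k0: "0 \<le> ?k" using Cw_ge(1) CT_nonneg C0_nonneg by simp
  have e3: "\<eta> powr (1 - \<alpha>) * \<eta> ^ 3 / (\<eta> * \<eta>) = \<eta> powr (2 - \<alpha>)"
    using \<eta>0 powr_add[of \<eta> "1 - \<alpha>" 1] by (simp add: power3_eq_cube)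
  have "2 * Cw ^ 3 / ((real i)\<^sup>2 * \<eta>) * (CT * C0 * x powr (\<sigma> - 2) * \<eta> ^ 3 * (real k * \<eta>) powr (1 - \<alpha>) * w) * (Cw / \<eta>)
      = ?k * ?X * (real k powr (1 - \<alpha>) * w)" for k w
  proof -
    have "2 * Cw ^ 3 / ((real i)\<^sup>2 * \<eta>) * (CT * C0 * x powr (\<sigma> - 2) * \<eta> ^ 3 * (real k * \<eta>) powr (1 - \<alpha>) * w) * (Cw / \<eta>)
      = ?k * (x powr (\<sigma> - 2) * (\<eta> powr (1 - \<alpha>) * \<eta> ^ 3 / (\<eta> * \<eta>)) / (real i)\<^sup>2) * (real k powr (1 - \<alpha>) * w)"
      using \<eta>0 by (simp add: powr_mult eval_nat_numeral mult_ac)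
    thus ?thesis unfolding e3 .
  qed
  hence "(\<Sum>j = i - i div 2..i + i div 2. 2 * Cw ^ 3 / ((real i)\<^sup>2 * \<eta>) * (CT * C0 * x powr (\<sigma> - 2) * \<eta> ^ 3 * (real (cell_dist i j) * \<eta>) powr (1 - \<alpha>) * weight N i j)) * (Cw / \<eta>)
     = ?k * ?X * ?S" unfolding sum_distrib_right sum_distrib_left by (intro sum.cong refl) blast
  also have "\<dots> \<le> ?k * ?X * (2 / (2 - \<alpha>) * real i powr (2 - \<alpha>) + (if N \<le> i + i div 2 then CC * real i * real (mid_dist N i) powr (1 - \<alpha>) else 0))"
    using weighted_sum[OF i] k0 by (intro mult_left_mono) auto
  also have "\<dots> = ?k * (2 / (2 - \<alpha>)) * (?X * real i powr (2 - \<alpha>)) + (if N \<le> i + i div 2 then ?k * CC * (?X * (real i * real (mid_dist N i) powr (1 - \<alpha>))) else 0)"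
    by (simp add: algebra_simps)
  also have "\<dots> \<le> CN1 * C0 * eps N * x powr (- \<alpha>) + CN2 * C0 * eps N * (T - X N (i - 1)) powr (1 - \<alpha>)"
  proof (rule add_mono)
    have "?X * real i powr (2 - \<alpha>) = x powr (\<sigma> - 2) * x powr (2 - \<alpha>) / (real i)\<^sup>2"
      unfolding xe using \<eta>0 ri by (simp add: powr_mult)
    also have "\<dots> = x powr \<sigma> / (real i)\<^sup>2 * x powr (- \<alpha>)"
      by (simp add: powr_add[symmetric])
    also have "\<dots> \<le> (T powr \<sigma> * eps N) * x powr (- \<alpha>)"
      unfolding x_def by (intro mult_right_mono mesh_powr_eps i1 i) auto
    finally have "?k * (2 / (2 - \<alpha>)) * (?X * real i powr (2 - \<alpha>)) \<le> ?k * (2 / (2 - \<alpha>)) * ((T powr \<sigma> * eps N) * x powr (- \<alpha>))"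
      by (rule mult_left_mono) (use k0 \<alpha>2 in simp)
    also have "\<dots> = CN1 * C0 * eps N * x powr (- \<alpha>)" by (simp add: CN1_def)
    finally show "?k * (2 / (2 - \<alpha>)) * (?X * real i powr (2 - \<alpha>)) \<le> CN1 * C0 * eps N * x powr (- \<alpha>)" .
  next
    have CC0: "0 \<le> CC" using \<alpha>1 by (simp add: CC_def)
    show "(if N \<le> i + i div 2 then ?k * CC * (?X * (real i * real (mid_dist N i) powr (1 - \<alpha>))) else 0) \<le> CN2 * C0 * eps N * (T - X N (i - 1)) powr (1 - \<alpha>)"
    proof (cases "N \<le> i + i div 2")
      case False
      thus ?thesis using CN12_nonneg C0_nonneg eps_nonneg by simp
    next
      case True
      note md = middle_distance[OF i True]
      have "?X * (real i * real (mid_dist N i) powr (1 - \<alpha>)) = x powr (\<sigma> - 2) * (\<eta> * real i) / (real i)\<^sup>2 * (\<eta> * real (mid_dist N i)) powr (1 - \<alpha>)"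
        using \<eta>0 powr_add[of \<eta> "1 - \<alpha>" 1] by (simp add: powr_mult mult_ac)
      also have "x powr (\<sigma> - 2) * (\<eta> * real i) / (real i)\<^sup>2 = x powr \<sigma> / (real i)\<^sup>2 * (1 / x)"
      proof -
        have "x powr (\<sigma> - 2) * x = x powr \<sigma> * (1 / x)"
          using powr_add[of x "\<sigma> - 2" 2] x0 by (simp add: powr_numeral power2_eq_square)
        thus ?thesis unfolding xe[symmetric] by simp
      qed
      also have "x powr \<sigma> / (real i)\<^sup>2 * (1 / x) * (\<eta> * real (mid_dist N i)) powr (1 - \<alpha>)
         \<le> (T powr \<sigma> * eps N) * (2 powr r / T) * (2 * Cw * (T - X N (i - 1)) powr (1 - \<alpha>))"
        using mesh_powr_eps[OF i1 i(2)] md x0 T0 eps_nonneg Cw_ge(1)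
        by (intro mult_mono mult_nonneg_nonneg) (auto simp: x_def \<eta>_def)
      finally have "?k * CC * (?X * (real i * real (mid_dist N i) powr (1 - \<alpha>))) \<le> ?k * CC * ((T powr \<sigma> * eps N) * (2 powr r / T) * (2 * Cw * (T - X N (i - 1)) powr (1 - \<alpha>)))"
        by (rule mult_left_mono) (use k0 CC0 in simp)
      also have "\<dots> = CN2 * C0 * eps N * (T - X N (i - 1)) powr (1 - \<alpha>)" by (simp add: CN2_def)
      finally show ?thesis using True by simp
    qed
  qed
  also have "\<dots> \<le> (CN1 + CN2) * C0 * eps N * rho N i"
  proof -
    have "0 \<le> CN1 * C0 * eps N" "0 \<le> CN2 * C0 * eps N"
      using CN12_nonneg C0_nonneg eps_nonneg by simp_all
    moreover have "x powr (- \<alpha>) \<le> rho N i" "(T - X N (i - 1)) powr (1 - \<alpha>) \<le> rho N i" by (auto simp: rho_def x_def)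
    ultimately have "CN1 * C0 * eps N * x powr (- \<alpha>) \<le> CN1 * C0 * eps N * rho N i"
      "CN2 * C0 * eps N * (T - X N (i - 1)) powr (1 - \<alpha>) \<le> CN2 * C0 * eps N * rho N i"
      by (auto intro: mult_left_mono)
    thus ?thesis by (simp add: distrib_right)
  qed
  finally show ?thesis unfolding x_def \<eta>_def .
qed

text \<open>Cells within i / 2 indices of i are treated along the diagonals. All others are at least
  a fixed fraction of x away from the three nodes, and there the second derivative of the kernel
  gives the scale x powr (- \<alpha>) directly.\<close>

lemma large_index:
  assumes i: "8 \<le> i" "i \<le> N"
  shows "\<bar>2 / span N i * ddx N i (P N)\<bar> \<le> (CN1 + CN2 + CN3 + CN4) * C0 * eps N * rho N i"
proof -
  have i1: "1 \<le> i" and N1: "1 \<le> N" using i by auto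
  define m where "m = i div 2"
  have m: "2 * m \<le> i" "i \<le> 2 * m + 1" "4 \<le> m" using i by (auto simp: m_def)
  define a b where "a = i - m" and "b = i + m"
  have ab: "1 \<le> a - 1" "a \<le> i" "i + 1 < b" "b + 2 \<le> 2 * N" "a + m = i" using m i by (auto simp: a_def b_def)
  have W: "win N i n" if "a \<le> n + 2" "n \<le> b + 2" for n
    by (rule window_near[OF i]) (use that m in \<open>auto simp: a_def b_def m_def[symmetric]\<close>)
  define \<eta> where "\<eta> = eta N i"
  have \<eta>0: "0 < \<eta>" using eta_pos i by (auto simp: \<eta>_def)
  define x where "x = X N i"
  have x0: "0 < x" using mesh_pos[of N i] i by (simp add: x_def)
  have xe: "x = \<eta> * real i" using i by (simp add: x_def \<eta>_def eta_def)
  have ri: "0 < real i" using i by simp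
  have C: "1 \<le> Cw" by (rule Cw_ge(1))
  let ?l = "X N (i - 1)" and ?c = "X N i" and ?r = "X N (i + 1)"
  define h h' where "h = H N i" and "h' = H N (i + 1)"
  have hh: "\<eta> / Cw \<le> h" "\<eta> / Cw \<le> h'" "h \<le> Cw * \<eta>" "h' \<le> Cw * \<eta>" "\<bar>h' - h\<bar> \<le> Cw * \<eta> / real i"
    using window_step[OF i1 i(2) W[of i]] window_step[OF i1 i(2) W[of "i + 1"]] window_step_diff[OF i1 i(2) W[of i] W[of "i + 1"]] ab
    by (auto simp: h_def h'_def \<eta>_def)
  have xs: "?l < ?c" "?c < ?r" using N1 i by (auto intro!: mesh_less)
  have hX: "?c - ?l = h" "?r - ?c = h'" using i1 by (auto simp: h_def h'_def step_eq')
  have lo0: "0 < \<eta> / Cw" using \<eta>0 C by simp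
  have sp: "span N i = h + h'" "0 < span N i" using span_eq[OF i1, of N] hh lo0 by (auto simp: h_def h'_def)
  have sp2: "2 / span N i \<le> Cw / \<eta>"
  proof -
    have "2 * (\<eta> / Cw) \<le> span N i" using hh sp by linarith
    hence "2 / span N i \<le> 2 / (2 * (\<eta> / Cw))"
      by (rule divide_left_mono) (use lo0 sp(2) in \<open>simp_all only: mult_pos_pos zero_less_numeral zero_le_numeral\<close>)
    thus ?thesis by simp
  qed
  \<comment> \<open>At least i / 4 cells of length at least \<eta> / Cw separate the three nodes
    from the far parts.\<close>
  define \<rho> where "\<rho> = x / (4 * Cw)"
  have \<rho>0: "0 < \<rho>" using x0 C by (simp add: \<rho>_def)
  have \<rho>p: "\<rho> powr (- \<alpha>) \<le> 16 * Cw\<^sup>2 * x powr (- \<alpha>)"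
  proof -
    have e: "\<rho> powr (- \<alpha>) = x powr (- \<alpha>) * (4 * Cw) powr \<alpha>"
      unfolding \<rho>_def using x0 C powr_divide[of x "4 * Cw" "- \<alpha>"] powr_minus_divide[of "4 * Cw" \<alpha>] by simp
    have "(4 * Cw) powr \<alpha> \<le> (4 * Cw) powr 2" using C \<alpha>2 by (intro powr_mono) auto
    also have "(4 * Cw) powr 2 = 16 * Cw\<^sup>2" using C by (simp add: powr_numeral power_mult_distrib)
    finally have "(4 * Cw) powr \<alpha> \<le> 16 * Cw\<^sup>2" .
    hence "x powr (- \<alpha>) * (4 * Cw) powr \<alpha> \<le> x powr (- \<alpha>) * (16 * Cw\<^sup>2)" by (rule mult_left_mono) simp
    thus ?thesis unfolding e by (simp only: mult_ac)
  qed
  have gapm: "\<rho> \<le> ?l - X N (a - 1)" "\<rho> \<le> X N b - ?r"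
  proof -
    have "real i / 4 \<le> real (m - 1)" using m by linarith
    hence "real i / 4 * (\<eta> / Cw) \<le> real (m - 1) * (\<eta> / Cw)" using lo0 by (intro mult_right_mono) auto
    hence 1: "\<rho> \<le> real (m - 1) * (\<eta> / Cw)" using \<eta>0 C by (simp add: \<rho>_def xe mult.commute)
    have "real (m - 1) * (\<eta> / Cw) \<le> real m * (\<eta> / Cw)" using lo0 by (intro mult_right_mono) auto
    also have "\<dots> \<le> X N (a - 1 + m) - X N (a - 1)"
      unfolding \<eta>_def by (rule gap_bounds(1)[OF i1 i(2)], rule W) (use ab m in \<open>auto simp: b_def\<close>)
    also have "a - 1 + m = i - 1" using ab by simp
    finally show "\<rho> \<le> ?l - X N (a - 1)" using 1 by linarith
    have "real (m - 1) * (\<eta> / Cw) \<le> X N (i + 1 + (m - 1)) - ?r"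
      unfolding \<eta>_def by (rule gap_bounds(1)[OF i1 i(2)], rule W) (use ab m in \<open>auto simp: b_def\<close>)
    also have "i + 1 + (m - 1) = b" using m by (simp add: b_def)
    finally show "\<rho> \<le> X N b - ?r" using 1 by linarith
  qed
  let ?M = "CE * C0 * eps N"
  have M0: "0 \<le> ?M" using CE_nonneg C0_nonneg eps_nonneg by simp
  have Xb: "0 \<le> X N (a - 1)" "X N (a - 1) \<le> X N b" "X N b \<le> 2 * T" using ab N1 by (auto intro!: mesh_nonneg mesh_le mesh_upper)
  define P1 P2 P3 where "P1 = (\<lambda>p. integral {0..X N (a - 1)} (\<lambda>y. K (p - y) * E N y))"
    and "P2 = (\<lambda>p. \<Sum>j = a..b. Tc N p j)" and "P3 = (\<lambda>p. integral {X N b..2 * T} (\<lambda>y. K (p - y) * E N y))"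
  have Psplit: "P N p = P1 p + P2 p + P3 p" for p
  proof -
    have i0: "(\<lambda>y. K (p - y) * E N y) integrable_on {0..2 * T}" by (rule K_mult_integrable[OF E_cont[OF N1]])
    have "integral {0..2 * T} (\<lambda>y. K (p - y) * E N y) = P1 p + integral {X N (a - 1)..2 * T} (\<lambda>y. K (p - y) * E N y)"
      unfolding P1_def by (rule Henstock_Kurzweil_Integration.integral_combine[symmetric]) (use Xb i0 in auto)
    also have "integral {X N (a - 1)..2 * T} (\<lambda>y. K (p - y) * E N y) = integral {X N (a - 1)..X N b} (\<lambda>y. K (p - y) * E N y) + P3 p"
      unfolding P3_def by (rule Henstock_Kurzweil_Integration.integral_combine[symmetric]) (use Xb integrable_subinterval_real[OF i0] in auto)
    also have "integral {X N (a - 1)..X N b} (\<lambda>y. K (p - y) * E N y) = (\<Sum>j = a - 1 + 1..b. Tc N p j)"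
      unfolding Tc_def by (rule integral_cells[OF N1]) (use ab i0 in auto)
    also have "a - 1 + 1 = a" using ab by simp
    finally show ?thesis by (simp add: P_def P2_def)
  qed
  have bE: "\<bar>E N y\<bar> \<le> ?M" if "y \<in> {0..2 * T}" for y using E_bound[OF N1 that] .
  have far: "2 / span N i * \<bar>ddx N i g\<bar> \<le> 16 * \<kappa> * Cw\<^sup>2 * CE * C0 * eps N * x powr (- \<alpha>)"
    if "\<bar>ddx N i g\<bar> \<le> ?M * (\<kappa> * (\<alpha> - 1) * \<rho> powr (- \<alpha>)) * (?r - ?l) / 2" for g
  proof -
    have "2 / span N i * \<bar>ddx N i g\<bar> \<le> 2 / span N i * (?M * (\<kappa> * (\<alpha> - 1) * \<rho> powr (- \<alpha>)) * span N i / 2)"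
      using that sp(2) by (intro mult_left_mono) (auto simp: span_def)
    also have "\<dots> = ?M * (\<kappa> * (\<alpha> - 1) * \<rho> powr (- \<alpha>))" using sp(2) by simp
    also have "\<dots> \<le> ?M * (\<kappa> * 1 * (16 * Cw\<^sup>2 * x powr (- \<alpha>)))"
      using M0 \<kappa>0 \<alpha>1 \<alpha>2 \<rho>p by (intro mult_left_mono mult_mono) auto
    finally show ?thesis by (simp add: mult_ac)
  qed
  have B1: "2 / span N i * \<bar>ddx N i P1\<bar> \<le> 16 * \<kappa> * Cw\<^sup>2 * CE * C0 * eps N * x powr (- \<alpha>)"
    unfolding P1_def
  proof (rule far)
    show "\<bar>ddx N i (\<lambda>p. integral {0..X N (a - 1)} (\<lambda>y. K (p - y) * E N y))\<bar> \<le> ?M * (\<kappa> * (\<alpha> - 1) * \<rho> powr (- \<alpha>)) * (?r - ?l) / 2"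
      unfolding ddx_def
    proof (rule far_integral_bound[OF xs Xb(1) _ \<rho>0 _ _ M0])
      show "?r + \<rho> \<le> 0 \<or> X N (a - 1) \<le> ?l - \<rho>" using gapm by auto
      show "continuous_on {0..X N (a - 1)} (E N)" by (rule continuous_on_subset[OF E_cont[OF N1]]) (use Xb in auto)
      show "\<bar>E N y\<bar> \<le> ?M" if "y \<in> {0..X N (a - 1)}" for y by (rule bE) (use that Xb in auto)
    qed
  qed
  have B3: "2 / span N i * \<bar>ddx N i P3\<bar> \<le> 16 * \<kappa> * Cw\<^sup>2 * CE * C0 * eps N * x powr (- \<alpha>)"
    unfolding P3_def
  proof (rule far)
    show "\<bar>ddx N i (\<lambda>p. integral {X N b..2 * T} (\<lambda>y. K (p - y) * E N y))\<bar> \<le> ?M * (\<kappa> * (\<alpha> - 1) * \<rho> powr (- \<alpha>)) * (?r - ?l) / 2"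
      unfolding ddx_def
    proof (rule far_integral_bound[OF xs Xb(3) _ \<rho>0 _ _ M0])
      show "?r + \<rho> \<le> X N b \<or> 2 * T \<le> ?l - \<rho>" using gapm by auto
      show "continuous_on {X N b..2 * T} (E N)" by (rule continuous_on_subset[OF E_cont[OF N1]]) (use Xb in auto)
      show "\<bar>E N y\<bar> \<le> ?M" if "y \<in> {X N b..2 * T}" for y by (rule bE) (use that Xb in auto)
    qed
  qed
  define Mj where "Mj = (\<lambda>j. CT * C0 * X N i powr (\<sigma> - 2) * eta N i ^ 3 * (real (cell_dist i j) * eta N i) powr (1 - \<alpha>))"
  have TS: "S3 (Mj j) (1 / real i) (weight N i j) (Tc N ?l (j - 1)) (Tc N ?c j) (Tc N ?r (j + 1))" if "a \<le> j + 1" "j \<le> b + 1" for j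
    unfolding Mj_def by (rule T_S3[OF i]) (use that in \<open>auto simp: a_def b_def m_def\<close>)
  have om1: "1 \<le> weight N i j" if "a \<le> j + 1" "j \<le> b + 1" for j
    by (rule weight_props(1)[OF i]) (use that in \<open>auto simp: a_def b_def m_def\<close>)
  define D where "D = (\<lambda>j. (Tc N ?r (j + 1) - Tc N ?c j) / h' - (Tc N ?c j - Tc N ?l (j - 1)) / h)"
  \<comment> \<open>The cell ranges are the same for the three nodes, so after shifting them along
    with the node one cell integral is left over at each end for each outer node. They are paired so
    that each of \<open>e1\<close> and \<open>e2\<close> is again a difference.\<close>
  define e1 where "e1 = Tc N ?r a / h' - Tc N ?l (a - 1) / h"
  define e2 where "e2 = Tc N ?l b / h - Tc N ?r (b + 1) / h'"
  have ddP2: "ddx N i P2 = (\<Sum>j = a..b. D j) + e1 + e2"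
  proof -
    have r: "P2 ?r = (\<Sum>j = a..b. Tc N ?r (j + 1)) + Tc N ?r a - Tc N ?r (b + 1)"
      unfolding P2_def using sum_atLeastAtMost_Suc_shift[of a b "Tc N ?r"] ab by simp
    have l: "P2 ?l = (\<Sum>j = a..b. Tc N ?l (j - 1)) - Tc N ?l (a - 1) + Tc N ?l b"
      unfolding P2_def using sum_atLeastAtMost_Suc_shift[of a b "\<lambda>j. Tc N ?l (j - 1)"] ab by simp
    have c: "P2 ?c = (\<Sum>j = a..b. Tc N ?c j)" by (simp add: P2_def)
    have "ddx N i P2 = (P2 ?r - P2 ?c) / h' - (P2 ?c - P2 ?l) / h"
      unfolding ddx_def dd_def hX ..
    also have "\<dots> = ((\<Sum>j = a..b. Tc N ?r (j + 1)) - (\<Sum>j = a..b. Tc N ?c j)) / h' - ((\<Sum>j = a..b. Tc N ?c j) - (\<Sum>j = a..b. Tc N ?l (j - 1))) / h + e1 + e2"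
      unfolding r l c e1_def e2_def by (simp add: diff_divide_distrib add_divide_distrib)
    also have "((\<Sum>j = a..b. Tc N ?r (j + 1)) - (\<Sum>j = a..b. Tc N ?c j)) / h' - ((\<Sum>j = a..b. Tc N ?c j) - (\<Sum>j = a..b. Tc N ?l (j - 1))) / h = (\<Sum>j = a..b. D j)"
      unfolding D_def sum_subtractf[symmetric] sum_divide_distrib ..
    finally show ?thesis .
  qed
  have sumD: "Cw / \<eta> * \<bar>\<Sum>j = a..b. D j\<bar> \<le> (CN1 + CN2) * C0 * eps N * rho N i"
  proof -
    have "\<bar>\<Sum>j = a..b. D j\<bar> \<le> (\<Sum>j = a..b. \<bar>D j\<bar>)" by (rule sum_abs)
    also have "\<dots> \<le> (\<Sum>j = a..b. 2 * Cw ^ 3 / ((real i)\<^sup>2 * \<eta>) * (Mj j * weight N i j))"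
      unfolding D_def by (rule sum_mono, rule S3_slope[OF TS om1 \<eta>0 hh(1,2,5) ri]) auto
    finally have "Cw / \<eta> * \<bar>\<Sum>j = a..b. D j\<bar> \<le> Cw / \<eta> * (\<Sum>j = a..b. 2 * Cw ^ 3 / ((real i)\<^sup>2 * \<eta>) * (Mj j * weight N i j))"
      using C \<eta>0 by (intro mult_left_mono) auto
    also have "\<dots> \<le> (CN1 + CN2) * C0 * eps N * rho N i"
      using near_sum_bound[OF i] unfolding Mj_def \<eta>_def a_def b_def m_def by (simp add: mult.commute)
    finally show ?thesis .
  qed
  define Q where "Q = CT * C0 * x powr (\<sigma> - 2) * \<eta> ^ 3 * x powr (1 - \<alpha>)"
  have Q0: "0 \<le> Q" using CT_nonneg C0_nonneg \<eta>0 by (simp add: Q_def)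
  have Mj_edge: "Mj j \<le> 2 * Q" if "m + 1 \<le> cell_dist i j" for j
  proof -
    have "real i \<le> 2 * real (cell_dist i j)" using that m by linarith
    hence "\<eta> * real i \<le> \<eta> * (2 * real (cell_dist i j))" using \<eta>0 by (intro mult_left_mono) auto
    hence k: "x / 2 \<le> real (cell_dist i j) * \<eta>" by (simp add: xe mult_ac)
    hence "(real (cell_dist i j) * \<eta>) powr (1 - \<alpha>) \<le> (x / 2) powr (1 - \<alpha>)"
      using x0 \<alpha>1 by (intro powr_mono2') auto
    also have "\<dots> = x powr (1 - \<alpha>) * 2 powr (\<alpha> - 1)"
      using x0 powr_divide[of x 2 "1 - \<alpha>"] powr_minus_divide[of 2 "\<alpha> - 1"] by simp
    also have "2 powr (\<alpha> - 1) \<le> 2 powr (1 :: real)" using \<alpha>2 by (intro powr_mono) auto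
    hence "x powr (1 - \<alpha>) * 2 powr (\<alpha> - 1) \<le> x powr (1 - \<alpha>) * 2" by (intro mult_left_mono) auto
    finally have "CT * C0 * x powr (\<sigma> - 2) * \<eta> ^ 3 * (real (cell_dist i j) * \<eta>) powr (1 - \<alpha>) \<le> CT * C0 * x powr (\<sigma> - 2) * \<eta> ^ 3 * (x powr (1 - \<alpha>) * 2)"
      using CT_nonneg C0_nonneg \<eta>0 by (intro mult_left_mono) auto
    thus ?thesis by (simp add: Mj_def Q_def x_def \<eta>_def mult_ac)
  qed
  define \<delta> where "\<delta> = 2 * Q / real i + ?M * (\<kappa> * \<rho> powr (- \<alpha>) * (Cw * \<eta>)) * (Cw * \<eta>)"
  have kl: "?M * (\<kappa> * \<rho> powr (- \<alpha>) * d) * g \<le> ?M * (\<kappa> * \<rho> powr (- \<alpha>) * (Cw * \<eta>)) * (Cw * \<eta>)"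
    if "0 \<le> d" "d \<le> Cw * \<eta>" "0 \<le> g" "g \<le> Cw * \<eta>" for d g
    using that \<kappa>0 C \<eta>0 CE_nonneg C0_nonneg eps_nonneg by (intro mult_mono mult_left_mono mult_nonneg_nonneg) auto
  have tri: "\<bar>s - t\<bar> \<le> \<delta>" if "\<bar>s - z\<bar> \<le> Mc * (1 / real i)" "Mc \<le> 2 * Q" "\<bar>z - t\<bar> \<le> ?M * (\<kappa> * \<rho> powr (- \<alpha>) * (Cw * \<eta>)) * (Cw * \<eta>)" for s t z Mc
  proof -
    have "Mc * (1 / real i) \<le> 2 * Q * (1 / real i)" using that(2) ri by (intro mult_right_mono) auto
    hence "\<bar>s - z\<bar> \<le> 2 * Q / real i" using that(1) by simp
    thus ?thesis unfolding \<delta>_def using that(3) abs_triangle_ineq[of "s - z" "z - t"] by simp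
  qed
  have kka: "m + 1 \<le> cell_dist i (a - 1)" "m + 1 \<le> cell_dist i (b + 1)"
    using ab m by (auto simp: cell_dist_def b_def)
  have Sa: "S3 (Mj (a - 1)) (1 / real i) (weight N i (a - 1)) (Tc N ?l (a - 1 - 1)) (Tc N ?c (a - 1)) (Tc N ?r a)"
    using TS[of "a - 1"] ab by simp
  have Sb: "S3 (Mj (b + 1)) (1 / real i) (weight N i (b + 1)) (Tc N ?l b) (Tc N ?c (b + 1)) (Tc N ?r (b + 1 + 1))"
    using TS[of "b + 1"] ab by simp
  have Ha: "0 \<le> H N (a - 1)" "H N (a - 1) \<le> Cw * \<eta>"
    using less_imp_le[OF step_pos[OF N1 ab(1)]] ab i window_step(2)[OF i1 i(2) W[of "a - 1"]] by (auto simp: \<eta>_def)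
  have Hb: "0 \<le> H N (b + 1)" "H N (b + 1) \<le> Cw * \<eta>"
    using less_imp_le[OF step_pos[OF N1, of "b + 1"]] ab i window_step(2)[OF i1 i(2) W[of "b + 1"]] by (auto simp: \<eta>_def)
  have h0: "0 \<le> h" "0 \<le> h'" using hh lo0 by linarith+
  \<comment> \<open>One step along the diagonal, controlled by \<open>TS\<close>, followed by a step
    of the node alone, which is harmless because the cell is at least \<rho> away.\<close>
  have d1: "\<bar>Tc N ?r a - Tc N ?l (a - 1)\<bar> \<le> \<delta>"
  proof (rule tri)
    show "\<bar>Tc N ?r a - Tc N ?c (a - 1)\<bar> \<le> Mj (a - 1) * (1 / real i)" using Sa unfolding S3_def by blast
    show "Mj (a - 1) \<le> 2 * Q" by (rule Mj_edge) (rule kka)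
    have "\<bar>Tc N ?l (a - 1) - Tc N ?c (a - 1)\<bar> \<le> ?M * (\<kappa> * \<rho> powr (- \<alpha>) * (?c - ?l)) * H N (a - 1)"
      by (rule Tc_lipschitz[OF N1 _ _ \<rho>0]) (use ab i gapm xs in auto)
    also have "\<dots> \<le> ?M * (\<kappa> * \<rho> powr (- \<alpha>) * (Cw * \<eta>)) * (Cw * \<eta>)" unfolding hX by (rule kl) (use h0 hh Ha in auto)
    finally show "\<bar>Tc N ?c (a - 1) - Tc N ?l (a - 1)\<bar> \<le> ?M * (\<kappa> * \<rho> powr (- \<alpha>) * (Cw * \<eta>)) * (Cw * \<eta>)" by (simp add: abs_minus_commute)
  qed
  have d2: "\<bar>Tc N ?l b - Tc N ?r (b + 1)\<bar> \<le> \<delta>"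
  proof (rule tri)
    show "\<bar>Tc N ?l b - Tc N ?c (b + 1)\<bar> \<le> Mj (b + 1) * (1 / real i)" using Sb unfolding S3_def by (simp add: abs_minus_commute)
    show "Mj (b + 1) \<le> 2 * Q" by (rule Mj_edge) (rule kka)
    have "\<bar>Tc N ?c (b + 1) - Tc N ?r (b + 1)\<bar> \<le> ?M * (\<kappa> * \<rho> powr (- \<alpha>) * (?r - ?c)) * H N (b + 1)"
      by (rule Tc_lipschitz[OF N1 _ _ \<rho>0]) (use ab i gapm xs in auto)
    also have "\<dots> \<le> ?M * (\<kappa> * \<rho> powr (- \<alpha>) * (Cw * \<eta>)) * (Cw * \<eta>)" unfolding hX by (rule kl) (use h0 hh Hb in auto)
    finally show "\<bar>Tc N ?c (b + 1) - Tc N ?r (b + 1)\<bar> \<le> ?M * (\<kappa> * \<rho> powr (- \<alpha>) * (Cw * \<eta>)) * (Cw * \<eta>)" .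
  qed
  have m1: "\<bar>Tc N ?r a\<bar> \<le> 2 * Q"
    using Sa Mj_edge[OF kka(1)] unfolding S3_def by (meson order_trans)
  have m2: "\<bar>Tc N ?l b\<bar> \<le> 2 * Q"
    using Sb Mj_edge[OF kka(2)] unfolding S3_def by (meson order_trans)
  have hh5: "\<bar>h - h'\<bar> \<le> Cw * \<eta> / real i" using hh(5) by (simp add: abs_minus_commute)
  define Z where "Z = \<delta> * (Cw / \<eta>) + 2 * Q * (Cw ^ 3 / (\<eta> * real i))"
  have E1: "\<bar>e1\<bar> \<le> Z" unfolding e1_def Z_def by (rule edge_bound[OF m1 d1 \<eta>0 hh(2,1) hh5 ri])
  have E2: "\<bar>e2\<bar> \<le> Z" unfolding e2_def Z_def by (rule edge_bound[OF m2 d2 \<eta>0 hh(1,2,5) ri])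
  have ZB: "Cw / \<eta> * Z \<le> (4 * Cw ^ 4 * CT * T powr \<sigma> + 16 * \<kappa> * Cw ^ 6 * CE) * (C0 * eps N * x powr (- \<alpha>))"
  proof -
    have QQ: "Q / (real i * \<eta> * \<eta>) \<le> CT * C0 * (T powr \<sigma> * eps N) * x powr (- \<alpha>)"
    proof -
      have "x powr (\<sigma> - 2) * x powr (1 - \<alpha>) * x = x powr \<sigma> * x powr (- \<alpha>)"
        using x0 powr_add[of x "\<sigma> - 2 + (1 - \<alpha>)" 1] by (simp add: powr_add[symmetric])
      hence "x powr (\<sigma> - 2) * x powr (1 - \<alpha>) * \<eta> = x powr \<sigma> * x powr (- \<alpha>) / real i"
        using ri by (simp add: xe field_simps)
      hence "Q / (real i * \<eta> * \<eta>) = CT * C0 * (x powr \<sigma> / (real i)\<^sup>2) * x powr (- \<alpha>)"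
        using \<eta>0 ri by (simp add: Q_def power3_eq_cube power2_eq_square field_simps)
      also have "\<dots> \<le> CT * C0 * (T powr \<sigma> * eps N) * x powr (- \<alpha>)"
        unfolding x_def using CT_nonneg C0_nonneg by (intro mult_right_mono mult_left_mono mesh_powr_eps i1 i) auto
      finally show ?thesis .
    qed
    have "Cw / \<eta> * Z = (2 * Cw\<^sup>2 + 2 * Cw ^ 4) * (Q / (real i * \<eta> * \<eta>)) + ?M * \<kappa> * Cw ^ 4 * \<rho> powr (- \<alpha>)"
      using \<eta>0 ri by (simp add: Z_def \<delta>_def field_simps eval_nat_numeral)
    also have "\<dots> \<le> (4 * Cw ^ 4) * (CT * C0 * (T powr \<sigma> * eps N) * x powr (- \<alpha>)) + ?M * \<kappa> * Cw ^ 4 * (16 * Cw\<^sup>2 * x powr (- \<alpha>))"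
    proof (rule add_mono)
      have "Cw\<^sup>2 \<le> Cw ^ 4" using C by (intro power_increasing) auto
      hence "2 * Cw\<^sup>2 + 2 * Cw ^ 4 \<le> 4 * Cw ^ 4" by simp
      thus "(2 * Cw\<^sup>2 + 2 * Cw ^ 4) * (Q / (real i * \<eta> * \<eta>)) \<le> (4 * Cw ^ 4) * (CT * C0 * (T powr \<sigma> * eps N) * x powr (- \<alpha>))"
        by (rule mult_mono[OF _ QQ]) (use Q0 \<eta>0 in auto)
      show "?M * \<kappa> * Cw ^ 4 * \<rho> powr (- \<alpha>) \<le> ?M * \<kappa> * Cw ^ 4 * (16 * Cw\<^sup>2 * x powr (- \<alpha>))"
        using M0 \<kappa>0 C by (intro mult_left_mono \<rho>p) auto
    qed
    also have "\<dots> = (4 * Cw ^ 4 * CT * T powr \<sigma> + 16 * \<kappa> * Cw ^ 6 * CE) * (C0 * eps N * x powr (- \<alpha>))"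
      by (simp add: algebra_simps eval_nat_numeral)
    finally show ?thesis .
  qed
  have w: "0 \<le> C0 * eps N * x powr (- \<alpha>)" "C0 * eps N * x powr (- \<alpha>) \<le> C0 * eps N * rho N i"
    using C0_nonneg eps_nonneg by (auto simp: rho_def x_def intro!: mult_left_mono)
  have ddP: "ddx N i (P N) = ddx N i P1 + ddx N i P2 + ddx N i P3"
    unfolding ddx_def dd_def Psplit by (simp add: add_divide_distrib diff_divide_distrib)
  have "\<bar>2 / span N i * ddx N i (P N)\<bar> = 2 / span N i * \<bar>ddx N i (P N)\<bar>" using sp(2) by (simp add: abs_mult)
  also have "\<dots> \<le> 2 / span N i * (\<bar>ddx N i P1\<bar> + \<bar>ddx N i P2\<bar> + \<bar>ddx N i P3\<bar>)"
    unfolding ddP using sp(2) by (intro mult_left_mono) auto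
  also have "\<dots> = 2 / span N i * \<bar>ddx N i P1\<bar> + 2 / span N i * \<bar>ddx N i P2\<bar> + 2 / span N i * \<bar>ddx N i P3\<bar>"
    by (simp only: distrib_left)
  also have "\<dots> \<le> 16 * \<kappa> * Cw\<^sup>2 * CE * C0 * eps N * x powr (- \<alpha>) + Cw / \<eta> * (\<bar>\<Sum>j = a..b. D j\<bar> + Z + Z) + 16 * \<kappa> * Cw\<^sup>2 * CE * C0 * eps N * x powr (- \<alpha>)"
  proof (intro add_mono B1 B3)
    have "\<bar>ddx N i P2\<bar> \<le> \<bar>\<Sum>j = a..b. D j\<bar> + Z + Z" unfolding ddP2 using E1 E2 by linarith
    thus "2 / span N i * \<bar>ddx N i P2\<bar> \<le> Cw / \<eta> * (\<bar>\<Sum>j = a..b. D j\<bar> + Z + Z)"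
      by (rule mult_mono[OF sp2]) (use C \<eta>0 in auto)
  qed
  also have "\<dots> = Cw / \<eta> * \<bar>\<Sum>j = a..b. D j\<bar> + 2 * (Cw / \<eta> * Z) + CN4 * (C0 * eps N * x powr (- \<alpha>))"
    by (simp add: CN4_def algebra_simps add_divide_distrib)
  also have "\<dots> \<le> (CN1 + CN2) * C0 * eps N * rho N i + CN3 * (C0 * eps N * x powr (- \<alpha>)) + CN4 * (C0 * eps N * x powr (- \<alpha>))"
    using sumD ZB unfolding CN3_def by linarith
  also have "\<dots> \<le> (CN1 + CN2) * C0 * eps N * rho N i + CN3 * (C0 * eps N * rho N i) + CN4 * (C0 * eps N * rho N i)"
  proof -
    have "0 \<le> CN3" "0 \<le> CN4" using CT_nonneg CE_nonneg \<kappa>0 C by (simp_all add: CN3_def CN4_def)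
    thus ?thesis by (intro add_mono order_refl mult_left_mono[OF w(2)])
  qed
  finally show ?thesis by (simp add: algebra_simps)
qed

section \<open>Convergence\<close>

definition Ctr :: real where "Ctr = CS + (CN1 + CN2 + CN3 + CN4) + CQ"

lemma CS_nonneg: "0 \<le> CS" using CE_nonneg \<kappa>0 \<alpha>1 \<alpha>2 by (simp add: CS_def)

lemma CQ_nonneg: "0 \<le> CQ" using Cw_ge(1) \<alpha>2 by (simp add: CQ_def)

lemma CN34_nonneg: "0 \<le> CN3" "0 \<le> CN4"
  using CT_nonneg CE_nonneg \<kappa>0 Cw_ge(1) by (simp_all add: CN3_def CN4_def)

lemma Ctr_nonneg: "0 \<le> Ctr"
  using CS_nonneg CN12_nonneg CN34_nonneg CQ_nonneg by (simp add: Ctr_def)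

lemma truncation_left:
  assumes N: "2 \<le> N" and i: "1 \<le> i" "i \<le> N"
  shows "\<bar>L N (\<lambda>j. u (X N j)) i - f (X N i)\<bar> \<le> Ctr * C0 * eps N * rho N i"
proof -
  have N1: "1 \<le> N" using N by simp
  let ?e = "C0 * eps N"
  have e: "0 \<le> ?e" using C0_nonneg eps_nonneg by simp
  have rho: "X N i powr (- \<alpha>) \<le> rho N i" by (simp add: rho_def)
  have lift: "c * C0 * eps N * X N i powr (- \<alpha>) \<le> c * (?e * rho N i)" if "0 \<le> c" for c
  proof -
    have "?e * X N i powr (- \<alpha>) \<le> ?e * rho N i" using e rho by (rule mult_left_mono[rotated])
    from mult_left_mono[OF this that] show ?thesis by (simp only: mult_ac)
  qed
  have 0: "0 \<le> ?e * rho N i" using e rho_pos[OF N1 i] by simp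
  have "L N (\<lambda>j. u (X N j)) i - f (X N i)
      = - (2 / span N i * ddx N i (P N)) - (2 / span N i * ddx N i F + f (X N i))"
  proof -
    have "ddx N i (uhF) = ddx N i (P N) + ddx N i F" if "uhF = frac_int \<alpha> T (uh N)" for uhF
    proof -
      have "uhF = (\<lambda>x. P N x + F x)" using P_eq[OF N1] that by (auto simp: fun_eq_iff algebra_simps)
      thus ?thesis unfolding ddx_def by (simp add: dd_add)
    qed
    thus ?thesis unfolding L_eq[OF i(1)] by (simp add: algebra_simps)
  qed
  hence "\<bar>L N (\<lambda>j. u (X N j)) i - f (X N i)\<bar> \<le> \<bar>2 / span N i * ddx N i (P N)\<bar> + \<bar>2 / span N i * ddx N i F + f (X N i)\<bar>"
    by linarith
  also have "\<dots> \<le> (CS + (CN1 + CN2 + CN3 + CN4)) * (?e * rho N i) + CQ * (?e * rho N i)"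
  proof (rule add_mono)
    have cn: "0 \<le> CN1 + CN2 + CN3 + CN4" using CN12_nonneg CN34_nonneg by simp
    show "\<bar>2 / span N i * ddx N i (P N)\<bar> \<le> (CS + (CN1 + CN2 + CN3 + CN4)) * (?e * rho N i)"
    proof (cases "i \<le> 8")
      case True
      have "\<bar>2 / span N i * ddx N i (P N)\<bar> \<le> CS * C0 * eps N * X N i powr (- \<alpha>)" by (rule small_index[OF N i(1) True i(2)])
      also have "\<dots> \<le> CS * (?e * rho N i)" by (rule lift[OF CS_nonneg])
      also have "\<dots> \<le> (CS + (CN1 + CN2 + CN3 + CN4)) * (?e * rho N i)" using cn 0 by (intro mult_right_mono) auto
      finally show ?thesis .
    next
      case False
      hence "\<bar>2 / span N i * ddx N i (P N)\<bar> \<le> (CN1 + CN2 + CN3 + CN4) * C0 * eps N * rho N i" by (intro large_index i) auto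
      also have "\<dots> = (CN1 + CN2 + CN3 + CN4) * (?e * rho N i)" by (simp only: mult_ac)
      also have "\<dots> \<le> (CS + (CN1 + CN2 + CN3 + CN4)) * (?e * rho N i)" using CS_nonneg 0 by (intro mult_right_mono) auto
      finally show ?thesis .
    qed
    have "\<bar>2 / span N i * ddx N i F + f (X N i)\<bar> \<le> CQ * C0 * eps N * X N i powr (- \<alpha>)"
    proof (cases "i = 1")
      case True thus ?thesis using quad_first[OF N] by simp
    next
      case False thus ?thesis using i by (intro quad_rest[OF N]) auto
    qed
    also have "\<dots> \<le> CQ * (?e * rho N i)" by (rule lift[OF CQ_nonneg])
    finally show "\<bar>2 / span N i * ddx N i F + f (X N i)\<bar> \<le> CQ * (?e * rho N i)" .
  qed
  also have "\<dots> = Ctr * C0 * eps N * rho N i" by (simp add: Ctr_def algebra_simps)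
  finally show ?thesis .
qed

text \<open>Carries the truncation estimate from the left half to the right half: the bounds are
  symmetric in x and 2 T - x, and only derivatives of odd order change sign.\<close>

lemma reflected: "frac_data \<alpha> T r \<sigma> C0 (\<lambda>x. u (2 * T - x)) (\<lambda>x. - u1 (2 * T - x)) (\<lambda>x. u2 (2 * T - x))
    (\<lambda>x. - u3 (2 * T - x)) (\<lambda>x. u4 (2 * T - x)) (\<lambda>x. f (2 * T - x)) (\<lambda>x. - f1 (2 * T - x)) (\<lambda>x. f2 (2 * T - x)) (\<lambda>x. - F1 (2 * T - x))"
proof -
  have O: "2 * T - x \<in> Omega T" if "x \<in> Omega T" for x using that by (auto simp: Omega_def)
  have b: "bdist T (2 * T - x) = bdist T x" for x by (simp add: bdist_def min.commute)
  have d: "((\<lambda>x. g (2 * T - x)) has_real_derivative - g' (2 * T - x)) (at x)"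
    if "(g has_real_derivative g' (2 * T - x)) (at (2 * T - x))" for g g' x
  proof -
    have "((\<lambda>x. 2 * T - x) has_real_derivative - 1) (at x)" by (auto intro!: derivative_eq_intros)
    from DERIV_chain2[where f = g and g = "\<lambda>x. 2 * T - x", OF that this] show ?thesis by simp
  qed
  have d': "((\<lambda>x. - g (2 * T - x)) has_real_derivative g' (2 * T - x)) (at x)"
    if "(g has_real_derivative g' (2 * T - x)) (at (2 * T - x))" for g g' x
    using DERIV_minus[OF d[of g g' x, OF that]] by simp
  show ?thesis
  proof unfold_locales
    fix x assume x: "x \<in> Omega T"
    note x' = O[OF x]
    show "((\<lambda>x. u (2 * T - x)) has_real_derivative - u1 (2 * T - x)) (at x)" by (rule d, rule du, rule x')
    show "((\<lambda>x. - u1 (2 * T - x)) has_real_derivative u2 (2 * T - x)) (at x)" by (rule d', rule du1, rule x')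
    show "((\<lambda>x. u2 (2 * T - x)) has_real_derivative - u3 (2 * T - x)) (at x)" by (rule d, rule du2, rule x')
    show "((\<lambda>x. - u3 (2 * T - x)) has_real_derivative u4 (2 * T - x)) (at x)" by (rule d', rule du3, rule x')
    show "((\<lambda>x. f (2 * T - x)) has_real_derivative - f1 (2 * T - x)) (at x)" by (rule d, rule df, rule x')
    show "((\<lambda>x. - f1 (2 * T - x)) has_real_derivative f2 (2 * T - x)) (at x)" by (rule d', rule df1, rule x')
    have "frac_int \<alpha> T (\<lambda>y. u (2 * T - y)) = (\<lambda>x. frac_int \<alpha> T u (2 * T - x))"
      using frac_int_reflect[OF u_cont] by auto
    thus "(frac_int \<alpha> T (\<lambda>x. u (2 * T - x)) has_real_derivative - F1 (2 * T - x)) (at x)"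
      using d[of F F1 x, OF dF[OF x']] by simp
    show "((\<lambda>x. - F1 (2 * T - x)) has_real_derivative - f (2 * T - x)) (at x)" by (rule d'[where g' = "\<lambda>x. - f x"], rule dF1, rule x')
    show "\<bar>u (2 * T - x)\<bar> \<le> C0 * bdist T x powr \<sigma>" "\<bar>u2 (2 * T - x)\<bar> \<le> C0 * bdist T x powr (\<sigma> - 2)"
      "\<bar>- u3 (2 * T - x)\<bar> \<le> C0 * bdist T x powr (\<sigma> - 3)" "\<bar>u4 (2 * T - x)\<bar> \<le> C0 * bdist T x powr (\<sigma> - 4)"
      "\<bar>f (2 * T - x)\<bar> \<le> C0 * bdist T x powr (\<sigma> - \<alpha>)" "\<bar>- f1 (2 * T - x)\<bar> \<le> C0 * bdist T x powr (\<sigma> - \<alpha> - 1)"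
      "\<bar>f2 (2 * T - x)\<bar> \<le> C0 * bdist T x powr (\<sigma> - \<alpha> - 2)"
      using bu[OF x'] bu2[OF x'] bu3[OF x'] bu4[OF x'] bf[OF x'] bf1[OF x'] bf2[OF x'] by (simp_all add: b)
  next
    fix x assume "x \<notin> Omega T"
    hence "2 * T - x \<notin> Omega T" by (auto simp: Omega_def)
    thus "u (2 * T - x) = 0" by (rule u_out)
  qed
qed

lemma truncation_right:
  assumes N: "2 \<le> N" and i: "1 \<le> i" "i \<le> N"
  shows "\<bar>L N (\<lambda>j. u (X N j)) (2 * N - i) - f (X N (2 * N - i))\<bar> \<le> Ctr * C0 * eps N * rho N i"
proof -
  interpret R: frac_data \<alpha> T r \<sigma> C0 "\<lambda>x. u (2 * T - x)" "\<lambda>x. - u1 (2 * T - x)" "\<lambda>x. u2 (2 * T - x)"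
    "\<lambda>x. - u3 (2 * T - x)" "\<lambda>x. u4 (2 * T - x)" "\<lambda>x. f (2 * T - x)" "\<lambda>x. - f1 (2 * T - x)" "\<lambda>x. f2 (2 * T - x)" "\<lambda>x. - F1 (2 * T - x)"
    by (rule reflected)
  have N1: "1 \<le> N" using N by simp
  have "L N (\<lambda>j. u (X N j)) (2 * N - i) = L N (\<lambda>j. u (X N (2 * N - j))) i"
    using L_reflect[OF N1 i(1), of "\<lambda>j. u (X N j)"] i by simp
  also have "\<dots> = L N (\<lambda>j. u (2 * T - X N j)) i"
    using L_sum[OF N1 i(1)] N1 by (auto simp: mesh_reflect intro!: sum.cong)
  finally show ?thesis
    using R.truncation_left[OF N i] mesh_reflect[OF N1, of i] i by simp
qed

definition Cst :: real where "Cst = Ctr * ((T + 2 * C2 / c1 + 1) / c3)"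

lemma convergence:
  assumes N: "2 \<le> N" and U: "is_approx_solution \<alpha> T r f N U" and i: "i \<in> {1..2 * N - 1}"
  shows "\<bar>U i - u (X N i)\<bar> \<le> Cst * C0 * eps N"
proof -
  have N1: "1 \<le> N" using N by simp
  have LU: "L N U k = f (X N k)" if "k \<in> {1..2 * N - 1}" for k
    using U that unfolding is_approx_solution_def L_def by blast
  have "\<bar>U i - u (X N i)\<bar> \<le> (Ctr * C0 * eps N) * ((T + 2 * C2 / c1 + 1) / c3)"
  proof (rule stability[OF N _ _ _ i, where e = "\<lambda>j. U j - u (X N j)"])
    show "0 \<le> Ctr * C0 * eps N" using Ctr_nonneg C0_nonneg eps_nonneg by simp
  next
    fix k assume k: "1 \<le> k" "k \<le> N"
    show "\<bar>L N (\<lambda>j. U j - u (X N j)) k\<bar> \<le> Ctr * C0 * eps N * rho N k"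
      using truncation_left[OF N k] LU[of k] k N by (simp add: L_diff abs_minus_commute)
    show "\<bar>L N (\<lambda>j. U j - u (X N j)) (2 * N - k)\<bar> \<le> Ctr * C0 * eps N * rho N k"
    proof -
      have k': "1 \<le> 2 * N - k" "2 * N - k \<in> {1..2 * N - 1}" using k N by auto
      show ?thesis
        unfolding L_diff[OF N1 k'(1)] LU[OF k'(2)] using truncation_right[OF N k] by (simp add: abs_minus_commute)
    qed
  qed
  thus ?thesis by (simp add: Cst_def mult_ac)
qed

end

section \<open>Independence of the constant from the solution\<close>

lemma mesh_refine:
  assumes "1 \<le> N" "1 \<le> M" "j \<le> 2 * N"
  shows "mesh T r (N * M) (j * M) = mesh T r N j"
  using assms by (auto simp: mesh_def left_diff_distrib[symmetric] mult.assoc[symmetric])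

context frac_data
begin

text \<open>The nodal values of u and of v both satisfy the discrete system with right-hand side f
  up to a truncation error, so stability applies to their difference. No discrete solution is
  involved.\<close>

lemma two_solutions:
  assumes D: "frac_data \<alpha> T r \<sigma> C0' v v1 v2 v3 v4 f g1 g2 G1" and N: "2 \<le> N" and i: "i \<in> {1..2 * N - 1}"
  shows "\<bar>u (X N i) - v (X N i)\<bar> \<le> Cst * (C0 + C0') * eps N"
proof -
  \<comment> \<open>The constants in the estimates are built from \<alpha>, T, r and \<sigma> only,
    hence they are the same for both instances.\<close>
  interpret V: frac_data \<alpha> T r \<sigma> C0' v v1 v2 v3 v4 f g1 g2 G1 by (rule D)
  have N1: "1 \<le> N" using N by simp
  have comb: "\<bar>L N (\<lambda>j. u (X N j) - v (X N j)) k\<bar> \<le> Ctr * (C0 + C0') * eps N * \<rho>"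
    if k: "1 \<le> k" and a: "\<bar>L N (\<lambda>j. u (X N j)) k - f (X N k)\<bar> \<le> Ctr * C0 * eps N * \<rho>"
      and b: "\<bar>L N (\<lambda>j. v (X N j)) k - f (X N k)\<bar> \<le> Ctr * C0' * eps N * \<rho>" for k \<rho>
  proof -
    have "\<bar>L N (\<lambda>j. u (X N j)) k - L N (\<lambda>j. v (X N j)) k\<bar> \<le> Ctr * C0 * eps N * \<rho> + Ctr * C0' * eps N * \<rho>"
      using a b by linarith
    thus ?thesis unfolding L_diff[OF N1 k] by (simp add: algebra_simps)
  qed
  have "\<bar>u (X N i) - v (X N i)\<bar> \<le> (Ctr * (C0 + C0') * eps N) * ((T + 2 * C2 / c1 + 1) / c3)"
  proof (rule stability[OF N _ _ _ i, where e = "\<lambda>j. u (X N j) - v (X N j)"])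
    show "0 \<le> Ctr * (C0 + C0') * eps N" using Ctr_nonneg C0_nonneg V.C0_nonneg eps_nonneg by simp
    show "\<bar>L N (\<lambda>j. u (X N j) - v (X N j)) k\<bar> \<le> Ctr * (C0 + C0') * eps N * rho N k" if "1 \<le> k" "k \<le> N" for k
      by (rule comb[OF _ truncation_left[OF N that] V.truncation_left[OF N that]]) (use that in auto)
    show "\<bar>L N (\<lambda>j. u (X N j) - v (X N j)) (2 * N - k)\<bar> \<le> Ctr * (C0 + C0') * eps N * rho N k" if "1 \<le> k" "k \<le> N" for k
      by (rule comb[OF _ truncation_right[OF N that] V.truncation_right[OF N that]]) (use that N in auto)
  qed
  thus ?thesis by (simp add: Cst_def mult_ac)
qed

text \<open>The nodes of the mesh with parameter \<open>N\<close> are nodes of the one with parameter \<open>N M\<close>; let \<open>M\<close>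
  tend to infinity.\<close>

lemma nodal_unique:
  assumes D: "frac_data \<alpha> T r \<sigma> C0' v v1 v2 v3 v4 f g1 g2 G1" and N: "1 \<le> N" and i: "i \<in> {1..2 * N - 1}"
  shows "v (X N i) = u (X N i)"
proof -
  let ?c = "Cst * (C0 + C0')" and ?p = "min (r * \<sigma>) 2"
  have p: "- ?p < 0" using r1 \<sigma>0 by simp
  have "filterlim (\<lambda>M. real (N * M)) at_top sequentially"
    using N by (auto intro!: filterlim_tendsto_pos_mult_at_top[OF tendsto_const] filterlim_real_sequentially)
  from tendsto_neg_powr[OF p this] have "(\<lambda>M. ?c * real (N * M) powr (- ?p)) \<longlonglongrightarrow> ?c * 0"
    by (intro tendsto_intros)
  moreover have "\<bar>u (X N i) - v (X N i)\<bar> \<le> ?c * real (N * M) powr (- ?p)" if M: "2 \<le> M" for M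
  proof -
    have NM: "2 \<le> N * M" using mult_le_mono[OF N M] by simp
    have iM: "i * M \<in> {1..2 * (N * M) - 1}"
    proof -
      have "i + 1 \<le> 2 * N" using i by auto
      hence "(i + 1) * M \<le> 2 * N * M" by (rule mult_right_mono) simp
      thus ?thesis using M i by (auto simp: algebra_simps)
    qed
    have "\<bar>u (X N i) - v (X N i)\<bar> \<le> ?c * eps (N * M)"
    proof -
      have "X (N * M) (i * M) = X N i" by (rule mesh_refine) (use N M i in auto)
      thus ?thesis using two_solutions[OF D NM iM] by simp
    qed
    also have "eps (N * M) = real (N * M) powr (- ?p)"
      using NM by (simp add: eps_def powr_divide powr_minus_divide)
    finally show ?thesis .
  qed
  ultimately have "\<bar>u (X N i) - v (X N i)\<bar> \<le> ?c * 0"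
    by (intro LIMSEQ_le_const[of _ "?c * 0"]) (auto intro: exI[of _ 2])
  thus ?thesis by simp
qed

text \<open>The constant is built from the single solution u and its \<open>C0\<close>; by
  \<open>nodal_unique\<close> any other solution has the same nodal values and may be replaced by
  u.\<close>

lemma uniform_constant:
  "\<exists>C>0. \<forall>C0' v v1 v2 v3 v4 g1 g2 G1. frac_data \<alpha> T r \<sigma> C0' v v1 v2 v3 v4 f g1 g2 G1 \<longrightarrow>
     (\<forall>N\<ge>1. \<forall>U. is_approx_solution \<alpha> T r f N U \<longrightarrow> (\<forall>i\<in>{1..2 * N - 1}. \<bar>U i - v (X N i)\<bar> \<le> C * eps N))"
proof -
  let ?w = "f T / A 1 1 1"
  define C where "C = \<bar>Cst * C0\<bar> + \<bar>?w - u T\<bar> + 1"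
  have "\<bar>U i - v (X N i)\<bar> \<le> C * eps N"
    if D: "frac_data \<alpha> T r \<sigma> C0' v v1 v2 v3 v4 f g1 g2 G1" and N: "1 \<le> N"
      and U: "is_approx_solution \<alpha> T r f N U" and i: "i \<in> {1..2 * N - 1}" for C0' v v1 v2 v3 v4 g1 g2 G1 N U i
  proof (cases "N = 1")
    case True
    have i1: "i = 1" using i True by simp
    have X1: "X 1 1 = T" by (rule mesh_mid) simp
    have "L 1 U 1 = f T" using U X1 unfolding is_approx_solution_def L_def True by auto
    moreover have "L 1 U 1 = A 1 1 1 * U 1" "L 1 (\<lambda>_. 1) 1 = A 1 1 1" by (simp_all add: L_sum)
    moreover have "0 < c1 * X 1 1 powr (- \<alpha>)" using c1_pos X1 T0 by simp
    ultimately have "U 1 = ?w" using L_one[of 1 1] by (simp add: field_simps)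
    moreover have "v (X N i) = u T" using nodal_unique[OF D N i] unfolding True i1 X1 .
    moreover have "eps N = 1" by (simp add: eps_def True)
    ultimately show ?thesis by (simp add: C_def i1)
  next
    case False
    hence "2 \<le> N" using N by simp
    from convergence[OF this U i] have "\<bar>U i - v (X N i)\<bar> \<le> Cst * C0 * eps N"
      unfolding nodal_unique[OF D N i] .
    also have "\<dots> \<le> C * eps N" by (rule mult_right_mono[OF _ eps_nonneg]) (simp add: C_def)
    finally show ?thesis .
  qed
  moreover have "0 < C" by (simp add: C_def)
  ultimately show ?thesis by blast
qed

end

section \<open>From the stated hypotheses to the instance\<close>

lemma Ck_on_DERIV:
  assumes "Ck_on k g S" "l < k" "x \<in> S"
  shows "((deriv ^^ l) g has_real_derivative (deriv ^^ Suc l) g x) (at x)"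
  using assms by (auto simp: Ck_on_def DERIV_deriv_iff_field_differentiable)

lemma frac_dataI:
  assumes par: "1 < \<alpha>" "\<alpha> < 2" "0 < T" "1 \<le> r" "0 < \<sigma>" "\<sigma> \<le> \<alpha> / 2"
    and f: "Ck_on 2 f (Omega T)" and u: "Ck_on 4 u (Omega T)" and sol: "is_solution \<alpha> T f u"
    and bu: "\<forall>x\<in>Omega T. \<forall>l\<le>4. \<bar>(deriv ^^ l) u x\<bar> \<le> C0 * bdist T x powr (\<sigma> - real l)"
    and bf: "\<forall>x\<in>Omega T. \<forall>l\<le>2. \<bar>(deriv ^^ l) f x\<bar> \<le> C0 * bdist T x powr (\<sigma> - \<alpha> - real l)"
  shows "frac_data \<alpha> T r \<sigma> C0 u ((deriv ^^ 1) u) ((deriv ^^ 2) u) ((deriv ^^ 3) u) ((deriv ^^ 4) u)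
    f ((deriv ^^ 1) f) ((deriv ^^ 2) f) (deriv (frac_int \<alpha> T u))"
proof unfold_locales
  show "1 < \<alpha>" "\<alpha> < 2" "0 < T" "1 \<le> r" "0 < \<sigma>" by fact+
  show "\<sigma> < \<alpha>" using par by simp
  have n: "Suc 2 = 3" "Suc 3 = 4" by simp_all
  fix x assume x: "x \<in> Omega T"
  show "(u has_real_derivative (deriv ^^ 1) u x) (at x)" using Ck_on_DERIV[OF u _ x, of 0] by simp
  show "((deriv ^^ 1) u has_real_derivative (deriv ^^ 2) u x) (at x)"
    using Ck_on_DERIV[OF u _ x, of 1] unfolding Suc_1 by simp
  show "((deriv ^^ 2) u has_real_derivative (deriv ^^ 3) u x) (at x)"
    using Ck_on_DERIV[OF u _ x, of 2] unfolding n by simp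
  show "((deriv ^^ 3) u has_real_derivative (deriv ^^ 4) u x) (at x)"
    using Ck_on_DERIV[OF u _ x, of 3] unfolding n by simp
  show "(f has_real_derivative (deriv ^^ 1) f x) (at x)" using Ck_on_DERIV[OF f _ x, of 0] by simp
  show "((deriv ^^ 1) f has_real_derivative (deriv ^^ 2) f x) (at x)"
    using Ck_on_DERIV[OF f _ x, of 1] unfolding Suc_1 by simp
  show "(frac_int \<alpha> T u has_real_derivative deriv (frac_int \<alpha> T u) x) (at x)"
    using sol x by (simp add: is_solution_def DERIV_deriv_iff_field_differentiable)
  have "(deriv (frac_int \<alpha> T u) has_real_derivative deriv (deriv (frac_int \<alpha> T u)) x) (at x)"
    using sol x by (simp add: is_solution_def DERIV_deriv_iff_field_differentiable)
  moreover have "- f x = deriv (deriv (frac_int \<alpha> T u)) x"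
    using sol x by (auto simp: is_solution_def frac_laplacian_def numeral_2_eq_2)
  ultimately show "(deriv (frac_int \<alpha> T u) has_real_derivative - f x) (at x)" by simp
  note bux = bspec[OF bu x, rule_format] and bfx = bspec[OF bf x, rule_format]
  show "\<bar>u x\<bar> \<le> C0 * bdist T x powr \<sigma>" "\<bar>(deriv ^^ 2) u x\<bar> \<le> C0 * bdist T x powr (\<sigma> - 2)"
    "\<bar>(deriv ^^ 3) u x\<bar> \<le> C0 * bdist T x powr (\<sigma> - 3)" "\<bar>(deriv ^^ 4) u x\<bar> \<le> C0 * bdist T x powr (\<sigma> - 4)"
    using bux[of 0] bux[of 2] bux[of 3] bux[of 4] by simp_all
  show "\<bar>f x\<bar> \<le> C0 * bdist T x powr (\<sigma> - \<alpha>)" "\<bar>(deriv ^^ 1) f x\<bar> \<le> C0 * bdist T x powr (\<sigma> - \<alpha> - 1)"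
    "\<bar>(deriv ^^ 2) f x\<bar> \<le> C0 * bdist T x powr (\<sigma> - \<alpha> - 2)"
    using bfx[of 0] bfx[of 1] bfx[of 2] by simp_all
next
  fix x assume "x \<notin> Omega T"
  thus "u x = 0" using sol by (simp add: is_solution_def)
qed

theorem theorem4p5:
  fixes \<alpha> T r \<sigma> :: real and f :: "real \<Rightarrow> real"
  assumes "1 < \<alpha>" and "\<alpha> < 2" and "0 < T" and "1 \<le> r" and "0 < \<sigma>" and "\<sigma> \<le> \<alpha> / 2"
    and "Ck_on 2 f (Omega T)"
  shows "\<exists>C>0. \<forall>(u :: real \<Rightarrow> real) (C0 :: real).
           is_solution \<alpha> T f u \<and> Ck_on 4 u (Omega T) \<and>
           (\<forall>x\<in>Omega T. \<forall>l\<le>4. \<bar>(deriv ^^ l) u x\<bar> \<le> C0 * bdist T x powr (\<sigma> - real l)) \<and>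
           (\<forall>x\<in>Omega T. \<forall>l\<le>2. \<bar>(deriv ^^ l) f x\<bar> \<le> C0 * bdist T x powr (\<sigma> - \<alpha> - real l))
         \<longrightarrow> (\<forall>N\<ge>1. \<forall>U. is_approx_solution \<alpha> T r f N U \<longrightarrow>
               (MAX i\<in>{1..2 * N - 1}. \<bar>U i - u (mesh T r N i)\<bar>)
                 \<le> C * (1 / real N) powr min (r * \<sigma>) 2)"
    (is "\<exists>C>0. \<forall>u C0. ?H u C0 \<longrightarrow> ?G C u")
proof (cases "\<exists>u C0. ?H u C0")
  \<comment> \<open>Without any admissible pair the implication is vacuous, and any positive
    constant will do.\<close>
  case False
  hence "\<not> ?H u C0" for u C0 by blast
  thus ?thesis by (intro exI[of _ 1]) (simp only: simp_thms zero_less_one)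
next
  case True
  have data: "frac_data \<alpha> T r \<sigma> C0 u ((deriv ^^ 1) u) ((deriv ^^ 2) u) ((deriv ^^ 3) u) ((deriv ^^ 4) u)
      f ((deriv ^^ 1) f) ((deriv ^^ 2) f) (deriv (frac_int \<alpha> T u))" if "?H u C0" for u C0
    using assms that by (intro frac_dataI) blast+
  \<comment> \<open>An arbitrary admissible pair fixes the constant; all other pairs are instances
    over the same f and are covered by \<open>uniform_constant\<close>.\<close>
  from True obtain u C0 where "?H u C0" by blast
  then interpret frac_data \<alpha> T r \<sigma> C0 u "(deriv ^^ 1) u" "(deriv ^^ 2) u" "(deriv ^^ 3) u" "(deriv ^^ 4) u"
      f "(deriv ^^ 1) f" "(deriv ^^ 2) f" "deriv (frac_int \<alpha> T u)" by (rule data)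
  obtain C where C: "0 < C" and
    b: "\<forall>C0' v v1 v2 v3 v4 g1 g2 G1. frac_data \<alpha> T r \<sigma> C0' v v1 v2 v3 v4 f g1 g2 G1 \<longrightarrow>
      (\<forall>N\<ge>1. \<forall>U. is_approx_solution \<alpha> T r f N U \<longrightarrow> (\<forall>i\<in>{1..2 * N - 1}. \<bar>U i - v (X N i)\<bar> \<le> C * eps N))"
    using uniform_constant by (elim exE conjE)
  have "?G C v" if "?H v C0'" for v C0'
  proof (intro allI impI)
    fix N U assume N: "1 \<le> N" and U: "is_approx_solution \<alpha> T r f N U"
    \<comment> \<open>The maximum is over a nonempty set, which \<open>Max.boundedI\<close>
      requires.\<close>
    have "(1 :: nat) \<in> {1..2 * N - 1}" using N by simp
    thus "(MAX i\<in>{1..2 * N - 1}. \<bar>U i - v (X N i)\<bar>) \<le> C * (1 / real N) powr min (r * \<sigma>) 2"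
      using b[rule_format, OF data[OF that] N U] unfolding eps_def by (intro Max.boundedI) auto
  qed
  with C show ?thesis by blast
qed

end
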